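(* Let $n$ be a positive integer. Let $\mathscr{C}_n^{\mathsf Y}$ be the full subcategory of $\mathscr{C}_n$ whose objects are the coherent functors $\mathbf f$ such that $\mathbf f(\mathbb{K}[\mathfrak{S}_n/\mathfrak{S}_\lambda])=0$ for all partitions $\lambda$ of $n$, and let $i_*:\mathscr{C}_n^{\mathsf Y}\to\mathscr{C}_n$ be the inclusion. Then the functor $j^*:\mathscr{C}_n\to\mathscr{P}_n$ and its adjoints $j_!$ (left) and $j_*$ (right), $\mathscr{P}_n\to\mathscr{C}_n$, are part of a recollement of abelian categories $(\mathscr{C}_n^{\mathsf Y},\mathscr{C}_n,\mathscr{P}_n)$ with functors $i_*$, its left adjoint $i^*$ and right adjoint $i^!$, and $j^*,j_!,j_*$.
   Context: $\mathbb{K}$ is a field of positive characteristic $p$; $\mathscr{V}$ is the category of finite-dimensional $\mathbb{K}$-vector spaces; $W^\vee$ is the dual space. For a finite group $G$, ${}_G\mathscr{V}$ is the category of finite-dimensional $\mathbb{K}[G]$-modules and $\mathscr{A}(G)$ is the category of covariant $\mathbb{K}$-linear functors ${}_G\mathscr{V}\to\mathscr{V}$. For $M\in{}_G\mathscr{V}$ put $\mathbf h_M=\mathrm{Hom}_G(M,-)$ in $\mathscr{A}(G)$. A functor $\mathbf f\in\mathscr{A}(G)$ is coherent if there is an exact sequence $\mathbf h_N\to\mathbf h_M\to\mathbf f\to0$ with $M,N\in{}_G\mathscr{V}$; $\mathscr{C}(G)$ is the full subcategory of coherent functors; it is abelian and its inclusion in $\mathscr{A}(G)$ is exact. $\mathfrak{S}_n$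 is the symmetric group, $\mathscr{A}_n=\mathscr{A}(\mathfrak{S}_n)$, $\mathscr{C}_n=\mathscr{C}(\mathfrak{S}_n)$, and $\mathfrak{S}_\lambda\subset\mathfrak{S}_n$ is the Young subgroup of the partition $\lambda$. Strict polynomial functors: $\Gamma^n(V)=(V^{\otimes n})^{\mathfrak{S}_n}$; $\Gamma^n\mathscr{V}$ is the category with the same objects as $\mathscr{V}$ and with morphisms $\mathrm{Hom}_{\Gamma^n\mathscr{V}}(V,W)=\Gamma^n(\mathrm{Hom}(V,W))\cong\mathrm{Hom}_{\mathfrak{S}_n}(V^{\otimes n},W^{\otimes n})$; $V\mapsto V^{\otimes n}$ is a full embedding $\Gamma^n\mathscr{V}\to{}_{\mathfrak{S}_n}\mathscr{V}$. $\mathscr{P}_n$ is the category of $\mathbb{K}$-linear functors $\Gamma^n\mathscr{V}\to\mathscr{V}$ (homogeneous strict polynomial functors of degree $n$). $j^*:\mathscr{A}_n\to\mathscr{P}_n$ is $j^*(\mathbf f)(V)=\mathbf f(V^{\otimes n})$. It has a right adjoint $j_*(F)(M)=\mathrm{Hom}_{\mathscr{P}_n}(j^*(\mathbf h_M),F)$ and a left adjoint $j_!(F)=\mathbb{D}(j_*(\mathbb{D}F))$, where $(\mathbb{D}F)(V)=F(V^\vee)^\vee$ and $(\mathbb{D}\mathbf f)(M)=\mathbf f(M^\vee)^\vee$. These adjoints take values in coherent functors, and $j^*$ is restricted to $\mathscr{C}_n$. A recollement of abelian categories $(\mathscr{A}',\mathscr{A},\mathscr{A}'')$ consists of additive functors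 $i_*:\mathscr{A}'\to\mathscr{A}$, $i^*,i^!:\mathscr{A}\to\mathscr{A}'$, $j^*:\mathscr{A}\to\mathscr{A}''$, $j_!,j_*:\mathscr{A}''\to\mathscr{A}$ such that: $j_!$ is left adjoint and $j_*$ is right adjoint to $j^*$; the unit $Id\to j^*j_!$ and the counit $j^*j_*\to Id$ are isomorphisms; $i^*$ is left adjoint and $i^!$ right adjoint to $i_*$; the unit $Id\to i^!i_*$ and the counit $i^*i_*\to Id$ are isomorphisms; $i_*$ induces an equivalence from $\mathscr{A}'$ onto $\ker(j^* )$. *)

theory Defs
  imports "HOL-Algebra.Sym_Groups" "HOL-Algebra.Left_Coset" "HOL-Library.Function_Algebras" HOL.Vector_Spaces
begin

section \<open>Categories, functors, abelian categories\<close>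

text \<open>
  Arrows are untagged elements of a type \<open>'m\<close>, and hom-sets may overlap; therefore a functor's
  action on arrows takes source and target as arguments. In the (pre)additive setting \<open>'m\<close> is an
  abelian group and every hom-set is a subgroup of it.
\<close>

record ('o, 'm) cat =
  Obj :: "'o set"
  Hom :: "'o \<Rightarrow> 'o \<Rightarrow> 'm set"
  Idm :: "'o \<Rightarrow> 'm"
  Cmp :: "'m \<Rightarrow> 'm \<Rightarrow> 'm"  \<comment> \<open>\<open>Cmp C g f\<close> is \<open>g\<close> after \<open>f\<close>\<close>

record ('k, 'o, 'm) lincat = "('o, 'm) cat" +
  Scl :: "'k \<Rightarrow> 'm \<Rightarrow> 'm"

record ('o, 'm, 'p, 'q) func =
  Fo :: "'o \<Rightarrow> 'p"
  Fm :: "'o \<Rightarrow> 'o \<Rightarrow> 'm \<Rightarrow> 'q"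

definition category :: "('o, 'm, 'x) cat_scheme \<Rightarrow> bool" where
  "category C \<longleftrightarrow>
     (\<forall>X\<in>Obj C. Idm C X \<in> Hom C X X) \<and>
     (\<forall>X\<in>Obj C. \<forall>Y\<in>Obj C. \<forall>Z\<in>Obj C. \<forall>f\<in>Hom C X Y. \<forall>g\<in>Hom C Y Z. Cmp C g f \<in> Hom C X Z) \<and>
     (\<forall>X\<in>Obj C. \<forall>Y\<in>Obj C. \<forall>f\<in>Hom C X Y. Cmp C f (Idm C X) = f \<and> Cmp C (Idm C Y) f = f) \<and>
     (\<forall>W\<in>Obj C. \<forall>X\<in>Obj C. \<forall>Y\<in>Obj C. \<forall>Z\<in>Obj C. \<forall>f\<in>Hom C W X. \<forall>g\<in>Hom C X Y. \<forall>h\<in>Hom C Y Z.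
        Cmp C h (Cmp C g f) = Cmp C (Cmp C h g) f)"

definition preadditive :: "('o, 'm::ab_group_add, 'x) cat_scheme \<Rightarrow> bool" where
  "preadditive C \<longleftrightarrow> category C \<and>
     (\<forall>X\<in>Obj C. \<forall>Y\<in>Obj C. 0 \<in> Hom C X Y \<and>
        (\<forall>f\<in>Hom C X Y. - f \<in> Hom C X Y \<and> (\<forall>g\<in>Hom C X Y. f + g \<in> Hom C X Y))) \<and>
     (\<forall>X\<in>Obj C. \<forall>Y\<in>Obj C. \<forall>Z\<in>Obj C. \<forall>f\<in>Hom C X Y. \<forall>f'\<in>Hom C X Y. \<forall>g\<in>Hom C Y Z. \<forall>g'\<in>Hom C Y Z.
        Cmp C g (f + f') = Cmp C g f + Cmp C g f' \<and> Cmp C (g + g') f = Cmp C g f + Cmp C g' f)"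

definition zero_object :: "('o, 'm, 'x) cat_scheme \<Rightarrow> 'o \<Rightarrow> bool" where
  "zero_object C Z \<longleftrightarrow> Z \<in> Obj C \<and>
     (\<forall>X\<in>Obj C. (\<exists>!f. f \<in> Hom C X Z) \<and> (\<exists>!f. f \<in> Hom C Z X))"

definition biproduct ::
    "('o, 'm::ab_group_add, 'x) cat_scheme \<Rightarrow> 'o \<Rightarrow> 'o \<Rightarrow> 'o \<Rightarrow> 'm \<Rightarrow> 'm \<Rightarrow> 'm \<Rightarrow> 'm \<Rightarrow> bool" where
  "biproduct C X Y P i1 i2 p1 p2 \<longleftrightarrow> P \<in> Obj C \<and>
     i1 \<in> Hom C X P \<and> i2 \<in> Hom C Y P \<and> p1 \<in> Hom C P X \<and> p2 \<in> Hom C P Y \<and>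
     Cmp C p1 i1 = Idm C X \<and> Cmp C p2 i2 = Idm C Y \<and> Cmp C p2 i1 = 0 \<and> Cmp C p1 i2 = 0 \<and>
     Cmp C i1 p1 + Cmp C i2 p2 = Idm C P"

definition is_kernel ::
    "('o, 'm::ab_group_add, 'x) cat_scheme \<Rightarrow> 'o \<Rightarrow> 'm \<Rightarrow> 'o \<Rightarrow> 'm \<Rightarrow> bool" where
  "is_kernel C X f K k \<longleftrightarrow> K \<in> Obj C \<and> k \<in> Hom C K X \<and> Cmp C f k = 0 \<and>
     (\<forall>T\<in>Obj C. \<forall>h\<in>Hom C T X. Cmp C f h = 0 \<longrightarrow> (\<exists>!u. u \<in> Hom C T K \<and> Cmp C k u = h))"

definition is_cokernel ::
    "('o, 'm::ab_group_add, 'x) cat_scheme \<Rightarrow> 'o \<Rightarrow> 'm \<Rightarrow> 'o \<Rightarrow> 'm \<Rightarrow> bool" where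
  "is_cokernel C Y f Q q \<longleftrightarrow> Q \<in> Obj C \<and> q \<in> Hom C Y Q \<and> Cmp C q f = 0 \<and>
     (\<forall>T\<in>Obj C. \<forall>h\<in>Hom C Y T. Cmp C h f = 0 \<longrightarrow> (\<exists>!u. u \<in> Hom C Q T \<and> Cmp C u q = h))"

definition monic :: "('o, 'm, 'x) cat_scheme \<Rightarrow> 'o \<Rightarrow> 'm \<Rightarrow> bool" where
  "monic C X f \<longleftrightarrow> (\<forall>T\<in>Obj C. \<forall>g\<in>Hom C T X. \<forall>h\<in>Hom C T X. Cmp C f g = Cmp C f h \<longrightarrow> g = h)"

definition epic :: "('o, 'm, 'x) cat_scheme \<Rightarrow> 'o \<Rightarrow> 'm \<Rightarrow> bool" where
  "epic C Y f \<longleftrightarrow> (\<forall>T\<in>Obj C. \<forall>g\<in>Hom C Y T. \<forall>h\<in>Hom C Y T. Cmp C g f = Cmp C h f \<longrightarrow> g = h)"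

definition abelian_category :: "('o, 'm::ab_group_add, 'x) cat_scheme \<Rightarrow> bool" where
  "abelian_category C \<longleftrightarrow> preadditive C \<and>
     (\<exists>Z. zero_object C Z) \<and>
     (\<forall>X\<in>Obj C. \<forall>Y\<in>Obj C. \<exists>P i1 i2 p1 p2. biproduct C X Y P i1 i2 p1 p2) \<and>
     (\<forall>X\<in>Obj C. \<forall>Y\<in>Obj C. \<forall>f\<in>Hom C X Y.
        (\<exists>K k. is_kernel C X f K k) \<and> (\<exists>Q q. is_cokernel C Y f Q q) \<and>
        (monic C X f \<longrightarrow> (\<exists>Z\<in>Obj C. \<exists>g\<in>Hom C Y Z. is_kernel C Y g X f)) \<and>
        (epic C Y f \<longrightarrow> (\<exists>W\<in>Obj C. \<exists>g\<in>Hom C W X. is_cokernel C X g Y f)))"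

definition iso_in :: "('o, 'm, 'x) cat_scheme \<Rightarrow> 'o \<Rightarrow> 'o \<Rightarrow> 'm \<Rightarrow> bool" where
  "iso_in C X Y f \<longleftrightarrow> f \<in> Hom C X Y \<and>
     (\<exists>g\<in>Hom C Y X. Cmp C g f = Idm C X \<and> Cmp C f g = Idm C Y)"

definition is_functor ::
    "('o, 'm, 'x) cat_scheme \<Rightarrow> ('p, 'q, 'y) cat_scheme \<Rightarrow> ('o, 'm, 'p, 'q) func \<Rightarrow> bool" where
  "is_functor C D F \<longleftrightarrow>
     (\<forall>X\<in>Obj C. Fo F X \<in> Obj D \<and> Fm F X X (Idm C X) = Idm D (Fo F X)) \<and>
     (\<forall>X\<in>Obj C. \<forall>Y\<in>Obj C. \<forall>f\<in>Hom C X Y. Fm F X Y f \<in> Hom D (Fo F X) (Fo F Y)) \<and>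
     (\<forall>X\<in>Obj C. \<forall>Y\<in>Obj C. \<forall>Z\<in>Obj C. \<forall>f\<in>Hom C X Y. \<forall>g\<in>Hom C Y Z.
        Fm F X Z (Cmp C g f) = Cmp D (Fm F Y Z g) (Fm F X Y f))"

definition additive_functor ::
    "('o, 'm::ab_group_add, 'x) cat_scheme \<Rightarrow> ('p, 'q::ab_group_add, 'y) cat_scheme \<Rightarrow>
     ('o, 'm, 'p, 'q) func \<Rightarrow> bool" where
  "additive_functor C D F \<longleftrightarrow> is_functor C D F \<and>
     (\<forall>X\<in>Obj C. \<forall>Y\<in>Obj C. \<forall>f\<in>Hom C X Y. \<forall>g\<in>Hom C X Y.
        Fm F X Y (f + g) = Fm F X Y f + Fm F X Y g)"

definition linear_functor ::
    "('k, 'o, 'm::ab_group_add, 'x) lincat_scheme \<Rightarrow> ('k, 'p, 'q::ab_group_add, 'y) lincat_scheme \<Rightarrow>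
     ('o, 'm, 'p, 'q) func \<Rightarrow> bool" where
  "linear_functor C D F \<longleftrightarrow> additive_functor C D F \<and>
     (\<forall>X\<in>Obj C. \<forall>Y\<in>Obj C. \<forall>f\<in>Hom C X Y. \<forall>c. Fm F X Y (Scl C c f) = Scl D c (Fm F X Y f))"

definition id_func :: "('o, 'm, 'o, 'm) func" where
  "id_func = \<lparr>Fo = \<lambda>X. X, Fm = \<lambda>_ _ f. f\<rparr>"

definition comp_func ::
    "('p, 'q, 'r, 's) func \<Rightarrow> ('o, 'm, 'p, 'q) func \<Rightarrow> ('o, 'm, 'r, 's) func" (infixr \<open>\<odot>\<close> 70) where
  "G \<odot> F = \<lparr>Fo = \<lambda>X. Fo G (Fo F X), Fm = \<lambda>X Y f. Fm G (Fo F X) (Fo F Y) (Fm F X Y f)\<rparr>"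

definition nat_trans ::
    "('o, 'm, 'x) cat_scheme \<Rightarrow> ('p, 'q, 'y) cat_scheme \<Rightarrow>
     ('o, 'm, 'p, 'q) func \<Rightarrow> ('o, 'm, 'p, 'q) func \<Rightarrow> ('o \<Rightarrow> 'q) \<Rightarrow> bool" where
  "nat_trans C D F G \<eta> \<longleftrightarrow>
     (\<forall>X\<in>Obj C. \<eta> X \<in> Hom D (Fo F X) (Fo G X)) \<and>
     (\<forall>X\<in>Obj C. \<forall>Y\<in>Obj C. \<forall>f\<in>Hom C X Y.
        Cmp D (\<eta> Y) (Fm F X Y f) = Cmp D (Fm G X Y f) (\<eta> X))"

definition nat_iso ::
    "('o, 'm, 'x) cat_scheme \<Rightarrow> ('p, 'q, 'y) cat_scheme \<Rightarrow>
     ('o, 'm, 'p, 'q) func \<Rightarrow> ('o, 'm, 'p, 'q) func \<Rightarrow> ('o \<Rightarrow> 'q) \<Rightarrow> bool" where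
  "nat_iso C D F G \<eta> \<longleftrightarrow> nat_trans C D F G \<eta> \<and> (\<forall>X\<in>Obj C. iso_in D (Fo F X) (Fo G X) (\<eta> X))"

definition adjunction ::
    "('o, 'm, 'x) cat_scheme \<Rightarrow> ('p, 'q, 'y) cat_scheme \<Rightarrow>
     ('o, 'm, 'p, 'q) func \<Rightarrow> ('p, 'q, 'o, 'm) func \<Rightarrow> ('o \<Rightarrow> 'm) \<Rightarrow> ('p \<Rightarrow> 'q) \<Rightarrow> bool" where
  "adjunction C D L R \<eta> \<epsilon> \<longleftrightarrow> is_functor C D L \<and> is_functor D C R \<and>
     nat_trans C C id_func (R \<odot> L) \<eta> \<and> nat_trans D D (L \<odot> R) id_func \<epsilon> \<and>
     (\<forall>X\<in>Obj C. Cmp D (\<epsilon> (Fo L X)) (Fm L X (Fo R (Fo L X)) (\<eta> X)) = Idm D (Fo L X)) \<and>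
     (\<forall>Y\<in>Obj D. Cmp C (Fm R (Fo L (Fo R Y)) Y (\<epsilon> Y)) (\<eta> (Fo R Y)) = Idm C (Fo R Y))"

definition equivalence ::
    "('o, 'm, 'x) cat_scheme \<Rightarrow> ('p, 'q, 'y) cat_scheme \<Rightarrow> ('o, 'm, 'p, 'q) func \<Rightarrow> bool" where
  "equivalence C D F \<longleftrightarrow> is_functor C D F \<and>
     (\<exists>G \<eta> \<epsilon>. is_functor D C G \<and> nat_iso C C id_func (G \<odot> F) \<eta> \<and> nat_iso D D (F \<odot> G) id_func \<epsilon>)"

definition full_subcat :: "('o, 'm, 'x) cat_scheme \<Rightarrow> ('o \<Rightarrow> bool) \<Rightarrow> ('o, 'm, 'x) cat_scheme" where
  "full_subcat C P = C\<lparr>Obj := {X \<in> Obj C. P X}\<rparr>"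

definition kernel_subcat ::
    "('o, 'm, 'x) cat_scheme \<Rightarrow> ('p, 'q, 'y) cat_scheme \<Rightarrow> ('o, 'm, 'p, 'q) func \<Rightarrow>
     ('o, 'm, 'x) cat_scheme" where
  "kernel_subcat C D F = full_subcat C (\<lambda>X. zero_object D (Fo F X))"

text \<open>
  \<open>recollement A' A A'' iL iI iR jL jJ jR\<close> stands for \<open>iL = i\<^sup>*\<close>, \<open>iI = i\<^sub>*\<close>, \<open>iR = i\<^sup>!\<close>,
  \<open>jL = j\<^sub>!\<close>, \<open>jJ = j\<^sup>*\<close>, \<open>jR = j\<^sub>*\<close>.
\<close>

definition recollement ::
    "('a, 'f::ab_group_add, 'x) cat_scheme \<Rightarrow> ('b, 'g::ab_group_add, 'y) cat_scheme \<Rightarrow>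
     ('c, 'h::ab_group_add, 'z) cat_scheme \<Rightarrow>
     ('b, 'g, 'a, 'f) func \<Rightarrow> ('a, 'f, 'b, 'g) func \<Rightarrow> ('b, 'g, 'a, 'f) func \<Rightarrow>
     ('c, 'h, 'b, 'g) func \<Rightarrow> ('b, 'g, 'c, 'h) func \<Rightarrow> ('c, 'h, 'b, 'g) func \<Rightarrow> bool" where
  "recollement A' A A'' iL iI iR jL jJ jR \<longleftrightarrow>
     abelian_category A' \<and> abelian_category A \<and> abelian_category A'' \<and>
     additive_functor A' A iI \<and> additive_functor A A' iL \<and> additive_functor A A' iR \<and>
     additive_functor A A'' jJ \<and> additive_functor A'' A jL \<and> additive_functor A'' A jR \<and>
     (\<exists>\<eta> \<epsilon>. adjunction A'' A jL jJ \<eta> \<epsilon> \<and> nat_iso A'' A'' id_func (jJ \<odot> jL) \<eta>) \<and>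
     (\<exists>\<eta> \<epsilon>. adjunction A A'' jJ jR \<eta> \<epsilon> \<and> nat_iso A'' A'' (jJ \<odot> jR) id_func \<epsilon>) \<and>
     (\<exists>\<eta> \<epsilon>. adjunction A A' iL iI \<eta> \<epsilon> \<and> nat_iso A' A' (iL \<odot> iI) id_func \<epsilon>) \<and>
     (\<exists>\<eta> \<epsilon>. adjunction A' A iI iR \<eta> \<epsilon> \<and> nat_iso A' A' id_func (iR \<odot> iI) \<eta>) \<and>
     equivalence A' (kernel_subcat A A'' jJ) iI"


section \<open>Finite-dimensional vector spaces\<close>

text \<open>
  The universe of vectors is the space of functions \<open>idx \<Rightarrow> 'k\<close>: a finite-dimensional vector space
  is a finite-dimensional subspace of it. The index type is closed under forming tuples, so that
  tensor powers of subspaces are again subspaces. Linear maps are extended by zero outside their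
  domain; thus hom-spaces are subspaces of function spaces with pointwise operations.
\<close>

datatype idx = Ix nat | Tup "idx list"

type_synonym 'k vec = "idx \<Rightarrow> 'k"

definition fscale :: "('k \<Rightarrow> 'b \<Rightarrow> 'b) \<Rightarrow> 'k \<Rightarrow> ('a \<Rightarrow> 'b) \<Rightarrow> 'a \<Rightarrow> 'b" where
  "fscale s c f = (\<lambda>x. s c (f x))"

abbreviation vscale :: "'k::field \<Rightarrow> 'k vec \<Rightarrow> 'k vec" where
  "vscale \<equiv> fscale (*)"

abbreviation dscale :: "'k::field \<Rightarrow> ('k vec \<Rightarrow> 'k) \<Rightarrow> 'k vec \<Rightarrow> 'k" where
  "dscale \<equiv> fscale (*)"

definition lin ::
    "('k::field \<Rightarrow> 'a::ab_group_add \<Rightarrow> 'a) \<Rightarrow> 'a set \<Rightarrow> ('k \<Rightarrow> 'b::ab_group_add \<Rightarrow> 'b) \<Rightarrow> 'b set \<Rightarrow>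
     ('a \<Rightarrow> 'b) set" where
  "lin s V t W = {f. (\<forall>x\<in>V. f x \<in> W) \<and> (\<forall>x\<in>V. \<forall>y\<in>V. f (x + y) = f x + f y) \<and>
     (\<forall>c. \<forall>x\<in>V. f (s c x) = t c (f x)) \<and> (\<forall>x. x \<notin> V \<longrightarrow> f x = 0)}"

definition id_on :: "'a set \<Rightarrow> 'a::zero \<Rightarrow> 'a" where
  "id_on V = (\<lambda>x. if x \<in> V then x else 0)"

definition Vect :: "('k::field, 'k vec set, 'k vec \<Rightarrow> 'k vec) lincat" where
  "Vect = \<lparr>Obj = {V. \<exists>B. finite B \<and> V = module.span vscale B},
           Hom = (\<lambda>V W. lin vscale V vscale W), Idm = id_on, Cmp = (\<circ>), Scl = fscale vscale\<rparr>"

text \<open>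
  Spaces of linear maps or of natural transformations live in other types. \<open>model s W\<close> is an object
  of \<open>Vect\<close> isomorphic to a given finite-dimensional space \<open>W\<close> with scalar multiplication \<open>s\<close>;
  \<open>coords s W\<close> is a chosen isomorphism, and \<open>tmap\<close> transports linear maps along these isomorphisms.
\<close>

definition coords ::
    "('k::field \<Rightarrow> 'a::ab_group_add \<Rightarrow> 'a) \<Rightarrow> 'a set \<Rightarrow> 'a \<Rightarrow> 'k vec" where
  "coords s W = (SOME \<phi>. \<phi> \<in> lin s W vscale UNIV \<and> inj_on \<phi> W)"

definition model :: "('k::field \<Rightarrow> 'a::ab_group_add \<Rightarrow> 'a) \<Rightarrow> 'a set \<Rightarrow> 'k vec set" where
  "model s W = coords s W ` W"

definition tmap ::
    "('k::field \<Rightarrow> 'a::ab_group_add \<Rightarrow> 'a) \<Rightarrow> 'a set \<Rightarrow> ('k \<Rightarrow> 'b::ab_group_add \<Rightarrow> 'b) \<Rightarrow> 'b set \<Rightarrow>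
     ('a \<Rightarrow> 'b) \<Rightarrow> 'k vec \<Rightarrow> 'k vec" where
  "tmap s W t Z f =
     (\<lambda>y. if y \<in> model s W then coords t Z (f (inv_into W (coords s W) y)) else 0)"

definition functionals :: "'k::field vec set \<Rightarrow> ('k vec \<Rightarrow> 'k) set" where
  "functionals V = lin vscale V (*) UNIV"

definition dual :: "'k::field vec set \<Rightarrow> 'k vec set" where
  "dual V = model dscale (functionals V)"

definition dual_map ::
    "'k::field vec set \<Rightarrow> 'k vec set \<Rightarrow> ('k vec \<Rightarrow> 'k vec) \<Rightarrow> 'k vec \<Rightarrow> 'k vec" where
  "dual_map V W f = tmap dscale (functionals W) dscale (functionals V) (\<lambda>\<xi>. \<xi> \<circ> f)"

definition eval_dual :: "'k::field vec set \<Rightarrow> 'k vec \<Rightarrow> 'k vec \<Rightarrow> 'k" where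
  "eval_dual V = inv_into (functionals V) (coords dscale (functionals V))"


section \<open>Linear functor categories and coherent functors\<close>

type_synonym ('k, 'o, 'm) vfunc = "('o, 'm, 'k vec set, 'k vec \<Rightarrow> 'k vec) func"

text \<open>Natural transformations are families that vanish outside the objects of the source.\<close>

definition FunK ::
    "('k::field, 'o, 'm::ab_group_add) lincat \<Rightarrow>
     ('k, ('k, 'o, 'm) vfunc, 'o \<Rightarrow> 'k vec \<Rightarrow> 'k vec) lincat" where
  "FunK C =
     \<lparr>Obj = {F. linear_functor C Vect F},
      Hom = (\<lambda>F G. {\<eta>. nat_trans C Vect F G \<eta> \<and> (\<forall>X. X \<notin> Obj C \<longrightarrow> \<eta> X = 0)}),
      Idm = (\<lambda>F X. if X \<in> Obj C then Idm Vect (Fo F X) else 0),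
      Cmp = (\<lambda>\<eta> \<theta> X. Cmp Vect (\<eta> X) (\<theta> X)),
      Scl = fscale (Scl Vect)\<rparr>"

definition hrep ::
    "('k::field, 'o, 'm::ab_group_add) lincat \<Rightarrow> 'o \<Rightarrow> ('k, 'o, 'm) vfunc" where
  "hrep C M =
     \<lparr>Fo = \<lambda>X. model (Scl C) (Hom C M X),
      Fm = \<lambda>X Y g. tmap (Scl C) (Hom C M X) (Scl C) (Hom C M Y) (\<lambda>f. Cmp C g f)\<rparr>"

definition hrep_map ::
    "('k::field, 'o, 'm::ab_group_add) lincat \<Rightarrow> 'o \<Rightarrow> 'o \<Rightarrow> 'm \<Rightarrow> 'o \<Rightarrow> 'k vec \<Rightarrow> 'k vec" where
  "hrep_map C M N g =
     (\<lambda>X. if X \<in> Obj C then tmap (Scl C) (Hom C N X) (Scl C) (Hom C M X) (\<lambda>f. Cmp C f g) else 0)"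

definition coherent ::
    "('k::field, 'o, 'm::ab_group_add) lincat \<Rightarrow> ('k, 'o, 'm) vfunc \<Rightarrow> bool" where
  "coherent C f \<longleftrightarrow>
     (\<exists>M\<in>Obj C. \<exists>N\<in>Obj C. \<exists>\<alpha>\<in>Hom (FunK C) (hrep C N) (hrep C M). \<exists>\<beta>\<in>Hom (FunK C) (hrep C M) f.
        \<forall>X\<in>Obj C. \<beta> X ` Fo (hrep C M) X = Fo f X \<and>
          {y \<in> Fo (hrep C M) X. \<beta> X y = 0} = \<alpha> X ` Fo (hrep C N) X)"

definition Coh ::
    "('k::field, 'o, 'm::ab_group_add) lincat \<Rightarrow>
     ('k, ('k, 'o, 'm) vfunc, 'o \<Rightarrow> 'k vec \<Rightarrow> 'k vec) lincat" where
  "Coh C = full_subcat (FunK C) (coherent C)"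


section \<open>Group representations\<close>

type_synonym ('k, 'g) rep = "'k vec set \<times> ('g \<Rightarrow> 'k vec \<Rightarrow> 'k vec)"

text \<open>The category of finite-dimensional modules over the group algebra of \<open>G\<close>.\<close>

definition Rep :: "('g, 'x) monoid_scheme \<Rightarrow>
    ('k::field, ('k, 'g) rep, 'k vec \<Rightarrow> 'k vec) lincat" where
  "Rep G =
     \<lparr>Obj = {(V, \<rho>). V \<in> Obj Vect \<and> (\<forall>g\<in>carrier G. \<rho> g \<in> Hom Vect V V) \<and>
               \<rho> \<one>\<^bsub>G\<^esub> = Idm Vect V \<and>
               (\<forall>g\<in>carrier G. \<forall>h\<in>carrier G. \<rho> (g \<otimes>\<^bsub>G\<^esub> h) = Cmp Vect (\<rho> g) (\<rho> h))},
      Hom = (\<lambda>(V, \<rho>) (W, \<sigma>). {f \<in> Hom Vect V W. \<forall>g\<in>carrier G. \<forall>x\<in>V. f (\<rho> g x) = \<sigma> g (f x)}),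
      Idm = (\<lambda>(V, \<rho>). Idm Vect V), Cmp = Cmp Vect, Scl = Scl Vect\<rparr>"

definition dual_rep :: "('g, 'x) monoid_scheme \<Rightarrow> ('k::field, 'g) rep \<Rightarrow> ('k, 'g) rep" where
  "dual_rep G = (\<lambda>(V, \<rho>). (dual V, \<lambda>g. dual_map V V (\<rho> (inv\<^bsub>G\<^esub> g))))"

text \<open>The permutation module on the left cosets of \<open>H\<close>: functions on \<open>G/H\<close> (elements of the free
  vector space on \<open>G/H\<close>, as \<open>G\<close> is finite), extended by zero.\<close>

definition coset_space :: "('g, 'x) monoid_scheme \<Rightarrow> 'g set \<Rightarrow> ('g set \<Rightarrow> 'k::field) set" where
  "coset_space G H = {x. \<forall>C. C \<notin> lcosets\<^bsub>G\<^esub> H \<longrightarrow> x C = 0}"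

definition perm_rep :: "('g, 'x) monoid_scheme \<Rightarrow> 'g set \<Rightarrow> ('k::field, 'g) rep" where
  "perm_rep G H =
     (let W = (coset_space G H :: ('g set \<Rightarrow> 'k) set); s = fscale (*) in
      (model s W,
       \<lambda>g. tmap s W s W (\<lambda>x C. if C \<in> lcosets\<^bsub>G\<^esub> H then x (inv\<^bsub>G\<^esub> g <#\<^bsub>G\<^esub> C) else 0)))"

text \<open>The duality on linear functors on representations, on objects and on arrows
  \<open>\<alpha> : f \<rightarrow> f'\<close> (it is contravariant).\<close>

definition dualA ::
    "('g, 'x) monoid_scheme \<Rightarrow> ('k::field, ('k, 'g) rep, 'k vec \<Rightarrow> 'k vec) vfunc \<Rightarrow>
     ('k, ('k, 'g) rep, 'k vec \<Rightarrow> 'k vec) vfunc" where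
  "dualA G f =
     \<lparr>Fo = \<lambda>M. dual (Fo f (dual_rep G M)),
      Fm = \<lambda>M N g. dual_map (Fo f (dual_rep G N)) (Fo f (dual_rep G M))
             (Fm f (dual_rep G N) (dual_rep G M) (dual_map (fst M) (fst N) g))\<rparr>"

definition dualA_map ::
    "('g, 'x) monoid_scheme \<Rightarrow> ('k::field, ('k, 'g) rep, 'k vec \<Rightarrow> 'k vec) vfunc \<Rightarrow>
     ('k, ('k, 'g) rep, 'k vec \<Rightarrow> 'k vec) vfunc \<Rightarrow>
     (('k, 'g) rep \<Rightarrow> 'k vec \<Rightarrow> 'k vec) \<Rightarrow> ('k, 'g) rep \<Rightarrow> 'k vec \<Rightarrow> 'k vec" where
  "dualA_map G f f' \<alpha> =
     (\<lambda>M. if M \<in> Obj (Rep G)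
          then dual_map (Fo f (dual_rep G M)) (Fo f' (dual_rep G M)) (\<alpha> (dual_rep G M)) else 0)"


section \<open>Tensor powers and strict polynomial functors\<close>

text \<open>
  The pure tensor \<open>v\<^sub>1 \<otimes> \<dots> \<otimes> v\<^sub>n\<close> is the function \<open>(t\<^sub>1, \<dots>, t\<^sub>n) \<mapsto> v\<^sub>1(t\<^sub>1) \<cdots> v\<^sub>n(t\<^sub>n)\<close> on tuples of
  indices, and \<open>V\<^sup>\<otimes>\<^sup>n\<close> is the span of the pure tensors with factors in \<open>V\<close>. A permutation \<open>\<sigma>\<close> maps
  this tensor to the one with \<open>i\<close>-th factor \<open>v\<^bsub>\<sigma>\<^sup>-\<^sup>1(i)\<^esub>\<close>. Factors are numbered from \<open>1\<close>, list
  positions from \<open>0\<close>.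
\<close>

definition pure_tensor :: "nat \<Rightarrow> (nat \<Rightarrow> 'k::field vec) \<Rightarrow> 'k vec" where
  "pure_tensor n v =
     (\<lambda>i. case i of Ix _ \<Rightarrow> 0
        | Tup ts \<Rightarrow> if length ts = n then \<Prod>k=1..n. v k (ts ! (k - 1)) else 0)"

definition tpow :: "nat \<Rightarrow> 'k::field vec set \<Rightarrow> 'k vec set" where
  "tpow n V = module.span vscale {pure_tensor n v |v. \<forall>k\<in>{1..n}. v k \<in> V}"

definition permute_factors :: "nat \<Rightarrow> (nat \<Rightarrow> nat) \<Rightarrow> 'k::field vec \<Rightarrow> 'k vec" where
  "permute_factors n \<sigma> x =
     (\<lambda>i. case i of Ix _ \<Rightarrow> 0
        | Tup ts \<Rightarrow> if length ts = n then x (Tup (map (\<lambda>k. ts ! (\<sigma> k - 1)) [1..<Suc n])) else 0)"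

definition tpow_rep :: "nat \<Rightarrow> 'k::field vec set \<Rightarrow> ('k, nat \<Rightarrow> nat) rep" where
  "tpow_rep n V =
     (tpow n V, \<lambda>\<sigma> x. if x \<in> tpow n V then permute_factors n \<sigma> x else 0)"

text \<open>The morphisms \<open>\<Gamma>\<^sup>n(Hom(V, W))\<close> are given as the equivariant maps \<open>V\<^sup>\<otimes>\<^sup>n \<rightarrow> W\<^sup>\<otimes>\<^sup>n\<close>.\<close>

definition GammaVect :: "nat \<Rightarrow> ('k::field, 'k vec set, 'k vec \<Rightarrow> 'k vec) lincat" where
  "GammaVect n =
     \<lparr>Obj = Obj Vect,
      Hom = (\<lambda>V W. Hom (Rep (sym_group n)) (tpow_rep n V) (tpow_rep n W)),
      Idm = (\<lambda>V. Idm (Rep (sym_group n)) (tpow_rep n V)),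
      Cmp = Cmp (Rep (sym_group n)), Scl = Scl (Rep (sym_group n))\<rparr>"

type_synonym 'k pfunc = "('k, 'k vec set, 'k vec \<Rightarrow> 'k vec) vfunc"
type_synonym 'k pnat = "'k vec set \<Rightarrow> 'k vec \<Rightarrow> 'k vec"
type_synonym 'k srep = "('k, nat \<Rightarrow> nat) rep"
type_synonym 'k sfunc = "('k, 'k srep, 'k vec \<Rightarrow> 'k vec) vfunc"
type_synonym 'k snat = "'k srep \<Rightarrow> 'k vec \<Rightarrow> 'k vec"

definition StrictPoly :: "nat \<Rightarrow> ('k::field, 'k pfunc, 'k pnat) lincat" where
  "StrictPoly n = FunK (GammaVect n)"

definition CohSym :: "nat \<Rightarrow> ('k::field, 'k sfunc, 'k snat) lincat" where
  "CohSym n = Coh (Rep (sym_group n))"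

text \<open>\<open>tensor_duality n V\<close> is the canonical isomorphism \<open>(V\<^sup>\<or>)\<^sup>\<otimes>\<^sup>n \<cong> (V\<^sup>\<otimes>\<^sup>n)\<^sup>\<or>\<close>. The dual of an arrow
  \<open>V\<^sup>\<otimes>\<^sup>n \<rightarrow> W\<^sup>\<otimes>\<^sup>n\<close> of \<open>GammaVect n\<close> is the transpose, read along these isomorphisms.\<close>

definition tensor_duality :: "nat \<Rightarrow> 'k::field vec set \<Rightarrow> 'k vec \<Rightarrow> 'k vec \<Rightarrow> 'k" where
  "tensor_duality n V =
     (THE \<kappa>. \<kappa> \<in> lin vscale (tpow n (dual V)) dscale (functionals (tpow n V)) \<and>
        (\<forall>\<xi> v. (\<forall>k\<in>{1..n}. \<xi> k \<in> dual V \<and> v k \<in> V) \<longrightarrow>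
           \<kappa> (pure_tensor n \<xi>) (pure_tensor n v) = (\<Prod>k=1..n. eval_dual V (\<xi> k) (v k))))"

definition gamma_dual_map ::
    "nat \<Rightarrow> 'k::field vec set \<Rightarrow> 'k vec set \<Rightarrow> ('k vec \<Rightarrow> 'k vec) \<Rightarrow> 'k vec \<Rightarrow> 'k vec" where
  "gamma_dual_map n V W \<phi> =
     (\<lambda>x. if x \<in> tpow n (dual W)
          then inv_into (tpow n (dual V)) (tensor_duality n V) (tensor_duality n W x \<circ> \<phi>) else 0)"

definition dualP :: "nat \<Rightarrow> 'k::field pfunc \<Rightarrow> 'k pfunc" where
  "dualP n F =
     \<lparr>Fo = \<lambda>V. dual (Fo F (dual V)),
      Fm = \<lambda>V W \<phi>. dual_map (Fo F (dual W)) (Fo F (dual V))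
             (Fm F (dual W) (dual V) (gamma_dual_map n V W \<phi>))\<rparr>"

definition dualP_map :: "'k::field pfunc \<Rightarrow> 'k pfunc \<Rightarrow> 'k pnat \<Rightarrow> 'k pnat" where
  "dualP_map F F' \<alpha> =
     (\<lambda>V. if V \<in> Obj Vect
          then dual_map (Fo F (dual V)) (Fo F' (dual V)) (\<alpha> (dual V)) else 0)"


section \<open>The functors of the recollement\<close>

definition jstar :: "nat \<Rightarrow> ('k::field sfunc, 'k snat, 'k pfunc, 'k pnat) func" where
  "jstar n =
     \<lparr>Fo = \<lambda>f. \<lparr>Fo = \<lambda>V. Fo f (tpow_rep n V), Fm = \<lambda>V W. Fm f (tpow_rep n V) (tpow_rep n W)\<rparr>,
      Fm = \<lambda>f g \<alpha> V. if V \<in> Obj Vect then \<alpha> (tpow_rep n V) else 0\<rparr>"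

definition jlower_hom :: "nat \<Rightarrow> 'k::field pfunc \<Rightarrow> 'k srep \<Rightarrow> 'k pnat set" where
  "jlower_hom n F M = Hom (StrictPoly n) (Fo (jstar n) (hrep (Rep (sym_group n)) M)) F"

definition jlower :: "nat \<Rightarrow> ('k::field pfunc, 'k pnat, 'k sfunc, 'k snat) func" where
  "jlower n =
     (let G = sym_group n; P = (StrictPoly n :: ('k, 'k pfunc, 'k pnat) lincat); s = Scl P in
     \<lparr>Fo = \<lambda>F.
        \<lparr>Fo = \<lambda>M. model s (jlower_hom n F M),
         Fm = \<lambda>M N g. tmap s (jlower_hom n F M) s (jlower_hom n F N)
           (\<lambda>\<alpha>. Cmp P \<alpha> (Fm (jstar n) (hrep (Rep G) N) (hrep (Rep G) M) (hrep_map (Rep G) M N g)))\<rparr>,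
      Fm = \<lambda>F F' \<beta> M. if M \<in> Obj (Rep G)
        then tmap s (jlower_hom n F M) s (jlower_hom n F' M) (\<lambda>\<alpha>. Cmp P \<beta> \<alpha>) else 0\<rparr>)"

definition jshriek :: "nat \<Rightarrow> ('k::field pfunc, 'k pnat, 'k sfunc, 'k snat) func" where
  "jshriek n =
     \<lparr>Fo = \<lambda>F. dualA (sym_group n) (Fo (jlower n) (dualP n F)),
      Fm = \<lambda>F F' \<alpha>. dualA_map (sym_group n)
        (Fo (jlower n) (dualP n F')) (Fo (jlower n) (dualP n F))
        (Fm (jlower n) (dualP n F') (dualP n F) (dualP_map F F' \<alpha>))\<rparr>"

definition is_partition :: "nat \<Rightarrow> nat list \<Rightarrow> bool" where
  "is_partition n l \<longleftrightarrow> sorted_wrt (\<ge>) l \<and> (\<forall>x\<in>set l. x > 0) \<and> sum_list l = n"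

definition young_subgroup :: "nat \<Rightarrow> nat list \<Rightarrow> (nat \<Rightarrow> nat) set" where
  "young_subgroup n l = {\<sigma> \<in> carrier (sym_group n). \<forall>i<length l.
     let B = {sum_list (take i l)<..sum_list (take (Suc i) l)} in \<sigma> ` B = B}"

definition CohSymY :: "nat \<Rightarrow> ('k::field, 'k sfunc, 'k snat) lincat" where
  "CohSymY n = full_subcat (CohSym n)
     (\<lambda>f. \<forall>l. is_partition n l \<longrightarrow> Fo f (perm_rep (sym_group n) (young_subgroup n l)) = {0})"

definition incl :: "('k::field sfunc, 'k snat, 'k sfunc, 'k snat) func" where
  "incl = id_func"

end

theory Submission
 imports Defs
begin

text \<open>
 A functor is coherent iff it is generated by some \<open>Hom(M, -)\<close> (a quotient of it) and cogenerated by
 some \<open>N\<close> (a subfunctor of \<open>X \<mapsto> lin(Hom(X, N), W)\<close>). The two conditions are exchanged by the duality,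
 and a kernel or cokernel inherits one of them trivially. The other one comes down to a statement
 about modules: for a functional \<open>theta\<close> on \<open>Hom(M, N)\<close> the maps \<open>h\<close> into \<open>N\<close> with
 \<open>theta(h g) = 0\<close> for all \<open>g\<close> are those that factor through a single map \<open>v : N' \<rightarrow> N\<close>. The
 trace form writes \<open>theta\<close> as \<open>h \<mapsto> tr(t h)\<close>, and \<open>N'\<close> parametrizes the ways of writing \<open>t h\<close> as a
 sum of differences \<open>c\<inverse> s c - s\<close> over the group elements \<open>c\<close>.

 Every \<open>V\<^sup>\<otimes>\<^sup>n\<close> is a sum of retracts of the single module \<open>E\<^sup>\<otimes>\<^sup>n\<close>, \<open>dim E = n\<close>. Hence
 \<open>j\<^sub>*(F)(M)\<close> consists of the linear maps \<open>Hom(M, E\<^sup>\<otimes>\<^sup>n) \<rightarrow> F(E)\<close> that commute with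
 \<open>End(E\<^sup>\<otimes>\<^sup>n)\<close>, which makes it coherent; \<open>j\<^sub>!\<close> is its conjugate by the dualities. The adjoints
 \<open>i\<^sup>!\<close> and \<open>i\<^sup>*\<close> of the inclusion of \<open>ker j\<^sup>*\<close> are the kernel of \<open>f \<rightarrow> j\<^sub>*j\<^sup>*f\<close> and the cokernel of
 \<open>j\<^sub>!j\<^sup>*f \<rightarrow> f\<close>. Finally the words in a basis of \<open>V\<close> decompose \<open>V\<^sup>\<otimes>\<^sup>n\<close> into the modules
 \<open>K[S_n/S_lambda]\<close>, all of which occur in \<open>E\<^sup>\<otimes>\<^sup>n\<close>; so \<open>ker j\<^sup>*\<close> is the subcategory of the statement.
\<close>

section \<open>Linear algebra relative to subspaces\<close>

text \<open>The group order may vanish in the field, and this shapes the module-theoretic core. If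
  it were invertible, the linear map \<open>t : N -> M\<close> with
  \<open>theta(h) = tr(t h)\<close> could be averaged to an equivariant one; the same averaging
  would turn \<open>tr(t h g) = 0\<close> for all equivariant \<open>g\<close> into
  \<open>t h = 0\<close>, and \<open>N'\<close> would be the kernel of \<open>t\<close>. In general
  the dual of the invariants \<open>Hom_G(M, Y)\<close> is the space of coinvariants of
  \<open>lin(Y, M)\<close>, so the trace condition only says that \<open>t h\<close> is a sum of
  terms \<open>c^-1 s c - s\<close>. The maps \<open>s\<close> are neither unique nor equivariant,
  so \<open>N'\<close> carries them as data, with their values along whole orbits.

  A second choice saves half the work: generation is phrased with functionals, as the mirror image
  of cogeneration. Only cokernels are treated directly; kernels follow by duality.

  The construction of \<open>i\<^sup>!\<close> and \<open>i\<^sup>*\<close> does not go through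
  exactness of \<open>j\<^sup>*\<close>. That \<open>j\<^sup>*\<close> kills the kernel of
  \<open>f \<rightarrow> j\<^sub>*j\<^sup>*f\<close> is proved with the other adjoint
  \<open>j\<^sub>!\<close>, and dually.\<close>

definition linon ::
	"('k::field => 'a::ab_group_add => 'a) => 'a set => ('k => 'b::ab_group_add => 'b) => 'b set =>
	 ('a => 'b) => bool" where
 "linon s V t W f \<longleftrightarrow> (ALL x:V. f x:W) & (ALL x:V. ALL y:V. f (x + y) = f x + f y) &
	 (ALL c. ALL x:V. f (s c x) = t c (f x))"

text \<open>\<open>linon\<close> asks for linearity on \<open>V\<close> only, so plain lambda terms
  can be composed without regard to their values elsewhere. \<open>restr\<close> restores the
  convention of \<open>lin\<close>, value 0 outside the domain, at the end.\<close>

definition restr :: "'a set => ('a => 'b::zero) => 'a => 'b" where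
 "restr V f = (%x. if x:V then f x else 0)"

text \<open>Scalar multiplication is an explicit argument because vectors, functionals, linear maps
  and natural transformations each come with their own; bundling \<open>vector_space s\<close> makes
  one fact suffice for each space.\<close>

definition subsp :: "('k::field => 'a::ab_group_add => 'a) => 'a set => bool" where
 "subsp s V \<longleftrightarrow> vector_space s & module.subspace s V"

definition fds :: "('k::field => 'a::ab_group_add => 'a) => 'a set => bool" where
 "fds s V \<longleftrightarrow> vector_space s & (EX B. finite B & V = module.span s B)"

lemma vs_k [simp, intro]: "vector_space ((*) :: 'k::field => 'k => 'k)"
 by unfold_locales (simp_all add: algebra_simps)

lemma vector_space_fscale [simp, intro]: "vector_space s ==> vector_space (fscale s)"
 unfolding vector_space_def fscale_def by (auto simp: fun_eq_iff)

lemma lin_iff: "f:lin s V t W \<longleftrightarrow> linon s V t W f & (ALL x. x ~: V --> f x = 0)"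
 by (auto simp: lin_def linon_def)

lemma restr_in [simp]: "x:V ==> restr V f x = f x" by (simp add: restr_def)
lemma restr_out [simp]: "x ~: V ==> restr V f x = 0" by (simp add: restr_def)

lemma subsp_vs: "subsp s V ==> vector_space s" by (simp add: subsp_def)

lemma subspI:
 assumes "vector_space s" "0:V" "!!x y. x:V ==> y:V ==> x + y:V" "!!c x. x:V ==> s c x:V"
 shows "subsp s V"
proof -
 interpret vector_space s by fact
 show ?thesis using assms by (simp add: subsp_def subspace_def)
qed

lemma subspD:
 assumes "subsp s V"
 shows "0:V" "!!x y. x:V ==> y:V ==> x + y:V" "!!c x. x:V ==> s c x:V"
	"!!x. x:V ==> - x:V" "!!x y. x:V ==> y:V ==> x - y:V"
	"!!f I. (!!i. i:I ==> f i:V) ==> sum f I:V"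
proof -
 interpret vector_space s using assms by (rule subsp_vs)
 have "subspace V" using assms by (simp add: subsp_def)
 then show "0:V" "!!x y. x:V ==> y:V ==> x + y:V" "!!c x. x:V ==> s c x:V"
	"!!x. x:V ==> - x:V" "!!x y. x:V ==> y:V ==> x - y:V"
	"!!f I. (!!i. i:I ==> f i:V) ==> sum f I:V"
	by (auto intro: subspace_0 subspace_add subspace_scale subspace_neg subspace_diff subspace_sum)
qed

lemma subsp_UNIV [simp, intro]: "vector_space s ==> subsp s UNIV"
 by (rule subspI) auto

lemma fsub [simp, intro]: "fds s V ==> subsp s V"
proof -
 assume a: "fds s V"
 then interpret vector_space s by (simp add: fds_def)
 show ?thesis using a by (auto simp: fds_def subsp_def)
qed

lemma fds_vs: "fds s V ==> vector_space s" by (simp add: fds_def)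

lemma vs_simps:
 assumes "vector_space s"
 shows "s c 0 = 0" "s 0 x = 0" "s 1 x = x" "s a (x + y) = s a x + s a y" "s (a + b) x = s a x + s b x"
	"s a (s b x) = s (a * b) x" "s a (- x) = - s a x" "s a (x - y) = s a x - s a y" "s (- a) x = - s a x"
	"s (a - b) x = s a x - s b x" "s a (sum f I) = (SUM i:I. s a (f i))" "s (sum g J) x = (SUM i:J. s (g i) x)"
proof -
 interpret vector_space s by fact
 show "s c 0 = 0" "s 0 x = 0" "s 1 x = x" "s a (x + y) = s a x + s a y" "s (a + b) x = s a x + s b x"
	"s a (s b x) = s (a * b) x" "s a (- x) = - s a x" "s a (x - y) = s a x - s a y" "s (- a) x = - s a x"
	"s (a - b) x = s a x - s b x" "s a (sum f I) = (SUM i:I. s a (f i))" "s (sum g J) x = (SUM i:J. s (g i) x)"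
	by (simp_all add: scale_right_distrib scale_left_distrib scale_right_diff_distrib
		scale_left_diff_distrib scale_sum_right scale_sum_left)
qed

lemma fdsI:
 assumes "subsp s V" "finite B" "B <= V" "!!x. x:V ==> x:module.span s B"
 shows "fds s V"
proof -
 interpret vector_space s using assms(1) by (rule subsp_vs)
 have "span B <= V" using assms by (intro span_minimal) (auto simp: subsp_def)
 then show ?thesis using assms by (auto simp: fds_def intro!: exI[of _ B] vector_space_axioms)
qed

lemma fdsI_sum:
 assumes "subsp s V" "finite I" "!!i. i:I ==> e i:V" "!!x. x:V ==> EX c. x = (SUM i:I. s (c i) (e i))"
 shows "fds s V"
proof (rule fdsI[OF assms(1), of "e ` I"])
 interpret vector_space s using assms(1) by (rule subsp_vs)
 fix x assume "x:V"
 then obtain c where "x = (SUM i:I. s (c i) (e i))" using assms(4) by blast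
 then show "x:span (e ` I)" by (auto intro!: span_sum span_scale intro: span_base)
qed (use assms in auto)

lemma linonD:
 assumes "linon s V t W f"
 shows "x:V ==> f x:W" "x:V ==> y:V ==> f (x + y) = f x + f y" "x:V ==> f (s c x) = t c (f x)"
 using assms by (auto simp: linon_def)

lemma linon_more:
 assumes f: "linon s V t W f" and V: "subsp s V" and t: "vector_space t"
 shows "f 0 = 0" "x:V ==> f (- x) = - f x" "x:V ==> y:V ==> f (x - y) = f x - f y"
	"(!!i. i:I ==> g i:V) ==> f (sum g I) = (SUM i:I. f (g i))"
	"(!!i. i:I ==> g i:V) ==> f (SUM i:I. s (h i) (g i)) = (SUM i:I. t (h i) (f (g i)))"
proof -
 note s = vs_simps[OF subsp_vs[OF V]] and t' = vs_simps[OF t]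
 show 0: "f 0 = 0" using linonD(3)[OF f subspD(1)[OF V], of 0] s(2) t'(2) by simp
 have neg: "f (- x) = - f x" if "x:V" for x
	using linonD(3)[OF f that, of "-1"] s t' by simp
 then show "x:V ==> f (- x) = - f x" .
 show "x:V ==> y:V ==> f (x - y) = f x - f y"
	using linonD(2)[OF f, of x "- y"] neg[of y] subspD(4)[OF V] by simp
 have sm: "f (sum g I) = (SUM i:I. f (g i))" if "!!i. i:I ==> g i:V" for g
	using that
 proof (induction I rule: infinite_finite_induct)
	case (insert x F)
	then show ?case using subspD(6)[OF V, of F g] by (simp add: linonD(2)[OF f])
 qed (auto simp: 0)
 then show "(!!i. i:I ==> g i:V) ==> f (sum g I) = (SUM i:I. f (g i))" .
 show "(!!i. i:I ==> g i:V) ==> f (SUM i:I. s (h i) (g i)) = (SUM i:I. t (h i) (f (g i)))"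
	by (subst sm) (auto intro!: sum.cong subspD(3)[OF V] linonD(3)[OF f])
qed

lemma lin_linon [intro]: "f:lin s V t W ==> linon s V t W f" by (simp add: lin_iff)

lemmas linD = linonD[OF lin_linon]
lemmas lin_more = linon_more[OF lin_linon]

lemma lin_out: "f:lin s V t W ==> x ~: V ==> f x = 0" by (simp add: lin_iff)

lemma lin_eqI: "f:lin s V t W ==> g:lin s V t W' ==> (!!x. x:V ==> f x = g x) ==> f = g"
 by (rule ext) (metis lin_out)

lemma linI:
 assumes "!!x. x:V ==> f x:W" "!!x y. x:V ==> y:V ==> f (x + y) = f x + f y"
	"!!c x. x:V ==> f (s c x) = t c (f x)" "!!x. x ~: V ==> f x = 0"
 shows "f:lin s V t W"
 using assms by (simp add: lin_def)

lemma restr_lin: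
 assumes "subsp s V" "linon s V t W f" shows "restr V f:lin s V t W"
 using linonD[OF assms(2)] subspD[OF assms(1)] by (intro linI) auto

lemma linon_mono: "linon s V t W f ==> U <= V ==> (!!x. x:U ==> f x:Z) ==> linon s U t Z f"
 by (auto simp: linon_def subset_iff)

lemma linon_comp: "linon s V t W f ==> linon t W u Z g ==> linon s V u Z (%x. g (f x))"
 by (auto simp: linon_def)

lemma lin_comp:
 assumes "f:lin s V t W" "g:lin t W u Z" "subsp t W" "vector_space u" shows "g o f:lin s V u Z"
 using linon_comp[of s V t W f u Z g] assms lin_more(1)[OF assms(2,3,4)] lin_out[OF assms(1)]
 by (auto simp: lin_iff comp_def)

lemma subsp_linon:
 assumes "vector_space t" "subsp t W"
 shows "subsp (fscale t) (lin s V t W)"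
proof -
 note v = vs_simps[OF assms(1)]
 show ?thesis using subspD[OF assms(2)] assms(1)
	by (intro subspI) (auto simp: lin_def fscale_def v algebra_simps)
qed

lemma subsp_image:
 assumes "subsp s V" "vector_space t" "linon s V t W f" shows "subsp t (f ` V)"
proof (rule subspI)
 note d = linonD[OF assms(3)] linon_more[OF assms(3,1,2)] and S = subspD[OF assms(1)]
 show "0:f ` V" using S(1) d(4) by force
 show "x + y:f ` V" if "x:f ` V" "y:f ` V" for x y
	using that S(2) by (auto simp flip: d(2))
 show "t c x:f ` V" if "x:f ` V" for c x using that S(3) by (auto simp flip: d(3))
qed fact

lemma subsp_ker:
 assumes "subsp s V" "vector_space t" "linon s V t W f" shows "subsp s {x:V. f x = 0}"
 using subspD[OF assms(1)] subsp_vs[OF assms(1)] linonD[OF assms(3)] linon_more[OF assms(3,1,2)] vs_simps[OF assms(2)]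
 by (intro subspI) auto

section \<open>Dual bases, extension of linear maps, separation by functionals\<close>

lemma fds_dual_basis:
 assumes V: "fds s V"
 shows "EX B xi. finite B & B <= V & (ALL b:B. xi b:lin s V (*) UNIV) &
	(ALL b:B. ALL c:B. xi b c = (if b = c then 1 else 0)) & (ALL x:V. (SUM b:B. s (xi b x) b) = x)"
proof -
 interpret vector_space s using V by (rule fds_vs)
 obtain T where T: "finite T" "V = span T" using V by (auto simp: fds_def)
 obtain B where B: "B <= V" "independent B" "V <= span B"
	using maximal_independent_subset[of V] by blast
 have fB: "finite B" using independent_span_bound[OF T(1) B(2)] B T by auto
 define xi where "xi b = restr V (%x. representation B x b)" for b
 have "xi b:lin s V (*) UNIV" if "b:B" for b
	unfolding xi_def
	using B by (intro restr_lin fsub[OF V]) (auto simp: linon_def representation_add representation_scale subset_iff)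
 moreover have "xi b c = (if b = c then 1 else 0)" if "b:B" "c:B" for b c
	using that B by (auto simp: xi_def representation_basis subset_iff)
 moreover have "(SUM b:B. s (xi b x) b) = x" if "x:V" for x
	using that B fB sum_representation_eq[OF B(2), of x B] by (auto simp: xi_def)
 ultimately show ?thesis using fB B(1) by (intro exI[of _ B] exI[of _ xi]) blast
qed

text \<open>One fixed basis with its coordinate functionals. Traces, words in tensor powers and the
  number of summands in direct sums all refer to this choice.\<close>

definition dbas :: "('k::field => 'a::ab_group_add => 'a) => 'a set => 'a set \<times> ('a => 'a => 'k)" where
 "dbas s V = (SOME (B, xi). finite B & B <= V & (ALL b:B. xi b:lin s V (*) UNIV) &
	(ALL b:B. ALL c:B. xi b c = (if b = c then 1 else 0)) & (ALL x:V. (SUM b:B. s (xi b x) b) = x))"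

definition "bas s V = fst (dbas s V)"
definition "cob s V = snd (dbas s V)"

lemma bas:
 assumes V: "fds s V"
 shows "finite (bas s V)" "bas s V <= V" "b:bas s V ==> b:V" "b:bas s V ==> cob s V b:lin s V (*) UNIV"
	"b:bas s V ==> c:bas s V ==> cob s V b c = (if b = c then 1 else 0)"
	"x:V ==> (SUM b:bas s V. s (cob s V b x) b) = x"
proof -
 let ?P = "%(B, xi). finite B & B <= V & (ALL b:B. xi b:lin s V (*) UNIV) &
	(ALL b:B. ALL c:B. xi b c = (if b = c then 1 else 0)) & (ALL x:V. (SUM b:B. s (xi b x) b) = x)"
 have "EX p. ?P p" using fds_dual_basis[OF V] by auto
 then have "?P (dbas s V)" unfolding dbas_def by (rule someI_ex)
 then have p: "finite (bas s V) & bas s V <= V & (ALL b:bas s V. cob s V b:lin s V (*) UNIV) &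
	(ALL b:bas s V. ALL c:bas s V. cob s V b c = (if b = c then 1 else 0)) &
	(ALL x:V. (SUM b:bas s V. s (cob s V b x) b) = x)"
	unfolding bas_def cob_def by (cases "dbas s V") auto
 show "finite (bas s V)" using p by blast
 show "bas s V <= V" using p by blast
 show "b:bas s V ==> b:V" using p by blast
 show "b:bas s V ==> cob s V b:lin s V (*) UNIV" using p by blast
 show "b:bas s V ==> c:bas s V ==> cob s V b c = (if b = c then 1 else 0)" using p by blast
 show "x:V ==> (SUM b:bas s V. s (cob s V b x) b) = x" using p by blast
qed

lemma lin_bas:
 assumes "fds s V" "vector_space t" "linon s V t W f" "x:V"
 shows "f x = (SUM b:bas s V. t (cob s V b x) (f b))"
 using linon_more(5)[OF assms(3) fsub[OF assms(1)] assms(2), of "bas s V" "%b. b" "%b. cob s V b x"]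
	bas[OF assms(1)] assms(4) by simp

lemma fds_sub:
 assumes V: "fds s V" and U: "subsp s U" "U <= V" shows "fds s U"
proof -
 interpret vector_space s using V by (rule fds_vs)
 obtain T where T: "finite T" "V = span T" using V by (auto simp: fds_def)
 obtain B where B: "B <= U" "independent B" "U <= span B" using maximal_independent_subset[of U] by blast
 have fB: "finite B" using independent_span_bound[OF T(1) B(2)] B T U by auto
 show ?thesis using B fB by (intro fdsI[OF U(1), of B]) auto
qed

lemma fds_zero [simp, intro]: "vector_space s ==> fds s {0}"
 by (rule fdsI_sum[of _ _ "{}"]) (auto intro!: subspI simp: vs_simps)

lemma fds_field [simp, intro]: "fds ((*) :: 'k::field => 'k => 'k) UNIV"
 by (rule fdsI_sum[of _ _ "{1}" "%_. 1"]) (auto intro!: exI[of _ "%_. _"])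

lemma fds_image:
 assumes "fds s V" "vector_space t" "linon s V t W f" shows "fds t (f ` V)"
proof (rule fdsI_sum[of _ _ "bas s V" f, OF subsp_image[OF fsub[OF assms(1)] assms(2,3)] bas(1)[OF assms(1)]])
 show "f i:f ` V" if "i:bas s V" for i using bas(3)[OF assms(1) that] by simp
 fix x assume "x:f ` V"
 then obtain y where "y:V" "x = f y" by blast
 then show "EX c. x = (SUM i:bas s V. t (c i) (f i))"
	using lin_bas[OF assms, of y] by (intro exI[of _ "%b. cob s V b y"]) simp
qed

text \<open>A basis of the image is pulled back. This is how spaces of natural transformations are
  seen to be finite-dimensional: they embed by evaluation into a space of linear maps.\<close>

lemma fds_inj:
 assumes V: "subsp s V" and W: "fds t W" and f: "linon s V t W f" and inj: "inj_on f V"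
 shows "fds s V"
proof -
 note t = fds_vs[OF W]
 have im: "fds t (f ` V)" by (rule fds_sub[OF W subsp_image[OF V t f]]) (use linonD[OF f] in auto)
 define g where "g = inv_into V f"
 have g: "g y:V" "f (g y) = y" if "y:f ` V" for y
	unfolding g_def using that by (auto simp: inv_into_into f_inv_into_f)
 show ?thesis
 proof (rule fdsI_sum[OF V bas(1)[OF im], of g])
	fix x assume x: "x:V"
	then have fx: "f x:f ` V" by simp
	have "f x = (SUM b:bas t (f ` V). t (cob t (f ` V) b (f x)) b)" using bas(6)[OF im fx] by simp
	also have "... = (SUM b:bas t (f ` V). t (cob t (f ` V) b (f x)) (f (g b)))"
	 by (rule sum.cong) (use g bas(3)[OF im] in auto)
	also have "... = f (SUM b:bas t (f ` V). s (cob t (f ` V) b (f x)) (g b))"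
	 by (rule linon_more(5)[OF f V t, symmetric]) (use g bas(3)[OF im] in auto)
	finally have "x = (SUM b:bas t (f ` V). s (cob t (f ` V) b (f x)) (g b))"
	 using inj x g(1) bas(3)[OF im] by (auto dest!: inj_onD intro!: subspD[OF V])
	then show "EX c. x = (SUM b:bas t (f ` V). s (c b) (g b))"
	 by (intro exI[of _ "%b. cob t (f ` V) b (f x)"])
 qed (use g bas(3)[OF im] in auto)
qed

definition elem :: "('k::field => 'b => 'b) => ('a => 'k) => 'b => 'a => 'b" where
 "elem t xi w = (%x. t (xi x) w)"

lemma elem_lin:
 assumes "subsp t W" "xi:lin s V (*) UNIV" "w:W" shows "elem t xi w:lin s V t W"
 using linD[OF assms(2)] lin_out[OF assms(2)] subspD[OF assms(1)] vs_simps[OF subsp_vs[OF assms(1)]] assms(3)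
 by (intro linI) (auto simp: elem_def)

lemma sum_fun_apply: "sum f I x = (SUM i:I. f i x)"
 by (induction I rule: infinite_finite_induct) auto

lemma lin_elem_sum:
 assumes V: "fds s V" and t: "subsp t W" and f: "f:lin s V t W"
 shows "f = (SUM b:bas s V. elem t (cob s V b) (f b))"
proof (rule lin_eqI[OF f, of _ W])
 show "(SUM b:bas s V. elem t (cob s V b) (f b)):lin s V t W"
	using bas[OF V] linD(1)[OF f]
	by (intro subspD(6)[OF subsp_linon[OF subsp_vs[OF t] t]]) (auto intro!: elem_lin[OF t])
 show "f x = (SUM b:bas s V. elem t (cob s V b) (f b)) x" if "x:V" for x
	unfolding sum_fun_apply elem_def using lin_bas[OF V subsp_vs[OF t] lin_linon[OF f] that] .
qed

lemma fds_lin [intro]: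
 assumes V: "fds s V" and W: "fds t W" shows "fds (fscale t) (lin s V t W)"
proof (rule fdsI_sum[of _ _ "bas s V \<times> bas t W" "%(b, c). elem t (cob s V b) c"])
 note t = fds_vs[OF W]
 show "subsp (fscale t) (lin s V t W)" using fsub[OF W] t by (rule subsp_linon[rotated])
 show "finite (bas s V \<times> bas t W)" using bas[OF V] bas[OF W] by simp
 show "(case i of (b, c) => elem t (cob s V b) c):lin s V t W" if "i:bas s V \<times> bas t W" for i
	using that by (auto intro!: elem_lin fsub[OF W] bas(3)[OF W] bas(4)[OF V])
 fix f assume f: "f:lin s V t W"
 have "f x = (SUM i:bas s V \<times> bas t W. fscale t (case i of (b, c) => cob t W c (f b)) (case i of (b, c) => elem t (cob s V b) c)) x" for x
 proof -
	have "f x = (SUM b:bas s V. t (cob s V b x) (f b))"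
	 by (subst lin_elem_sum[OF V fsub[OF W] f]) (simp add: sum_fun_apply elem_def)
	also have "... = (SUM b:bas s V. SUM c:bas t W. t (cob t W c (f b)) (t (cob s V b x) c))"
	proof (rule sum.cong[OF refl])
	 fix b assume b: "b:bas s V"
	 have "f b:W" using linD(1)[OF f bas(3)[OF V b]] .
	 then show "t (cob s V b x) (f b) = (SUM c:bas t W. t (cob t W c (f b)) (t (cob s V b x) c))"
		by (subst bas(6)[OF W, symmetric, of "f b"]) (simp_all add: vs_simps[OF t] mult.commute)
	qed
	finally show ?thesis
	 by (simp add: sum_fun_apply fscale_def elem_def sum.cartesian_product split_def)
 qed
 then show "EX c. f = (SUM i:bas s V \<times> bas t W. fscale t (c i) (case i of (b, c) => elem t (cob s V b) c))"
	by (auto intro!: exI[of _ "%(b, c). cob t W c (f b)"])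
qed

lemma lin_extend:
 assumes V: "subsp s V" and U: "fds s U" "U <= V" and t: "subsp t W" and f: "f:lin s U t W"
 shows "EX g:lin s V t W. ALL x:U. g x = f x"
proof -
 interpret v1: vector_space s using V by (rule subsp_vs)
 interpret v2: vector_space "(*) :: 'a => 'a => 'a" by simp
 interpret vp: vector_space_pair s "(*) :: 'a => 'a => 'a" ..
 obtain B where B: "B <= U" "v1.independent B" "U <= v1.span B" using v1.maximal_independent_subset[of U] by blast
 have ex: "EX xi. xi:lin s V (*) UNIV & (ALL x:U. xi x = cob s U b x)" if b: "b:bas s U" for b
 proof -
	obtain g where g: "Vector_Spaces.linear s (*) g" "ALL x:B. g x = cob s U b x"
	 using vp.linear_independent_extend[OF B(2), of "cob s U b"] by auto
	note c = bas(4)[OF U(1) b]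
	have gl: "linon s UNIV (*) UNIV g" using g(1)
	 by (simp add: linon_def vp.linear_add vp.linear_scale)
	have "subsp s {x:U. g x = cob s U b x}"
	 using subspD[OF fsub[OF U(1)]] linonD[OF gl] linD[OF c] v1.vector_space_axioms
		vp.linear_0[OF g(1)] lin_more(1)[OF c fsub[OF U(1)]]
	 by (intro subspI) auto
	then have "v1.span B <= {x:U. g x = cob s U b x}"
	 using B g(2) by (intro v1.span_minimal) (auto simp: subsp_def)
	then have "ALL x:U. g x = cob s U b x" using B by auto
	moreover have "restr V g:lin s V (*) UNIV" using gl V by (intro restr_lin) (auto simp: linon_def)
	ultimately show ?thesis using U(2) by (intro exI[of _ "restr V g"]) auto
 qed
 define xi where "xi b = (SOME xi. xi:lin s V (*) UNIV & (ALL x:U. xi x = cob s U b x))" for b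
 have xi: "xi b:lin s V (*) UNIV" "x:U ==> xi b x = cob s U b x" if "b:bas s U" for b x
	using someI_ex[OF ex[OF that]] unfolding xi_def by blast+
 let ?g = "SUM b:bas s U. elem t (xi b) (f b)"
 have "?g:lin s V t W"
	using xi(1) bas(3)[OF U(1)] linD(1)[OF f] t
	by (intro subspD(6)[OF subsp_linon[OF subsp_vs[OF t] t]]) (auto intro!: elem_lin)
 moreover have "?g x = f x" if "x:U" for x
	using lin_bas[OF U(1) subsp_vs[OF t] lin_linon[OF f] that] xi(2)[OF _ that] by (simp add: sum_fun_apply elem_def)
 ultimately show ?thesis by blast
qed

lemma proj_ex:
 assumes V: "fds s V" and U: "subsp s U" "U <= V"
 shows "EX pr:lin s V s V. ALL x:V. pr x = 0 \<longleftrightarrow> x:U"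
proof -
 have fU: "fds s U" by (rule fds_sub[OF V U])
 have "id_on U:lin s U s U" using subspD[OF U(1)] by (intro linI) (auto simp: id_on_def)
 from lin_extend[OF fsub[OF V] fU U(2) U(1) this]
 obtain g where g: "g:lin s V s U" "ALL x:U. g x = x" by (auto simp: id_on_def)
 have "restr V (%x. x - g x):lin s V s V"
	using linD[OF g(1)] subspD[OF fsub[OF V]] U(2) vs_simps[OF fds_vs[OF V]]
	by (intro restr_lin fsub[OF V]) (auto simp: linon_def subset_iff)
 moreover have "restr V (%x. x - g x) x = 0 \<longleftrightarrow> x:U" if "x:V" for x
	using that g linD(1)[OF g(1) that] by auto
 ultimately show ?thesis by blast
qed

lemma separation:
 assumes V: "fds s V" and U: "subsp s U" "U <= V" and x: "x:V" "x ~: U"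
 shows "EX xi:lin s V (*) UNIV. (ALL u:U. xi u = 0) & xi x ~= 0"
proof -
 obtain pr where p: "pr:lin s V s V" "ALL x:V. pr x = 0 \<longleftrightarrow> x:U" using proj_ex[OF V U] by blast
 have "pr x ~= 0" using p(2) x by blast
 moreover have "pr x = (SUM b:bas s V. s (cob s V b (pr x)) b)" using bas(6)[OF V] linD(1)[OF p(1) x(1)] by simp
 ultimately obtain b where b: "b:bas s V" "cob s V b (pr x) ~= 0"
	by (metis (mono_tags, lifting) fds_vs V sum.neutral vs_simps(2))
 note c = bas(4)[OF V b(1)]
 have "cob s V b o pr:lin s V (*) UNIV"
	by (rule lin_comp[OF p(1) c fsub[OF V]]) simp
 moreover have "pr u = 0" if "u:U" for u using p(2) U(2) that by blast
 then have "ALL u:U. (cob s V b o pr) u = 0" using lin_more(1)[OF c fsub[OF V]] by simp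
 ultimately show ?thesis using b(2) by (intro bexI[of _ "cob s V b o pr"]) auto
qed

lemma separation0:
 assumes V: "fds s V" and x: "x:V" "x ~= 0" shows "EX xi:lin s V (*) UNIV. xi x ~= 0"
 using separation[OF V _ _ x(1), of "{0}"] x fsub[OF fds_zero[OF fds_vs[OF V]]] subspD(1)[OF fsub[OF V]] by auto

text \<open>The values of \<open>Y\<close> on the coordinate functionals are the coordinates of the
  vector sought.\<close>

lemma bidual_rep:
 assumes V: "fds s V" and Y: "linon (fscale (*)) (lin s V (*) UNIV) (*) UNIV Y"
 shows "EX v:V. ALL xi:lin s V (*) UNIV. Y xi = xi v"
proof
 let ?v = "SUM b:bas s V. s (Y (cob s V b)) b"
 show "?v:V" using bas[OF V] by (intro subspD[OF fsub[OF V]]) auto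
 show "ALL xi:lin s V (*) UNIV. Y xi = xi ?v"
 proof
	fix xi assume x: "xi:lin s V (*) UNIV"
	have e: "xi = (SUM b:bas s V. fscale (*) (xi b) (cob s V b))"
	 by (subst lin_elem_sum[OF V _ x]) (auto simp: elem_def fscale_def mult.commute)
	have "Y xi = (SUM b:bas s V. xi b * Y (cob s V b))"
	 by (subst e, subst linon_more(5)[OF Y]) (auto intro!: subsp_linon bas(4)[OF V])
	also have "... = xi ?v"
	 by (subst lin_more(5)[OF x fsub[OF V]]) (auto intro!: bas(3)[OF V] sum.cong simp: mult.commute)
	finally show "Y xi = xi ?v" .
 qed
qed

text \<open>A functional outside \<open>S\<close> would be separated from \<open>S\<close> by an
  element of the bidual, that is by a vector, which contradicts the last assumption. Membership in a
  space of functionals is proved in this form several times below.\<close>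

lemma annihilator_annihilator:
 assumes V: "fds s V" and S: "subsp (fscale (*)) S" "S <= lin s V (*) UNIV"
	and w: "om:lin s V (*) UNIV" "!!v. v:V ==> (!!xi. xi:S ==> xi v = 0) ==> om v = 0"
 shows "om:S"
proof (rule ccontr)
 assume "om ~: S"
 from separation[OF fds_lin[OF V fds_field] S w(1) this] obtain Y where
	Y: "Y:lin (fscale (*)) (lin s V (*) UNIV) (*) UNIV" "ALL u:S. Y u = 0" "Y om ~= 0" by blast
 obtain v where v: "v:V" "ALL xi:lin s V (*) UNIV. Y xi = xi v" using bidual_rep[OF V lin_linon[OF Y(1)]] by blast
 show False using w(2)[OF v(1)] Y v S(2) w(1) by (metis subsetD)
qed

section \<open>The trace form\<close>

definition trace :: "('k::field => 'a::ab_group_add => 'a) => 'a set => ('a => 'a) => 'k" where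
 "trace s V f = (SUM b:bas s V. cob s V b (f b))"

lemma trace_linon:
 assumes V: "fds s V" shows "linon (fscale s) (lin s V s V) (*) UNIV (trace s V)"
 using bas[OF V] linD[OF bas(4)[OF V]]
 by (auto simp: linon_def trace_def fscale_def linD(1) sum.distrib sum_distrib_left
	 intro!: sum.cong simp flip: sum.distrib)

lemma trace_comm:
 assumes V: "fds s V" and W: "fds t W" and f: "f:lin s V t W" and g: "g:lin t W s V"
 shows "trace s V (g o f) = trace t W (f o g)"
proof -
 have "trace s V (g o f) = (SUM b:bas s V. SUM c:bas t W. cob t W c (f b) * cob s V b (g c))"
	unfolding trace_def
 proof (rule sum.cong[OF refl])
	fix b assume b: "b:bas s V"
	have "linon t W (*) UNIV (%y. cob s V b (g y))"
	 by (rule linon_comp[OF lin_linon[OF g] lin_linon[OF bas(4)[OF V b]]])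
	from lin_bas[OF W _ this, of "f b"] linD(1)[OF f bas(3)[OF V b]]
	show "cob s V b ((g o f) b) = (SUM c:bas t W. cob t W c (f b) * cob s V b (g c))" by simp
 qed
 also have "... = (SUM c:bas t W. SUM b:bas s V. cob s V b (g c) * cob t W c (f b))"
	by (subst sum.swap) (simp add: mult.commute)
 also have "... = trace t W (f o g)"
	unfolding trace_def
 proof (rule sum.cong[OF refl])
	fix c assume c: "c:bas t W"
	have "linon s V (*) UNIV (%y. cob t W c (f y))"
	 by (rule linon_comp[OF lin_linon[OF f] lin_linon[OF bas(4)[OF W c]]])
	from lin_bas[OF V _ this, of "g c"] linD(1)[OF g bas(3)[OF W c]]
	show "(SUM b:bas s V. cob s V b (g c) * cob t W c (f b)) = cob t W c ((f o g) c)" by simp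
 qed
 finally show ?thesis .
qed

lemma trace_elem:
 assumes V: "fds s V" and W: "fds t W" and g: "g:lin s V t W" and e: "xi:lin t W (*) UNIV" "v:V"
 shows "trace s V (elem s xi v o g) = xi (g v)"
proof -
 have "xi (g v) = (SUM b:bas s V. cob s V b v * xi (g b))"
	by (rule lin_bas[OF V _ linon_comp[OF lin_linon[OF g] lin_linon[OF e(1)]] e(2)]) simp
 also have "... = trace s V (elem s xi v o g)"
	unfolding trace_def by (intro sum.cong refl) (simp add: elem_def linD(3)[OF bas(4)[OF V] e(2)])
 finally show ?thesis by simp
qed

text \<open>The trace form identifies \<open>lin t W s V\<close> with the dual of
  \<open>lin s V t W\<close>. The matrix of \<open>g\<close> is read off from the values of
  \<open>Y\<close> on the rank one maps \<open>elem t (cob s V b) c\<close>.\<close>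

lemma trace_rep:
 assumes V: "fds s V" and W: "fds t W"
	and Y: "Y:lin (fscale t) (lin s V t W) (*) UNIV"
 shows "EX g:lin t W s V. ALL f:lin s V t W. Y f = trace t W (f o g)"
proof
 let ?g = "SUM (b, c):bas s V \<times> bas t W. elem s (cob t W c) (s (Y (elem t (cob s V b) c)) b)"
 note SV = subspD[OF fsub[OF V]]
 show g: "?g:lin t W s V"
	by (rule subspD(6)[OF subsp_linon[OF fds_vs[OF V] fsub[OF V]]])
	 (auto intro!: elem_lin[OF fsub[OF V]] SV(3) intro: bas(3)[OF V] bas(4)[OF W])
 show "ALL f:lin s V t W. Y f = trace t W (f o ?g)"
 proof
	fix f assume f: "f:lin s V t W"
	have gd: "?g d = (SUM b:bas s V. s (Y (elem t (cob s V b) d)) b)" if d: "d:bas t W" for d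
	proof -
	 have "?g d = (SUM b:bas s V. SUM c:bas t W. s (cob t W c d * Y (elem t (cob s V b) c)) b)"
		by (simp add: sum_fun_apply elem_def split_def sum.cartesian_product vs_simps[OF fds_vs[OF V]])
	 also have "... = (SUM b:bas s V. SUM c:bas t W. if c = d then s (Y (elem t (cob s V b) d)) b else 0)"
		by (intro sum.cong refl) (auto simp: bas(5)[OF W _ d] vs_simps[OF fds_vs[OF V]])
	 finally show ?thesis using d bas(1)[OF W] by simp
	qed
	have fg: "f (?g d) = (SUM b:bas s V. t (Y (elem t (cob s V b) d)) (f b))" if "d:bas t W" for d
	 unfolding gd[OF that] by (rule lin_more(5)[OF f fsub[OF V] fds_vs[OF W] bas(3)[OF V]])
	have "trace t W (f o ?g) = (SUM d:bas t W. SUM b:bas s V. Y (elem t (cob s V b) d) * cob t W d (f b))"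
	 unfolding trace_def comp_def
	 by (intro sum.cong refl, subst fg, assumption, subst lin_more(5)[OF bas(4)[OF W] fsub[OF W]])
		 (auto intro!: linD(1)[OF f] bas(3)[OF V])
	also have "... = (SUM b:bas s V. Y (SUM d:bas t W. fscale t (cob t W d (f b)) (elem t (cob s V b) d)))"
	 by (subst sum.swap, intro sum.cong refl, subst lin_more(5)[OF Y])
		(auto intro!: subsp_linon fsub[OF W] fds_vs[OF W] elem_lin bas(4)[OF V] bas(3)[OF W] simp: mult.commute)
	also have "... = (SUM b:bas s V. Y (elem t (cob s V b) (f b)))"
	proof (intro sum.cong refl arg_cong[of _ _ Y])
	 fix b assume b: "b:bas s V"
	 have fb: "f b:W" using linD(1)[OF f bas(3)[OF V b]] .
	 have "(SUM d:bas t W. fscale t (cob t W d (f b)) (elem t (cob s V b) d))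
		 = (%x. t (cob s V b x) (SUM d:bas t W. t (cob t W d (f b)) d))"
		by (auto simp: fun_eq_iff sum_fun_apply fscale_def elem_def vs_simps[OF fds_vs[OF W]] mult.commute)
	 then show "(SUM d:bas t W. fscale t (cob t W d (f b)) (elem t (cob s V b) d)) = elem t (cob s V b) (f b)"
		by (simp add: bas(6)[OF W fb] elem_def)
	qed
	also have "... = Y (SUM b:bas s V. elem t (cob s V b) (f b))"
	 by (rule lin_more(4)[OF Y, symmetric])
		(auto intro!: subsp_linon fsub[OF W] fds_vs[OF W] elem_lin bas(4)[OF V] linD(1)[OF f] bas(3)[OF V])
	also have "... = Y f" using lin_elem_sum[OF V fsub[OF W] f] by simp
	finally show "Y f = trace t W (f o ?g)" by simp
 qed
qed

lemma fds_fun: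
 assumes I: "finite I" and V: "!!i. i:I ==> fds s (V i)" and s: "vector_space s"
 shows "fds (fscale s) {f. (ALL i:I. f i:V i) & (ALL i. i ~: I --> f i = 0)}"
	(is "fds _ ?S")
proof (rule fdsI_sum[of _ _ "SIGMA i:I. bas s (V i)" "%(i, b) j. if j = i then b else 0"])
 note S = subspD[OF fsub[OF V]]
 show "subsp (fscale s) ?S" using s S vs_simps[OF s] by (intro subspI) (auto simp: fscale_def)
 show "finite (SIGMA i:I. bas s (V i))" using I bas(1)[OF V] by auto
 show "(case p of (i, b) => %j. if j = i then b else 0):?S" if "p:(SIGMA i:I. bas s (V i))" for p
	using that bas(3)[OF V] S(1) by auto
 fix f assume f: "f:?S"
 have "f j = (SUM p:(SIGMA i:I. bas s (V i)). fscale s (case p of (i, b) => cob s (V i) b (f i)) (case p of (i, b) => %j. if j = i then b else 0)) j" for j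
 proof -
	have "(SUM p:(SIGMA i:I. bas s (V i)). fscale s (case p of (i, b) => cob s (V i) b (f i)) (case p of (i, b) => %j. if j = i then b else 0)) j
	 = (SUM i:I. SUM b:bas s (V i). s (cob s (V i) b (f i)) (if j = i then b else 0))"
	 using I bas(1)[OF V] by (subst sum.Sigma) (auto simp: sum_fun_apply fscale_def split_def)
	also have "... = (SUM i:I. if i = j then SUM b:bas s (V i). s (cob s (V i) b (f i)) b else 0)"
	 by (intro sum.cong refl) (auto simp: vs_simps[OF s])
	also have "... = f j" using f I by (auto simp: bas(6)[OF V])
	finally show ?thesis by simp
 qed
 then show "EX c. f = (SUM p:(SIGMA i:I. bas s (V i)). fscale s (c p) (case p of (i, b) => %j. if j = i then b else 0))"
	by (intro exI[of _ "%p. case p of (i, b) => cob s (V i) b (f i)"] ext)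
qed

section \<open>Models of finite-dimensional spaces, and duals\<close>

abbreviation "vlin V W == lin vscale V vscale W"

lemma Vect_Obj: "V:Obj Vect \<longleftrightarrow> fds vscale V" by (auto simp: Vect_def fds_def)
lemma Vect_sel: "Hom Vect V W = vlin V W" "Idm Vect = id_on" "Cmp Vect = (o)" "Scl Vect = fscale vscale"
 by (simp_all add: Vect_def)

lemma vs_v [simp, intro]: "vector_space (vscale :: 'k::field => 'k vec => 'k vec)" by simp

lemma id_on_lin: "subsp s V ==> id_on V:lin s V s V"
 using subspD[of s V] by (intro linI) (auto simp: id_on_def)

lemma coords_ex:
 assumes W: "fds s W" shows "EX ph. ph:lin s W vscale UNIV & inj_on ph W"
proof -
 obtain e where e: "bij_betw e {0..<card (bas s W)} (bas s W)"
	using ex_bij_betw_nat_finite[OF bas(1)[OF W]] by blast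
 define ph where "ph = restr W (%x i. case i of Ix n => if n < card (bas s W) then cob s W (e n) x else 0 | Tup _ => 0)"
 have eb: "e n:bas s W" if "n < card (bas s W)" for n using e that by (auto simp: bij_betw_def)
 have "ph:lin s W vscale UNIV" unfolding ph_def
	using linD[OF bas(4)[OF W eb]]
	by (intro restr_lin fsub[OF W]) (auto simp: linon_def fscale_def fun_eq_iff split: idx.splits)
 moreover have "inj_on ph W"
 proof (rule inj_onI)
	fix x y assume xy: "x:W" "y:W" "ph x = ph y"
	have "cob s W b x = cob s W b y" if "b:bas s W" for b
	proof -
	 have "b:e ` {0..<card (bas s W)}" using e that by (simp add: bij_betw_def)
	 then obtain n where n: "n < card (bas s W)" "b = e n" by auto
	 then show ?thesis using fun_cong[OF xy(3), of "Ix n"] xy by (simp add: ph_def)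
	qed
	then have "(SUM b:bas s W. s (cob s W b x) b) = (SUM b:bas s W. s (cob s W b y) b)" by simp
	then show "x = y" using bas(6)[OF W] xy by simp
 qed
 ultimately show ?thesis by blast
qed

definition dec :: "('k::field => 'a::ab_group_add => 'a) => 'a set => 'k vec => 'a" where
 "dec s W = inv_into W (coords s W)"

lemma coords:
 assumes W: "fds s W"
 shows "coords s W:lin s W vscale UNIV" "inj_on (coords s W) W"
 using someI_ex[OF coords_ex[OF W]] unfolding coords_def by blast+

lemma coords_linon:
 assumes W: "fds s W" shows "linon s W vscale (model s W) (coords s W)"
 using linD[OF coords(1)[OF W]] by (auto simp: linon_def model_def)

lemma coords_model [simp]: "x:W ==> coords s W x:model s W" by (simp add: model_def)

lemma dec_coords [simp]: "fds s W ==> x:W ==> dec s W (coords s W x) = x"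
 by (simp add: dec_def inv_into_f_f coords(2))

lemma coords_dec [simp]: "y:model s W ==> coords s W (dec s W y) = y"
 by (simp add: dec_def model_def f_inv_into_f)

lemma dec_in [simp]: "y:model s W ==> dec s W y:W"
 by (simp add: dec_def model_def inv_into_into)

lemma model_fds [simp]: "fds s W ==> fds vscale (model s W)"
 unfolding model_def by (rule fds_image[OF _ _ lin_linon[OF coords(1)]]) auto

lemma dec_inj: "y:model s W ==> z:model s W ==> dec s W y = dec s W z ==> y = z"
 by (metis coords_dec)

lemma coords_inj: "fds s W ==> y:W ==> z:W ==> coords s W y = coords s W z ==> y = z"
 by (metis dec_coords)

lemma dec_linon:
 assumes W: "fds s W" shows "linon vscale (model s W) s W (dec s W)"
proof -
 note c = linonD[OF coords_linon[OF W]] and S = subspD[OF fsub[OF W]]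
	and M = subspD[OF fsub[OF model_fds[OF W]]]
 have "dec s W (x + y) = dec s W x + dec s W y" if "x:model s W" "y:model s W" for x y
	by (rule coords_inj[OF W]) (use that S M c in simp_all)
 moreover have "dec s W (vscale r x) = s r (dec s W x)" if "x:model s W" for x r
	by (rule coords_inj[OF W]) (use that S M c in simp_all)
 ultimately show ?thesis by (auto simp: linon_def)
qed

lemma tmap_eq: "tmap s W t Z f y = (if y:model s W then coords t Z (f (dec s W y)) else 0)"
 by (simp add: tmap_def dec_def)

lemma tmap_in [simp]: "y:model s W ==> tmap s W t Z f y = coords t Z (f (dec s W y))" by (simp add: tmap_eq)

lemma tmap_coords [simp]: "fds s W ==> x:W ==> tmap s W t Z f (coords s W x) = coords t Z (f x)"
 by simp

lemma tmap_lin: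
 assumes W: "fds s W" and Z: "fds t Z" and f: "linon s W t Z f"
 shows "tmap s W t Z f:vlin (model s W) (model t Z)"
proof -
 have "linon vscale (model s W) vscale (model t Z) (%y. coords t Z (f (dec s W y)))"
	by (rule linon_comp[OF linon_comp[OF dec_linon[OF W] f] coords_linon[OF Z]])
 then have "restr (model s W) (%y. coords t Z (f (dec s W y))):vlin (model s W) (model t Z)"
	by (rule restr_lin[OF fsub[OF model_fds[OF W]]])
 moreover have "tmap s W t Z f = restr (model s W) (%y. coords t Z (f (dec s W y)))"
	by (auto simp: fun_eq_iff tmap_eq restr_def)
 ultimately show ?thesis by simp
qed

lemma coords_zero: "fds s W ==> coords s W 0 = 0"
 by (rule lin_more(1)[OF coords(1)]) auto

lemma zero_model [simp]: "fds s W ==> 0:model s W"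
 by (rule subspD(1)[OF fsub[OF model_fds]])

lemma dec_zero [simp]: "fds s W ==> dec s W 0 = 0"
 by (rule linon_more(1)[OF dec_linon]) (auto simp: fds_vs)

text \<open>Outside its model the inner map gives 0, which lies in the next model and is decoded to
  0; \<open>g 0 = 0\<close> makes the composite vanish there, as the right-hand side does.\<close>

lemma tmap_comp:
 assumes "fds s W" "fds t Z" "!!x. x:W ==> f x:Z" "fds u Q" "g 0 = 0"
 shows "tmap t Z u Q g o tmap s W t Z f = tmap s W u Q (%x. g (f x))"
 using assms by (auto simp: fun_eq_iff tmap_eq coords_zero)

lemma tmap_id: "tmap s W s W (%x. x) = id_on (model s W)"
 by (auto simp: fun_eq_iff tmap_eq id_on_def)

lemma tmap_cong: "(!!x. x:W ==> f x = g x) ==> tmap s W t Z f = tmap s W t Z g"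
 by (auto simp: fun_eq_iff tmap_eq)

lemma tmap_add:
 assumes "fds t Z" "!!x. x:W ==> f x:Z & g x:Z"
 shows "tmap s W t Z (%x. f x + g x) = tmap s W t Z f + tmap s W t Z g"
 using linonD(2)[OF coords_linon[OF assms(1)]] assms(2) by (auto simp: fun_eq_iff tmap_eq)

lemma tmap_scale:
 assumes "fds t Z" "!!x. x:W ==> f x:Z"
 shows "tmap s W t Z (%x. t c (f x)) = fscale vscale c (tmap s W t Z f)"
 using linonD(3)[OF coords_linon[OF assms(1)]] assms(2)
 by (auto simp: fun_eq_iff tmap_eq fscale_def)

section \<open>Dual spaces and biduality\<close>

lemma fds_functionals [simp]: "fds vscale V ==> fds dscale (functionals V)"
 unfolding functionals_def by (rule fds_lin) auto

lemma dual_fds [simp]: "fds vscale V ==> fds vscale (dual V)"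
 unfolding dual_def by (rule model_fds) simp

lemma eval_dual_eq: "eval_dual V = dec dscale (functionals V)"
 by (simp add: eval_dual_def dec_def)

lemma eval_dual_in: "y:dual V ==> eval_dual V y:functionals V"
 unfolding eval_dual_eq dual_def by (rule dec_in)

lemma eval_dual_lin: "y:dual V ==> eval_dual V y:lin vscale V (*) UNIV"
 using eval_dual_in unfolding functionals_def by blast

lemma dual_ext:
 assumes "y:dual V" "z:dual V" "!!x. x:V ==> eval_dual V y x = eval_dual V z x"
 shows "y = z"
proof -
 have "eval_dual V y = eval_dual V z" by (rule lin_eqI[OF eval_dual_lin eval_dual_lin]) fact+
 then show ?thesis using assms(1,2) dec_inj unfolding dual_def eval_dual_eq by blast
qed

text \<open>The inverse of \<open>eval_dual V\<close>: the vector of \<open>dual V\<close> that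
  stands for a given functional.\<close>

definition codual :: "'k::field vec set => ('k vec => 'k) => 'k vec" where
 "codual V xi = coords dscale (functionals V) xi"

lemma codual:
 assumes "fds vscale V" "xi:lin vscale V (*) UNIV"
 shows "codual V xi:dual V" "eval_dual V (codual V xi) = xi"
 using assms unfolding codual_def dual_def eval_dual_eq functionals_def[symmetric] by simp_all

lemma codual_eval: "y:dual V ==> codual V (eval_dual V y) = y"
 unfolding codual_def dual_def eval_dual_eq by simp

lemma eval_dual_linear:
 assumes "fds vscale V"
 shows "y:dual V ==> z:dual V ==> eval_dual V (y + z) x = eval_dual V y x + eval_dual V z x"
	"y:dual V ==> eval_dual V (vscale c y) x = c * eval_dual V y x"
	"eval_dual V 0 x = 0"
 using linonD[OF dec_linon[OF fds_functionals[OF assms]]] dec_zero[OF fds_functionals[OF assms]]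
 unfolding dual_def eval_dual_eq by (simp_all add: fscale_def)

lemma eval_dual_linon:
 assumes "fds vscale V" shows "linon vscale (dual V) (*) UNIV (%y. eval_dual V y x)"
 using eval_dual_linear[OF assms] by (simp add: linon_def)

lemma functional_comp:
 assumes "f:vlin V W" "xi:lin vscale W (*) UNIV" "fds vscale W"
 shows "xi o f:lin vscale V (*) UNIV"
 by (rule lin_comp[OF assms(1,2)]) (use assms(3) in auto)

lemma dual_map_lin:
 assumes "fds vscale V" "fds vscale W" "f:vlin V W"
 shows "dual_map V W f:vlin (dual W) (dual V)"
 unfolding dual_map_def dual_def
 by (rule tmap_lin)
	(use assms functional_comp[OF assms(3)] in \<open>auto simp: linon_def functionals_def fscale_def\<close>)

lemma dual_map_in:
 assumes "fds vscale V" "fds vscale W" "f:vlin V W" "y:dual W"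
 shows "dual_map V W f y:dual V" "eval_dual V (dual_map V W f y) x = eval_dual W y (f x)"
proof -
 show "dual_map V W f y:dual V" using linD(1)[OF dual_map_lin[OF assms(1-3)] assms(4)] .
 have "eval_dual W y o f:functionals V"
	unfolding functionals_def by (rule functional_comp[OF assms(3) eval_dual_lin[OF assms(4)] assms(2)])
 then show "eval_dual V (dual_map V W f y) x = eval_dual W y (f x)"
	using assms by (simp add: dual_map_def dual_def eval_dual_eq)
qed

lemma dual_map_eqI:
 assumes "fds vscale V" "g:vlin W (dual V)" "h:vlin W (dual V)"
	"!!y x. y:W ==> x:V ==> eval_dual V (g y) x = eval_dual V (h y) x"
 shows "g = h"
 by (rule lin_eqI[OF assms(2,3)], rule dual_ext[of _ V]) (use assms linD(1)[OF assms(2)] linD(1)[OF assms(3)] in auto)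

lemma dual_map_id: "fds vscale V ==> dual_map V V (id_on V) = id_on (dual V)"
 by (rule dual_map_eqI[of V _ "dual V"])
	(auto intro!: dual_map_lin id_on_lin simp: dual_map_in id_on_lin, simp add: id_on_def)

lemma dual_map_comp:
 assumes V: "fds vscale V" "fds vscale W" "fds vscale Z" and f: "f:vlin V W" "g:vlin W Z"
 shows "dual_map V Z (g o f) = dual_map V W f o dual_map W Z g"
proof (rule dual_map_eqI[of V _ "dual Z"])
 have gf: "g o f:vlin V Z" using V f by (intro lin_comp) auto
 show "dual_map V Z (g o f):vlin (dual Z) (dual V)" using V gf by (intro dual_map_lin) auto
 show "dual_map V W f o dual_map W Z g:vlin (dual Z) (dual V)"
	using V f by (intro lin_comp[OF dual_map_lin dual_map_lin]) auto
 show "eval_dual V (dual_map V Z (g o f) y) x = eval_dual V ((dual_map V W f o dual_map W Z g) y) x"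
	if "y:dual Z" for y x
	using V f gf that by (simp add: dual_map_in)
qed fact

lemma dual_map_add:
 assumes V: "fds vscale V" "fds vscale W" and f: "f:vlin V W" "g:vlin V W"
 shows "dual_map V W (f + g) = dual_map V W f + dual_map V W g"
proof (rule dual_map_eqI[of V _ "dual W"])
 have S: "subsp (fscale vscale) (vlin A B)" if "fds vscale B" for A B :: "'a vec set"
	using that by (intro subsp_linon) auto
 have fg: "f + g:vlin V W" using subspD(2)[OF S[OF V(2)]] f by simp
 show "dual_map V W (f + g):vlin (dual W) (dual V)" using V fg by (intro dual_map_lin) auto
 show "dual_map V W f + dual_map V W g:vlin (dual W) (dual V)"
	using V f by (intro subspD(2)[OF S] dual_map_lin) auto
 show "eval_dual V (dual_map V W (f + g) y) x = eval_dual V ((dual_map V W f + dual_map V W g) y) x"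
	if "y:dual W" "x:V" for y x
	using V f fg that linD(1)[OF f(1) that(2)] linD(1)[OF f(2) that(2)]
	by (simp add: dual_map_in eval_dual_linear linD(2)[OF eval_dual_lin])
qed fact

lemma dual_map_scale:
 assumes V: "fds vscale V" "fds vscale W" and f: "f:vlin V W"
 shows "dual_map V W (fscale vscale c f) = fscale vscale c (dual_map V W f)"
proof (rule dual_map_eqI[of V _ "dual W"])
 have S: "subsp (fscale vscale) (vlin A B)" if "fds vscale B" for A B :: "'a vec set"
	using that by (intro subsp_linon) auto
 have fg: "fscale vscale c f:vlin V W" using subspD(3)[OF S[OF V(2)]] f by simp
 show "dual_map V W (fscale vscale c f):vlin (dual W) (dual V)" using V fg by (intro dual_map_lin) auto
 show "fscale vscale c (dual_map V W f):vlin (dual W) (dual V)"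
	using V f by (intro subspD(3)[OF S] dual_map_lin) auto
 show "eval_dual V (dual_map V W (fscale vscale c f) y) x = eval_dual V (fscale vscale c (dual_map V W f) y) x"
	if "y:dual W" "x:V" for y x
	using V f fg that linD(1)[OF f that(2)]
	by (simp add: dual_map_in fscale_def[of vscale] eval_dual_linear linD(3)[OF eval_dual_lin])
qed fact

text \<open>The canonical map into the bidual, which sends \<open>x\<close> to evaluation at
  \<open>x\<close>.\<close>

definition iotaV :: "'k::field vec set => 'k vec => 'k vec" where
 "iotaV V = restr V (%x. codual (dual V) (restr (dual V) (%y. eval_dual V y x)))"

definition iotaV' :: "'k::field vec set => 'k vec => 'k vec" where
 "iotaV' V = restr (dual (dual V)) (inv_into V (iotaV V))"

lemma iotaV_in:
 assumes V: "fds vscale V" and x: "x:V"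
 shows "iotaV V x:dual (dual V)" "y:dual V ==> eval_dual (dual V) (iotaV V x) y = eval_dual V y x"
proof -
 have "restr (dual V) (%y. eval_dual V y x):lin vscale (dual V) (*) UNIV"
	by (rule restr_lin[OF fsub[OF dual_fds[OF V]] eval_dual_linon[OF V]])
 from codual[OF dual_fds[OF V] this]
 show "iotaV V x:dual (dual V)" "y:dual V ==> eval_dual (dual V) (iotaV V x) y = eval_dual V y x"
	using x by (simp_all add: iotaV_def)
qed

lemma iotaV_lin:
 assumes V: "fds vscale V" shows "iotaV V:vlin V (dual (dual V))"
proof (rule linI)
 note S = subspD[OF fsub[OF V]] and D = subspD[OF fsub[OF dual_fds[OF dual_fds[OF V]]]]
 show "iotaV V (x + y) = iotaV V x + iotaV V y" if "x:V" "y:V" for x y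
	by (rule dual_ext[of _ "dual V"])
	 (use V S D that in \<open>simp_all add: iotaV_in eval_dual_linear linD[OF eval_dual_lin]\<close>)
 show "iotaV V (vscale c x) = vscale c (iotaV V x)" if "x:V" for x c
	by (rule dual_ext[of _ "dual V"])
	 (use V S D that in \<open>simp_all add: iotaV_in eval_dual_linear linD[OF eval_dual_lin]\<close>)
qed (use V iotaV_in(1)[OF V] in \<open>auto simp: iotaV_def restr_def\<close>)

lemma iotaV_inj:
 assumes V: "fds vscale V" shows "inj_on (iotaV V) V"
proof (rule inj_onI, rule ccontr)
 fix x y assume a: "x:V" "y:V" "iotaV V x = iotaV V y" "x ~= y"
 then obtain xi where x: "xi:lin vscale V (*) UNIV" "xi (x - y) ~= 0"
	using separation0[OF V, of "x - y"] subspD(5)[OF fsub[OF V]] by auto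
 have "eval_dual (dual V) (iotaV V x) (codual V xi) = eval_dual (dual V) (iotaV V y) (codual V xi)" using a by simp
 then have "xi x = xi y"
	unfolding iotaV_in(2)[OF V a(1) codual(1)[OF V x(1)]] iotaV_in(2)[OF V a(2) codual(1)[OF V x(1)]] codual(2)[OF V x(1)] .
 then show False using x(2) lin_more(3)[OF x(1) fsub[OF V] _ a(1,2)] by simp
qed

lemma iotaV_surj:
 assumes V: "fds vscale V" shows "iotaV V ` V = dual (dual V)"
proof
 show "iotaV V ` V <= dual (dual V)" using iotaV_in[OF V] by auto
 show "dual (dual V) <= iotaV V ` V"
 proof
	fix z assume z: "z:dual (dual V)"
	have "linon dscale (lin vscale V (*) UNIV) (*) UNIV (%xi. eval_dual (dual V) z (codual V xi))"
	 using linon_comp[OF _ lin_linon[OF eval_dual_lin[OF z]], of dscale "functionals V" "codual V"]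
		coords_linon[OF fds_functionals[OF V]] unfolding codual_def[abs_def] dual_def functionals_def by blast
	from bidual_rep[OF V this] obtain v where v: "v:V"
	 "!!xi. xi:lin vscale V (*) UNIV ==> eval_dual (dual V) z (codual V xi) = xi v" by blast
	have "z = iotaV V v"
	proof (rule dual_ext[OF z iotaV_in(1)[OF V v(1)]])
	 fix y assume y: "y:dual V"
	 show "eval_dual (dual V) z y = eval_dual (dual V) (iotaV V v) y"
		using v(2)[OF eval_dual_lin[OF y]] codual_eval[OF y] iotaV_in(2)[OF V v(1) y] by simp
	qed
	then show "z:iotaV V ` V" using v(1) by blast
 qed
qed

lemma inverse_lin:
 assumes "f:lin s V t W" "subsp s V" "inj_on f V" "f ` V = W" "vector_space t"
 shows "restr W (inv_into V f):lin t W s V" "restr W (inv_into V f) o f = id_on V"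
	"f o restr W (inv_into V f) = id_on W"
proof -
 let ?g = "restr W (inv_into V f)"
 note S = subspD[OF assms(2)]
 have g: "?g y:V" "f (?g y) = y" if "y:W" for y
	using that assms(4) by (auto simp: inv_into_into f_inv_into_f)
 have gf: "?g (f x) = x" if "x:V" for x using that assms(3,4) by (auto simp: inv_into_f_f)
 have SW: "subsp t W" using subsp_image[OF assms(2,5) lin_linon[OF assms(1)]] assms(4) by simp
 show "?g:lin t W s V"
 proof (rule linI)
	fix x y assume xy: "x:W" "y:W"
	have "f (?g x + ?g y) = x + y" using linD(2)[OF assms(1) g(1)[OF xy(1)] g(1)[OF xy(2)]] g(2) xy by simp
	then show "?g (x + y) = ?g x + ?g y" using gf[of "?g x + ?g y"] S(2) g(1) xy by simp
 next
	fix x c assume x: "x:W"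
	have "f (s c (?g x)) = t c x" using linD(3)[OF assms(1) g(1)[OF x]] g(2) x by simp
	then show "?g (t c x) = s c (?g x)" using gf[of "s c (?g x)"] S(3) g(1) x by simp
 qed (use g in auto)
 have "0:W" "f 0 = 0" using subspD(1)[OF SW] lin_more(1)[OF assms(1,2,5)] by auto
 then show "?g o f = id_on V" using gf gf[of 0] S(1) lin_out[OF assms(1)]
	by (auto simp: fun_eq_iff id_on_def)
 show "f o ?g = id_on W" using g \<open>f 0 = 0\<close> by (auto simp: fun_eq_iff id_on_def)
qed

lemma iotaV'_lin:
 assumes V: "fds vscale V"
 shows "iotaV' V:vlin (dual (dual V)) V" "iotaV' V o iotaV V = id_on V"
	"iotaV V o iotaV' V = id_on (dual (dual V))"
 using inverse_lin[OF iotaV_lin[OF V] fsub[OF V] iotaV_inj[OF V] iotaV_surj[OF V]]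
 unfolding iotaV'_def by auto

lemma iotaV_natural:
 assumes V: "fds vscale V" "fds vscale W" and f: "f:vlin V W"
 shows "dual_map (dual W) (dual V) (dual_map V W f) o iotaV V = iotaV W o f"
proof (rule dual_map_eqI[of "dual W" _ V])
 note d = dual_map_lin[OF V f]
 show "dual_map (dual W) (dual V) (dual_map V W f) o iotaV V:vlin V (dual (dual W))"
	using V d by (intro lin_comp[OF iotaV_lin dual_map_lin]) auto
 show "iotaV W o f:vlin V (dual (dual W))"
	using V f by (intro lin_comp[OF f iotaV_lin]) auto
 show "eval_dual (dual W) ((dual_map (dual W) (dual V) (dual_map V W f) o iotaV V) y) x =
	eval_dual (dual W) ((iotaV W o f) y) x" if "y:V" "x:dual W" for y x
	using V d f that linD(1)[OF f that(1)] linD(1)[OF d that(2)] by (simp add: dual_map_in iotaV_in)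
qed (use V in simp)

text \<open>The triangle identity that makes the contravariant functor \<open>dual\<close> adjoint
  to itself; for representations it becomes \<open>io_tri\<close>.\<close>

lemma iotaV_triangle:
 assumes V: "fds vscale V"
 shows "dual_map V (dual (dual V)) (iotaV V) o iotaV (dual V) = id_on (dual V)"
proof (rule dual_map_eqI[of V _ "dual V"])
 note i = iotaV_lin[OF V]
 show "dual_map V (dual (dual V)) (iotaV V) o iotaV (dual V):vlin (dual V) (dual V)"
	using V i by (intro lin_comp[OF iotaV_lin dual_map_lin]) auto
 show "eval_dual V ((dual_map V (dual (dual V)) (iotaV V) o iotaV (dual V)) y) x = eval_dual V (id_on (dual V) y) x"
	if "y:dual V" "x:V" for y x
	using V i that by (simp add: dual_map_in iotaV_in id_on_def)
qed (use V in \<open>auto intro!: id_on_lin\<close>)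

section \<open>Abelian categories of linear functors\<close>

lemma full_subcat_sel [simp]:
 "Obj (full_subcat C P) = {X:Obj C. P X}" "Hom (full_subcat C P) = Hom C"
 "Idm (full_subcat C P) = Idm C" "Cmp (full_subcat C P) = Cmp C"
 by (simp_all add: full_subcat_def)

lemma FunK_sel:
 "Obj (FunK C) = {F. linear_functor C Vect F}"
 "Hom (FunK C) F G = {et. nat_trans C Vect F G et & (ALL X. X ~: Obj C --> et X = 0)}"
 "Idm (FunK C) F = (%X. if X:Obj C then id_on (Fo F X) else 0)"
 "Cmp (FunK C) et th = (%X. et X o th X)" "Scl (FunK C) = fscale (fscale vscale)"
 by (simp_all add: FunK_def Vect_sel cong: if_cong)

text \<open>Composition in the intended categories is composition of functions. It is associative
  and additive in the left argument for arbitrary elements of the arrow type, so these laws are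
  unconditional and serve as rewrite rules; additivity in the right argument needs linearity of the
  left one and keeps its typing assumptions.\<close>

locale lcat =
 fixes C :: "('k::field, 'o, 'm::ab_group_add) lincat"
 assumes idm [simp]: "X:Obj C ==> Idm C X:Hom C X X"
	and cmp: "X:Obj C ==> Y:Obj C ==> Z:Obj C ==> f:Hom C X Y ==> g:Hom C Y Z ==> Cmp C g f:Hom C X Z"
	and idr: "X:Obj C ==> Y:Obj C ==> f:Hom C X Y ==> Cmp C f (Idm C X) = f"
	and idl: "X:Obj C ==> Y:Obj C ==> f:Hom C X Y ==> Cmp C (Idm C Y) f = f"
	and assoc: "Cmp C (Cmp C h g) f = Cmp C h (Cmp C g f)"
	and hom_fds [simp]: "X:Obj C ==> Y:Obj C ==> fds (Scl C) (Hom C X Y)"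
	and addl: "Cmp C (g + g') f = Cmp C g f + Cmp C g' f"
	and scll: "Cmp C (Scl C c g) f = Scl C c (Cmp C g f)"
	and addr: "X:Obj C ==> Y:Obj C ==> Z:Obj C ==> f:Hom C X Y ==> f':Hom C X Y ==> g:Hom C Y Z ==>
	 Cmp C g (f + f') = Cmp C g f + Cmp C g f'"
	and sclr: "X:Obj C ==> Y:Obj C ==> Z:Obj C ==> f:Hom C X Y ==> g:Hom C Y Z ==>
	 Cmp C g (Scl C c f) = Scl C c (Cmp C g f)"
begin

lemma cmp_linon:
 assumes "X:Obj C" "Y:Obj C" "Z:Obj C"
 shows "g:Hom C Y Z ==> linon (Scl C) (Hom C X Y) (Scl C) (Hom C X Z) (%f. Cmp C g f)"
	"f:Hom C X Y ==> linon (Scl C) (Hom C Y Z) (Scl C) (Hom C X Z) (%g. Cmp C g f)"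
 using assms by (auto simp: linon_def addl scll intro!: cmp[of X Y Z] addr[of X Y Z] sclr[of X Y Z])

lemma hom_closed:
 assumes "X:Obj C" "Y:Obj C"
 shows "0:Hom C X Y" "f:Hom C X Y ==> g:Hom C X Y ==> f + g:Hom C X Y"
	"f:Hom C X Y ==> Scl C c f:Hom C X Y" "(!!i. i:I ==> h i:Hom C X Y) ==> sum h I:Hom C X Y"
proof -
 note S = subspD[OF fsub[OF hom_fds[OF assms]]]
 show "0:Hom C X Y" by (rule S(1))
 show "f:Hom C X Y ==> g:Hom C X Y ==> f + g:Hom C X Y" by (rule S(2))
 show "f:Hom C X Y ==> Scl C c f:Hom C X Y" by (rule S(3))
 show "(!!i. i:I ==> h i:Hom C X Y) ==> sum h I:Hom C X Y" by (rule S(6))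
qed

lemma FobjD:
 assumes "F:Obj (FunK C)"
 shows "X:Obj C ==> fds vscale (Fo F X)"
	"X:Obj C ==> Y:Obj C ==> f:Hom C X Y ==> Fm F X Y f:vlin (Fo F X) (Fo F Y)"
	"X:Obj C ==> Fm F X X (Idm C X) = id_on (Fo F X)"
	"X:Obj C ==> Y:Obj C ==> Z:Obj C ==> f:Hom C X Y ==> g:Hom C Y Z ==>
	 Fm F X Z (Cmp C g f) = Fm F Y Z g o Fm F X Y f"
	"X:Obj C ==> Y:Obj C ==> f:Hom C X Y ==> g:Hom C X Y ==> Fm F X Y (f + g) = Fm F X Y f + Fm F X Y g"
	"X:Obj C ==> Y:Obj C ==> f:Hom C X Y ==> Fm F X Y (Scl C c f) = fscale vscale c (Fm F X Y f)"
 using assms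
 by (simp_all add: FunK_sel linear_functor_def additive_functor_def is_functor_def Vect_sel Vect_Obj)

lemma FunK_objI:
 assumes "!!X. X:Obj C ==> fds vscale (Fo F X)"
	"!!X Y f. X:Obj C ==> Y:Obj C ==> f:Hom C X Y ==> Fm F X Y f:vlin (Fo F X) (Fo F Y)"
	"!!X. X:Obj C ==> Fm F X X (Idm C X) = id_on (Fo F X)"
	"!!X Y Z f g. X:Obj C ==> Y:Obj C ==> Z:Obj C ==> f:Hom C X Y ==> g:Hom C Y Z ==>
	 Fm F X Z (Cmp C g f) = Fm F Y Z g o Fm F X Y f"
	"!!X Y f g. X:Obj C ==> Y:Obj C ==> f:Hom C X Y ==> g:Hom C X Y ==> Fm F X Y (f + g) = Fm F X Y f + Fm F X Y g"
	"!!X Y f c. X:Obj C ==> Y:Obj C ==> f:Hom C X Y ==> Fm F X Y (Scl C c f) = fscale vscale c (Fm F X Y f)"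
 shows "F:Obj (FunK C)"
 using assms
 by (simp add: FunK_sel linear_functor_def additive_functor_def is_functor_def Vect_sel Vect_Obj)

lemma Fm_in: "F:Obj (FunK C) ==> X:Obj C ==> Y:Obj C ==> f:Hom C X Y ==> x:Fo F X ==> Fm F X Y f x:Fo F Y"
 using linD(1)[OF FobjD(2)] .

lemma Fm_id: "F:Obj (FunK C) ==> X:Obj C ==> x:Fo F X ==> Fm F X X (Idm C X) x = x"
 by (simp add: FobjD(3) id_on_def)

lemma Fm_comp: "F:Obj (FunK C) ==> X:Obj C ==> Y:Obj C ==> Z:Obj C ==> f:Hom C X Y ==> g:Hom C Y Z ==>
	 Fm F X Z (Cmp C g f) x = Fm F Y Z g (Fm F X Y f x)"
 by (simp add: FobjD(4))

lemma Fm_linon: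
 assumes F: "F:Obj (FunK C)" and XY: "X:Obj C" "Y:Obj C" and x: "x:Fo F X"
 shows "linon (Scl C) (Hom C X Y) vscale (Fo F Y) (%f. Fm F X Y f x)"
 using assms by (simp add: linon_def Fm_in FobjD(5,6), simp add: fscale_def)

lemma Fm_sum:
 assumes F: "F:Obj (FunK C)" and XY: "X:Obj C" "Y:Obj C" and x: "x:Fo F X"
	and f: "!!i. i:I ==> f i:Hom C X Y"
 shows "Fm F X Y (sum f I) x = (SUM i:I. Fm F X Y (f i) x)"
 by (rule linon_more(4)[OF Fm_linon[OF F XY x]]) (use XY f in auto)

lemma FhomD:
 assumes "et:Hom (FunK C) F G"
 shows "X:Obj C ==> et X:vlin (Fo F X) (Fo G X)"
	"X:Obj C ==> Y:Obj C ==> f:Hom C X Y ==> et Y (Fm F X Y f x) = Fm G X Y f (et X x)"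
	"X ~: Obj C ==> et X = 0"
proof -
 have n: "nat_trans C Vect F G et" "!!X. X ~: Obj C ==> et X = 0" using assms by (auto simp: FunK_sel)
 show "X:Obj C ==> et X:vlin (Fo F X) (Fo G X)" using n(1) by (simp add: nat_trans_def Vect_sel)
 show "et Y (Fm F X Y f x) = Fm G X Y f (et X x)" if "X:Obj C" "Y:Obj C" "f:Hom C X Y"
 proof -
	have "et Y o Fm F X Y f = Fm G X Y f o et X" using n(1) that by (simp add: nat_trans_def Vect_sel)
	from fun_cong[OF this, of x] show ?thesis by simp
 qed
 show "X ~: Obj C ==> et X = 0" by (rule n(2))
qed

lemma FhomI:
 assumes F: "F:Obj (FunK C)" and G: "G:Obj (FunK C)"
	and l: "!!X. X:Obj C ==> et X:vlin (Fo F X) (Fo G X)"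
	and n: "!!X Y f x. X:Obj C ==> Y:Obj C ==> f:Hom C X Y ==> x:Fo F X ==> et Y (Fm F X Y f x) = Fm G X Y f (et X x)"
	and o: "!!X. X ~: Obj C ==> et X = 0"
 shows "et:Hom (FunK C) F G"
proof -
 have "et Y o Fm F X Y f = Fm G X Y f o et X" if XY: "X:Obj C" "Y:Obj C" "f:Hom C X Y" for X Y f
 proof (rule lin_eqI)
	show "et Y o Fm F X Y f:vlin (Fo F X) (Fo G Y)"
	 using XY by (intro lin_comp[OF FobjD(2)[OF F] l] fsub FobjD(1)[OF F]) auto
	show "Fm G X Y f o et X:vlin (Fo F X) (Fo G Y)"
	 using XY by (intro lin_comp[OF l FobjD(2)[OF G]] fsub FobjD(1)[OF G]) auto
 qed (use n XY in auto)
 then show ?thesis using l o by (simp add: FunK_sel nat_trans_def Vect_sel)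
qed

lemma hom_in: "et:Hom (FunK C) F G ==> X:Obj C ==> x:Fo F X ==> et X x:Fo G X"
 using linD(1)[OF FhomD(1)] .

lemma hom_eqI:
 assumes "et:Hom (FunK C) F G" "th:Hom (FunK C) F G'" "!!X x. X:Obj C ==> x:Fo F X ==> et X x = th X x"
 shows "et = th"
proof
 fix X show "et X = th X"
 proof (cases "X:Obj C")
	case True then show ?thesis using lin_eqI[OF FhomD(1)[OF assms(1) True] FhomD(1)[OF assms(2) True]] assms(3) by blast
 next
	case False then show ?thesis using FhomD(3)[OF assms(1)] FhomD(3)[OF assms(2)] by simp
 qed
qed

lemma FunK_id: "F:Obj (FunK C) ==> Idm (FunK C) F:Hom (FunK C) F F"
 by (rule FhomI) (auto simp: FunK_sel(3) Fm_in id_on_lin[OF fsub[OF FobjD(1)]], simp add: id_on_def Fm_in)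

lemma FunK_cmp:
 assumes "F:Obj (FunK C)" "G:Obj (FunK C)" "H:Obj (FunK C)" "et:Hom (FunK C) F G" "th:Hom (FunK C) G H"
 shows "Cmp (FunK C) th et:Hom (FunK C) F H"
proof (rule FhomI[OF assms(1,3)])
 show "Cmp (FunK C) th et X:vlin (Fo F X) (Fo H X)" if "X:Obj C" for X
	unfolding FunK_sel(4) using that assms
	by (intro lin_comp[OF FhomD(1) FhomD(1)]) (auto intro: FobjD(1))
 show "Cmp (FunK C) th et X = 0" if "X ~: Obj C" for X
	using FhomD(3)[OF assms(5) that] by (simp add: FunK_sel(4) fun_eq_iff)
qed (simp add: FunK_sel(4) FhomD(2)[OF assms(4)] FhomD(2)[OF assms(5)])

lemma FunK_subsp:
 assumes "F:Obj (FunK C)" "G:Obj (FunK C)"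
 shows "subsp (fscale (fscale vscale)) (Hom (FunK C) F G)"
proof (rule subspI)
 show "vector_space (fscale (fscale (vscale :: 'k => 'k vec => 'k vec)))" by simp
 have S: "subsp (fscale vscale) (vlin (Fo F X) (Fo G X))" if "X:Obj C" for X
	using FobjD(1)[OF assms(2) that] by (intro subsp_linon) auto
 note L = linD[OF FobjD(2)[OF assms(2)]] lin_more[OF FobjD(2)[OF assms(2)]]
 note S' = subspD[OF S]
 show "0:Hom (FunK C) F G"
	using S'(1) lin_more(1)[OF FobjD(2)[OF assms(2)] fsub[OF FobjD(1)[OF assms(2)]]]
	by (intro FhomI assms) auto
 show "et + th:Hom (FunK C) F G" if h: "et:Hom (FunK C) F G" "th:Hom (FunK C) F G" for et th
	using S'(2) FhomD[OF h(1)] FhomD[OF h(2)] hom_in[OF h(1)] hom_in[OF h(2)] L(2)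
	by (intro FhomI assms) auto
 show "fscale (fscale vscale) c et:Hom (FunK C) F G" if h: "et:Hom (FunK C) F G" for et c
	using S'(3) FhomD[OF h(1)] hom_in[OF h(1)] L(3)
	by (intro FhomI assms) (auto simp: fscale_def[of "fscale vscale"] fscale_def[of vscale] fscale_def[of "(*)"] fun_eq_iff)
qed

lemma FunK_cmp_add:
 assumes "F:Obj (FunK C)" "G:Obj (FunK C)" "H:Obj (FunK C)"
	"f:Hom (FunK C) F G" "f':Hom (FunK C) F G" "g:Hom (FunK C) G H"
 shows "Cmp (FunK C) g (f + f') = Cmp (FunK C) g f + Cmp (FunK C) g f'"
proof (rule hom_eqI)
 note S = subspD[OF FunK_subsp]
 show "Cmp (FunK C) g (f + f'):Hom (FunK C) F H" "Cmp (FunK C) g f + Cmp (FunK C) g f':Hom (FunK C) F H"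
	using assms by (auto intro!: S(2) FunK_cmp[of F G H])
 show "Cmp (FunK C) g (f + f') X x = (Cmp (FunK C) g f + Cmp (FunK C) g f') X x" if "X:Obj C" "x:Fo F X" for X x
	using linD(2)[OF FhomD(1)[OF assms(6) that(1)] hom_in[OF assms(4) that] hom_in[OF assms(5) that]]
	by (simp add: FunK_sel(4))
qed

lemma preadditive_FunK: "preadditive (full_subcat (FunK C) P)"
proof -
 note S = subspD[OF FunK_subsp]
 have add: "Cmp (FunK C) (g + g') f = Cmp (FunK C) g f + Cmp (FunK C) g' f" for f g g'
	by (auto simp: FunK_sel(4) fun_eq_iff)
 have idr: "Cmp (FunK C) f (Idm (FunK C) X) = f & Cmp (FunK C) (Idm (FunK C) Y) f = f"
	if "X:Obj (FunK C)" "Y:Obj (FunK C)" "f:Hom (FunK C) X Y" for X Y f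
 proof
	show "Cmp (FunK C) f (Idm (FunK C) X) = f"
	 by (rule hom_eqI[OF FunK_cmp[OF that(1,1,2) FunK_id that(3)] that(3)]) (use that in \<open>auto simp: FunK_sel(3,4) id_on_def\<close>)
	show "Cmp (FunK C) (Idm (FunK C) Y) f = f"
	 by (rule hom_eqI[OF FunK_cmp[OF that(1,2,2,3) FunK_id] that(3)])
		(use that hom_in[OF that(3)] in \<open>auto simp: FunK_sel(3,4) id_on_def\<close>)
 qed
 show ?thesis unfolding preadditive_def category_def full_subcat_sel
	using S(1,2,4) FunK_cmp_add add idr FunK_id FunK_cmp
	by (auto simp: FunK_sel(4) comp_assoc)
qed

section \<open>Pointwise kernels and cokernels, biproducts, zero objects\<close>

definition pw_ker where
 "pw_ker F al K k \<longleftrightarrow> (ALL X:Obj C. inj_on (k X) (Fo K X) & k X ` Fo K X = {x:Fo F X. al X x = 0})"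

definition pw_cok where
 "pw_cok F G al Q q \<longleftrightarrow> (ALL X:Obj C. q X ` Fo G X = Fo Q X & {y:Fo G X. q X y = 0} = al X ` Fo F X)"

lemma hom0:
 assumes "et:Hom (FunK C) F G" "F:Obj (FunK C)" "X:Obj C" shows "et X 0 = 0"
 using lin_more(1)[OF FhomD(1)[OF assms(1,3)] fsub[OF FobjD(1)[OF assms(2,3)]]] by simp

text \<open>The factorization is found on each object separately and is natural because
  \<open>k\<close> is injective there. The predicate \<open>P\<close> only restricts the test
  objects, so the same pointwise data serve in every full subcategory that contains
  \<open>K\<close>.\<close>

lemma pw_ker_is_kernel:
 assumes F: "F:Obj (FunK C)" and G: "G:Obj (FunK C)" and K: "K:Obj (FunK C)" "P K"
	and a: "al:Hom (FunK C) F G" and k: "k:Hom (FunK C) K F" and pw: "pw_ker F al K k"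
 shows "is_kernel (full_subcat (FunK C) P) F al K k"
 unfolding is_kernel_def full_subcat_sel
proof (intro conjI ballI impI)
 have ki: "inj_on (k X) (Fo K X)" "k X ` Fo K X = {x:Fo F X. al X x = 0}" if "X:Obj C" for X
	using pw that by (auto simp: pw_ker_def)
 show "Cmp (FunK C) al k = 0"
	by (rule hom_eqI[OF FunK_cmp[OF K(1) F G k a] subspD(1)[OF FunK_subsp[OF K(1) G]]])
	 (use ki in \<open>auto simp: FunK_sel(4)\<close>)
 fix T h assume T: "T:{X:Obj (FunK C). P X}" and h: "h:Hom (FunK C) T F" "Cmp (FunK C) al h = 0"
 then have TT: "T:Obj (FunK C)" by simp
 have hx: "h X x:k X ` Fo K X" if "X:Obj C" "x:Fo T X" for X x
	using ki(2)[OF that(1)] hom_in[OF h(1) that] fun_cong[OF fun_cong[OF h(2), of X], of x] by (simp add: FunK_sel(4))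
 define u where "u X = (if X:Obj C then restr (Fo T X) (%x. inv_into (Fo K X) (k X) (h X x)) else 0)" for X
 have ux: "u X x:Fo K X" "k X (u X x) = h X x" if "X:Obj C" "x:Fo T X" for X x
	using hx[OF that] that by (auto simp: u_def inv_into_into f_inv_into_f)
 have uq: "y = z" if "X:Obj C" "y:Fo K X" "z:Fo K X" "k X y = k X z" for X y z
	using ki(1)[OF that(1)] that by (auto dest: inj_onD)
 note SK = subspD[OF fsub[OF FobjD(1)[OF K(1)]]] and ST = subspD[OF fsub[OF FobjD(1)[OF TT]]]
	and kl = linD[OF FhomD(1)[OF k]] and hl = linD[OF FhomD(1)[OF h(1)]]
 have u: "u:Hom (FunK C) T K"
 proof (rule FhomI[OF TT K(1)])
	fix X assume X: "X:Obj C"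
	show "u X:vlin (Fo T X) (Fo K X)"
	proof (rule linI)
	 show "u X (x + y) = u X x + u X y" if "x:Fo T X" "y:Fo T X" for x y
		by (rule uq[OF X]) (use X that ux SK ST kl hl in simp_all)
	 show "u X (vscale c x) = vscale c (u X x)" if "x:Fo T X" for x c
		by (rule uq[OF X]) (use X that ux SK ST kl hl in simp_all)
	qed (use ux X in \<open>auto simp: u_def\<close>)
 next
	fix X Y f x assume f: "X:Obj C" "Y:Obj C" "f:Hom C X Y" and x: "x:Fo T X"
	show "u Y (Fm T X Y f x) = Fm K X Y f (u X x)"
	 by (rule uq[OF f(2)]) (use f x ux Fm_in[OF TT] Fm_in[OF K(1)] FhomD(2)[OF k f] FhomD(2)[OF h(1) f] in simp_all)
 qed (simp add: u_def)
 show "EX! u. u:Hom (FunK C) T K & Cmp (FunK C) k u = h"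
 proof (rule ex1I[of _ u])
	have "Cmp (FunK C) k u = h"
	 by (rule hom_eqI[OF FunK_cmp[OF TT K(1) F u k] h(1)]) (simp add: FunK_sel(4) ux)
	then show "u:Hom (FunK C) T K & Cmp (FunK C) k u = h" using u by simp
	show "v = u" if v: "v:Hom (FunK C) T K & Cmp (FunK C) k v = h" for v
	proof (rule hom_eqI[of v T K u K])
	 fix X x assume x: "X:Obj C" "x:Fo T X"
	 have "k X (v X x) = h X x" using v by (auto simp: FunK_sel(4))
	 then show "v X x = u X x" using uq[OF x(1)] ux[OF x] hom_in[of v T K X x] v x by simp
	qed (use v u in auto)
 qed
qed (use K k in auto)

lemma pw_cok_is_cokernel:
 assumes F: "F:Obj (FunK C)" and G: "G:Obj (FunK C)" and Q: "Q:Obj (FunK C)" "P Q"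
	and a: "al:Hom (FunK C) F G" and q: "q:Hom (FunK C) G Q" and pw: "pw_cok F G al Q q"
 shows "is_cokernel (full_subcat (FunK C) P) G al Q q"
 unfolding is_cokernel_def full_subcat_sel
proof (intro conjI ballI impI)
 have qi: "q X ` Fo G X = Fo Q X" "{y:Fo G X. q X y = 0} = al X ` Fo F X" if "X:Obj C" for X
	using pw that by (auto simp: pw_cok_def)
 have "q X (al X x) = 0" if "X:Obj C" "x:Fo F X" for X x
	using qi(2)[OF that(1)] that(2) by blast
 then show "Cmp (FunK C) q al = 0"
	by (intro hom_eqI[OF FunK_cmp[OF F G Q(1) a q] subspD(1)[OF FunK_subsp[OF F Q(1)]]])
	 (simp add: FunK_sel(4))
 fix T h assume T: "T:{X:Obj (FunK C). P X}" and h: "h:Hom (FunK C) G T" "Cmp (FunK C) h al = 0"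
 then have TT: "T:Obj (FunK C)" by simp
 note SG = subspD[OF fsub[OF FobjD(1)[OF G]]]
	and ql = linD[OF FhomD(1)[OF q]] and hl = linD[OF FhomD(1)[OF h(1)]]
 have hq: "h X y = h X z" if "X:Obj C" "y:Fo G X" "z:Fo G X" "q X y = q X z" for X y z
 proof -
	have "q X (y - z) = 0" using that lin_more(3)[OF FhomD(1)[OF q] fsub[OF FobjD(1)[OF G]]] by simp
	then have "y - z : al X ` Fo F X" using qi(2)[OF that(1)] that SG(5) by auto
	then have "h X (y - z) = 0" using fun_cong[OF fun_cong[OF h(2), of X]] by (auto simp: FunK_sel(4))
	then show ?thesis using that lin_more(3)[OF FhomD(1)[OF h(1)] fsub[OF FobjD(1)[OF G]]] by simp
 qed
 define u where "u X = (if X:Obj C then restr (Fo Q X) (%x. h X (inv_into (Fo G X) (q X) x)) else 0)" for X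
 have ux: "u X (q X y) = h X y" if "X:Obj C" "y:Fo G X" for X y
	using that qi(1)[OF that(1)] hom_in[OF q that] unfolding u_def
	by (auto intro!: hq inv_into_into simp: f_inv_into_f)
 have qs: "EX y:Fo G X. x = q X y" if "X:Obj C" "x:Fo Q X" for X x using qi(1)[OF that(1)] that by blast
 have u: "u:Hom (FunK C) Q T"
 proof (rule FhomI[OF Q(1) TT])
	fix X assume X: "X:Obj C"
	show "u X:vlin (Fo Q X) (Fo T X)"
	proof (rule linI)
	 show "u X x:Fo T X" if "x:Fo Q X" for x
		using qs[OF X that] ux[OF X] hom_in[OF h(1) X] by auto
	 show "u X (x + y) = u X x + u X y" if "x:Fo Q X" "y:Fo Q X" for x y
		using qs[OF X that(1)] qs[OF X that(2)] ux[OF X] SG(2)[OF X] hl[OF X] by (auto simp flip: ql(2)[OF X])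
	 show "u X (vscale c x) = vscale c (u X x)" if "x:Fo Q X" for x c
		using qs[OF X that(1)] ux[OF X] SG(3)[OF X] hl[OF X] by (auto simp flip: ql(3)[OF X])
	qed (use ux X in \<open>auto simp: u_def\<close>)
 next
	fix X Y f x assume f: "X:Obj C" "Y:Obj C" "f:Hom C X Y" and x: "x:Fo Q X"
	from qs[OF f(1) x] obtain y where y: "y:Fo G X" "x = q X y" by blast
	show "u Y (Fm Q X Y f x) = Fm T X Y f (u X x)"
	 using y ux[OF f(1) y(1)] ux[OF f(2) Fm_in[OF G f y(1)]] FhomD(2)[OF q f, of y] FhomD(2)[OF h(1) f, of y] by simp
 qed (simp add: u_def)
 show "EX! u. u:Hom (FunK C) Q T & Cmp (FunK C) u q = h"
 proof (rule ex1I[of _ u])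
	have "Cmp (FunK C) u q = h"
	 by (rule hom_eqI[OF FunK_cmp[OF G Q(1) TT q u] h(1)]) (simp add: FunK_sel(4) ux)
	then show "u:Hom (FunK C) Q T & Cmp (FunK C) u q = h" using u by simp
	show "v = u" if v: "v:Hom (FunK C) Q T & Cmp (FunK C) v q = h" for v
	proof (rule hom_eqI[of v Q T u T])
	 fix X x assume x: "X:Obj C" "x:Fo Q X"
	 from qs[OF x] obtain y where y: "y:Fo G X" "x = q X y" by blast
	 show "v X x = u X x" using v y ux[OF x(1) y(1)] by (auto simp: FunK_sel(4))
	qed (use v u in auto)
 qed
qed (use Q q in auto)

lemma pw_ker_ex:
 assumes F: "F:Obj (FunK C)" and G: "G:Obj (FunK C)" and a: "al:Hom (FunK C) F G"
 shows "EX K:Obj (FunK C). EX k:Hom (FunK C) K F. pw_ker F al K k"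
proof -
 define KX where "KX X = {x:Fo F X. al X x = 0}" for X
 define K :: "('k, 'o, 'm) vfunc" where "K = \<lparr>Fo = KX, Fm = %X Y f. restr (KX X) (Fm F X Y f)\<rparr>"
 define k :: "'o => 'k vec => 'k vec" where "k X = (if X:Obj C then id_on (KX X) else 0)" for X
 have S: "subsp vscale (KX X)" if "X:Obj C" for X
	unfolding KX_def by (rule subsp_ker[OF fsub[OF FobjD(1)[OF F that]] vs_v lin_linon[OF FhomD(1)[OF a that]]])
 have sub: "KX X <= Fo F X" for X by (auto simp: KX_def)
 have fin: "Fm F X Y f x:KX Y" if "X:Obj C" "Y:Obj C" "f:Hom C X Y" "x:KX X" for X Y f x
	using that Fm_in[OF F that(1-3)] FhomD(2)[OF a that(1-3)]
	 lin_more(1)[OF FobjD(2)[OF G that(1-3)] fsub[OF FobjD(1)[OF G that(1)]]] by (auto simp: KX_def)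
 have K: "K:Obj (FunK C)"
 proof (rule FunK_objI)
	show "fds vscale (Fo K X)" if "X:Obj C" for X
	 using fds_sub[OF FobjD(1)[OF F that] S[OF that] sub] by (simp add: K_def)
	show "Fm K X Y f:vlin (Fo K X) (Fo K Y)" if "X:Obj C" "Y:Obj C" "f:Hom C X Y" for X Y f
	 unfolding K_def func.select_convs
	 by (rule restr_lin[OF S[OF that(1)] linon_mono[OF lin_linon[OF FobjD(2)[OF F that]] sub fin[OF that]]])
	show "Fm K X X (Idm C X) = id_on (Fo K X)" if "X:Obj C" for X
	 using sub[of X] by (auto simp: K_def FobjD(3)[OF F that] restr_def id_on_def fun_eq_iff)
	show "Fm K X Z (Cmp C g f) = Fm K Y Z g o Fm K X Y f"
	 if "X:Obj C" "Y:Obj C" "Z:Obj C" "f:Hom C X Y" "g:Hom C Y Z" for X Y Z f g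
	 using that fin[OF that(1,2,4)] lin_more(1)[OF FobjD(2)[OF F that(2,3,5)] fsub[OF FobjD(1)[OF F that(2)]]]
	 by (auto simp: K_def FobjD(4)[OF F that] restr_def fun_eq_iff)
 qed (auto simp: K_def restr_def FobjD(5,6)[OF F] fscale_def fun_eq_iff)
 moreover have "k:Hom (FunK C) K F"
	by (rule FhomI[OF K F])
	 (use subspD[OF S] sub fin in \<open>auto simp: K_def k_def subset_iff id_on_def intro!: linI\<close>)
 moreover have "pw_ker F al K k"
	using sub by (force simp: pw_ker_def K_def k_def id_on_def inj_on_def KX_def image_iff)
 ultimately show ?thesis by blast
qed

text \<open>A quotient has to be a subspace of the same universe of vectors. It is realized as the
  image of an endomorphism \<open>q X\<close> of \<open>Fo G X\<close> whose kernel is the image of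
  \<open>al X\<close>. The transition maps lift along \<open>q X\<close>, apply \<open>G\<close> and
  project again; \<open>wd\<close> says that the choice of the lift is immaterial.\<close>

lemma pw_cok_ex:
 assumes F: "F:Obj (FunK C)" and G: "G:Obj (FunK C)" and a: "al:Hom (FunK C) F G"
 shows "EX Q:Obj (FunK C). EX q:Hom (FunK C) G Q. pw_cok F G al Q q"
proof -
 have ex: "EX pr. pr:vlin (Fo G X) (Fo G X) & (ALL x:Fo G X. pr x = 0 \<longleftrightarrow> x : al X ` Fo F X)" if "X:Obj C" for X
	using proj_ex[OF FobjD(1)[OF G that] subsp_image[OF fsub[OF FobjD(1)[OF F that]] vs_v lin_linon[OF FhomD(1)[OF a that]]]]
	 hom_in[OF a that] by blast
 define q :: "'o => 'k vec => 'k vec" where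
	"q X = (if X:Obj C then SOME pr. pr:vlin (Fo G X) (Fo G X) & (ALL x:Fo G X. pr x = 0 \<longleftrightarrow> x : al X ` Fo F X) else 0)" for X
 have ql: "q X:vlin (Fo G X) (Fo G X)" and q0: "x:Fo G X ==> q X x = 0 \<longleftrightarrow> x : al X ` Fo F X" if "X:Obj C" for X x
	using someI_ex[OF ex[OF that]] that by (simp_all add: q_def)
 note SG = subspD[OF fsub[OF FobjD(1)[OF G]]] and q = linD[OF ql]
	and fl = linD[OF FobjD(2)[OF G]]
 define QX where "QX X = q X ` Fo G X" for X
 define m where "m X Y f = restr (QX X) (%y. q Y (Fm G X Y f (inv_into (Fo G X) (q X) y)))" for X Y f
 define Q :: "('k, 'o, 'm) vfunc" where "Q = \<lparr>Fo = QX, Fm = m\<rparr>"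
 have wd: "q Y (Fm G X Y f y) = q Y (Fm G X Y f z)"
	if f: "X:Obj C" "Y:Obj C" "f:Hom C X Y" "y:Fo G X" "z:Fo G X" "q X y = q X z" for X Y f y z
 proof -
	have "q X (y - z) = 0" using f lin_more(3)[OF ql[OF f(1)] fsub[OF FobjD(1)[OF G]]] by simp
	then have "y - z : al X ` Fo F X" using q0 f SG(5) by auto
	then have "Fm G X Y f (y - z) : al Y ` Fo F Y"
	 using FhomD(2)[OF a f(1-3)] Fm_in[OF F f(1-3)] by (auto simp flip: FhomD(2)[OF a f(1-3)])
	then have "q Y (Fm G X Y f (y - z)) = 0" using q0 f Fm_in[OF G f(1-3)] SG(5) by auto
	then show ?thesis using f lin_more(3)[OF FobjD(2)[OF G f(1-3)] fsub[OF FobjD(1)[OF G]]]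
	 lin_more(3)[OF ql[OF f(2)] fsub[OF FobjD(1)[OF G]]] Fm_in[OF G f(1-3)] by simp
 qed
 have mq: "m X Y f (q X y) = q Y (Fm G X Y f y)" if f: "X:Obj C" "Y:Obj C" "f:Hom C X Y" "y:Fo G X" for X Y f y
	using f unfolding m_def QX_def by (auto intro!: wd inv_into_into simp: f_inv_into_f)
 have qs: "EX y:Fo G X. x = q X y" if "x:QX X" for X x using that by (auto simp: QX_def)
 have fQ: "fds vscale (QX X)" if "X:Obj C" for X
	unfolding QX_def by (rule fds_image[OF FobjD(1)[OF G that] vs_v lin_linon[OF ql[OF that]]])
 have mo: "m X Y f x = 0" if "x ~: QX X" for X Y f x using that by (simp add: m_def)
 have ml: "m X Y f:vlin (QX X) (QX Y)" if f: "X:Obj C" "Y:Obj C" "f:Hom C X Y" for X Y f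
 proof (rule linI)
	show "m X Y f x:QX Y" if "x:QX X" for x
	 using qs[OF that] mq[OF f] Fm_in[OF G f] by (auto simp: QX_def)
	show "m X Y f (x + y) = m X Y f x + m X Y f y" if "x:QX X" "y:QX X" for x y
	 using qs[OF that(1)] qs[OF that(2)] mq[OF f] SG(2)[OF f(1)] fl[OF f] q[OF f(2)] by (auto simp flip: q(2)[OF f(1)])
	show "m X Y f (vscale c x) = vscale c (m X Y f x)" if "x:QX X" for x c
	 using qs[OF that(1)] mq[OF f] SG(3)[OF f(1)] fl[OF f] q[OF f(2)] by (auto simp flip: q(3)[OF f(1)])
 qed (rule mo)
 have Q: "Q:Obj (FunK C)"
 proof (rule FunK_objI)
	show "Fm Q X X (Idm C X) = id_on (Fo Q X)" if "X:Obj C" for X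
	proof (rule lin_eqI)
	 show "Fm Q X X (Idm C X):vlin (Fo Q X) (Fo Q X)" using ml that by (simp add: Q_def)
	 show "id_on (Fo Q X):vlin (Fo Q X) (Fo Q X)" using fQ that by (intro id_on_lin) (simp add: Q_def)
	 show "Fm Q X X (Idm C X) x = id_on (Fo Q X) x" if x: "x:Fo Q X" for x
		using qs[of x X] x that \<open>X:Obj C\<close> by (auto simp: Q_def mq id_on_def Fm_id[OF G])
	qed
	show "Fm Q X Z (Cmp C g f) = Fm Q Y Z g o Fm Q X Y f"
	 if h: "X:Obj C" "Y:Obj C" "Z:Obj C" "f:Hom C X Y" "g:Hom C Y Z" for X Y Z f g
	proof (rule lin_eqI)
	 show "Fm Q X Z (Cmp C g f):vlin (Fo Q X) (Fo Q Z)"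
		using ml[OF h(1,3) cmp[OF h]] by (simp add: Q_def)
	 show "Fm Q Y Z g o Fm Q X Y f:vlin (Fo Q X) (Fo Q Z)"
		using lin_comp[OF ml[OF h(1,2,4)] ml[OF h(2,3,5)] fsub[OF fQ[OF h(2)]] vs_v] by (simp add: Q_def)
	 show "Fm Q X Z (Cmp C g f) x = (Fm Q Y Z g o Fm Q X Y f) x" if x: "x:Fo Q X" for x
		using qs[of x X] x h Fm_in[OF G h(1,2,4)] by (auto simp: Q_def mq mq[OF h(1,3) cmp[OF h]] Fm_comp[OF G h])
	qed
	show "Fm Q X Y (f + g) = Fm Q X Y f + Fm Q X Y g"
	 if "X:Obj C" "Y:Obj C" "f:Hom C X Y" "g:Hom C X Y" for X Y f g
	proof
	 fix x show "Fm Q X Y (f + g) x = (Fm Q X Y f + Fm Q X Y g) x"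
		using qs[of x X] that mo[of x X] by (cases "x:QX X") (auto simp: Q_def mq hom_closed FobjD(5)[OF G] Fm_in[OF G] q)
	qed
	show "Fm Q X Y (Scl C c f) = fscale vscale c (Fm Q X Y f)"
	 if "X:Obj C" "Y:Obj C" "f:Hom C X Y" for X Y f c
	proof
	 fix x show "Fm Q X Y (Scl C c f) x = fscale vscale c (Fm Q X Y f) x"
		using qs[of x X] that mo[of x X]
		by (cases "x:QX X") (auto simp: Q_def mq hom_closed FobjD(6)[OF G] Fm_in[OF G] q fscale_def[of vscale] vs_simps[OF vs_v])
	qed
 qed (use fQ ml in \<open>auto simp: Q_def\<close>)
 moreover have "q:Hom (FunK C) G Q"
 proof (rule FhomI[OF G Q])
	show "q X:vlin (Fo G X) (Fo Q X)" if "X:Obj C" for X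
	 using q(2,3)[OF that] lin_out[OF ql[OF that]] by (auto simp: Q_def QX_def intro!: linI)
	show "q Y (Fm G X Y f x) = Fm Q X Y f (q X x)" if "X:Obj C" "Y:Obj C" "f:Hom C X Y" "x:Fo G X" for X Y f x
	 using mq[OF that] by (simp add: Q_def)
 qed (simp add: q_def)
 moreover have "pw_cok F G al Q q"
	unfolding pw_cok_def
 proof
	fix X assume X: "X:Obj C"
	have "{y:Fo G X. q X y = 0} = al X ` Fo F X" using q0[OF X] hom_in[OF a X] by blast
	then show "q X ` Fo G X = Fo Q X & {y:Fo G X. q X y = 0} = al X ` Fo F X" by (simp add: Q_def QX_def)
 qed
 ultimately show ?thesis by blast
qed

text \<open>Pairs are functions on \<open>bool\<close>, a type other than that of vectors. The sum
  is therefore the model of a space of such functions, with \<open>True\<close> marking the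
  component from \<open>F\<close>.\<close>

lemma biproduct_ex:
 assumes F: "F:Obj (FunK C)" and G: "G:Obj (FunK C)"
 shows "EX S i1 i2 p1 p2. biproduct (FunK C) F G S i1 i2 p1 p2"
proof -
 define s :: "'k => (bool => 'k vec) => bool => 'k vec" where "s = fscale vscale"
 define W where "W X = {w :: bool => 'k vec. (ALL b:UNIV. w b:(if b then Fo F X else Fo G X)) & (ALL b. b ~: UNIV --> w b = 0)}" for X
 have Wi: "w:W X \<longleftrightarrow> w True:Fo F X & w False:Fo G X" for w X by (auto simp: W_def split: if_splits)
 have fW: "fds s (W X)" if "X:Obj C" for X
	unfolding W_def s_def by (rule fds_fun) (use FobjD(1)[OF F that] FobjD(1)[OF G that] in auto)
 define m where "m X Y f w = (%b. if b then Fm F X Y f (w True) else Fm G X Y f (w False))" for X Y f and w :: "bool => 'k vec"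
 define S :: "('k, 'o, 'm) vfunc" where "S = \<lparr>Fo = %X. model s (W X), Fm = %X Y f. tmap s (W X) s (W Y) (m X Y f)\<rparr>"
 have ml: "linon s (W X) s (W Y) (m X Y f)" if f: "X:Obj C" "Y:Obj C" "f:Hom C X Y" for X Y f
	using Fm_in[OF F f] Fm_in[OF G f] linD[OF FobjD(2)[OF F f]] linD[OF FobjD(2)[OF G f]]
	by (auto simp: linon_def Wi m_def s_def fscale_def[of vscale] fun_eq_iff)
 have m0: "m X Y f 0 = 0" if f: "X:Obj C" "Y:Obj C" "f:Hom C X Y" for X Y f
	using lin_more(1)[OF FobjD(2)[OF F f]] lin_more(1)[OF FobjD(2)[OF G f]] FobjD(1)[OF F f(1)] FobjD(1)[OF G f(1)]
	by (auto simp: m_def fun_eq_iff)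
 have S: "S:Obj (FunK C)"
 proof (rule FunK_objI)
	show "Fm S X X (Idm C X) = id_on (Fo S X)" if "X:Obj C" for X
	 unfolding S_def func.select_convs tmap_id[symmetric]
	 by (rule tmap_cong) (use that Fm_id[OF F that] Fm_id[OF G that] in \<open>auto simp: m_def Wi fun_eq_iff\<close>)
	show "Fm S X Z (Cmp C g f) = Fm S Y Z g o Fm S X Y f"
	 if h: "X:Obj C" "Y:Obj C" "Z:Obj C" "f:Hom C X Y" "g:Hom C Y Z" for X Y Z f g
	proof -
	 have "m X Z (Cmp C g f) = (%w. m Y Z g (m X Y f w))"
		by (auto simp: m_def Fm_comp[OF F h] Fm_comp[OF G h] fun_eq_iff)
	 then show ?thesis unfolding S_def func.select_convs
		by (simp add: tmap_comp[where f="m X Y f" and g="m Y Z g", OF fW[OF h(1)] fW[OF h(2)] linonD(1)[OF ml[OF h(1,2,4)]] fW[OF h(3)] m0[OF h(2,3,5)]])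
	qed
	show "Fm S X Y (f + g) = Fm S X Y f + Fm S X Y g"
	 if h: "X:Obj C" "Y:Obj C" "f:Hom C X Y" "g:Hom C X Y" for X Y f g
	proof -
	 have "m X Y (f + g) = (%w. m X Y f w + m X Y g w)"
		by (auto simp: m_def FobjD(5)[OF F h] FobjD(5)[OF G h] fun_eq_iff)
	 then show ?thesis unfolding S_def func.select_convs
		by (simp add: tmap_add[OF fW[OF h(2)]] linonD(1)[OF ml] h)
	qed
	show "Fm S X Y (Scl C c f) = fscale vscale c (Fm S X Y f)"
	 if h: "X:Obj C" "Y:Obj C" "f:Hom C X Y" for X Y f c
	proof -
	 have "m X Y (Scl C c f) = (%w. s c (m X Y f w))"
		by (auto simp: m_def FobjD(6)[OF F h] FobjD(6)[OF G h] s_def fscale_def[of vscale] fun_eq_iff)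
	 then show ?thesis unfolding S_def func.select_convs
		by (simp add: tmap_scale[OF fW[OF h(2)]] linonD(1)[OF ml] h)
	qed
 qed (use fW ml in \<open>auto simp: S_def intro!: tmap_lin\<close>)
 define i where "i b X = (if X:Obj C then restr (if b then Fo F X else Fo G X) (%x. coords s (W X) (%c. if b = c then x else 0)) else 0)" for b X
 define p where "p b X = (if X:Obj C then restr (model s (W X)) (%y. dec s (W X) y b) else 0)" for b X
 note SF = subspD[OF fsub[OF FobjD(1)[OF F]]] and SG = subspD[OF fsub[OF FobjD(1)[OF G]]]
	and c = linonD[OF coords_linon[OF fW]] and d = linonD[OF dec_linon[OF fW]]
 let ?F = "%b. if b then F else G"
 have FG: "?F b:Obj (FunK C)" for b using F G by simp
 have ce: "(%c. if b = c then x else 0):W X" if "X:Obj C" "x:Fo (?F b) X" for b X x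
	using that SF(1) SG(1) by (cases b) (auto simp: Wi)
 have ih: "i b:Hom (FunK C) (?F b) S" for b
 proof (rule FhomI[OF FG S])
	fix X assume X: "X:Obj C"
	have e: "(%c. if b = c then x + y else 0) = (%c. if b = c then x else 0) + (%c. if b = c then y else 0)"
	 "(%c. if b = c then vscale r x else 0) = s r (%c. if b = c then x else 0)" for x y :: "'k vec" and r
	 by (auto simp: fun_eq_iff s_def fscale_def)
	have "linon vscale (Fo (?F b) X) vscale (model s (W X)) (%x. coords s (W X) (%c. if b = c then x else 0))"
	 using ce[OF X] c[OF X] by (simp add: linon_def e split del: if_split)
	from restr_lin[OF fsub[OF FobjD(1)[OF FG X]] this]
	show "i b X:vlin (Fo (?F b) X) (Fo S X)" using X by (simp add: i_def S_def if_distrib[of "%F. Fo F X"])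
 next
	fix X Y f x assume f: "X:Obj C" "Y:Obj C" "f:Hom C X Y" and x: "x:Fo (?F b) X"
	have "m X Y f (%c. if b = c then x else 0) = (%c. if b = c then Fm (?F b) X Y f x else 0)"
	 using lin_more(1)[OF FobjD(2)[OF F f]] lin_more(1)[OF FobjD(2)[OF G f]] FobjD(1)[OF F f(1)] FobjD(1)[OF G f(1)]
	 by (auto simp: m_def fun_eq_iff)
	then show "i b Y (Fm (?F b) X Y f x) = Fm S X Y f (i b X x)"
	 using f x ce[OF f(1) x] fW Fm_in[OF FG f x] by (simp add: i_def S_def if_distrib[of "%F. Fo F X" for X] split del: if_split)
 qed (simp add: i_def)
 have ph: "p b:Hom (FunK C) S (?F b)" for b
 proof (rule FhomI[OF S FG])
	fix X assume X: "X:Obj C"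
	have "linon vscale (model s (W X)) vscale (Fo (?F b) X) (%y. dec s (W X) y b)"
	 using d[OF X] dec_in[of _ s "W X"] by (cases b) (auto simp: linon_def Wi s_def fscale_def[of vscale])
	from restr_lin[OF fsub[OF model_fds[OF fW[OF X]]] this]
	show "p b X:vlin (Fo S X) (Fo (?F b) X)" using X by (simp add: p_def S_def)
 next
	fix X Y f x assume f: "X:Obj C" "Y:Obj C" "f:Hom C X Y" and x: "x:Fo S X"
	then show "p b Y (Fm S X Y f x) = Fm (?F b) X Y f (p b X x)"
	 using fW linonD(1)[OF ml[OF f]] by (cases b) (simp_all add: p_def S_def m_def)
 qed (simp add: p_def)
 have pi: "p b X (i b' X x) = (if b' = b then x else 0)" if "X:Obj C" "x:Fo (?F b') X" for b b' X x
	using that ce[OF that] fW[OF that(1)] by (auto simp: p_def i_def if_distrib[of "%F. Fo F X" for X] split del: if_split)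
 have piT: "p b X (i True X x) = (if b then x else 0)" if "X:Obj C" "x:Fo F X" for b X x
 proof -
	have "x:Fo (?F True) X" using that by simp
	from pi[OF that(1) this] show ?thesis by simp
 qed
 have piF: "p b X (i False X x) = (if b then 0 else x)" if "X:Obj C" "x:Fo G X" for b X x
 proof -
	have "x:Fo (?F False) X" using that by simp
	from pi[OF that(1) this] show ?thesis by simp
 qed
 note [simp] = FunK_sel(3,4)
 have "biproduct (FunK C) F G S (i True) (i False) (p True) (p False)"
	unfolding biproduct_def
 proof (intro conjI)
	show "i True:Hom (FunK C) F S" "i False:Hom (FunK C) G S" "p True:Hom (FunK C) S F" "p False:Hom (FunK C) S G"
	 using ih[of True] ih[of False] ph[of True] ph[of False] by simp_all
	note ih' = this
	show "Cmp (FunK C) (p True) (i True) = Idm (FunK C) F"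
	 by (rule hom_eqI[OF FunK_cmp[OF F S F ih'(1,3)] FunK_id[OF F]]) (simp add: id_on_def piT)
	show "Cmp (FunK C) (p False) (i False) = Idm (FunK C) G"
	 by (rule hom_eqI[OF FunK_cmp[OF G S G ih'(2,4)] FunK_id[OF G]]) (simp add: id_on_def piF)
	show "Cmp (FunK C) (p False) (i True) = 0"
	 by (rule hom_eqI[OF FunK_cmp[OF F S G ih'(1,4)] subspD(1)[OF FunK_subsp[OF F G]]]) (simp add: piT)
	show "Cmp (FunK C) (p True) (i False) = 0"
	 by (rule hom_eqI[OF FunK_cmp[OF G S F ih'(2,3)] subspD(1)[OF FunK_subsp[OF G F]]]) (simp add: piF)
	show "Cmp (FunK C) (i True) (p True) + Cmp (FunK C) (i False) (p False) = Idm (FunK C) S"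
	proof (rule hom_eqI[OF subspD(2)[OF FunK_subsp[OF S S] FunK_cmp[OF S F S ih'(3,1)] FunK_cmp[OF S G S ih'(4,2)]] FunK_id[OF S]])
	 fix X x assume X: "X:Obj C" "x:Fo S X"
	 then have x: "x:model s (W X)" by (simp add: S_def)
	 let ?w = "dec s (W X) x"
	 have w: "?w:W X" using x by simp
	 have "coords s (W X) (%c. if c then ?w True else 0) + coords s (W X) (%c. if ~ c then ?w False else 0)
		= coords s (W X) ((%c. if c then ?w True else 0) + (%c. if ~ c then ?w False else 0))"
		by (rule c(2)[OF X(1), symmetric]) (use w SF(1)[OF X(1)] SG(1)[OF X(1)] in \<open>auto simp: Wi\<close>)
	 also have "(%c. if c then ?w True else 0) + (%c. if ~ c then ?w False else 0) = ?w" by (auto simp: fun_eq_iff)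
	 finally have e: "coords s (W X) (%c. if c then ?w True else 0) + coords s (W X) (%c. if ~ c then ?w False else 0) = x"
		by (simp only: coords_dec[OF x])
	 have "i True X (p True X x) = coords s (W X) (%c. if c then ?w True else 0)"
		"i False X (p False X x) = coords s (W X) (%c. if ~ c then ?w False else 0)"
		using X x w by (simp_all add: i_def p_def Wi)
	 then have "i True X (p True X x) + i False X (p False X x) = x" using e by (simp only:)
	 then show "(Cmp (FunK C) (i True) (p True) + Cmp (FunK C) (i False) (p False)) X x = Idm (FunK C) S X x"
		using X by (simp only: plus_fun_apply FunK_sel comp_apply id_on_def if_True)
	qed
 qed (rule S)
 then show ?thesis by blast
qed

lemma zero_FunK_ex: "EX Z:Obj (FunK C). ALL X:Obj C. Fo Z X = {0}"
proof (rule bexI[of _ "\<lparr>Fo = %_. {0}, Fm = %_ _ _. 0\<rparr>"])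
 show "\<lparr>Fo = %_. {0}, Fm = %_ _ _. 0\<rparr>:Obj (FunK C)"
	by (rule FunK_objI) (auto simp: id_on_def fun_eq_iff lin_def fscale_def)
qed simp

lemma zero_FunK:
 assumes Z: "Z:Obj (FunK C)" "P Z" and z: "!!X. X:Obj C ==> Fo Z X = {0}"
 shows "zero_object (full_subcat (FunK C) P) Z"
proof -
 have "(EX! f. f:Hom (FunK C) X Z) & (EX! f. f:Hom (FunK C) Z X)" if X: "X:Obj (FunK C)" for X
 proof
	show "EX! f. f:Hom (FunK C) X Z"
	proof (rule ex1I)
	 show "0:Hom (FunK C) X Z" by (rule subspD(1)[OF FunK_subsp[OF X Z(1)]])
	 show "f = 0" if "f:Hom (FunK C) X Z" for f
		by (rule hom_eqI[OF that subspD(1)[OF FunK_subsp[OF X Z(1)]]]) (use hom_in[OF that] z in auto)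
	qed
	show "EX! f. f:Hom (FunK C) Z X"
	proof (rule ex1I)
	 show "0:Hom (FunK C) Z X" by (rule subspD(1)[OF FunK_subsp[OF Z(1) X]])
	 show "f = 0" if "f:Hom (FunK C) Z X" for f
		by (rule hom_eqI[OF that subspD(1)[OF FunK_subsp[OF Z(1) X]]]) (use hom0[OF that Z(1)] z in auto)
	qed
 qed
 then show ?thesis using Z by (simp add: zero_object_def)
qed

lemma zero_object_FunK:
 "zero_object (FunK C) Z \<longleftrightarrow> Z:Obj (FunK C) & (ALL X:Obj C. Fo Z X = {0})"
proof
 assume Z: "zero_object (FunK C) Z"
 then have ZO: "Z:Obj (FunK C)" by (simp add: zero_object_def)
 have "Idm (FunK C) Z = 0"
	using Z FunK_id[OF ZO] subspD(1)[OF FunK_subsp[OF ZO ZO]] unfolding zero_object_def by blast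
 then have e: "Idm (FunK C) Z X x = 0" for X x by simp
 have "x = 0" if "X:Obj C" "x:Fo Z X" for X x
	using e[of X x] that by (simp add: FunK_sel(3) id_on_def)
 then have "Fo Z X = {0}" if "X:Obj C" for X
	using that subspD(1)[OF fsub[OF FobjD(1)[OF ZO that]]] by blast
 then show "Z:Obj (FunK C) & (ALL X:Obj C. Fo Z X = {0})" using ZO by blast
next
 assume "Z:Obj (FunK C) & (ALL X:Obj C. Fo Z X = {0})"
 then show "zero_object (FunK C) Z" using zero_FunK[of Z "%_. True"] by (simp add: zero_object_def)
qed

text \<open>A monic arrow is tested against its own pointwise kernel, which lies in the subcategory
  by \<open>ker\<close>. So it is injective on every object, and it is then a pointwise kernel of
  its cokernel. Epic arrows are treated dually.\<close>

lemma abelian_FunK_sub: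
 assumes zero: "!!Z. Z:Obj (FunK C) ==> (!!X. X:Obj C ==> Fo Z X = {0}) ==> P Z"
	and bip: "!!F G S i1 i2 p1 p2. F:Obj (FunK C) ==> G:Obj (FunK C) ==> P F ==> P G ==>
	 biproduct (FunK C) F G S i1 i2 p1 p2 ==> P S"
	and ker: "!!F G al K k. F:Obj (FunK C) ==> G:Obj (FunK C) ==> K:Obj (FunK C) ==> P F ==> P G ==>
	 al:Hom (FunK C) F G ==> k:Hom (FunK C) K F ==> pw_ker F al K k ==> P K"
	and cok: "!!F G al Q q. F:Obj (FunK C) ==> G:Obj (FunK C) ==> Q:Obj (FunK C) ==> P F ==> P G ==>
	 al:Hom (FunK C) F G ==> q:Hom (FunK C) G Q ==> pw_cok F G al Q q ==> P Q"
 shows "abelian_category (full_subcat (FunK C) P)" (is "abelian_category ?D")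
 unfolding abelian_category_def
proof (intro conjI ballI preadditive_FunK)
 obtain Z where "Z:Obj (FunK C)" "!!X. X:Obj C ==> Fo Z X = {0}" using zero_FunK_ex by blast
 then show "EX Z. zero_object ?D Z" using zero_FunK[of Z P] zero by blast
 show "EX S i1 i2 p1 p2. biproduct ?D F G S i1 i2 p1 p2" if FG: "F:Obj ?D" "G:Obj ?D" for F G
 proof -
	obtain S i1 i2 p1 p2 where b: "biproduct (FunK C) F G S i1 i2 p1 p2" using biproduct_ex FG by fastforce
	moreover have "P S" using bip[OF _ _ _ _ b] FG by simp
	ultimately have "biproduct ?D F G S i1 i2 p1 p2" by (simp add: biproduct_def)
	then show ?thesis by blast
 qed
 fix F G al assume "F:Obj ?D" "G:Obj ?D" and "al:Hom ?D F G"
 then have F: "F:Obj (FunK C)" "P F" and G: "G:Obj (FunK C)" "P G" and a: "al:Hom (FunK C) F G" by auto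
 obtain K k where K: "K:Obj (FunK C)" and k: "k:Hom (FunK C) K F" and pk: "pw_ker F al K k"
	using pw_ker_ex[OF F(1) G(1) a] by blast
 have PK: "P K" using ker[OF F(1) G(1) K F(2) G(2) a k pk] .
 obtain Q q where Q: "Q:Obj (FunK C)" and q: "q:Hom (FunK C) G Q" and pq: "pw_cok F G al Q q"
	using pw_cok_ex[OF F(1) G(1) a] by blast
 have PQ: "P Q" using cok[OF F(1) G(1) Q F(2) G(2) a q pq] .
 note isk = pw_ker_is_kernel[of F G K P, OF F(1) G(1) K PK a k pk]
 note isc = pw_cok_is_cokernel[of F G Q P, OF F(1) G(1) Q PQ a q pq]
 show "EX K k. is_kernel ?D F al K k" using isk by blast
 show "EX Q q. is_cokernel ?D G al Q q" using isc by blast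
 show "monic ?D F al --> (EX Z:Obj ?D. EX g:Hom ?D G Z. is_kernel ?D G g F al)"
 proof
	assume m: "monic ?D F al"
	have z: "0:Hom (FunK C) K F" by (rule subspD(1)[OF FunK_subsp[OF K F(1)]])
	have "Cmp (FunK C) al k = 0" using isk by (simp add: is_kernel_def)
	moreover have "Cmp (FunK C) al 0 = 0"
	 using hom0[OF a F(1)] FhomD(3)[OF a] by (fastforce simp: FunK_sel(4) fun_eq_iff)
	ultimately have "k = 0" using m z k K PK unfolding monic_def by simp
	then have "inj_on (al X) (Fo F X)" if X: "X:Obj C" for X
	proof -
	 have "{x:Fo F X. al X x = 0} = k X ` Fo K X" using pk X by (simp add: pw_ker_def)
	 then have z: "x = 0" if "x:Fo F X" "al X x = 0" for x using that \<open>k = 0\<close> by auto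
	 show ?thesis
	 proof (rule inj_onI)
		fix x y assume xy: "x:Fo F X" "y:Fo F X" "al X x = al X y"
		have "x - y = 0"
		 by (rule z) (simp_all add: xy subspD(5)[OF fsub[OF FobjD(1)[OF F(1) X]]]
			lin_more(3)[OF FhomD(1)[OF a X] fsub[OF FobjD(1)[OF F(1) X]]])
		then show "x = y" by simp
	 qed
	qed
	then have "pw_ker G q F al" using pq by (simp add: pw_ker_def pw_cok_def)
	then have "is_kernel ?D G q F al" by (intro pw_ker_is_kernel[of G Q F P] F G Q a q)
	then show "EX Z:Obj ?D. EX g:Hom ?D G Z. is_kernel ?D G g F al" using Q PQ q by auto
 qed
 show "epic ?D G al --> (EX Z:Obj ?D. EX g:Hom ?D Z F. is_cokernel ?D F g G al)"
 proof
	assume e: "epic ?D G al"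
	have z: "0:Hom (FunK C) G Q" by (rule subspD(1)[OF FunK_subsp[OF G(1) Q]])
	have "Cmp (FunK C) q al = 0" using isc by (simp add: is_cokernel_def)
	moreover have "Cmp (FunK C) 0 al = 0" by (auto simp: FunK_sel(4) fun_eq_iff)
	ultimately have "q = 0" using e z q Q PQ unfolding epic_def by simp
	have "al X ` Fo F X = Fo G X" "{x:Fo F X. al X x = 0} = k X ` Fo K X" if X: "X:Obj C" for X
	proof -
	 have "{y:Fo G X. q X y = 0} = al X ` Fo F X" using pq X by (simp add: pw_cok_def)
	 then show "al X ` Fo F X = Fo G X" by (simp add: \<open>q = 0\<close>)
	 show "{x:Fo F X. al X x = 0} = k X ` Fo K X" using pk X by (simp add: pw_ker_def)
	qed
	then have "pw_cok K F k G al" by (simp add: pw_cok_def)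
	then have "is_cokernel ?D F k G al" by (intro pw_cok_is_cokernel[of K F G P] F G K a k)
	then show "EX Z:Obj ?D. EX g:Hom ?D Z F. is_cokernel ?D F g G al" using K PK k by auto
 qed
qed

end

section \<open>Adjunctions from universal arrows, and recollements\<close>

locale acat =
 fixes C :: "('o, 'm::ab_group_add, 'x) cat_scheme"
 assumes pre: "preadditive C"
	and assoc: "Cmp C (Cmp C h g) f = Cmp C h (Cmp C g f)"
begin

lemma idm: "X:Obj C ==> Idm C X:Hom C X X"
 and cmp: "X:Obj C ==> Y:Obj C ==> Z:Obj C ==> f:Hom C X Y ==> g:Hom C Y Z ==> Cmp C g f:Hom C X Z"
 and idr: "X:Obj C ==> Y:Obj C ==> f:Hom C X Y ==> Cmp C f (Idm C X) = f"
 and idl: "X:Obj C ==> Y:Obj C ==> f:Hom C X Y ==> Cmp C (Idm C Y) f = f"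
 and zero: "X:Obj C ==> Y:Obj C ==> 0:Hom C X Y"
 and add: "X:Obj C ==> Y:Obj C ==> f:Hom C X Y ==> g':Hom C X Y ==> f + g':Hom C X Y"
 and addr: "X:Obj C ==> Y:Obj C ==> Z:Obj C ==> f:Hom C X Y ==> f':Hom C X Y ==> g:Hom C Y Z ==>
	 Cmp C g (f + f') = Cmp C g f + Cmp C g f'"
 and addl: "X:Obj C ==> Y:Obj C ==> Z:Obj C ==> f:Hom C X Y ==> g:Hom C Y Z ==> g'':Hom C Y Z ==>
	 Cmp C (g + g'') f = Cmp C g f + Cmp C g'' f"
 using pre unfolding preadditive_def category_def by (blast | simp)+

lemma cmp0r: "X:Obj C ==> Y:Obj C ==> Z:Obj C ==> g:Hom C Y Z ==> Cmp C g 0 = 0"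
 using addr[of X Y Z 0 0 g] zero[of X Y] by simp

lemma cmp0l: "X:Obj C ==> Y:Obj C ==> Z:Obj C ==> f:Hom C X Y ==> Cmp C 0 f = 0"
 using addl[of X Y Z f 0 0] zero[of Y Z] by simp

lemma zero_objectI:
 assumes Z: "Z:Obj C" and e: "Idm C Z = 0" shows "zero_object C Z"
proof -
 have "f = 0" if "X:Obj C" "f:Hom C X Z" for X f
	using idl[OF that(1) Z that(2)] cmp0l[OF that(1) Z Z that(2)] e by simp
 moreover have "f = 0" if "X:Obj C" "f:Hom C Z X" for X f
	using idr[OF Z that] cmp0r[OF Z Z that] e by simp
 ultimately show ?thesis unfolding zero_object_def using Z zero by metis
qed

lemma zero_objectD: "zero_object C Z ==> f:Hom C Z Z ==> f = 0"
 using zero[of Z Z] unfolding zero_object_def by blast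

end

lemma functorD:
 assumes "is_functor C D F"
 shows "X:Obj C ==> Fo F X:Obj D" "X:Obj C ==> Fm F X X (Idm C X) = Idm D (Fo F X)"
	"X:Obj C ==> Y:Obj C ==> f:Hom C X Y ==> Fm F X Y f:Hom D (Fo F X) (Fo F Y)"
	"X:Obj C ==> Y:Obj C ==> Z:Obj C ==> f:Hom C X Y ==> g:Hom C Y Z ==>
	 Fm F X Z (Cmp C g f) = Cmp D (Fm F Y Z g) (Fm F X Y f)"
 using assms by (auto simp: is_functor_def)

lemma additive_functorD:
 assumes "additive_functor C D F"
 shows "is_functor C D F"
	"X:Obj C ==> Y:Obj C ==> f:Hom C X Y ==> g:Hom C X Y ==> Fm F X Y (f + g) = Fm F X Y f + Fm F X Y g"
 using assms by (auto simp: additive_functor_def)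

lemma additive_functor_zero:
 assumes "additive_functor C D F" "acat C" "X:Obj C" "Y:Obj C" shows "Fm F X Y 0 = 0"
 using additive_functorD(2)[OF assms(1,3,4), of 0 0] acat.zero[OF assms(2-4)] by simp

lemma adjunctionD:
 assumes "adjunction C D L R et ep"
 shows "is_functor C D L" "is_functor D C R"
	"X:Obj C ==> et X:Hom C X (Fo R (Fo L X))" "Y:Obj D ==> ep Y:Hom D (Fo L (Fo R Y)) Y"
	"X:Obj C ==> X':Obj C ==> f:Hom C X X' ==>
	 Cmp C (et X') f = Cmp C (Fm R (Fo L X) (Fo L X') (Fm L X X' f)) (et X)"
	"Y:Obj D ==> Y':Obj D ==> g:Hom D Y Y' ==>
	 Cmp D (ep Y') (Fm L (Fo R Y) (Fo R Y') (Fm R Y Y' g)) = Cmp D g (ep Y)"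
	"X:Obj C ==> Cmp D (ep (Fo L X)) (Fm L X (Fo R (Fo L X)) (et X)) = Idm D (Fo L X)"
	"Y:Obj D ==> Cmp C (Fm R (Fo L (Fo R Y)) Y (ep Y)) (et (Fo R Y)) = Idm C (Fo R Y)"
 using assms unfolding adjunction_def nat_trans_def id_func_def comp_func_def by simp_all

locale adj = C: acat C + D: acat D
 for C :: "('o, 'm::ab_group_add, 'x) cat_scheme" and D :: "('p, 'q::ab_group_add, 'y) cat_scheme" +
 fixes L R et ep
 assumes adj: "adjunction C D L R et ep"
begin

lemmas a = adjunctionD[OF adj]
lemmas l = functorD[OF a(1)]
lemmas r = functorD[OF a(2)]

lemma transpose:
 assumes "X:Obj C" "Y:Obj D" "b:Hom C X (Fo R Y)"
 shows "Cmp C (Fm R (Fo L X) Y (Cmp D (ep Y) (Fm L X (Fo R Y) b))) (et X) = b"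
proof -
 note o = assms(1,2) l(1)[OF assms(1)] r(1)[OF assms(2)] l(1)[OF r(1)[OF assms(2)]] r(1)[OF l(1)[OF assms(1)]]
 note lb = l(3)[OF o(1,4) assms(3)]
 have "Cmp C (Fm R (Fo L X) Y (Cmp D (ep Y) (Fm L X (Fo R Y) b))) (et X)
	 = Cmp C (Fm R (Fo L (Fo R Y)) Y (ep Y)) (Cmp C (Fm R (Fo L X) (Fo L (Fo R Y)) (Fm L X (Fo R Y) b)) (et X))"
	using r(4)[OF o(3,5,2) lb a(4)[OF o(2)]] by (simp add: C.assoc)
 also have "... = Cmp C (Cmp C (Fm R (Fo L (Fo R Y)) Y (ep Y)) (et (Fo R Y))) b"
	using a(5)[OF o(1,4) assms(3)] by (simp add: C.assoc)
 also have "... = b" using a(8)[OF o(2)] C.idl[OF o(1,4) assms(3)] by simp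
 finally show ?thesis .
qed

lemma cotranspose:
 assumes "X:Obj C" "Y:Obj D" "c:Hom D (Fo L X) Y"
 shows "Cmp D (ep Y) (Fm L X (Fo R Y) (Cmp C (Fm R (Fo L X) Y c) (et X))) = c"
proof -
 note o = assms(1,2) l(1)[OF assms(1)] r(1)[OF assms(2)] l(1)[OF r(1)[OF assms(2)]] r(1)[OF l(1)[OF assms(1)]]
 note rc = r(3)[OF o(3,2) assms(3)]
 have "Cmp D (ep Y) (Fm L X (Fo R Y) (Cmp C (Fm R (Fo L X) Y c) (et X)))
	 = Cmp D (Cmp D (ep Y) (Fm L (Fo R (Fo L X)) (Fo R Y) (Fm R (Fo L X) Y c))) (Fm L X (Fo R (Fo L X)) (et X))"
	using l(4)[OF o(1,6,4) a(3)[OF o(1)] rc] by (simp add: D.assoc)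
 also have "... = Cmp D c (Cmp D (ep (Fo L X)) (Fm L X (Fo R (Fo L X)) (et X)))"
	using a(6)[OF o(3,2) assms(3)] by (simp add: D.assoc)
 also have "... = c" using a(7)[OF o(1)] D.idr[OF o(3,2) assms(3)] by simp
 finally show ?thesis .
qed

end

text \<open>The action of \<open>R\<close> on arrows is prescribed and tied to the universal
  property by the second part of \<open>Rm\<close>. Functor laws, additivity, naturality of the unit
  and the triangle identity are then all equations between arrows into some \<open>Fo R F\<close>
  that agree after applying \<open>J\<close> and composing with \<open>ep F\<close>;
  \<open>uq\<close> turns this into equality.\<close>

lemma right_adjoint_of_couniversal:
 fixes A :: "('o, 'm::ab_group_add, 'x) cat_scheme" and B :: "('p, 'q::ab_group_add, 'y) cat_scheme"
 assumes A: "acat A" and B: "acat B" and J: "additive_functor A B J"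
	and obj: "!!F. F:Obj B ==> Fo R F:Obj A"
	and eps: "!!F. F:Obj B ==> ep F:Hom B (Fo J (Fo R F)) F"
	and univ: "!!F f a. F:Obj B ==> f:Obj A ==> a:Hom B (Fo J f) F ==>
	 EX! b. b:Hom A f (Fo R F) & Cmp B (ep F) (Fm J f (Fo R F) b) = a"
	and Rm: "!!F F' be. F:Obj B ==> F':Obj B ==> be:Hom B F F' ==> Fm R F F' be:Hom A (Fo R F) (Fo R F')"
	 "!!F F' be. F:Obj B ==> F':Obj B ==> be:Hom B F F' ==>
		Cmp B (ep F') (Fm J (Fo R F) (Fo R F') (Fm R F F' be)) = Cmp B be (ep F)"
 shows "additive_functor B A R & (EX et. adjunction A B J R et ep)"
proof -
 interpret A: acat A by fact
 interpret B: acat B by fact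
 note j = functorD[OF additive_functorD(1)[OF J]] additive_functorD(2)[OF J]
 have uq: "b = b'" if "F:Obj B" "f:Obj A" "b:Hom A f (Fo R F)" "b':Hom A f (Fo R F)"
	"Cmp B (ep F) (Fm J f (Fo R F) b) = Cmp B (ep F) (Fm J f (Fo R F) b')" for F f b b'
 proof -
	have "Cmp B (ep F) (Fm J f (Fo R F) b'):Hom B (Fo J f) F"
	 by (rule B.cmp[OF _ _ _ j(3) eps]) (use that obj j(1) in auto)
	from univ[OF that(1,2) this] show ?thesis using that by blast
 qed
 have fnc: "is_functor B A R"
	unfolding is_functor_def
 proof (intro conjI ballI)
	fix F assume F: "F:Obj B"
	note o = F obj[OF F] j(1)[OF obj[OF F]]
	show "Fo R F:Obj A" by (rule obj[OF F])
	show "Fm R F F (Idm B F) = Idm A (Fo R F)"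
	 by (rule uq[OF F obj[OF F] Rm(1)[OF F F B.idm[OF F]] A.idm[OF obj[OF F]]])
		(simp add: Rm(2)[OF F F B.idm[OF F]] B.idl[OF o(3,1) eps[OF F]] j(2)[OF o(2)] B.idr[OF o(3,1) eps[OF F]])
 next
	fix F F' f assume F: "F:Obj B" "F':Obj B" "f:Hom B F F'"
	show "Fm R F F' f:Hom A (Fo R F) (Fo R F')" using Rm(1)[OF F] .
	fix F'' g assume G: "F'':Obj B" "g:Hom B F' F''"
	note o = obj[OF F(1)] obj[OF F(2)] obj[OF G(1)] and rf = Rm(1)[OF F] and rg = Rm(1)[OF F(2) G]
	show "Fm R F F'' (Cmp B g f) = Cmp A (Fm R F' F'' g) (Fm R F F' f)"
	proof (rule uq[OF G(1) o(1) Rm(1)[OF F(1) G(1) B.cmp[OF F(1,2) G(1) F(3) G(2)]] A.cmp[OF o rf rg]])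
	 have "Cmp B (ep F'') (Fm J (Fo R F) (Fo R F'') (Cmp A (Fm R F' F'' g) (Fm R F F' f)))
		= Cmp B (Cmp B (ep F'') (Fm J (Fo R F') (Fo R F'') (Fm R F' F'' g))) (Fm J (Fo R F) (Fo R F') (Fm R F F' f))"
		by (simp add: j(4)[OF o rf rg] B.assoc)
	 also have "... = Cmp B g (Cmp B f (ep F))" by (simp add: Rm(2)[OF F(2) G] B.assoc Rm(2)[OF F])
	 finally show "Cmp B (ep F'') (Fm J (Fo R F) (Fo R F'') (Fm R F F'' (Cmp B g f))) =
		Cmp B (ep F'') (Fm J (Fo R F) (Fo R F'') (Cmp A (Fm R F' F'' g) (Fm R F F' f)))"
		by (simp add: Rm(2)[OF F(1) G(1) B.cmp[OF F(1,2) G(1) F(3) G(2)]] B.assoc)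
	qed
 qed
 moreover have "Fm R F F' (f + g) = Fm R F F' f + Fm R F F' g"
	if F: "F:Obj B" "F':Obj B" "f:Hom B F F'" "g:Hom B F F'" for F F' f g
 proof -
	note o = obj[OF F(1)] obj[OF F(2)] and rf = Rm(1)[OF F(1,2,3)] and rg = Rm(1)[OF F(1,2,4)]
	show ?thesis
	 by (rule uq[OF F(2) o(1) Rm(1)[OF F(1,2) B.add[OF F]] A.add[OF o rf rg]])
		(simp add: j(5)[OF o rf rg] Rm(2)[OF F(1,2) B.add[OF F]] B.addl[OF j(1)[OF o(1)] F(1,2) eps[OF F(1)] F(3,4)]
		 B.addr[OF j(1)[OF o(1)] j(1)[OF o(2)] F(2) j(3)[OF o rf] j(3)[OF o rg] eps[OF F(2)]] Rm(2)[OF F(1,2,3)] Rm(2)[OF F(1,2,4)])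
 qed
 ultimately have addf: "additive_functor B A R" by (simp add: additive_functor_def)
 define et where "et f = (THE b. b:Hom A f (Fo R (Fo J f)) & Cmp B (ep (Fo J f)) (Fm J f (Fo R (Fo J f)) b) = Idm B (Fo J f))" for f
 have eta: "et f:Hom A f (Fo R (Fo J f))" "Cmp B (ep (Fo J f)) (Fm J f (Fo R (Fo J f)) (et f)) = Idm B (Fo J f)"
	if "f:Obj A" for f
	using theI'[OF univ[OF j(1)[OF that] that B.idm[OF j(1)[OF that]]]] unfolding et_def by blast+
 have nat: "Cmp A (et f') ph = Cmp A (Fm R (Fo J f) (Fo J f') (Fm J f f' ph)) (et f)"
	if f: "f:Obj A" "f':Obj A" "ph:Hom A f f'" for f f' ph
 proof -
	note o = j(1)[OF f(1)] j(1)[OF f(2)] and Jph = j(3)[OF f]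
	note ro = obj[OF o(1)] obj[OF o(2)] and Rph = Rm(1)[OF o Jph]
	show ?thesis
	proof (rule uq[OF o(2) f(1) A.cmp[OF f(1,2) ro(2) f(3) eta(1)[OF f(2)]] A.cmp[OF f(1) ro eta(1)[OF f(1)] Rph]])
	 have "Cmp B (ep (Fo J f')) (Fm J f (Fo R (Fo J f')) (Cmp A (et f') ph)) = Fm J f f' ph"
		by (simp add: j(4)[OF f(1,2) ro(2) f(3) eta(1)[OF f(2)]] eta(2)[OF f(2)] B.idl[OF o Jph] flip: B.assoc)
	 also have "... = Cmp B (Cmp B (ep (Fo J f')) (Fm J (Fo R (Fo J f)) (Fo R (Fo J f')) (Fm R (Fo J f) (Fo J f') (Fm J f f' ph))))
		 (Fm J f (Fo R (Fo J f)) (et f))"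
		by (simp add: Rm(2)[OF o Jph] B.assoc eta(2)[OF f(1)] B.idr[OF o Jph])
	 finally show "Cmp B (ep (Fo J f')) (Fm J f (Fo R (Fo J f')) (Cmp A (et f') ph)) =
		Cmp B (ep (Fo J f')) (Fm J f (Fo R (Fo J f')) (Cmp A (Fm R (Fo J f) (Fo J f') (Fm J f f' ph)) (et f)))"
		by (simp add: j(4)[OF f(1) ro eta(1)[OF f(1)] Rph] B.assoc)
	qed
 qed
 have tri: "Cmp A (Fm R (Fo J (Fo R F)) F (ep F)) (et (Fo R F)) = Idm A (Fo R F)" if F: "F:Obj B" for F
 proof -
	note o = obj[OF F] j(1)[OF obj[OF F]] obj[OF j(1)[OF obj[OF F]]]
	note Re = Rm(1)[OF o(2) F eps[OF F]]
	show ?thesis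
	proof (rule uq[OF F o(1) A.cmp[OF o(1,3,1) eta(1)[OF o(1)] Re] A.idm[OF o(1)]])
	 have "Cmp B (ep F) (Fm J (Fo R F) (Fo R F) (Cmp A (Fm R (Fo J (Fo R F)) F (ep F)) (et (Fo R F))))
		= Cmp B (Cmp B (ep F) (Fm J (Fo R (Fo J (Fo R F))) (Fo R F) (Fm R (Fo J (Fo R F)) F (ep F)))) (Fm J (Fo R F) (Fo R (Fo J (Fo R F))) (et (Fo R F)))"
		by (simp add: j(4)[OF o(1,3,1) eta(1)[OF o(1)] Re] B.assoc)
	 also have "... = ep F" by (simp add: Rm(2)[OF o(2) F eps[OF F]] B.assoc eta(2)[OF o(1)] B.idr[OF o(2) F eps[OF F]])
	 finally show "Cmp B (ep F) (Fm J (Fo R F) (Fo R F) (Cmp A (Fm R (Fo J (Fo R F)) F (ep F)) (et (Fo R F)))) =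
		Cmp B (ep F) (Fm J (Fo R F) (Fo R F) (Idm A (Fo R F)))"
		by (simp add: j(2)[OF o(1)] B.idr[OF o(2) F eps[OF F]])
	qed
 qed
 have "adjunction A B J R et ep"
	unfolding adjunction_def nat_trans_def id_func_def comp_func_def func.select_convs
	using fnc additive_functorD(1)[OF J] eta nat tri eps Rm(2) by blast
 then show ?thesis using addf by blast
qed

lemma left_adjoint_of_universal:
 fixes A :: "('o, 'm::ab_group_add, 'x) cat_scheme" and B :: "('p, 'q::ab_group_add, 'y) cat_scheme"
 assumes A: "acat A" and B: "acat B" and J: "additive_functor A B J"
	and obj: "!!F. F:Obj B ==> Fo L F:Obj A"
	and eta: "!!F. F:Obj B ==> et F:Hom B F (Fo J (Fo L F))"
	and univ: "!!F f a. F:Obj B ==> f:Obj A ==> a:Hom B F (Fo J f) ==>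
	 EX! b. b:Hom A (Fo L F) f & Cmp B (Fm J (Fo L F) f b) (et F) = a"
	and Lm: "!!F F' be. F:Obj B ==> F':Obj B ==> be:Hom B F F' ==> Fm L F F' be:Hom A (Fo L F) (Fo L F')"
	 "!!F F' be. F:Obj B ==> F':Obj B ==> be:Hom B F F' ==>
		Cmp B (Fm J (Fo L F) (Fo L F') (Fm L F F' be)) (et F) = Cmp B (et F') be"
 shows "additive_functor B A L & (EX ep. adjunction B A L J et ep)"
proof -
 interpret A: acat A by fact
 interpret B: acat B by fact
 note j = functorD[OF additive_functorD(1)[OF J]] additive_functorD(2)[OF J]
 have uq: "b = b'" if "F:Obj B" "f:Obj A" "b:Hom A (Fo L F) f" "b':Hom A (Fo L F) f"
	"Cmp B (Fm J (Fo L F) f b) (et F) = Cmp B (Fm J (Fo L F) f b') (et F)" for F f b b'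
 proof -
	have "Cmp B (Fm J (Fo L F) f b') (et F):Hom B F (Fo J f)"
	 by (rule B.cmp[OF _ _ _ eta j(3)]) (use that obj j(1) in auto)
	from univ[OF that(1,2) this] show ?thesis using that by blast
 qed
 have fnc: "is_functor B A L"
	unfolding is_functor_def
 proof (intro conjI ballI)
	fix F assume F: "F:Obj B"
	note o = F obj[OF F] j(1)[OF obj[OF F]]
	show "Fo L F:Obj A" by (rule obj[OF F])
	show "Fm L F F (Idm B F) = Idm A (Fo L F)"
	 by (rule uq[OF F obj[OF F] Lm(1)[OF F F B.idm[OF F]] A.idm[OF obj[OF F]]])
		(simp add: Lm(2)[OF F F B.idm[OF F]] B.idl[OF o(1,3) eta[OF F]] j(2)[OF o(2)] B.idr[OF o(1,3) eta[OF F]])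
 next
	fix F F' f assume F: "F:Obj B" "F':Obj B" "f:Hom B F F'"
	show "Fm L F F' f:Hom A (Fo L F) (Fo L F')" using Lm(1)[OF F] .
	fix F'' g assume G: "F'':Obj B" "g:Hom B F' F''"
	note o = obj[OF F(1)] obj[OF F(2)] obj[OF G(1)] and rf = Lm(1)[OF F] and rg = Lm(1)[OF F(2) G]
	show "Fm L F F'' (Cmp B g f) = Cmp A (Fm L F' F'' g) (Fm L F F' f)"
	proof (rule uq[OF F(1) o(3) Lm(1)[OF F(1) G(1) B.cmp[OF F(1,2) G(1) F(3) G(2)]] A.cmp[OF o rf rg]])
	 have "Cmp B (Fm J (Fo L F) (Fo L F'') (Cmp A (Fm L F' F'' g) (Fm L F F' f))) (et F)
		= Cmp B (Fm J (Fo L F') (Fo L F'') (Fm L F' F'' g)) (Cmp B (et F') f)"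
		by (simp add: j(4)[OF o rf rg] B.assoc Lm(2)[OF F])
	 also have "... = Cmp B (et F'') (Cmp B g f)" by (simp add: Lm(2)[OF F(2) G] flip: B.assoc)
	 finally show "Cmp B (Fm J (Fo L F) (Fo L F'') (Fm L F F'' (Cmp B g f))) (et F) =
		Cmp B (Fm J (Fo L F) (Fo L F'') (Cmp A (Fm L F' F'' g) (Fm L F F' f))) (et F)"
		by (simp add: Lm(2)[OF F(1) G(1) B.cmp[OF F(1,2) G(1) F(3) G(2)]] B.assoc)
	qed
 qed
 moreover have "Fm L F F' (f + g) = Fm L F F' f + Fm L F F' g"
	if F: "F:Obj B" "F':Obj B" "f:Hom B F F'" "g:Hom B F F'" for F F' f g
 proof -
	note o = obj[OF F(1)] obj[OF F(2)] and rf = Lm(1)[OF F(1,2,3)] and rg = Lm(1)[OF F(1,2,4)]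
	show ?thesis
	 by (rule uq[OF F(1) o(2) Lm(1)[OF F(1,2) B.add[OF F]] A.add[OF o rf rg]])
		(simp add: j(5)[OF o rf rg] Lm(2)[OF F(1,2) B.add[OF F]] B.addr[OF F(1,2) j(1)[OF o(2)] F(3,4) eta[OF F(2)]]
		 B.addl[OF F(1) j(1)[OF o(1)] j(1)[OF o(2)] eta[OF F(1)] j(3)[OF o rf] j(3)[OF o rg]] Lm(2)[OF F(1,2,3)] Lm(2)[OF F(1,2,4)])
 qed
 ultimately have addf: "additive_functor B A L" by (simp add: additive_functor_def)
 define ep where "ep f = (THE b. b:Hom A (Fo L (Fo J f)) f & Cmp B (Fm J (Fo L (Fo J f)) f b) (et (Fo J f)) = Idm B (Fo J f))" for f
 have eps: "ep f:Hom A (Fo L (Fo J f)) f" "Cmp B (Fm J (Fo L (Fo J f)) f (ep f)) (et (Fo J f)) = Idm B (Fo J f)"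
	if "f:Obj A" for f
	using theI'[OF univ[OF j(1)[OF that] that B.idm[OF j(1)[OF that]]]] unfolding ep_def by blast+
 have nat: "Cmp A (ep f') (Fm L (Fo J f) (Fo J f') (Fm J f f' ph)) = Cmp A ph (ep f)"
	if f: "f:Obj A" "f':Obj A" "ph:Hom A f f'" for f f' ph
 proof -
	note o = j(1)[OF f(1)] j(1)[OF f(2)] and Jph = j(3)[OF f]
	note ro = obj[OF o(1)] obj[OF o(2)] and Rph = Lm(1)[OF o Jph]
	show ?thesis
	proof (rule uq[OF o(1) f(2) A.cmp[OF ro f(2) Rph eps(1)[OF f(2)]] A.cmp[OF ro(1) f(1,2) eps(1)[OF f(1)] f(3)]])
	 have "Cmp B (Fm J (Fo L (Fo J f)) f' (Cmp A ph (ep f))) (et (Fo J f)) = Fm J f f' ph"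
		by (simp add: j(4)[OF ro(1) f(1,2) eps(1)[OF f(1)] f(3)] eps(2)[OF f(1)] B.idr[OF o Jph] B.assoc)
	 also have "... = Cmp B (Cmp B (Fm J (Fo L (Fo J f')) f' (ep f')) (et (Fo J f'))) (Fm J f f' ph)"
		by (simp add: eps(2)[OF f(2)] B.idl[OF o Jph])
	 finally show "Cmp B (Fm J (Fo L (Fo J f)) f' (Cmp A (ep f') (Fm L (Fo J f) (Fo J f') (Fm J f f' ph)))) (et (Fo J f)) =
		Cmp B (Fm J (Fo L (Fo J f)) f' (Cmp A ph (ep f))) (et (Fo J f))"
		by (simp add: j(4)[OF ro f(2) Rph eps(1)[OF f(2)]] B.assoc Lm(2)[OF o Jph])
	qed
 qed
 have tri: "Cmp A (ep (Fo L F)) (Fm L F (Fo J (Fo L F)) (et F)) = Idm A (Fo L F)" if F: "F:Obj B" for F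
 proof -
	note o = obj[OF F] j(1)[OF obj[OF F]] obj[OF j(1)[OF obj[OF F]]]
	note Le = Lm(1)[OF F o(2) eta[OF F]]
	show ?thesis
	proof (rule uq[OF F o(1) A.cmp[OF o(1,3,1) Le eps(1)[OF o(1)]] A.idm[OF o(1)]])
	 have "Cmp B (Fm J (Fo L F) (Fo L F) (Cmp A (ep (Fo L F)) (Fm L F (Fo J (Fo L F)) (et F)))) (et F)
		= Cmp B (Fm J (Fo L (Fo J (Fo L F))) (Fo L F) (ep (Fo L F))) (Cmp B (et (Fo J (Fo L F))) (et F))"
		by (simp add: j(4)[OF o(1,3,1) Le eps(1)[OF o(1)]] B.assoc Lm(2)[OF F o(2) eta[OF F]])
	 also have "... = et F" by (simp add: eps(2)[OF o(1)] B.idl[OF F o(2) eta[OF F]] flip: B.assoc)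
	 finally show "Cmp B (Fm J (Fo L F) (Fo L F) (Cmp A (ep (Fo L F)) (Fm L F (Fo J (Fo L F)) (et F)))) (et F) =
		Cmp B (Fm J (Fo L F) (Fo L F) (Idm A (Fo L F))) (et F)"
		by (simp add: j(2)[OF o(1)] B.idl[OF F o(2) eta[OF F]])
	qed
 qed
 have "adjunction B A L J et ep"
	unfolding adjunction_def nat_trans_def id_func_def comp_func_def func.select_convs
	using fnc additive_functorD(1)[OF J] eps nat tri eta Lm(2) by auto
 then show ?thesis using addf by blast
qed

section \<open>Full subcategories with adjoint inclusions, and the recollement\<close>

lemma abelian_ker_cok:
 assumes "abelian_category C" "X:Obj C" "Y:Obj C" "f:Hom C X Y"
 shows "EX K k. is_kernel C X f K k" "EX Q q. is_cokernel C Y f Q q"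
 using assms by (simp_all add: abelian_category_def)

lemma acat_full_subcat:
 assumes "acat A" shows "acat (full_subcat A P)"
proof -
 interpret A: acat A by fact
 have neg: "- f:Hom A X Y" if "X:Obj A" "Y:Obj A" "f:Hom A X Y" for X Y f
	using A.pre that unfolding preadditive_def by blast
 have cat: "category (full_subcat A P)"
	unfolding category_def full_subcat_sel by (auto intro: A.idm A.cmp A.idl A.idr simp: A.assoc)
 show ?thesis
	unfolding acat_def preadditive_def full_subcat_sel using cat A.assoc
	by (auto intro: neg A.zero A.add A.addl A.addr)
qed

lemma additive_incl: "additive_functor (full_subcat A P) A id_func"
 by (simp add: additive_functor_def is_functor_def id_func_def)

text \<open>For an object \<open>X\<close> of the subcategory the unit \<open>et X\<close> and the
  coreflection arrow \<open>snd (p X)\<close> are inverse to each other: one composite is a triangle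
  identity, the other follows from uniqueness of factorizations through
  \<open>snd (p X)\<close>.\<close>

lemma coreflective_ex:
 fixes A :: "('o, 'm::ab_group_add, 'x) cat_scheme"
 assumes A: "acat A"
	and ex: "!!f. f:Obj A ==> EX K k. K:Obj A & P K & k:Hom A K f &
	 (ALL T:Obj A. P T --> (ALL h:Hom A T f. EX! u. u:Hom A T K & Cmp A k u = h))"
 shows "EX R et ep. additive_functor A (full_subcat A P) R & adjunction (full_subcat A P) A id_func R et ep &
	nat_iso (full_subcat A P) (full_subcat A P) id_func (R \<odot> id_func) et"
proof -
 interpret A: acat A by fact
 let ?A' = "full_subcat A P"
 define Q where "Q f p \<longleftrightarrow> fst p:Obj A & P (fst p) & snd p:Hom A (fst p) f &
	 (ALL T:Obj A. P T --> (ALL h:Hom A T f. EX! u. u:Hom A T (fst p) & Cmp A (snd p) u = h))" for f p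
 define p where "p f = (SOME p. Q f p)" for f
 have "Q f (p f)" if "f:Obj A" for f
	unfolding p_def by (rule someI_ex) (use ex[OF that] in \<open>auto simp: Q_def\<close>)
 then have p: "fst (p f):Obj A" "P (fst (p f))" "snd (p f):Hom A (fst (p f)) f"
	"!!T h. T:Obj A ==> P T ==> h:Hom A T f ==> EX! u. u:Hom A T (fst (p f)) & Cmp A (snd (p f)) u = h"
	if "f:Obj A" for f using that unfolding Q_def by blast+
 define R where "R = \<lparr>Fo = %f. fst (p f), Fm = %f f' be. THE u. u:Hom A (fst (p f)) (fst (p f')) &
	Cmp A (snd (p f')) u = Cmp A be (snd (p f))\<rparr>"
 have Rm: "Fm R f f' be:Hom A (Fo R f) (Fo R f') & Cmp A (snd (p f')) (Fm R f f' be) = Cmp A be (snd (p f))"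
	if "f:Obj A" "f':Obj A" "be:Hom A f f'" for f f' be
	using theI'[OF p(4)[OF that(2) p(1,2)[OF that(1)] A.cmp[OF p(1)[OF that(1)] that(1,2) p(3)[OF that(1)] that(3)]]]
	unfolding R_def by simp
 have "additive_functor A ?A' R & (EX et. adjunction ?A' A id_func R et (%f. snd (p f)))"
 proof (rule right_adjoint_of_couniversal[OF acat_full_subcat[OF A] A additive_incl])
	show "EX! b. b:Hom ?A' f (Fo R F) & Cmp A (snd (p F)) (Fm id_func f (Fo R F) b) = a"
	 if "F:Obj A" "f:Obj ?A'" "a:Hom A (Fo id_func f) F" for F f a
	 using p(4)[OF that(1), of f a] that by (simp add: R_def id_func_def)
 qed (use p Rm in \<open>auto simp: R_def id_func_def\<close>)
 then obtain et where R: "additive_functor A ?A' R" and ad: "adjunction ?A' A id_func R et (%f. snd (p f))" by blast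
 note a = adjunctionD[OF ad, unfolded id_func_def full_subcat_sel, simplified]
 have "iso_in ?A' X (Fo R X) (et X)" if X: "X:Obj A" "P X" for X
 proof -
	note o = p(1,2)[OF X(1)]
	have e: "et X:Hom A X (fst (p X))" "Cmp A (snd (p X)) (et X) = Idm A X" using a X by (simp_all add: R_def)
	have "Cmp A (snd (p X)) (Cmp A (et X) (snd (p X))) = snd (p X)"
	 by (simp add: e(2) A.idl[OF o(1) X(1) p(3)[OF X(1)]] flip: A.assoc)
	moreover have "Cmp A (snd (p X)) (Idm A (fst (p X))) = snd (p X)" by (rule A.idr[OF o(1) X(1) p(3)[OF X(1)]])
	ultimately have "Cmp A (et X) (snd (p X)) = Idm A (fst (p X))"
	 using p(4)[OF X(1) o p(3)[OF X(1)]] A.cmp[OF o(1) X(1) o(1) p(3)[OF X(1)] e(1)] A.idm[OF o(1)] by blast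
	then show ?thesis using e p(3)[OF X(1)] by (auto simp: iso_in_def R_def)
 qed
 then have "nat_iso ?A' ?A' id_func (R \<odot> id_func) et"
	using ad by (simp add: nat_iso_def adjunction_def id_func_def comp_func_def)
 then show ?thesis using R ad by blast
qed

lemma reflective_ex:
 fixes A :: "('o, 'm::ab_group_add, 'x) cat_scheme"
 assumes A: "acat A"
	and ex: "!!f. f:Obj A ==> EX K k. K:Obj A & P K & k:Hom A f K &
	 (ALL T:Obj A. P T --> (ALL h:Hom A f T. EX! u. u:Hom A K T & Cmp A u k = h))"
 shows "EX L et ep. additive_functor A (full_subcat A P) L & adjunction A (full_subcat A P) L id_func et ep &
	nat_iso (full_subcat A P) (full_subcat A P) (L \<odot> id_func) id_func ep"
proof -
 interpret A: acat A by fact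
 let ?A' = "full_subcat A P"
 define Q where "Q f p \<longleftrightarrow> fst p:Obj A & P (fst p) & snd p:Hom A f (fst p) &
	 (ALL T:Obj A. P T --> (ALL h:Hom A f T. EX! u. u:Hom A (fst p) T & Cmp A u (snd p) = h))" for f p
 define p where "p f = (SOME p. Q f p)" for f
 have "Q f (p f)" if "f:Obj A" for f
	unfolding p_def by (rule someI_ex) (use ex[OF that] in \<open>auto simp: Q_def\<close>)
 then have p: "fst (p f):Obj A" "P (fst (p f))" "snd (p f):Hom A f (fst (p f))"
	"!!T h. T:Obj A ==> P T ==> h:Hom A f T ==> EX! u. u:Hom A (fst (p f)) T & Cmp A u (snd (p f)) = h"
	if "f:Obj A" for f using that unfolding Q_def by blast+
 define L where "L = \<lparr>Fo = %f. fst (p f), Fm = %f f' be. THE u. u:Hom A (fst (p f)) (fst (p f')) &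
	Cmp A u (snd (p f)) = Cmp A (snd (p f')) be\<rparr>"
 have Lm: "Fm L f f' be:Hom A (Fo L f) (Fo L f') & Cmp A (Fm L f f' be) (snd (p f)) = Cmp A (snd (p f')) be"
	if "f:Obj A" "f':Obj A" "be:Hom A f f'" for f f' be
	using theI'[OF p(4)[OF that(1) p(1,2)[OF that(2)] A.cmp[OF that(1,2) p(1)[OF that(2)] that(3) p(3)[OF that(2)]]]]
	unfolding L_def by simp
 have "additive_functor A ?A' L & (EX ep. adjunction A ?A' L id_func (%f. snd (p f)) ep)"
 proof (rule left_adjoint_of_universal[OF acat_full_subcat[OF A] A additive_incl])
	show "EX! b. b:Hom ?A' (Fo L F) f & Cmp A (Fm id_func (Fo L F) f b) (snd (p F)) = a"
	 if "F:Obj A" "f:Obj ?A'" "a:Hom A F (Fo id_func f)" for F f a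
	 using p(4)[OF that(1), of f a] that by (simp add: L_def id_func_def)
 qed (use p Lm in \<open>auto simp: L_def id_func_def\<close>)
 then obtain ep where L: "additive_functor A ?A' L" and ad: "adjunction A ?A' L id_func (%f. snd (p f)) ep" by blast
 note a = adjunctionD[OF ad, unfolded id_func_def full_subcat_sel, simplified]
 have "iso_in ?A' (Fo L X) X (ep X)" if X: "X:Obj A" "P X" for X
 proof -
	note o = p(1,2)[OF X(1)]
	have e: "ep X:Hom A (fst (p X)) X" "Cmp A (ep X) (snd (p X)) = Idm A X" using a X by (simp_all add: L_def)
	have "Cmp A (Cmp A (snd (p X)) (ep X)) (snd (p X)) = snd (p X)"
	 by (simp add: A.assoc e(2) A.idr[OF X(1) o(1) p(3)[OF X(1)]])
	moreover have "Cmp A (Idm A (fst (p X))) (snd (p X)) = snd (p X)" by (rule A.idl[OF X(1) o(1) p(3)[OF X(1)]])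
	ultimately have "Cmp A (snd (p X)) (ep X) = Idm A (fst (p X))"
	 using p(4)[OF X(1) o p(3)[OF X(1)]] A.cmp[OF o(1) X(1) o(1) e(1) p(3)[OF X(1)]] A.idm[OF o(1)] by blast
	then show ?thesis using e p(3)[OF X(1)] by (auto simp: iso_in_def L_def)
 qed
 then have "nat_iso ?A' ?A' (L \<odot> id_func) id_func ep"
	using ad by (simp add: nat_iso_def adjunction_def id_func_def comp_func_def)
 then show ?thesis using L ad by blast
qed

lemma equivalence_id:
 assumes "acat A" shows "equivalence A A id_func"
proof -
 interpret A: acat A by fact
 have f: "is_functor A A id_func" by (simp add: is_functor_def id_func_def)
 have "nat_iso A A id_func (id_func \<odot> id_func) (Idm A)" "nat_iso A A (id_func \<odot> id_func) id_func (Idm A)"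
	using A.idm A.idl A.idr by (auto simp: nat_iso_def nat_trans_def id_func_def comp_func_def iso_in_def)
 then show ?thesis using f unfolding equivalence_def by blast
qed

text \<open>Let \<open>K\<close> be the kernel of the unit \<open>f \<rightarrow> jR(J f)\<close>.
  An arrow into \<open>f\<close> from an object killed by \<open>J\<close> factors through
  \<open>K\<close>, because the unit vanishes at such an object; and \<open>J K = 0\<close>, which
  uses the left adjoint. The cokernel of the counit \<open>jL(J f) \<rightarrow> f\<close> is
  treated dually, with the two adjoints exchanged.\<close>

theorem recollement_of_adjoint_triple:
 fixes A :: "('b, 'g::ab_group_add, 'y) cat_scheme" and A'' :: "('c, 'h::ab_group_add, 'z) cat_scheme"
 assumes A: "acat A" "abelian_category A" and A'': "acat A''" "abelian_category A''"
	and ab: "abelian_category (kernel_subcat A A'' J)"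
	and J: "additive_functor A A'' J" and L: "additive_functor A'' A jL" and R: "additive_functor A'' A jR"
	and adL: "adjunction A'' A jL J et1 ep1" "nat_iso A'' A'' id_func (J \<odot> jL) et1"
	and adR: "adjunction A A'' J jR et2 ep2" "nat_iso A'' A'' (J \<odot> jR) id_func ep2"
 shows "EX iL iR. recollement (kernel_subcat A A'' J) A A'' iL id_func iR jL J jR"
proof -
 interpret A: acat A by fact
 interpret A'': acat A'' by fact
 interpret l: adj A'' A jL J et1 ep1 by unfold_locales fact
 interpret r: adj A A'' J jR et2 ep2 by unfold_locales fact
 note j = functorD[OF additive_functorD(1)[OF J]]
 let ?P = "%X. zero_object A'' (Fo J X)"
 have J0: "Fm J X Y 0 = 0" if "X:Obj A" "Y:Obj A" for X Y by (rule additive_functor_zero[OF J A(1) that])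
 \<comment> \<open>The unit at \<open>T\<close> is the transpose of the identity of
   \<open>J T\<close>, which is 0 here.\<close>
 have eta0: "et2 T = 0" if T: "T:Obj A" "?P T" for T
 proof -
	note o = j(1)[OF T(1)] r.r(1)[OF j(1)[OF T(1)]]
	have "Cmp A'' (ep2 (Fo J T)) (Fm J T (Fo jR (Fo J T)) (et2 T)) = 0"
	 using A''.zero_objectD[OF T(2) A''.idm[OF o(1)]] r.a(7)[OF T(1)] by simp
	then have "et2 T = Cmp A (Fm jR (Fo J T) (Fo J T) 0) (et2 T)" using r.transpose[OF T(1) o(1) r.a(3)[OF T(1)]] by simp
	also have "... = 0"
	 using additive_functor_zero[OF R A''(1) o(1) o(1)] A.cmp0l[OF T(1) o(2) o(2) r.a(3)[OF T(1)]] by simp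
	finally show ?thesis .
 qed
 have eps0: "ep1 T = 0" if T: "T:Obj A" "?P T" for T
 proof -
	note o = j(1)[OF T(1)] l.l(1)[OF j(1)[OF T(1)]]
	have "Cmp A'' (Fm J (Fo jL (Fo J T)) T (ep1 T)) (et1 (Fo J T)) = 0"
	 using A''.zero_objectD[OF T(2) A''.idm[OF o(1)]] l.a(8)[OF T(1)] by simp
	then have "ep1 T = Cmp A (ep1 T) (Fm jL (Fo J T) (Fo J T) 0)" using l.cotranspose[OF o(1) T(1) l.a(4)[OF T(1)]] by simp
	also have "... = 0"
	 using additive_functor_zero[OF L A''(1) o(1) o(1)] A.cmp0r[OF o(2) o(2) T(1) l.a(4)[OF T(1)]] by simp
	finally show ?thesis .
 qed
 have "EX R et ep. additive_functor A (full_subcat A ?P) R & adjunction (full_subcat A ?P) A id_func R et ep &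
	nat_iso (full_subcat A ?P) (full_subcat A ?P) id_func (R \<odot> id_func) et"
 proof (rule coreflective_ex[OF A(1)])
	fix f assume f: "f:Obj A"
	note o = j(1)[OF f] r.r(1)[OF j(1)[OF f]]
	obtain K k where k: "is_kernel A f (et2 f) K k"
	 using abelian_ker_cok(1)[OF A(2) f o(2) r.a(3)[OF f]] by blast
	then have K: "K:Obj A" "k:Hom A K f" "Cmp A (et2 f) k = 0"
	 "!!T h. T:Obj A ==> h:Hom A T f ==> Cmp A (et2 f) h = 0 ==> EX! u. u:Hom A T K & Cmp A k u = h"
	 unfolding is_kernel_def by blast+
	note oK = j(1)[OF K(1)] l.l(1)[OF j(1)[OF K(1)]] l.a(4)[OF K(1)]
	\<comment> \<open>\<open>J\<close> of the unit has the left inverse \<open>ep2 (Fo J f)\<close>, so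
	  it can be cancelled from \<open>J(et2 f) J(k) = 0\<close>. This gives \<open>J k = 0\<close>, but
	  not yet \<open>J K = 0\<close>.\<close>
	have Jk: "Fm J K f k = 0"
	proof -
	 have "Fm J K f k = Cmp A'' (ep2 (Fo J f)) (Cmp A'' (Fm J f (Fo jR (Fo J f)) (et2 f)) (Fm J K f k))"
		using r.a(7)[OF f] A''.idl[OF oK(1) o(1) j(3)[OF K(1) f K(2)]] by (simp flip: A''.assoc)
	 also have "... = 0" using j(4)[OF K(1) f o(2) K(2) r.a(3)[OF f], symmetric] K(3) J0[OF K(1) o(2)]
		 A''.cmp0r[OF oK(1) j(1)[OF o(2)] o(1) r.a(4)[OF o(1)]] by simp
	 finally show ?thesis .
	qed
	\<comment> \<open>An arrow out of \<open>jL(J K)\<close> is determined by its transpose, which is 0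
	  because \<open>J k = 0\<close>. As factorizations through \<open>k\<close> are unique,
	  \<open>ep1 K = 0\<close> follows; then the identity of \<open>J K\<close>, being
	  \<open>J(ep1 K)\<close> after \<open>et1\<close>, vanishes.\<close>
	have kb: "Cmp A k (ep1 K) = 0"
	proof -
	 note h = A.cmp[OF oK(2) K(1) f oK(3) K(2)]
	 have "Fm J (Fo jL (Fo J K)) f (Cmp A k (ep1 K)) = 0"
		using j(4)[OF oK(2) K(1) f oK(3) K(2)] Jk A''.cmp0l[OF j(1)[OF oK(2)] oK(1) o(1) j(3)[OF oK(2) K(1) oK(3)]] by simp
	 then have "Cmp A k (ep1 K) = Cmp A (ep1 f) (Fm jL (Fo J K) (Fo J f) (Cmp A'' 0 (et1 (Fo J K))))"
		using l.cotranspose[OF oK(1) f h] by simp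
	 then show ?thesis
		using A''.cmp0l[OF oK(1) j(1)[OF oK(2)] o(1) l.a(3)[OF oK(1)]] additive_functor_zero[OF L A''(1) oK(1) o(1)]
		 A.cmp0r[OF oK(2) l.l(1)[OF o(1)] f l.a(4)[OF f]] by simp
	qed
	have e0: "Cmp A k 0 = 0" by (rule A.cmp0r[OF oK(2) K(1) f K(2)])
	have "ep1 K = 0"
	 using K(4)[OF oK(2) A.zero[OF oK(2) f] A.cmp0r[OF oK(2) f o(2) r.a(3)[OF f]]] kb e0 oK(3) A.zero[OF oK(2) K(1)] by blast
	then have "Idm A'' (Fo J K) = 0"
	 using l.a(8)[OF K(1)] J0[OF oK(2) K(1)] A''.cmp0l[OF oK(1) j(1)[OF oK(2)] oK(1) l.a(3)[OF oK(1)]] by simp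
	then have PK: "?P K" by (rule A''.zero_objectI[OF oK(1)])
	have "EX! u. u:Hom A T K & Cmp A k u = h" if T: "T:Obj A" "?P T" "h:Hom A T f" for T h
	proof (rule K(4)[OF T(1,3)])
	 show "Cmp A (et2 f) h = 0"
		using r.a(5)[OF T(1) f T(3)] eta0[OF T(1,2)]
		 A.cmp0r[OF T(1) r.r(1)[OF j(1)[OF T(1)]] o(2) r.r(3)[OF j(1)[OF T(1)] o(1) j(3)[OF T(1) f T(3)]]] by simp
	qed
	then show "EX K k. K:Obj A & ?P K & k:Hom A K f &
	 (ALL T:Obj A. ?P T --> (ALL h:Hom A T f. EX! u. u:Hom A T K & Cmp A k u = h))"
	 using K PK by blast
 qed
 then obtain iR et3 ep3 where iR: "additive_functor A (full_subcat A ?P) iR" "adjunction (full_subcat A ?P) A id_func iR et3 ep3"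
	"nat_iso (full_subcat A ?P) (full_subcat A ?P) id_func (iR \<odot> id_func) et3" by blast
 have "EX L et ep. additive_functor A (full_subcat A ?P) L & adjunction A (full_subcat A ?P) L id_func et ep &
	nat_iso (full_subcat A ?P) (full_subcat A ?P) (L \<odot> id_func) id_func ep"
 proof (rule reflective_ex[OF A(1)])
	fix f assume f: "f:Obj A"
	note o = j(1)[OF f] l.l(1)[OF j(1)[OF f]]
	obtain K k where k: "is_cokernel A f (ep1 f) K k"
	 using abelian_ker_cok(2)[OF A(2) o(2) f l.a(4)[OF f]] by blast
	then have K: "K:Obj A" "k:Hom A f K" "Cmp A k (ep1 f) = 0"
	 "!!T h. T:Obj A ==> h:Hom A f T ==> Cmp A h (ep1 f) = 0 ==> EX! u. u:Hom A K T & Cmp A u k = h"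
	 unfolding is_cokernel_def by blast+
	note oK = j(1)[OF K(1)] r.r(1)[OF j(1)[OF K(1)]] r.a(3)[OF K(1)]
	have Jk: "Fm J f K k = 0"
	proof -
	 have "Fm J f K k = Cmp A'' (Cmp A'' (Fm J f K k) (Fm J (Fo jL (Fo J f)) f (ep1 f))) (et1 (Fo J f))"
		using l.a(8)[OF f] A''.idr[OF o(1) oK(1) j(3)[OF f K(1,2)]] by (simp add: A''.assoc)
	 also have "... = 0" using j(4)[OF o(2) f K(1) l.a(4)[OF f] K(2), symmetric] K(3) J0[OF o(2) K(1)]
		 A''.cmp0l[OF o(1) j(1)[OF o(2)] oK(1) l.a(3)[OF o(1)]] by simp
	 finally show ?thesis .
	qed
	have kb: "Cmp A (et2 K) k = 0"
	proof -
	 note h = A.cmp[OF f K(1) oK(2) K(2) oK(3)]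
	 have "Fm J f (Fo jR (Fo J K)) (Cmp A (et2 K) k) = 0"
		using j(4)[OF f K(1) oK(2) K(2) oK(3)] Jk A''.cmp0r[OF o(1) oK(1) j(1)[OF oK(2)] j(3)[OF K(1) oK(2) oK(3)]] by simp
	 then have "Cmp A (et2 K) k = Cmp A (Fm jR (Fo J f) (Fo J K) (Cmp A'' (ep2 (Fo J K)) 0)) (et2 f)"
		using r.transpose[OF f oK(1) h] by simp
	 then show ?thesis
		using A''.cmp0r[OF o(1) j(1)[OF oK(2)] oK(1) r.a(4)[OF oK(1)]] additive_functor_zero[OF R A''(1) o(1) oK(1)]
		 A.cmp0l[OF f r.r(1)[OF o(1)] oK(2) r.a(3)[OF f]] by simp
	qed
	have e0: "Cmp A 0 k = 0" by (rule A.cmp0l[OF f K(1) oK(2) K(2)])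
	have "et2 K = 0"
	 using K(4)[OF oK(2) A.zero[OF f oK(2)] A.cmp0l[OF o(2) f oK(2) l.a(4)[OF f]]] kb e0 oK(3) A.zero[OF K(1) oK(2)] by blast
	then have "Idm A'' (Fo J K) = 0"
	 using r.a(7)[OF K(1)] J0[OF K(1) oK(2)] A''.cmp0r[OF oK(1) j(1)[OF oK(2)] oK(1) r.a(4)[OF oK(1)]] by simp
	then have PK: "?P K" by (rule A''.zero_objectI[OF oK(1)])
	have "EX! u. u:Hom A K T & Cmp A u k = h" if T: "T:Obj A" "?P T" "h:Hom A f T" for T h
	proof (rule K(4)[OF T(1,3)])
	 show "Cmp A h (ep1 f) = 0"
		using l.a(6)[OF f T(1,3)] eps0[OF T(1,2)]
		 A.cmp0l[OF o(2) l.l(1)[OF j(1)[OF T(1)]] T(1) l.l(3)[OF o(1) j(1)[OF T(1)] j(3)[OF f T(1,3)]]] by simp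
	qed
	then show "EX K k. K:Obj A & ?P K & k:Hom A f K &
	 (ALL T:Obj A. ?P T --> (ALL h:Hom A f T. EX! u. u:Hom A K T & Cmp A u k = h))"
	 using K PK by blast
 qed
 then obtain iL et4 ep4 where iL: "additive_functor A (full_subcat A ?P) iL" "adjunction A (full_subcat A ?P) iL id_func et4 ep4"
	"nat_iso (full_subcat A ?P) (full_subcat A ?P) (iL \<odot> id_func) id_func ep4" by blast
 have eq: "equivalence (full_subcat A ?P) (full_subcat A ?P) id_func"
	by (rule equivalence_id[OF acat_full_subcat[OF A(1)]])
 have "recollement (kernel_subcat A A'' J) A A'' iL id_func iR jL J jR"
	unfolding recollement_def kernel_subcat_def
	using iR iL eq A A'' ab[unfolded kernel_subcat_def] additive_incl J L R adL adR by blast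
 then show ?thesis by blast
qed

section \<open>Dualities\<close>

text \<open>A contravariant self-equivalence with its biduality isomorphism as data. Faithfulness
  and fullness are derived; both are needed below, where a unit is known only through its
  dual.\<close>

locale catdual = acat A for A :: "('o, 'm::ab_group_add, 'x) cat_scheme" +
 fixes D :: "'o => 'o" and Dm :: "'o => 'o => 'm => 'm" and i i' :: "'o => 'm"
 assumes Dob: "X:Obj A ==> D X:Obj A"
	and Dh: "X:Obj A ==> Y:Obj A ==> f:Hom A X Y ==> Dm X Y f:Hom A (D Y) (D X)"
	and Did: "X:Obj A ==> Dm X X (Idm A X) = Idm A (D X)"
	and Dcomp: "X:Obj A ==> Y:Obj A ==> Z:Obj A ==> f:Hom A X Y ==> g:Hom A Y Z ==>
	 Dm X Z (Cmp A g f) = Cmp A (Dm X Y f) (Dm Y Z g)"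
	and ih: "X:Obj A ==> i X:Hom A X (D (D X))" and i'h: "X:Obj A ==> i' X:Hom A (D (D X)) X"
	and i'i: "X:Obj A ==> Cmp A (i' X) (i X) = Idm A X"
	and ii': "X:Obj A ==> Cmp A (i X) (i' X) = Idm A (D (D X))"
	and nat: "X:Obj A ==> Y:Obj A ==> f:Hom A X Y ==>
	 Cmp A (Dm (D Y) (D X) (Dm X Y f)) (i X) = Cmp A (i Y) f"
	and tri: "X:Obj A ==> Cmp A (Dm X (D (D X)) (i X)) (i (D X)) = Idm A (D X)"
begin

lemma faithful:
 assumes XY: "X:Obj A" "Y:Obj A" "f:Hom A X Y" "g:Hom A X Y" and e: "Dm X Y f = Dm X Y g"
 shows "f = g"
proof -
 have "Cmp A (i' Y) (Cmp A (i Y) f) = Cmp A (i' Y) (Cmp A (i Y) g)" using nat[OF XY(1-3)] nat[OF XY(1,2,4)] e by simp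
 then show ?thesis using XY by (simp add: i'i idl[OF XY(1,2)] flip: assoc)
qed

lemma nat':
 assumes XY: "X:Obj A" "Y:Obj A" "f:Hom A X Y"
 shows "Cmp A (i' Y) (Dm (D Y) (D X) (Dm X Y f)) = Cmp A f (i' X)"
proof -
 note o = Dob[OF Dob[OF XY(1)]] Dob[OF Dob[OF XY(2)]]
 note h = Dh[OF Dob[OF XY(2)] Dob[OF XY(1)] Dh[OF XY]]
 have "Cmp A (i' Y) (Dm (D Y) (D X) (Dm X Y f)) = Cmp A (i' Y) (Cmp A (Cmp A (Dm (D Y) (D X) (Dm X Y f)) (i X)) (i' X))"
	by (simp add: assoc ii'[OF XY(1)] idr[OF o h])
 also have "... = Cmp A (Cmp A (Cmp A (i' Y) (i Y)) f) (i' X)" by (simp add: nat[OF XY] assoc)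
 finally show ?thesis by (simp add: i'i[OF XY(2)] idl[OF XY])
qed

text \<open>The preimage is the dual of \<open>g\<close> conjugated with the biduality isomorphisms.
  To see that its dual is \<open>g\<close> again, one needs that dualizing \<open>i\<close> gives
  the inverse of \<open>i\<close> at the dual object; these are the facts \<open>e\<close> and
  \<open>e'\<close>, consequences of the triangle identity.\<close>

lemma full:
 assumes XY: "X:Obj A" "Y:Obj A" and g: "g:Hom A (D Y) (D X)"
 shows "EX f:Hom A X Y. Dm X Y f = g"
proof
 note o = Dob[OF XY(1)] Dob[OF XY(2)] Dob[OF Dob[OF XY(1)]] Dob[OF Dob[OF XY(2)]]
	Dob[OF Dob[OF Dob[OF XY(1)]]] Dob[OF Dob[OF Dob[OF XY(2)]]]
 let ?f = "Cmp A (i' Y) (Cmp A (Dm (D Y) (D X) g) (i X))"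
 note Dg = Dh[OF o(2,1) g]
 note h = cmp[OF XY(1) o(3,4) ih[OF XY(1)] Dg]
 show "?f:Hom A X Y" by (rule cmp[OF XY(1) o(4) XY(2) h i'h[OF XY(2)]])
 have e: "Dm X (D (D X)) (i X) = i' (D X)"
 proof -
	note d = Dh[OF XY(1) o(3) ih[OF XY(1)]]
	have "Dm X (D (D X)) (i X) = Cmp A (Cmp A (Dm X (D (D X)) (i X)) (i (D X))) (i' (D X))"
	 by (simp add: assoc ii'[OF o(1)] idr[OF o(5) o(1) d])
	then show ?thesis by (simp add: tri[OF XY(1)] idl[OF o(5,1) i'h[OF o(1)]])
 qed
 have e': "Dm (D (D Y)) Y (i' Y) = i (D Y)"
 proof -
	note d = Dh[OF o(4) XY(2) i'h[OF XY(2)]]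
	have "Dm (D (D Y)) Y (i' Y) = Cmp A (Dm (D (D Y)) Y (i' Y)) (Cmp A (Dm Y (D (D Y)) (i Y)) (i (D Y)))"
	 using tri[OF XY(2)] idr[OF o(2) o(6) d] by simp
	also have "... = Cmp A (Dm (D (D Y)) (D (D Y)) (Cmp A (i Y) (i' Y))) (i (D Y))"
	 by (simp add: Dcomp[OF o(4) XY(2) o(4) i'h[OF XY(2)] ih[OF XY(2)]] assoc)
	finally show ?thesis by (simp add: ii'[OF XY(2)] Did[OF o(4)] idl[OF o(2,6) ih[OF o(2)]])
 qed
 have "Dm X Y ?f = Cmp A (Cmp A (i' (D X)) (Dm (D (D X)) (D (D Y)) (Dm (D Y) (D X) g))) (i (D Y))"
	by (simp add: Dcomp[OF XY(1) o(4) XY(2) h i'h[OF XY(2)]] Dcomp[OF XY(1) o(3,4) ih[OF XY(1)] Dg] e e' assoc)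
 also have "... = g" by (simp add: nat'[OF o(2,1) g] assoc i'i[OF o(2)] idr[OF o(2,1) g])
 finally show "Dm X Y ?f = g" .
qed

end

text \<open>Writing \<open>D\<close> for both dualities, \<open>Hom(L F, f) = Hom(D f, D L F) =
  Hom(D f, R D F) = Hom(J D f, D F) = Hom(D J f, D F) = Hom(F, J f)\<close>. Here biduality
  identifies \<open>D L F\<close> with \<open>R D F\<close>, and \<open>c\<close> identifies
  \<open>J D f\<close> with \<open>D J f\<close>.\<close>

lemma left_adjoint_by_duality:
 fixes A :: "('o, 'm::ab_group_add, 'x) cat_scheme" and B :: "('p, 'q::ab_group_add, 'y) cat_scheme"
 assumes dA: "catdual A DA DAm iA iA'" and dB: "catdual B DB DBm iB iB'"
	and J: "additive_functor A B J" and R: "is_functor B A R" and ad: "adjunction A B J R et ep"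
	and iso: "nat_iso B B (J \<odot> R) id_func ep"
	and c: "!!f. f:Obj A ==> c f:Hom B (Fo J (DA f)) (DB (Fo J f))"
	 "!!f. f:Obj A ==> c' f:Hom B (DB (Fo J f)) (Fo J (DA f))"
	 "!!f. f:Obj A ==> Cmp B (c' f) (c f) = Idm B (Fo J (DA f))"
	 "!!f. f:Obj A ==> Cmp B (c f) (c' f) = Idm B (DB (Fo J f))"
	 "!!f f' ph. f:Obj A ==> f':Obj A ==> ph:Hom A f f' ==>
		Cmp B (DBm (Fo J f) (Fo J f') (Fm J f f' ph)) (c f') = Cmp B (c f) (Fm J (DA f') (DA f) (DAm f f' ph))"
	and L: "L = \<lparr>Fo = %F. DA (Fo R (DB F)), Fm = %F F' be. DAm (Fo R (DB F')) (Fo R (DB F)) (Fm R (DB F') (DB F) (DBm F F' be))\<rparr>"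
 shows "additive_functor B A L & (EX u e. adjunction B A L J u e & nat_iso B B id_func (J \<odot> L) u)"
proof -
 interpret A: catdual A DA DAm iA iA' by fact
 interpret B: catdual B DB DBm iB iB' by fact
 interpret r: adj A B J R et ep by unfold_locales fact
 note j = functorD[OF additive_functorD(1)[OF J]]
 note eps = r.a(4)
 have LF: "Fo L F = DA (Fo R (DB F))" for F by (simp add: L)
 have ob: "DB F:Obj B" "Fo R (DB F):Obj A" "Fo L F:Obj A" "DA (Fo L F):Obj A" "Fo J (Fo R (DB F)):Obj B"
	"Fo J (Fo L F):Obj B" "Fo J (DA (Fo L F)):Obj B" "DB (Fo J (Fo L F)):Obj B" if "F:Obj B" for F
	using that r.r(1) A.Dob B.Dob j(1) by (auto simp: LF)
 have ei: "iso_in B (Fo J (Fo R F)) F (ep F)" if "F:Obj B" for F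
	using iso that by (simp add: nat_iso_def id_func_def comp_func_def)
 let ?i' = "%F. iA' (Fo R (DB F))"
 have i'h: "?i' F:Hom A (DA (Fo L F)) (Fo R (DB F))" if "F:Obj B" for F
	using A.i'h[OF ob(2)[OF that]] by (simp add: LF)
 note Ji' = j(3)[OF ob(4,2) i'h]
 \<comment> \<open>The dual that the unit must have: the counit of \<open>R\<close> at
   \<open>D F\<close>, with its source read as \<open>D J L F\<close> through \<open>c'\<close> and
   biduality. Since \<open>D\<close> is full, \<open>g F\<close> is the dual of some arrow
   \<open>u F\<close>.\<close>
 define g where "g F = Cmp B (ep (DB F)) (Cmp B (Fm J (DA (Fo L F)) (Fo R (DB F)) (?i' F)) (c' (Fo L F)))" for F
 have g1: "Cmp B (Fm J (DA (Fo L F)) (Fo R (DB F)) (?i' F)) (c' (Fo L F)):Hom B (DB (Fo J (Fo L F))) (Fo J (Fo R (DB F)))" if "F:Obj B" for F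
	using B.cmp[OF ob(8,7,5) c(2)[OF ob(3)] Ji'] that by simp
 have gh: "g F:Hom B (DB (Fo J (Fo L F))) (DB F)" if "F:Obj B" for F
	unfolding g_def using B.cmp[OF ob(8,5,1) g1 eps[OF ob(1)]] that by simp
 define u where "u F = (SOME u. u:Hom B F (Fo J (Fo L F)) & DBm F (Fo J (Fo L F)) u = g F)" for F
 have u: "u F:Hom B F (Fo J (Fo L F))" "DBm F (Fo J (Fo L F)) (u F) = g F" if "F:Obj B" for F
 proof -
	have "EX u. u:Hom B F (Fo J (Fo L F)) & DBm F (Fo J (Fo L F)) u = g F"
	 using B.full[OF that ob(6)[OF that] gh[OF that]] by blast
	from someI_ex[OF this] show "u F:Hom B F (Fo J (Fo L F))" "DBm F (Fo J (Fo L F)) (u F) = g F"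
	 unfolding u_def by blast+
 qed
 have U: "Cmp B (DBm F (Fo J (Fo L F)) (u F)) (c (Fo L F)) = Cmp B (ep (DB F)) (Fm J (DA (Fo L F)) (Fo R (DB F)) (?i' F))"
	if F: "F:Obj B" for F
	using B.idr[OF ob(7,5) Ji', OF F F F F F] by (simp add: u(2)[OF F] g_def B.assoc c(3)[OF ob(3)[OF F]])
 \<comment> \<open>Composition with \<open>u F\<close> is translated into transposition for the
   given adjunction: \<open>b\<close> on the left corresponds to \<open>D b\<close> followed by
   \<open>?i' F\<close> on the right. As \<open>D\<close> is faithful and \<open>c f\<close> can be
   cancelled, existence and uniqueness of \<open>b\<close> reduce to those for
   \<open>R\<close>.\<close>
 have star: "Cmp B (DBm F (Fo J f) (Cmp B (Fm J (Fo L F) f b) (u F))) (c f)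
	 = Cmp B (ep (DB F)) (Fm J (DA f) (Fo R (DB F)) (Cmp A (?i' F) (DAm (Fo L F) f b)))"
	if F: "F:Obj B" and f: "f:Obj A" and b: "b:Hom A (Fo L F) f" for F f b
 proof -
	note Db = A.Dh[OF ob(3)[OF F] f b]
	have "Cmp B (DBm F (Fo J f) (Cmp B (Fm J (Fo L F) f b) (u F))) (c f)
		= Cmp B (DBm F (Fo J (Fo L F)) (u F)) (Cmp B (DBm (Fo J (Fo L F)) (Fo J f) (Fm J (Fo L F) f b)) (c f))"
	 by (simp add: B.Dcomp[OF F ob(6)[OF F] j(1)[OF f] u(1)[OF F] j(3)[OF ob(3)[OF F] f b]] B.assoc)
	also have "... = Cmp B (Cmp B (DBm F (Fo J (Fo L F)) (u F)) (c (Fo L F))) (Fm J (DA f) (DA (Fo L F)) (DAm (Fo L F) f b))"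
	 by (simp add: c(5)[OF ob(3)[OF F] f b] B.assoc)
	also have "... = Cmp B (ep (DB F)) (Fm J (DA f) (Fo R (DB F)) (Cmp A (?i' F) (DAm (Fo L F) f b)))"
	 by (simp add: U[OF F] B.assoc j(4)[OF A.Dob[OF f] ob(4)[OF F] ob(2)[OF F] Db i'h[OF F]])
	finally show ?thesis .
 qed
 have cinj: "x = y" if f: "f:Obj A" and F: "F:Obj B" and h: "x:Hom B (DB (Fo J f)) F" "y:Hom B (DB (Fo J f)) F"
	"Cmp B x (c f) = Cmp B y (c f)" for x y f F
 proof -
	have "Cmp B (Cmp B x (c f)) (c' f) = Cmp B (Cmp B y (c f)) (c' f)" using h by simp
	then show ?thesis by (simp add: B.assoc c(4)[OF f] B.idr[OF B.Dob[OF j(1)[OF f]] F h(1)] B.idr[OF B.Dob[OF j(1)[OF f]] F h(2)])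
 qed
 have "additive_functor B A L & (EX e. adjunction B A L J u e)"
 proof (rule left_adjoint_of_universal[OF A.acat_axioms B.acat_axioms J ob(3) u(1)])
	fix F f a assume F: "F:Obj B" and f: "f:Obj A" and a: "a:Hom B F (Fo J f)"
	note Da = B.cmp[OF j(1)[OF A.Dob[OF f]] B.Dob[OF j(1)[OF f]] ob(1)[OF F] c(1)[OF f] B.Dh[OF F j(1)[OF f] a]]
	let ?a = "Cmp B (DBm F (Fo J f) a) (c f)"
	note Ra = r.cotranspose[OF A.Dob[OF f] ob(1)[OF F] Da]
	define b' where "b' = Cmp A (Fm R (Fo J (DA f)) (DB F) ?a) (et (DA f))"
	have b': "b':Hom A (DA f) (Fo R (DB F))" unfolding b'_def
	 by (rule A.cmp[OF A.Dob[OF f] r.r(1)[OF j(1)[OF A.Dob[OF f]]] ob(2)[OF F] r.a(3)[OF A.Dob[OF f]] r.r(3)[OF j(1)[OF A.Dob[OF f]] ob(1)[OF F] Da]])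
	have ib: "Cmp A (iA (Fo R (DB F))) b':Hom A (DA f) (DA (Fo L F))"
	 unfolding LF by (rule A.cmp[OF A.Dob[OF f] ob(2)[OF F] _ b' A.ih[OF ob(2)[OF F]]]) (use ob(4)[OF F] in \<open>simp add: LF\<close>)
	obtain b where b: "b:Hom A (Fo L F) f" "DAm (Fo L F) f b = Cmp A (iA (Fo R (DB F))) b'"
	 using A.full[OF ob(3)[OF F] f ib] by blast
	have iib: "Cmp A (?i' F) (Cmp A (iA (Fo R (DB F))) b') = b'"
	 by (simp add: A.i'i[OF ob(2)[OF F]] A.idl[OF A.Dob[OF f] ob(2)[OF F] b'] flip: A.assoc)
	have mem: "Cmp B (Fm J (Fo L F) f x) (u F):Hom B F (Fo J f)" if "x:Hom A (Fo L F) f" for x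
	 by (rule B.cmp[OF F ob(6)[OF F] j(1)[OF f] u(1)[OF F] j(3)[OF ob(3)[OF F] f that]])
	show "EX! b. b:Hom A (Fo L F) f & Cmp B (Fm J (Fo L F) f b) (u F) = a"
	proof (rule ex1I[of _ b])
	 have "DBm F (Fo J f) (Cmp B (Fm J (Fo L F) f b) (u F)) = DBm F (Fo J f) a"
		by (rule cinj[OF f ob(1)[OF F] B.Dh[OF F j(1)[OF f] mem[OF b(1)]] B.Dh[OF F j(1)[OF f] a]])
		 (use star[OF F f b(1)] Ra in \<open>simp only: b(2) iib b'_def[symmetric]\<close>)
	 then show "b:Hom A (Fo L F) f & Cmp B (Fm J (Fo L F) f b) (u F) = a"
		using B.faithful[OF F j(1)[OF f] mem[OF b(1)] a] b(1) by blast
	 fix x assume x: "x:Hom A (Fo L F) f & Cmp B (Fm J (Fo L F) f x) (u F) = a"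
	 then have xh: "x:Hom A (Fo L F) f" by simp
	 note Dx = A.Dh[OF ob(3)[OF F] f xh]
	 let ?x' = "Cmp A (?i' F) (DAm (Fo L F) f x)"
	 have x'h: "?x':Hom A (DA f) (Fo R (DB F))" by (rule A.cmp[OF A.Dob[OF f] ob(4)[OF F] ob(2)[OF F] Dx i'h[OF F]])
	 have "Cmp B (ep (DB F)) (Fm J (DA f) (Fo R (DB F)) ?x') = ?a" using star[OF F f xh] x by simp
	 then have e: "?x' = b'" using r.transpose[OF A.Dob[OF f] ob(1)[OF F] x'h] by (simp add: b'_def)
	 have "Cmp A (iA (Fo R (DB F))) ?x' = DAm (Fo L F) f x"
		using A.ii'[OF ob(2)[OF F]] A.idl[OF A.Dob[OF f] ob(4)[OF F] Dx] by (simp add: LF flip: A.assoc)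
	 then have "DAm (Fo L F) f x = DAm (Fo L F) f b" using e b(2) by simp
	 then show "x = b" by (rule A.faithful[OF ob(3)[OF F] f xh b(1)])
	qed
 next
	fix F F' be assume F: "F:Obj B" "F':Obj B" "be:Hom B F F'"
	note Dbe = B.Dh[OF F]
	note Rbe = r.r(3)[OF ob(1)[OF F(2)] ob(1)[OF F(1)] Dbe]
	have Lb: "Fm L F F' be = DAm (Fo R (DB F')) (Fo R (DB F)) (Fm R (DB F') (DB F) (DBm F F' be))" by (simp add: L)
	show Lh: "Fm L F F' be:Hom A (Fo L F) (Fo L F')" unfolding Lb LF by (rule A.Dh[OF ob(2)[OF F(2)] ob(2)[OF F(1)] Rbe])
	note o = F(1,2) ob(6)[OF F(1)] ob(6)[OF F(2)]
	note JL = j(3)[OF ob(3)[OF F(1)] ob(3)[OF F(2)] Lh]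
	note h1 = B.cmp[OF F(1) o(3,4) u(1)[OF F(1)] JL] and h2 = B.cmp[OF F(1,2) o(4) F(3) u(1)[OF F(2)]]
	show "Cmp B (Fm J (Fo L F) (Fo L F') (Fm L F F' be)) (u F) = Cmp B (u F') be"
	proof (rule B.faithful[OF F(1) o(4) h1 h2], rule cinj[OF ob(3)[OF F(2)] ob(1)[OF F(1)] B.Dh[OF F(1) o(4) h1] B.Dh[OF F(1) o(4) h2]])
	 have "Cmp B (DBm F (Fo J (Fo L F')) (Cmp B (Fm J (Fo L F) (Fo L F') (Fm L F F' be)) (u F))) (c (Fo L F'))
		= Cmp B (ep (DB F)) (Fm J (DA (Fo L F')) (Fo R (DB F)) (Cmp A (Fm R (DB F') (DB F) (DBm F F' be)) (?i' F')))"
		using star[OF F(1) ob(3)[OF F(2)] Lh] A.nat'[OF ob(2)[OF F(2)] ob(2)[OF F(1)] Rbe] by (simp add: Lb LF)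
	 also have "... = Cmp B (Cmp B (ep (DB F)) (Fm J (Fo R (DB F')) (Fo R (DB F)) (Fm R (DB F') (DB F) (DBm F F' be))))
		 (Fm J (DA (Fo L F')) (Fo R (DB F')) (?i' F'))"
		by (simp add: j(4)[OF ob(4)[OF F(2)] ob(2)[OF F(2)] ob(2)[OF F(1)] i'h[OF F(2)] Rbe] B.assoc)
	 also have "... = Cmp B (DBm F F' be) (Cmp B (DBm F' (Fo J (Fo L F')) (u F')) (c (Fo L F')))"
		by (simp add: r.a(6)[OF ob(1)[OF F(2)] ob(1)[OF F(1)] Dbe] B.assoc U[OF F(2)])
	 finally show "Cmp B (DBm F (Fo J (Fo L F')) (Cmp B (Fm J (Fo L F) (Fo L F') (Fm L F F' be)) (u F))) (c (Fo L F'))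
		= Cmp B (DBm F (Fo J (Fo L F')) (Cmp B (u F') be)) (c (Fo L F'))"
		by (simp add: B.Dcomp[OF F(1,2) o(4) F(3) u(1)[OF F(2)]] B.assoc)
	qed
 qed
 then obtain e where L': "additive_functor B A L" and e: "adjunction B A L J u e" by blast
 have "iso_in B F (Fo J (Fo L F)) (u F)" if F: "F:Obj B" for F
 proof -
	note o = F ob(6)[OF F] ob(1)[OF F] ob(8)[OF F]
	obtain e' where e': "e':Hom B (DB F) (Fo J (Fo R (DB F)))" "Cmp B e' (ep (DB F)) = Idm B (Fo J (Fo R (DB F)))"
	 "Cmp B (ep (DB F)) e' = Idm B (DB F)" using ei[OF ob(1)[OF F]] unfolding iso_in_def by blast
	have ih: "iA (Fo R (DB F)):Hom A (Fo R (DB F)) (DA (Fo L F))" using A.ih[OF ob(2)[OF F]] by (simp add: LF)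
	note Ji = j(3)[OF ob(2)[OF F] ob(4)[OF F] ih]
	let ?J = "Fm J (Fo R (DB F)) (DA (Fo L F)) (iA (Fo R (DB F)))"
	let ?J' = "Fm J (DA (Fo L F)) (Fo R (DB F)) (?i' F)"
	have JJ: "Cmp B ?J' ?J = Idm B (Fo J (Fo R (DB F)))" "Cmp B ?J ?J' = Idm B (Fo J (DA (Fo L F)))"
	 using j(4)[OF ob(2)[OF F] ob(4)[OF F] ob(2)[OF F] ih i'h[OF F]] j(4)[OF ob(4)[OF F] ob(2)[OF F] ob(4)[OF F] i'h[OF F] ih]
		A.i'i[OF ob(2)[OF F]] A.ii'[OF ob(2)[OF F]] j(2)[OF ob(2)[OF F]] j(2)[OF ob(4)[OF F]] by (simp_all add: LF)
	let ?g' = "Cmp B (c (Fo L F)) (Cmp B ?J e')"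
	note Je = B.cmp[OF o(3) ob(5)[OF F] ob(7)[OF F] e'(1) Ji]
	have g': "?g':Hom B (DB F) (DB (Fo J (Fo L F)))"
	 by (rule B.cmp[OF o(3) ob(7)[OF F] o(4) Je c(1)[OF ob(3)[OF F]]])
	have a1: "Cmp B (Cmp B x y) z = Cmp B x w" if "Cmp B y z = w" for x y z w using that by (simp add: B.assoc)
	have "Cmp B (g F) ?g' = Cmp B (ep (DB F)) (Cmp B ?J' (Cmp B (Cmp B (c' (Fo L F)) (c (Fo L F))) (Cmp B ?J e')))"
	 by (simp add: g_def B.assoc)
	also have "... = Cmp B (ep (DB F)) (Cmp B (Cmp B ?J' ?J) e')"
	 by (simp add: c(3)[OF ob(3)[OF F]] B.idl[OF o(3) ob(7)[OF F] Je] B.assoc)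
	also have "... = Idm B (DB F)" by (simp add: JJ(1) B.idl[OF o(3) ob(5)[OF F] e'(1)] e'(3))
	finally have gg': "Cmp B (g F) ?g' = Idm B (DB F)" .
	have "Cmp B ?g' (g F) = Cmp B (c (Fo L F)) (Cmp B ?J (Cmp B (Cmp B e' (ep (DB F))) (Cmp B ?J' (c' (Fo L F)))))"
	 by (simp add: g_def B.assoc)
	also have "... = Cmp B (c (Fo L F)) (Cmp B (Cmp B ?J ?J') (c' (Fo L F)))"
	 by (simp add: e'(2) B.idl[OF o(4) ob(5)[OF F] g1[OF F]] B.assoc)
	also have "... = Idm B (DB (Fo J (Fo L F)))"
	 by (simp add: JJ(2) B.idl[OF o(4) ob(7)[OF F] c(2)[OF ob(3)[OF F]]] c(4)[OF ob(3)[OF F]])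
	finally have g'g: "Cmp B ?g' (g F) = Idm B (DB (Fo J (Fo L F)))" .
	obtain w where w: "w:Hom B (Fo J (Fo L F)) F" "DBm (Fo J (Fo L F)) F w = ?g'" using B.full[OF o(2,1) g'] by blast
	have "Cmp B w (u F) = Idm B F"
	 by (rule B.faithful[OF o(1,1) B.cmp[OF o(1,2,1) u(1)[OF F] w(1)] B.idm[OF F]])
		(simp add: B.Dcomp[OF o(1,2,1) u(1)[OF F] w(1)] u(2)[OF F] w(2) gg' B.Did[OF F])
	moreover have "Cmp B (u F) w = Idm B (Fo J (Fo L F))"
	 by (rule B.faithful[OF o(2,2) B.cmp[OF o(2,1,2) w(1) u(1)[OF F]] B.idm[OF o(2)]])
		(simp add: B.Dcomp[OF o(2,1,2) w(1) u(1)[OF F]] u(2)[OF F] w(2) g'g B.Did[OF o(2)])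
	ultimately show ?thesis using u(1)[OF F] w(1) unfolding iso_in_def by blast
 qed
 then have "nat_iso B B id_func (J \<odot> L) u"
	using e by (simp add: nat_iso_def adjunction_def id_func_def comp_func_def)
 then show ?thesis using L' e by blast
qed

text \<open>A duality on the source category. Composed with the duality of vector spaces it makes
  the linear functors, and each full subcategory closed under \<open>dF\<close>, an instance of
  \<open>catdual\<close>.\<close>

locale lduality = lcat C for C :: "('k::field, 'o, 'm::ab_group_add) lincat" +
 fixes D0 :: "'o => 'o" and D1 :: "'o => 'o => 'm => 'm" and io :: "'o => 'm"
 assumes D_obj: "X:Obj C ==> D0 X:Obj C"
	and D_hom: "X:Obj C ==> Y:Obj C ==> f:Hom C X Y ==> D1 X Y f:Hom C (D0 Y) (D0 X)"
	and D_id: "X:Obj C ==> D1 X X (Idm C X) = Idm C (D0 X)"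
	and D_comp: "X:Obj C ==> Y:Obj C ==> Z:Obj C ==> f:Hom C X Y ==> g:Hom C Y Z ==>
	 D1 X Z (Cmp C g f) = Cmp C (D1 X Y f) (D1 Y Z g)"
	and D_add: "X:Obj C ==> Y:Obj C ==> f:Hom C X Y ==> g:Hom C X Y ==> D1 X Y (f + g) = D1 X Y f + D1 X Y g"
	and D_scl: "X:Obj C ==> Y:Obj C ==> f:Hom C X Y ==> D1 X Y (Scl C c f) = Scl C c (D1 X Y f)"
	and io_hom: "X:Obj C ==> io X:Hom C X (D0 (D0 X))"
	and io_nat: "X:Obj C ==> Y:Obj C ==> f:Hom C X Y ==>
	 Cmp C (D1 (D0 Y) (D0 X) (D1 X Y f)) (io X) = Cmp C (io Y) f"
	and io_tri: "X:Obj C ==> Cmp C (D1 X (D0 (D0 X)) (io X)) (io (D0 X)) = Idm C (D0 X)"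
	and io_iso: "X:Obj C ==> EX g:Hom C (D0 (D0 X)) X. Cmp C g (io X) = Idm C X & Cmp C (io X) g = Idm C (D0 (D0 X))"
begin

definition dF :: "('k, 'o, 'm) vfunc => ('k, 'o, 'm) vfunc" where
 "dF F = \<lparr>Fo = %X. dual (Fo F (D0 X)),
	 Fm = %X Y g. dual_map (Fo F (D0 Y)) (Fo F (D0 X)) (Fm F (D0 Y) (D0 X) (D1 X Y g))\<rparr>"

definition dFm :: "('k, 'o, 'm) vfunc => ('k, 'o, 'm) vfunc => ('o => 'k vec => 'k vec) => 'o => 'k vec => 'k vec" where
 "dFm F F' al = (%X. if X:Obj C then dual_map (Fo F (D0 X)) (Fo F' (D0 X)) (al (D0 X)) else 0)"

text \<open>Biduality of functors combines two bidualities: \<open>F\<close> applied to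
  \<open>io X\<close> in the source category, followed by the canonical map of
  \<open>F(D0 (D0 X))\<close> into its bidual.\<close>

definition iF :: "('k, 'o, 'm) vfunc => 'o => 'k vec => 'k vec" where
 "iF F = (%X. if X:Obj C then iotaV (Fo F (D0 (D0 X))) o Fm F X (D0 (D0 X)) (io X) else 0)"

definition iF' :: "('k, 'o, 'm) vfunc => 'o => 'k vec => 'k vec" where
 "iF' F = (%X. if X:Obj C then restr (dual (dual (Fo F (D0 (D0 X))))) (inv_into (Fo F X) (iF F X)) else 0)"

lemma dF_Fo: "Fo (dF F) X = dual (Fo F (D0 X))" by (simp add: dF_def)

lemma dF_Fm:
 assumes "F:Obj (FunK C)" "X:Obj C" "Y:Obj C" "f:Hom C X Y" "y:dual (Fo F (D0 X))"
 shows "Fm (dF F) X Y f y:dual (Fo F (D0 Y))"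
	"eval_dual (Fo F (D0 Y)) (Fm (dF F) X Y f y) x = eval_dual (Fo F (D0 X)) y (Fm F (D0 Y) (D0 X) (D1 X Y f) x)"
 using dual_map_in[OF FobjD(1)[OF assms(1) D_obj[OF assms(3)]] FobjD(1)[OF assms(1) D_obj[OF assms(2)]]
	FobjD(2)[OF assms(1) D_obj[OF assms(3)] D_obj[OF assms(2)] D_hom[OF assms(2-4)]] assms(5)]
 by (simp_all add: dF_def)

lemma dF_obj:
 assumes F: "F:Obj (FunK C)" shows "dF F:Obj (FunK C)"
proof (rule FunK_objI)
 note o = FobjD[OF F]
 note v = o(1)[OF D_obj] and h = o(2)[OF D_obj D_obj D_hom]
 show "fds vscale (Fo (dF F) X)" if "X:Obj C" for X using v[OF that] by (simp add: dF_def)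
 show "Fm (dF F) X Y f:vlin (Fo (dF F) X) (Fo (dF F) Y)" if "X:Obj C" "Y:Obj C" "f:Hom C X Y" for X Y f
	using dual_map_lin[OF v[OF that(2)] v[OF that(1)] h[OF that(2,1) that(1,2,3)]] by (simp add: dF_def)
 show "Fm (dF F) X X (Idm C X) = id_on (Fo (dF F) X)" if "X:Obj C" for X
	using dual_map_id[OF v[OF that]] o(3)[OF D_obj[OF that]] by (simp add: dF_def D_id[OF that])
 show "Fm (dF F) X Z (Cmp C g f) = Fm (dF F) Y Z g o Fm (dF F) X Y f"
	if a: "X:Obj C" "Y:Obj C" "Z:Obj C" "f:Hom C X Y" "g:Hom C Y Z" for X Y Z f g
	using dual_map_comp[OF v[OF a(3)] v[OF a(2)] v[OF a(1)] h[OF a(3,2,2,3,5)] h[OF a(2,1,1,2,4)]]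
	by (simp add: dF_def D_comp[OF a] o(4)[OF D_obj[OF a(3)] D_obj[OF a(2)] D_obj[OF a(1)] D_hom[OF a(2,3,5)] D_hom[OF a(1,2,4)]])
 show "Fm (dF F) X Y (f + g) = Fm (dF F) X Y f + Fm (dF F) X Y g"
	if a: "X:Obj C" "Y:Obj C" "f:Hom C X Y" "g:Hom C X Y" for X Y f g
	using dual_map_add[OF v[OF a(2)] v[OF a(1)] h[OF a(2,1,1,2,3)] h[OF a(2,1,1,2,4)]]
	by (simp add: dF_def D_add[OF a] o(5)[OF D_obj[OF a(2)] D_obj[OF a(1)] D_hom[OF a(1,2,3)] D_hom[OF a(1,2,4)]])
 show "Fm (dF F) X Y (Scl C c f) = fscale vscale c (Fm (dF F) X Y f)"
	if a: "X:Obj C" "Y:Obj C" "f:Hom C X Y" for X Y f c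
	using dual_map_scale[OF v[OF a(2)] v[OF a(1)] h[OF a(2,1,1,2,3)]]
	by (simp add: dF_def D_scl[OF a] o(6)[OF D_obj[OF a(2)] D_obj[OF a(1)] D_hom[OF a(1,2,3)]])
qed

lemma dFm_in:
 assumes "F:Obj (FunK C)" "F':Obj (FunK C)" "al:Hom (FunK C) F F'" "X:Obj C" "y:dual (Fo F' (D0 X))"
 shows "dFm F F' al X y:dual (Fo F (D0 X))"
	"eval_dual (Fo F (D0 X)) (dFm F F' al X y) x = eval_dual (Fo F' (D0 X)) y (al (D0 X) x)"
 using dual_map_in[OF FobjD(1)[OF assms(1) D_obj[OF assms(4)]] FobjD(1)[OF assms(2) D_obj[OF assms(4)]]
	FhomD(1)[OF assms(3) D_obj[OF assms(4)]] assms(5)] assms(4) by (simp_all add: dFm_def)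

lemma dF_eqI:
 assumes "F:Obj (FunK C)" "et:Hom (FunK C) G (dF F)" "th:Hom (FunK C) G (dF F)"
	"!!X y x. X:Obj C ==> y:Fo G X ==> x:Fo F (D0 X) ==> eval_dual (Fo F (D0 X)) (et X y) x = eval_dual (Fo F (D0 X)) (th X y) x"
 shows "et = th"
 by (rule hom_eqI[OF assms(2,3)], rule dual_ext)
	(use hom_in[OF assms(2)] hom_in[OF assms(3)] assms(4) in \<open>auto simp: dF_Fo\<close>)

lemma dFm_hom:
 assumes F: "F:Obj (FunK C)" "F':Obj (FunK C)" and a: "al:Hom (FunK C) F F'"
 shows "dFm F F' al:Hom (FunK C) (dF F') (dF F)"
proof (rule FhomI[OF dF_obj[OF F(2)] dF_obj[OF F(1)]])
 show "dFm F F' al X:vlin (Fo (dF F') X) (Fo (dF F) X)" if "X:Obj C" for X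
	using dual_map_lin[OF FobjD(1)[OF F(1) D_obj[OF that]] FobjD(1)[OF F(2) D_obj[OF that]] FhomD(1)[OF a D_obj[OF that]]] that
	by (simp add: dFm_def dF_Fo)
 show "dFm F F' al Y (Fm (dF F') X Y f x) = Fm (dF F) X Y f (dFm F F' al X x)"
	if h: "X:Obj C" "Y:Obj C" "f:Hom C X Y" "x:Fo (dF F') X" for X Y f x
 proof -
	have x: "x:dual (Fo F' (D0 X))" using h(4) by (simp add: dF_Fo)
	note 1 = dF_Fm[OF F(2) h(1-3) x] and 2 = dFm_in[OF F a h(1) x]
	show ?thesis
	 by (rule dual_ext[of _ "Fo F (D0 Y)"])
		(simp_all add: dFm_in[OF F a h(2) 1(1)] dF_Fm[OF F(1) h(1-3) 2(1)] 1(2) 2(2)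
		 FhomD(2)[OF a D_obj[OF h(2)] D_obj[OF h(1)] D_hom[OF h(1-3)]])
 qed
qed (simp add: dFm_def)

lemma dFm_id:
 assumes "F:Obj (FunK C)" shows "dFm F F (Idm (FunK C) F) = Idm (FunK C) (dF F)"
 using dual_map_id[OF FobjD(1)[OF assms D_obj]] by (auto simp: dFm_def FunK_sel(3) D_obj dF_Fo fun_eq_iff)

lemma dFm_comp:
 assumes F: "F:Obj (FunK C)" "G:Obj (FunK C)" "H:Obj (FunK C)"
	and a: "al:Hom (FunK C) F G" "be:Hom (FunK C) G H"
 shows "dFm F H (Cmp (FunK C) be al) = Cmp (FunK C) (dFm F G al) (dFm G H be)"
proof
 fix X show "dFm F H (Cmp (FunK C) be al) X = Cmp (FunK C) (dFm F G al) (dFm G H be) X"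
 proof (cases "X:Obj C")
	case True
	note d = D_obj[OF True]
	show ?thesis
	 using dual_map_comp[OF FobjD(1)[OF F(1) d] FobjD(1)[OF F(2) d] FobjD(1)[OF F(3) d] FhomD(1)[OF a(1) d] FhomD(1)[OF a(2) d]] True
	 by (simp add: dFm_def FunK_sel(4))
 qed (simp add: dFm_def FunK_sel(4) fun_eq_iff)
qed

lemma iF_in:
 assumes F: "F:Obj (FunK C)" and X: "X:Obj C" and x: "x:Fo F X"
 shows "iF F X x:dual (dual (Fo F (D0 (D0 X))))"
	"y:dual (Fo F (D0 (D0 X))) ==>
	 eval_dual (dual (Fo F (D0 (D0 X)))) (iF F X x) y = eval_dual (Fo F (D0 (D0 X))) y (Fm F X (D0 (D0 X)) (io X) x)"
 using iotaV_in[OF FobjD(1)[OF F D_obj[OF D_obj[OF X]]] Fm_in[OF F X D_obj[OF D_obj[OF X]] io_hom[OF X] x]] X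
 by (simp_all add: iF_def)

lemma iF_lin:
 assumes F: "F:Obj (FunK C)" and X: "X:Obj C"
 shows "iF F X:vlin (Fo F X) (dual (dual (Fo F (D0 (D0 X)))))"
 using lin_comp[OF FobjD(2)[OF F X D_obj[OF D_obj[OF X]] io_hom[OF X]] iotaV_lin[OF FobjD(1)[OF F D_obj[OF D_obj[OF X]]]]]
	FobjD(1)[OF F D_obj[OF D_obj[OF X]]] X by (simp add: iF_def)

lemma iF_hom:
 assumes F: "F:Obj (FunK C)" shows "iF F:Hom (FunK C) F (dF (dF F))"
proof (rule FhomI[OF F dF_obj[OF dF_obj[OF F]]])
 show "iF F X:vlin (Fo F X) (Fo (dF (dF F)) X)" if "X:Obj C" for X
	using iF_lin[OF F that] by (simp add: dF_Fo)
 show "iF F Y (Fm F X Y f x) = Fm (dF (dF F)) X Y f (iF F X x)"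
	if h: "X:Obj C" "Y:Obj C" "f:Hom C X Y" "x:Fo F X" for X Y f x
 proof -
	note d = D_obj[OF h(1)] D_obj[OF h(2)] D_obj[OF D_obj[OF h(1)]] D_obj[OF D_obj[OF h(2)]]
	note hD = D_hom[OF h(1-3)] D_hom[OF d(2,1) D_hom[OF h(1-3)]]
	note fx = Fm_in[OF F h]
	have ix: "iF F X x:dual (Fo (dF F) (D0 X))" using iF_in(1)[OF F h(1,4)] by (simp add: dF_Fo)
	note 1 = dF_Fm[OF dF_obj[OF F] h(1-3) ix]
	show ?thesis
	proof (rule dual_ext[of _ "Fo (dF F) (D0 Y)"])
	 show "iF F Y (Fm F X Y f x):dual (Fo (dF F) (D0 Y))" using iF_in(1)[OF F h(2) fx] by (simp add: dF_Fo)
	 fix y assume "y:Fo (dF F) (D0 Y)"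
	 then have y: "y:dual (Fo F (D0 (D0 Y)))" by (simp add: dF_Fo)
	 note 2 = dF_Fm[OF F d(2,1) hD(1) y]
	 have e: "Fm F Y (D0 (D0 Y)) (io Y) (Fm F X Y f x) = Fm F (D0 (D0 X)) (D0 (D0 Y)) (D1 (D0 Y) (D0 X) (D1 X Y f)) (Fm F X (D0 (D0 X)) (io X) x)"
		using io_nat[OF h(1-3)] Fm_comp[OF F h(1,2) d(4) h(3) io_hom[OF h(2)], of x]
		 Fm_comp[OF F h(1) d(3,4) io_hom[OF h(1)] hD(2), of x] by simp
	 show "eval_dual (Fo (dF F) (D0 Y)) (iF F Y (Fm F X Y f x)) y = eval_dual (Fo (dF F) (D0 Y)) (Fm (dF (dF F)) X Y f (iF F X x)) y"
		using iF_in(2)[OF F h(2) fx y] iF_in(2)[OF F h(1,4) 2(1)] 1(2)[of y] 2(2) e by (simp add: dF_Fo)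
	qed (use 1 in auto)
 qed
qed (simp add: iF_def)

lemma io_bij:
 assumes F: "F:Obj (FunK C)" and X: "X:Obj C"
 shows "inj_on (Fm F X (D0 (D0 X)) (io X)) (Fo F X)" "Fm F X (D0 (D0 X)) (io X) ` Fo F X = Fo F (D0 (D0 X))"
proof -
 note d = D_obj[OF D_obj[OF X]]
 obtain g where g: "g:Hom C (D0 (D0 X)) X" "Cmp C g (io X) = Idm C X" "Cmp C (io X) g = Idm C (D0 (D0 X))"
	using io_iso[OF X] by blast
 have 1: "Fm F (D0 (D0 X)) X g (Fm F X (D0 (D0 X)) (io X) x) = x" if "x:Fo F X" for x
	using Fm_comp[OF F X d X io_hom[OF X] g(1), of x] Fm_id[OF F X that] g(2) by simp
 have 2: "Fm F X (D0 (D0 X)) (io X) (Fm F (D0 (D0 X)) X g x) = x" if "x:Fo F (D0 (D0 X))" for x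
	using Fm_comp[OF F d X d g(1) io_hom[OF X], of x] Fm_id[OF F d that] g(3) by simp
 show "inj_on (Fm F X (D0 (D0 X)) (io X)) (Fo F X)" by (rule inj_on_inverseI) (rule 1)
 show "Fm F X (D0 (D0 X)) (io X) ` Fo F X = Fo F (D0 (D0 X))"
	using Fm_in[OF F X d io_hom[OF X]] Fm_in[OF F d X g(1)] 2 by (auto simp: image_iff) (metis)
qed

lemma iF_bij:
 assumes F: "F:Obj (FunK C)" and X: "X:Obj C"
 shows "inj_on (iF F X) (Fo F X)" "iF F X ` Fo F X = dual (dual (Fo F (D0 (D0 X))))"
proof -
 note v = FobjD(1)[OF F D_obj[OF D_obj[OF X]]]
 show "inj_on (iF F X) (Fo F X)"
	using comp_inj_on[OF io_bij(1)[OF F X]] io_bij(2)[OF F X] iotaV_inj[OF v] X by (simp add: iF_def)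
 show "iF F X ` Fo F X = dual (dual (Fo F (D0 (D0 X))))"
 proof -
	have "iF F X = iotaV (Fo F (D0 (D0 X))) o Fm F X (D0 (D0 X)) (io X)" using X by (simp add: iF_def)
	then show ?thesis by (simp only: image_comp[symmetric] io_bij(2)[OF F X] iotaV_surj[OF v])
 qed
qed

lemma iF'_hom:
 assumes F: "F:Obj (FunK C)"
 shows "iF' F:Hom (FunK C) (dF (dF F)) F" "Cmp (FunK C) (iF' F) (iF F) = Idm (FunK C) F"
	"Cmp (FunK C) (iF F) (iF' F) = Idm (FunK C) (dF (dF F))"
proof -
 have 2: "iF' F X o iF F X = id_on (Fo F X)" "iF F X o iF' F X = id_on (dual (dual (Fo F (D0 (D0 X)))))"
	"iF' F X:vlin (dual (dual (Fo F (D0 (D0 X))))) (Fo F X)" if "X:Obj C" for X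
	using inverse_lin[OF iF_lin[OF F that] fsub[OF FobjD(1)[OF F that]] iF_bij[OF F that] vs_v] that
	by (simp_all add: iF'_def)
 show "iF' F:Hom (FunK C) (dF (dF F)) F"
 proof (rule FhomI[OF dF_obj[OF dF_obj[OF F]] F])
	fix X Y f x assume h: "X:Obj C" "Y:Obj C" "f:Hom C X Y" "x:Fo (dF (dF F)) X"
	obtain z where z: "z:Fo F X" "x = iF F X z" using h(4) iF_bij(2)[OF F h(1)] by (auto simp: dF_Fo)
	have "iF' F Y (Fm (dF (dF F)) X Y f x) = iF' F Y (iF F Y (Fm F X Y f z))"
	 using FhomD(2)[OF iF_hom[OF F] h(1-3)] z by simp
	also have "... = Fm F X Y f z" using fun_cong[OF 2(1)[OF h(2)]] Fm_in[OF F h(1-3) z(1)] by (simp add: id_on_def)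
	also have "z = iF' F X x" using fun_cong[OF 2(1)[OF h(1)]] z by (simp add: id_on_def)
	finally show "iF' F Y (Fm (dF (dF F)) X Y f x) = Fm F X Y f (iF' F X x)" .
 qed (use 2 in \<open>auto simp: dF_Fo iF'_def\<close>)
 show "Cmp (FunK C) (iF' F) (iF F) = Idm (FunK C) F"
	using 2(1) by (auto simp: FunK_sel(3,4) iF_def iF'_def fun_eq_iff)
 show "Cmp (FunK C) (iF F) (iF' F) = Idm (FunK C) (dF (dF F))"
	using 2(2) by (auto simp: FunK_sel(3,4) iF_def iF'_def dF_Fo fun_eq_iff)
qed

lemma acat_FunK: "acat (full_subcat (FunK C) P)"
 by unfold_locales (auto simp: preadditive_FunK FunK_sel(4) comp_assoc)

lemma iF_nat:
 assumes F: "F:Obj (FunK C)" "F':Obj (FunK C)" and a: "al:Hom (FunK C) F F'"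
 shows "Cmp (FunK C) (dFm (dF F') (dF F) (dFm F F' al)) (iF F) = Cmp (FunK C) (iF F') al"
proof (rule dF_eqI[OF dF_obj[OF F(2)]])
 note DF = dF_obj[OF F(1)] dF_obj[OF F(2)] dFm_hom[OF F a]
 note DDF = dF_obj[OF DF(1)] dF_obj[OF DF(2)] dFm_hom[OF DF(2,1,3)]
 show "Cmp (FunK C) (dFm (dF F') (dF F) (dFm F F' al)) (iF F):Hom (FunK C) F (dF (dF F'))"
	by (rule FunK_cmp[OF F(1) DDF(1,2) iF_hom[OF F(1)] DDF(3)])
 show "Cmp (FunK C) (iF F') al:Hom (FunK C) F (dF (dF F'))"
	by (rule FunK_cmp[OF F DDF(2) a iF_hom[OF F(2)]])
 fix X y x assume X: "X:Obj C" and y: "y:Fo F X" and x: "x:Fo (dF F') (D0 X)"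
 note d = D_obj[OF X] D_obj[OF D_obj[OF X]]
 have iy: "iF F X y:dual (Fo (dF F) (D0 X))" using iF_in(1)[OF F(1) X y] by (simp add: dF_Fo)
 have x': "x:dual (Fo F' (D0 (D0 X)))" using x by (simp add: dF_Fo)
 note 1 = dFm_in(2)[OF DF(2,1,3) X iy, of x]
 note 2 = dFm_in[OF F a d(1) x']
 show "eval_dual (Fo (dF F') (D0 X)) (Cmp (FunK C) (dFm (dF F') (dF F) (dFm F F' al)) (iF F) X y) x =
	eval_dual (Fo (dF F') (D0 X)) (Cmp (FunK C) (iF F') al X y) x"
	using 1 2 iF_in(2)[OF F(1) X y 2(1)] iF_in(2)[OF F(2) X hom_in[OF a X y] x']
	 FhomD(2)[OF a X d(2) io_hom[OF X], of y]
	by (simp add: FunK_sel(4) dF_Fo)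
qed

lemma iF_tri:
 assumes F: "F:Obj (FunK C)"
 shows "Cmp (FunK C) (dFm F (dF (dF F)) (iF F)) (iF (dF F)) = Idm (FunK C) (dF F)"
proof (rule dF_eqI[OF F])
 note D = dF_obj[OF F] dF_obj[OF dF_obj[OF F]] dF_obj[OF dF_obj[OF dF_obj[OF F]]]
 show "Cmp (FunK C) (dFm F (dF (dF F)) (iF F)) (iF (dF F)):Hom (FunK C) (dF F) (dF F)"
	by (rule FunK_cmp[OF D(1,3,1) iF_hom[OF D(1)] dFm_hom[OF F D(2) iF_hom[OF F]]])
 show "Idm (FunK C) (dF F):Hom (FunK C) (dF F) (dF F)" by (rule FunK_id[OF D(1)])
 fix X y x assume X: "X:Obj C" and y: "y:Fo (dF F) X" and x: "x:Fo F (D0 X)"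
 note d = D_obj[OF X] D_obj[OF D_obj[OF X]] D_obj[OF D_obj[OF D_obj[OF X]]]
 have y': "y:dual (Fo F (D0 X))" using y by (simp add: dF_Fo)
 have iy: "iF (dF F) X y:dual (Fo (dF (dF F)) (D0 X))" using iF_in(1)[OF D(1) X y] by (simp add: dF_Fo)
 have ix: "iF F (D0 X) x:dual (Fo (dF F) (D0 (D0 X)))" using iF_in(1)[OF F d(1) x] by (simp add: dF_Fo)
 note 3 = dF_Fm[OF F X d(2) io_hom[OF X] y']
 have "eval_dual (Fo F (D0 X)) (dFm F (dF (dF F)) (iF F) X (iF (dF F) X y)) x
	= eval_dual (dual (Fo (dF F) (D0 (D0 X)))) (iF (dF F) X y) (iF F (D0 X) x)"
	using dFm_in(2)[OF F D(2) iF_hom[OF F] X iy, of x] by (simp add: dF_Fo)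
 also have "... = eval_dual (Fo (dF F) (D0 (D0 X))) (iF F (D0 X) x) (Fm (dF F) X (D0 (D0 X)) (io X) y)"
	using iF_in(2)[OF D(1) X y ix] .
 also have "... = eval_dual (Fo F (D0 (D0 (D0 X)))) (Fm (dF F) X (D0 (D0 X)) (io X) y) (Fm F (D0 X) (D0 (D0 (D0 X))) (io (D0 X)) x)"
	using iF_in(2)[OF F d(1) x 3(1)] by (simp add: dF_Fo)
 also have "... = eval_dual (Fo F (D0 X)) y (Fm F (D0 (D0 (D0 X))) (D0 X) (D1 X (D0 (D0 X)) (io X)) (Fm F (D0 X) (D0 (D0 (D0 X))) (io (D0 X)) x))"
	by (rule 3(2))
 also have "... = eval_dual (Fo F (D0 X)) y x"
	using Fm_comp[OF F d(1,3,1) io_hom[OF d(1)] D_hom[OF X d(2) io_hom[OF X]], of x] io_tri[OF X] Fm_id[OF F d(1) x] by simp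
 finally show "eval_dual (Fo F (D0 X)) (Cmp (FunK C) (dFm F (dF (dF F)) (iF F)) (iF (dF F)) X y) x
	= eval_dual (Fo F (D0 X)) (Idm (FunK C) (dF F) X y) x"
	using X y by (simp add: FunK_sel(3,4) id_on_def)
qed

lemma catdual_FunK:
 assumes P: "!!F. F:Obj (FunK C) ==> P F ==> P (dF F)"
 shows "catdual (full_subcat (FunK C) P) dF dFm iF iF'"
proof -
 interpret a: acat "full_subcat (FunK C) P" by (rule acat_FunK)
 show ?thesis
	by unfold_locales
	 (auto simp: dF_obj P dFm_hom dFm_id dFm_comp iF_hom iF'_hom iF_nat iF_tri)
qed

end

section \<open>Coherent functors are the generated and cogenerated ones\<close>

text \<open>The functionals of the form \<open>om o al\<close> form the image of the transpose of
  \<open>al\<close>; a vector annihilated by all of them is killed by \<open>al\<close>, so the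
  double annihilator applies.\<close>

lemma functional_factor:
 assumes F: "fds s F" and G: "fds t G" and a: "al:lin s F t G" and x: "xi:lin s F (*) UNIV"
	and v: "!!v. v:F ==> al v = 0 ==> xi v = 0"
 shows "EX om:lin t G (*) UNIV. om o al = xi"
proof -
 let ?S = "(%om. om o al) ` lin t G (*) UNIV"
 have c: "om o al:lin s F (*) UNIV" if "om:lin t G (*) UNIV" for om
	by (rule lin_comp[OF a that fsub[OF G]]) simp
 have "xi:?S"
 proof (rule annihilator_annihilator[OF F _ _ x])
	show "subsp (fscale (*)) ?S"
	 by (rule subsp_image[where W="lin s F (*) UNIV" and s="fscale (*)", OF fsub[OF fds_lin[OF G fds_field]]])
		(use c in \<open>auto simp: linon_def fscale_def fun_eq_iff\<close>)
	show "?S <= lin s F (*) UNIV" using c by blast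
	fix w assume w: "w:F" "!!xi. xi:?S ==> xi w = 0"
	have "al w = 0"
	proof (rule ccontr)
	 assume "al w ~= 0"
	 then obtain om where o: "om:lin t G (*) UNIV" "om (al w) ~= 0" using separation0[OF G linD(1)[OF a w(1)]] by blast
	 then show False using w(2)[of "om o al"] by auto
	qed
	then show "xi w = 0" by (rule v[OF w(1)])
 qed
 then show ?thesis by blast
qed

section \<open>Generated and cogenerated functors\<close>

context lcat
begin

text \<open>Says that \<open>f(X)\<close> is spanned by the images of \<open>f(M)\<close> under all
  \<open>g : M \<rightarrow> X\<close>. The formulation by functionals avoids sums and mirrors
  \<open>cogen\<close>, so that \<open>gen_dual\<close> and \<open>cogen_dual\<close> need no
  bases.\<close>

definition gen :: "'o => ('k, 'o, 'm) vfunc => bool" where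
 "gen M f \<longleftrightarrow> M:Obj C & (ALL X:Obj C. ALL xi:functionals (Fo f X).
	 (ALL g:Hom C M X. ALL x:Fo f M. xi (Fm f M X g x) = 0) --> (ALL y:Fo f X. xi y = 0))"

definition cogen :: "'o => ('k, 'o, 'm) vfunc => bool" where
 "cogen N f \<longleftrightarrow> N:Obj C & (ALL X:Obj C. ALL y:Fo f X. (ALL g:Hom C X N. Fm f X N g y = 0) --> y = 0)"

lemma cogenD: "cogen N f ==> X:Obj C ==> y:Fo f X ==> (!!g. g:Hom C X N ==> Fm f X N g y = 0) ==> y = 0"
 by (simp add: cogen_def)

lemma genD: "gen M f ==> X:Obj C ==> xi:lin vscale (Fo f X) (*) UNIV ==>
	(!!g x. g:Hom C M X ==> x:Fo f M ==> xi (Fm f M X g x) = 0) ==> y:Fo f X ==> xi y = 0"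
 by (simp add: gen_def functionals_def)

lemma gen_quotient:
 assumes f: "f:Obj (FunK C)" "f':Obj (FunK C)" "et:Hom (FunK C) f f'"
	and s: "!!X. X:Obj C ==> et X ` Fo f X = Fo f' X" and g: "gen M f"
 shows "gen M f'"
 unfolding gen_def functionals_def
proof (intro conjI ballI impI)
 show M: "M:Obj C" using g by (simp add: gen_def)
 fix X xi y assume X: "X:Obj C" and xi: "xi:lin vscale (Fo f' X) (*) UNIV" and y: "y:Fo f' X"
	and v: "ALL g:Hom C M X. ALL x:Fo f' M. xi (Fm f' M X g x) = 0"
 have c: "xi o et X:lin vscale (Fo f X) (*) UNIV"
	by (rule functional_comp[OF FhomD(1)[OF f(3) X] xi FobjD(1)[OF f(2) X]])
 obtain z where z: "z:Fo f X" "y = et X z" using s[OF X] y by blast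
 have "(xi o et X) z = 0"
	by (rule genD[OF g X c _ z(1)]) (use v FhomD(2)[OF f(3) M X] hom_in[OF f(3) M] in simp)
 then show "xi y = 0" using z by simp
qed

lemma cogen_sub:
 assumes f: "f:Obj (FunK C)" "f':Obj (FunK C)" "et:Hom (FunK C) f f'"
	and s: "!!X. X:Obj C ==> inj_on (et X) (Fo f X)" and g: "cogen N f'"
 shows "cogen N f"
 unfolding cogen_def
proof (intro conjI ballI impI)
 show N: "N:Obj C" using g by (simp add: cogen_def)
 fix X y assume X: "X:Obj C" and y: "y:Fo f X" and v: "ALL g:Hom C X N. Fm f X N g y = 0"
 have "et X y = 0"
	by (rule cogenD[OF g X hom_in[OF f(3) X y]]) (use v FhomD(2)[OF f(3) X N, of _ y] hom0[OF f(3,1) N] in simp)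
 then show "y = 0"
	using inj_onD[OF s[OF X], of y 0] y hom0[OF f(3,1) X] subspD(1)[OF fsub[OF FobjD(1)[OF f(1) X]]] by simp
qed

lemma Fm_zero: "F:Obj (FunK C) ==> X:Obj C ==> Y:Obj C ==> x:Fo F X ==> Fm F X Y 0 x = 0"
 by (rule linon_more(1)[OF Fm_linon]) auto

lemma Fm0: "F:Obj (FunK C) ==> X:Obj C ==> Y:Obj C ==> f:Hom C X Y ==> Fm F X Y f 0 = 0"
 by (rule lin_more(1)[OF FobjD(2)]) (auto intro: FobjD(1))

text \<open>Replacing \<open>M\<close> by an object of which it is a retract provides two functors
  with a common generator, as needed for their biproduct.\<close>

lemma gen_retract:
 assumes f: "f:Obj (FunK C)" and g: "gen M f" and M': "M':Obj C" "i:Hom C M M'" "p:Hom C M' M" "Cmp C p i = Idm C M"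
 shows "gen M' f"
 unfolding gen_def functionals_def
proof (intro conjI ballI impI)
 have M: "M:Obj C" using g by (simp add: gen_def)
 fix X xi y assume X: "X:Obj C" and xi: "xi:lin vscale (Fo f X) (*) UNIV" and y: "y:Fo f X"
	and v: "ALL g:Hom C M' X. ALL x:Fo f M'. xi (Fm f M' X g x) = 0"
 show "xi y = 0"
 proof (rule genD[OF g X xi _ y])
	fix h x assume h: "h:Hom C M X" and x: "x:Fo f M"
	have "Fm f M X h x = Fm f M' X (Cmp C h p) (Fm f M M' i x)"
	 using Fm_comp[OF f M M'(1) X M'(2) cmp[OF M'(1) M X M'(3) h], of x] M'(4) idr[OF M X h] by (simp add: assoc)
	then show "xi (Fm f M X h x) = 0" using v cmp[OF M'(1) M X M'(3) h] Fm_in[OF f M M'(1,2) x] by simp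
 qed
qed (rule M'(1))

lemma cogen_retract:
 assumes f: "f:Obj (FunK C)" and g: "cogen N f" and N': "N':Obj C" "i:Hom C N N'" "p:Hom C N' N" "Cmp C p i = Idm C N"
 shows "cogen N' f"
 unfolding cogen_def
proof (intro conjI ballI impI)
 have N: "N:Obj C" using g by (simp add: cogen_def)
 fix X y assume X: "X:Obj C" and y: "y:Fo f X" and v: "ALL g:Hom C X N'. Fm f X N' g y = 0"
 show "y = 0"
 proof (rule cogenD[OF g X y])
	fix h assume h: "h:Hom C X N"
	have "Fm f X N h y = Fm f N' N p (Fm f X N' (Cmp C i h) y)"
	 using Fm_comp[OF f X N'(1) N cmp[OF X N N'(1) h N'(2)] N'(3), of y] N'(4) idl[OF X N h] by (simp flip: assoc)
	then show "Fm f X N h y = 0" using v cmp[OF X N N'(1) h N'(2)] Fm0[OF f N'(1) N N'(3)] by simp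
 qed
qed (rule N'(1))

lemma biproduct_pw:
 assumes b: "biproduct (FunK C) F G S i1 i2 p1 p2" and X: "X:Obj C" and y: "y:Fo S X"
 shows "i1 X (p1 X y) + i2 X (p2 X y) = y"
proof -
 have "(Cmp (FunK C) i1 p1 + Cmp (FunK C) i2 p2) X y = Idm (FunK C) S X y" using b by (simp add: biproduct_def)
 then show ?thesis using X y by (simp only: FunK_sel plus_fun_apply comp_apply id_on_def if_True)
qed

lemma gen_biproduct:
 assumes F: "F:Obj (FunK C)" "G:Obj (FunK C)" and b: "biproduct (FunK C) F G S i1 i2 p1 p2" and g: "gen M F" "gen M G"
 shows "gen M S"
 unfolding gen_def functionals_def
proof (intro conjI ballI impI)
 show M: "M:Obj C" using g by (simp add: gen_def)
 have S: "S:Obj (FunK C)" and i: "i1:Hom (FunK C) F S" "i2:Hom (FunK C) G S"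
	and p: "p1:Hom (FunK C) S F" "p2:Hom (FunK C) S G" using b by (simp_all add: biproduct_def)
 fix X xi y assume X: "X:Obj C" and xi: "xi:lin vscale (Fo S X) (*) UNIV" and y: "y:Fo S X"
	and v: "ALL g:Hom C M X. ALL x:Fo S M. xi (Fm S M X g x) = 0"
 have 1: "xi (i1 X z) = 0" if z: "z:Fo F X" for z
	using genD[OF g(1) X functional_comp[OF FhomD(1)[OF i(1) X] xi FobjD(1)[OF S X]] _ z]
	 v FhomD(2)[OF i(1) M X] hom_in[OF i(1) M] by simp
 have 2: "xi (i2 X z) = 0" if z: "z:Fo G X" for z
	using genD[OF g(2) X functional_comp[OF FhomD(1)[OF i(2) X] xi FobjD(1)[OF S X]] _ z]
	 v FhomD(2)[OF i(2) M X] hom_in[OF i(2) M] by simp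
 have "xi y = xi (i1 X (p1 X y)) + xi (i2 X (p2 X y))"
	using linD(2)[OF xi hom_in[OF i(1) X hom_in[OF p(1) X y]] hom_in[OF i(2) X hom_in[OF p(2) X y]]] biproduct_pw[OF b X y] by simp
 then show "xi y = 0" using 1[OF hom_in[OF p(1) X y]] 2[OF hom_in[OF p(2) X y]] by simp
qed

lemma cogen_biproduct:
 assumes F: "F:Obj (FunK C)" "G:Obj (FunK C)" and b: "biproduct (FunK C) F G S i1 i2 p1 p2" and g: "cogen N F" "cogen N G"
 shows "cogen N S"
 unfolding cogen_def
proof (intro conjI ballI impI)
 show N: "N:Obj C" using g by (simp add: cogen_def)
 have S: "S:Obj (FunK C)" and i: "i1:Hom (FunK C) F S" "i2:Hom (FunK C) G S"
	and p: "p1:Hom (FunK C) S F" "p2:Hom (FunK C) S G" using b by (simp_all add: biproduct_def)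
 fix X y assume X: "X:Obj C" and y: "y:Fo S X" and v: "ALL g:Hom C X N. Fm S X N g y = 0"
 have "p1 X y = 0"
	by (rule cogenD[OF g(1) X hom_in[OF p(1) X y]]) (use v FhomD(2)[OF p(1) X N, of _ y] hom0[OF p(1) S N] in simp)
 moreover have "p2 X y = 0"
	by (rule cogenD[OF g(2) X hom_in[OF p(2) X y]]) (use v FhomD(2)[OF p(2) X N, of _ y] hom0[OF p(2) S N] in simp)
 ultimately show "y = 0" using biproduct_pw[OF b X y] hom0[OF i(1) F(1) X] hom0[OF i(2) F(2) X] by simp
qed

lemma hrep_Fo: "Fo (hrep C M) X = model (Scl C) (Hom C M X)" by (simp add: hrep_def)

lemma hrep_obj:
 assumes M: "M:Obj C" shows "hrep C M:Obj (FunK C)"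
proof (rule FunK_objI)
 note c = cmp_linon[OF M]
 show "fds vscale (Fo (hrep C M) X)" if "X:Obj C" for X using M that by (simp add: hrep_def)
 show "Fm (hrep C M) X Y f:vlin (Fo (hrep C M) X) (Fo (hrep C M) Y)" if "X:Obj C" "Y:Obj C" "f:Hom C X Y" for X Y f
	using M that tmap_lin[OF hom_fds[OF M that(1)] hom_fds[OF M that(2)] c(1)[OF that]] by (simp add: hrep_def)
 show "Fm (hrep C M) X X (Idm C X) = id_on (Fo (hrep C M) X)" if "X:Obj C" for X
	unfolding hrep_def func.select_convs tmap_id[symmetric] by (rule tmap_cong) (rule idl[OF M that])
 show "Fm (hrep C M) X Z (Cmp C g f) = Fm (hrep C M) Y Z g o Fm (hrep C M) X Y f"
	if h: "X:Obj C" "Y:Obj C" "Z:Obj C" "f:Hom C X Y" "g:Hom C Y Z" for X Y Z f g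
 proof -
	have "Cmp C g 0 = 0" by (rule linon_more(1)[OF c(1)[OF h(2,3,5)]]) (use M h fds_vs[OF hom_fds[OF M M]] in auto)
	moreover have "Cmp C (Cmp C g f) = (%x. Cmp C g (Cmp C f x))" by (simp add: fun_eq_iff assoc)
	ultimately show ?thesis
	 using tmap_comp[where f="Cmp C f" and g="Cmp C g", OF hom_fds[OF M h(1)] hom_fds[OF M h(2)] cmp[OF M h(1,2) _ h(4)] hom_fds[OF M h(3)]]
	 by (simp add: hrep_def)
 qed
 show "Fm (hrep C M) X Y (f + g) = Fm (hrep C M) X Y f + Fm (hrep C M) X Y g"
	if h: "X:Obj C" "Y:Obj C" "f:Hom C X Y" "g:Hom C X Y" for X Y f g
 proof -
	have e: "Cmp C (f + g) = (%x. Cmp C f x + Cmp C g x)" by (simp add: fun_eq_iff addl)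
	show ?thesis
	 using tmap_add[of "Scl C" "Hom C M Y" "Hom C M X" "Cmp C f" "Cmp C g" "Scl C"] cmp[OF M h(1,2) _ h(3)] cmp[OF M h(1,2) _ h(4)] M h
	 by (simp add: hrep_def e)
 qed
 show "Fm (hrep C M) X Y (Scl C c f) = fscale vscale c (Fm (hrep C M) X Y f)"
	if h: "X:Obj C" "Y:Obj C" "f:Hom C X Y" for X Y f c
 proof -
	have e: "Cmp C (Scl C c f) = (%x. Scl C c (Cmp C f x))" by (simp add: fun_eq_iff scll)
	show ?thesis
	 using tmap_scale[of "Scl C" "Hom C M Y" "Hom C M X" "Cmp C f" "Scl C" c] cmp[OF M h(1,2) _ h(3)] M h
	 by (simp add: hrep_def e)
 qed
qed

lemma hrep_Fm: "M:Obj C ==> X:Obj C ==> h:Hom C M X ==>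
	Fm (hrep C M) X Y g (coords (Scl C) (Hom C M X) h) = coords (Scl C) (Hom C M Y) (Cmp C g h)"
 by (simp add: hrep_def)

definition yon :: "'o => ('k, 'o, 'm) vfunc => 'k vec => 'o => 'k vec => 'k vec" where
 "yon M f x = (%X. if X:Obj C
	 then restr (model (Scl C) (Hom C M X)) (%y. Fm f M X (dec (Scl C) (Hom C M X) y) x) else 0)"

lemma yon_coords: "M:Obj C ==> X:Obj C ==> h:Hom C M X ==> yon M f x X (coords (Scl C) (Hom C M X) h) = Fm f M X h x"
 by (simp add: yon_def)

lemma yon_hom:
 assumes M: "M:Obj C" and f: "f:Obj (FunK C)" and x: "x:Fo f M"
 shows "yon M f x:Hom (FunK C) (hrep C M) f"
proof (rule FhomI[OF hrep_obj[OF M] f])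
 show "yon M f x X:vlin (Fo (hrep C M) X) (Fo f X)" if "X:Obj C" for X
	using restr_lin[OF fsub[OF model_fds[OF hom_fds[OF M that]]] linon_comp[OF dec_linon[OF hom_fds[OF M that]] Fm_linon[OF f M that x]]] that
	by (simp add: yon_def hrep_Fo)
 show "yon M f x Y (Fm (hrep C M) X Y g y) = Fm f X Y g (yon M f x X y)"
	if h: "X:Obj C" "Y:Obj C" "g:Hom C X Y" "y:Fo (hrep C M) X" for X Y g y
 proof -
	let ?h = "dec (Scl C) (Hom C M X) y"
	have y: "y = coords (Scl C) (Hom C M X) ?h" "?h:Hom C M X" using h(4) by (simp_all add: hrep_Fo)
	show ?thesis
	 by (subst (1 2) y(1))
		(simp only: hrep_Fm[OF M h(1) y(2)] yon_coords[OF M h(2) cmp[OF M h(1,2) y(2) h(3)]] yon_coords[OF M h(1) y(2)] Fm_comp[OF f M h(1,2) y(2) h(3)])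
 qed
qed (simp add: yon_def)

lemma hrep_gen:
 assumes M: "M:Obj C" shows "gen M (hrep C M)"
 unfolding gen_def functionals_def
proof (intro conjI ballI impI)
 fix X xi y assume X: "X:Obj C" and y: "y:Fo (hrep C M) X"
	and v: "ALL g:Hom C M X. ALL x:Fo (hrep C M) M. xi (Fm (hrep C M) M X g x) = 0"
 let ?h = "dec (Scl C) (Hom C M X) y"
 have h: "y = coords (Scl C) (Hom C M X) ?h" "?h:Hom C M X" using y by (simp_all add: hrep_Fo)
 have "y = Fm (hrep C M) M X ?h (coords (Scl C) (Hom C M M) (Idm C M))"
	using hrep_Fm[OF M M idm[OF M], of X ?h] h(1) idr[OF M X h(2)] by simp
 moreover have "xi (Fm (hrep C M) M X ?h (coords (Scl C) (Hom C M M) (Idm C M))) = 0"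
	using v h(2) idm[OF M] by (simp add: hrep_Fo)
 ultimately show "xi y = 0" by simp
qed (rule M)

end

section \<open>Duality of generators, cogenerators, kernels and cokernels\<close>

context lduality
begin

lemma D_faithful:
 assumes XY: "X:Obj C" "Y:Obj C" "f:Hom C X Y" and e: "D1 X Y f = 0"
 shows "f = 0"
proof -
 note d = D_obj[OF D_obj[OF XY(1)]] D_obj[OF D_obj[OF XY(2)]]
 obtain g where g: "g:Hom C (D0 (D0 Y)) Y" "Cmp C g (io Y) = Idm C Y" using io_iso[OF XY(2)] by blast
 have z: "D1 (D0 Y) (D0 X) 0 = 0"
	using D_add[OF D_obj[OF XY(2)] D_obj[OF XY(1)] hom_closed(1)[OF D_obj[OF XY(2)] D_obj[OF XY(1)]] hom_closed(1)[OF D_obj[OF XY(2)] D_obj[OF XY(1)]]] by simp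
 have z': "Cmp C 0 h = 0" for h using addl[of 0 0 h] by simp
 have "Cmp C (io Y) f = 0" using io_nat[OF XY] e z z' by simp
 then have "f = Cmp C g 0" using idl[OF XY] g(2) assoc[of g "io Y" f] by simp
 also have "... = 0" using addr[OF XY(1) d(2) XY(2) hom_closed(1)[OF XY(1) d(2)] hom_closed(1)[OF XY(1) d(2)] g(1)] by simp
 finally show ?thesis .
qed

text \<open>The duality is adjoint to itself: arrows \<open>M \<rightarrow> D0 X\<close> correspond
  to arrows \<open>X \<rightarrow> D0 M\<close>. This is the surjectivity of the
  transposition.\<close>

lemma D_surj:
 assumes XM: "X:Obj C" "M:Obj C" and h: "h:Hom C M (D0 X)"
 shows "EX g:Hom C X (D0 M). Cmp C (D1 X (D0 M) g) (io M) = h"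
proof
 note d = D_obj[OF XM(1)] D_obj[OF XM(2)] D_obj[OF D_obj[OF XM(1)]] D_obj[OF D_obj[OF XM(2)]] D_obj[OF D_obj[OF D_obj[OF XM(1)]]]
 note Dh = D_hom[OF XM(2) d(1) h]
 let ?g = "Cmp C (D1 M (D0 X) h) (io X)"
 show "?g:Hom C X (D0 M)" by (rule cmp[OF XM(1) d(3,2) io_hom[OF XM(1)] Dh])
 have "Cmp C (D1 X (D0 M) ?g) (io M) = Cmp C (D1 X (D0 (D0 X)) (io X)) (Cmp C (D1 (D0 (D0 X)) (D0 M) (D1 M (D0 X) h)) (io M))"
	by (simp add: D_comp[OF XM(1) d(3,2) io_hom[OF XM(1)] Dh] assoc)
 also have "... = Cmp C (Cmp C (D1 X (D0 (D0 X)) (io X)) (io (D0 X))) h" by (simp add: io_nat[OF XM(2) d(1) h] assoc)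
 finally show "Cmp C (D1 X (D0 M) ?g) (io M) = h" by (simp add: io_tri[OF XM(1)] idl[OF XM(2) d(1) h])
qed

lemma gen_dual:
 assumes f: "f:Obj (FunK C)" and g: "gen M f" shows "cogen (D0 M) (dF f)"
 unfolding cogen_def
proof (intro conjI ballI impI)
 have M: "M:Obj C" using g by (simp add: gen_def)
 show "D0 M:Obj C" by (rule D_obj[OF M])
 fix X y assume X: "X:Obj C" and "y:Fo (dF f) X" and v: "ALL g:Hom C X (D0 M). Fm (dF f) X (D0 M) g y = 0"
 then have y: "y:dual (Fo f (D0 X))" by (simp add: dF_Fo)
 note V = FobjD(1)[OF f D_obj[OF X]]
 show "y = 0"
 proof (rule dual_ext[OF y subspD(1)[OF fsub[OF dual_fds[OF V]]]])
	fix z assume z: "z:Fo f (D0 X)"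
	have "eval_dual (Fo f (D0 X)) y z = 0"
	proof (rule genD[OF g D_obj[OF X] eval_dual_lin[OF y] _ z])
	 fix h x assume h: "h:Hom C M (D0 X)" and x: "x:Fo f M"
	 obtain k where k: "k:Hom C X (D0 M)" "Cmp C (D1 X (D0 M) k) (io M) = h" using D_surj[OF X M h] by blast
	 have "eval_dual (Fo f (D0 X)) y (Fm f M (D0 X) h x)
		 = eval_dual (Fo f (D0 (D0 M))) (Fm (dF f) X (D0 M) k y) (Fm f M (D0 (D0 M)) (io M) x)"
		using dF_Fm(2)[OF f X D_obj[OF M] k(1) y]
		 Fm_comp[OF f M D_obj[OF D_obj[OF M]] D_obj[OF X] io_hom[OF M] D_hom[OF X D_obj[OF M] k(1)], of x] k(2) by simp
	 then show "eval_dual (Fo f (D0 X)) y (Fm f M (D0 X) h x) = 0"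
		using v k(1) eval_dual_linear(3)[OF FobjD(1)[OF f D_obj[OF D_obj[OF M]]]] by simp
	qed
	then show "eval_dual (Fo f (D0 X)) y z = eval_dual (Fo f (D0 X)) 0 z" using eval_dual_linear(3)[OF V] by simp
 qed
qed

text \<open>A functional on a dual space is evaluation at a vector \<open>z\<close> of
  \<open>f(D0 X)\<close>, and \<open>z = 0\<close> is checked with arrows into
  \<open>N\<close>.\<close>

lemma cogen_dual:
 assumes f: "f:Obj (FunK C)" and g: "cogen N f" shows "gen (D0 N) (dF f)"
 unfolding gen_def functionals_def
proof (intro conjI ballI impI)
 have N: "N:Obj C" using g by (simp add: cogen_def)
 show "D0 N:Obj C" by (rule D_obj[OF N])
 fix X xi y assume X: "X:Obj C" and xi: "xi:lin vscale (Fo (dF f) X) (*) UNIV" and y: "y:Fo (dF f) X"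
	and v: "ALL g:Hom C (D0 N) X. ALL x:Fo (dF f) (D0 N). xi (Fm (dF f) (D0 N) X g x) = 0"
 note V = FobjD(1)[OF f D_obj[OF X]] and d = D_obj[OF N] D_obj[OF D_obj[OF N]]
 note V' = FobjD(1)[OF f d(2)]
 have xi': "xi:lin vscale (dual (Fo f (D0 X))) (*) UNIV" using xi by (simp add: dF_Fo)
 from codual[OF dual_fds[OF V] xi'] iotaV_surj[OF V] obtain z where z: "z:Fo f (D0 X)" "iotaV (Fo f (D0 X)) z = codual (dual (Fo f (D0 X))) xi"
	by (metis imageE)
 have ev: "xi w = eval_dual (Fo f (D0 X)) w z" if "w:dual (Fo f (D0 X))" for w
	using iotaV_in(2)[OF V z(1) that] z(2) codual(2)[OF dual_fds[OF V] xi'] by simp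
 have "z = 0"
 proof (rule cogenD[OF g D_obj[OF X] z(1)])
	fix h assume h: "h:Hom C (D0 X) N"
	let ?k = "D1 (D0 X) N h"

	obtain e where e: "e:Hom C (D0 (D0 X)) X" "Cmp C e (io X) = Idm C X" "Cmp C (io X) e = Idm C (D0 (D0 X))" using io_iso[OF X] by blast
	note o = D_obj[OF X] D_obj[OF D_obj[OF X]] D_obj[OF D_obj[OF D_obj[OF X]]]
	note kh = D_hom[OF o(1) N h]
	\<comment> \<open>An arrow \<open>h : D0 X \<rightarrow> N\<close> has to be reached from an arrow
	  \<open>D0 N \<rightarrow> X\<close>. As \<open>e\<close> inverts \<open>io X\<close>, the dual of
	  this \<open>?g\<close> is \<open>h\<close> followed by \<open>io N\<close>; see
	  \<open>Dg\<close>.\<close>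
	let ?g = "Cmp C e ?k"
	have gh: "?g:Hom C (D0 N) X" by (rule cmp[OF d(1) o(2) X kh e(1)])
	have De: "D1 (D0 (D0 X)) X e = io (D0 X)"
	proof -
	 note De = D_hom[OF o(2) X e(1)]
	 have "D1 (D0 (D0 X)) X e = Cmp C (D1 (D0 (D0 X)) X e) (Cmp C (D1 X (D0 (D0 X)) (io X)) (io (D0 X)))"
		by (simp add: io_tri[OF X] idr[OF o(1,3) De])
	 also have "... = Cmp C (D1 (D0 (D0 X)) (D0 (D0 X)) (Cmp C (io X) e)) (io (D0 X))"
		by (simp add: D_comp[OF o(2) X o(2) e(1) io_hom[OF X]] assoc)
	 finally show ?thesis by (simp add: e(3) D_id[OF o(2)] idl[OF o(1,3) io_hom[OF o(1)]])
	qed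
	have Dg: "D1 (D0 N) X ?g = Cmp C (io N) h"
	 by (simp add: D_comp[OF d(1) o(2) X kh e(1)] De io_nat[OF o(1) N h])
	have zero: "Fm f (D0 X) (D0 (D0 N)) (D1 (D0 N) X ?g) z = 0"
	proof (rule ccontr)
	 assume ne: "Fm f (D0 X) (D0 (D0 N)) (D1 (D0 N) X ?g) z ~= 0"
	 note Dgh = D_hom[OF d(1) X gh]
	 obtain om where o': "om:lin vscale (Fo f (D0 (D0 N))) (*) UNIV" "om (Fm f (D0 X) (D0 (D0 N)) (D1 (D0 N) X ?g) z) ~= 0"
		using separation0[OF V' Fm_in[OF f o(1) d(2) Dgh z(1)] ne] by blast
	 note c = codual[OF V' o'(1)]
	 note F = dF_Fm[OF f d(1) X gh c(1)]
	 have "xi (Fm (dF f) (D0 N) X ?g (codual (Fo f (D0 (D0 N))) om)) = 0" using v gh c(1) by (simp add: dF_Fo)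
	 then show False using ev[OF F(1)] F(2)[of z] c(2) o'(2) by simp
	qed
	obtain e' where e': "e':Hom C (D0 (D0 N)) N" "Cmp C e' (io N) = Idm C N" using io_iso[OF N] by blast
	have "Fm f (D0 X) N h z = Fm f (D0 (D0 N)) N e' (Fm f (D0 X) (D0 (D0 N)) (Cmp C (io N) h) z)"
	 using Fm_comp[OF f o(1) d(2) N cmp[OF o(1) N d(2) h io_hom[OF N]] e'(1), of z] e'(2) idl[OF o(1) N h] by (simp flip: assoc)
	then show "Fm f (D0 X) N h z = 0" using zero Dg Fm0[OF f d(2) N e'(1)] by simp
 qed
 then have "xi y = 0" if "y:dual (Fo f (D0 X))" for y
	using ev[OF that] lin_more(1)[OF eval_dual_lin[OF that] fsub[OF V]] by simp
 then show "xi y = 0" using y by (simp add: dF_Fo)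
qed

text \<open>Duality of vector spaces is exact because a functional that vanishes on the kernel of a
  map factors through the map. This is used once for the injection \<open>k\<close> and once for
  \<open>al\<close>.\<close>

lemma pw_ker_dual:
 assumes f: "f:Obj (FunK C)" "g:Obj (FunK C)" "K:Obj (FunK C)"
	and a: "al:Hom (FunK C) f g" and k: "k:Hom (FunK C) K f" and pw: "pw_ker f al K k"
 shows "pw_cok (dF g) (dF f) (dFm f g al) (dF K) (dFm K f k)"
 unfolding pw_cok_def
proof (intro ballI conjI)
 fix X assume X: "X:Obj C"
 note d = D_obj[OF X]
 have ki: "inj_on (k (D0 X)) (Fo K (D0 X))" "k (D0 X) ` Fo K (D0 X) = {x:Fo f (D0 X). al (D0 X) x = 0}"
	using pw d by (auto simp: pw_ker_def)
 note V = FobjD(1)[OF f(1) d] FobjD(1)[OF f(2) d] FobjD(1)[OF f(3) d]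
 note h = FhomD(1)[OF a d] FhomD(1)[OF k d]
 show "dFm K f k X ` Fo (dF f) X = Fo (dF K) X"
 proof
	show "dFm K f k X ` Fo (dF f) X <= Fo (dF K) X" using dFm_in(1)[OF f(3,1) k X] by (auto simp: dF_Fo)
	show "Fo (dF K) X <= dFm K f k X ` Fo (dF f) X"
	proof
	 fix y assume "y:Fo (dF K) X"
	 then have y: "y:dual (Fo K (D0 X))" by (simp add: dF_Fo)
	 have "EX om:lin vscale (Fo f (D0 X)) (*) UNIV. om o k (D0 X) = eval_dual (Fo K (D0 X)) y"
	 proof (rule functional_factor[OF V(3,1) h(2) eval_dual_lin[OF y]])
		fix v assume "v:Fo K (D0 X)" "k (D0 X) v = 0"
		then have "v = 0" using inj_onD[OF ki(1), of v 0] hom0[OF k f(3) d] subspD(1)[OF fsub[OF V(3)]] by simp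
		then show "eval_dual (Fo K (D0 X)) y v = 0" using lin_more(1)[OF eval_dual_lin[OF y] fsub[OF V(3)]] by simp
	 qed
	 then obtain om where o: "om:lin vscale (Fo f (D0 X)) (*) UNIV" "om o k (D0 X) = eval_dual (Fo K (D0 X)) y" by blast
	 note c = codual[OF V(1) o(1)]
	 note D = dFm_in[OF f(3,1) k X c(1)]
	 have "y = dFm K f k X (codual (Fo f (D0 X)) om)"
		by (rule dual_ext[OF y D(1)]) (simp add: D(2) c(2) o(2)[symmetric])
	 then show "y:dFm K f k X ` Fo (dF f) X" using c(1) by (auto simp: dF_Fo)
	qed
 qed
 show "{y:Fo (dF f) X. dFm K f k X y = 0} = dFm f g al X ` Fo (dF g) X" (is "?A = ?B")
 proof
	show "?B <= ?A"
	proof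
	 fix y assume "y:?B"
	 then obtain z where z: "z:dual (Fo g (D0 X))" "y = dFm f g al X z" by (auto simp: dF_Fo)
	 note D = dFm_in[OF f(1,2) a X z(1)]
	 note D' = dFm_in[OF f(3,1) k X D(1)]
	 have "dFm K f k X y = 0" unfolding z(2)
	 proof (rule dual_ext[OF D'(1) subspD(1)[OF fsub[OF dual_fds[OF V(3)]]]])
		fix x assume x: "x:Fo K (D0 X)"
		have "al (D0 X) (k (D0 X) x) = 0" using ki(2) x by blast
		then show "eval_dual (Fo K (D0 X)) (dFm K f k X (dFm f g al X z)) x = eval_dual (Fo K (D0 X)) 0 x"
		 using lin_more(1)[OF eval_dual_lin[OF z(1)] fsub[OF V(2)]] by (simp add: D'(2) D(2) eval_dual_linear(3)[OF V(3)])
	 qed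
	 then show "y:?A" using D(1) z(2) by (simp add: dF_Fo)
	qed
	show "?A <= ?B"
	proof
	 fix y assume "y:?A"
	 then have y: "y:dual (Fo f (D0 X))" "dFm K f k X y = 0" by (simp_all add: dF_Fo)
	 note D = dFm_in(2)[OF f(3,1) k X y(1)]
	 have "EX om:lin vscale (Fo g (D0 X)) (*) UNIV. om o al (D0 X) = eval_dual (Fo f (D0 X)) y"
	 proof (rule functional_factor[OF V(1,2) h(1) eval_dual_lin[OF y(1)]])
		fix v assume "v:Fo f (D0 X)" "al (D0 X) v = 0"
		then obtain x where x: "x:Fo K (D0 X)" "v = k (D0 X) x" using ki(2) by blast
		show "eval_dual (Fo f (D0 X)) y v = 0" using D[of x] y(2) x(2) by (simp add: eval_dual_linear(3)[OF V(3)])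
	 qed
	 then obtain om where o: "om:lin vscale (Fo g (D0 X)) (*) UNIV" "om o al (D0 X) = eval_dual (Fo f (D0 X)) y" by blast
	 note c = codual[OF V(2) o(1)]
	 note D' = dFm_in[OF f(1,2) a X c(1)]
	 have "y = dFm f g al X (codual (Fo g (D0 X)) om)"
		by (rule dual_ext[OF y(1) D'(1)]) (simp add: D'(2) c(2) o(2)[symmetric])
	 then show "y:?B" using c(1) by (auto simp: dF_Fo)
	qed
 qed
qed

end

lemma fsc_app: "fscale s c f x = s c (f x)" by (simp add: fscale_def)

text \<open>
 \<open>annihilator\<close> is the hom-level form of the statement that the cokernel of a map from a
 generated to a cogenerated functor is cogenerated.
\<close>

locale cohcat = lduality C D0 D1 io
 for C :: "('k::field, 'o, 'm::ab_group_add) lincat" and D0 D1 io +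
 fixes P :: 'o
 assumes sums: "(!!i. i < (k::nat) ==> X i:Obj C) ==> EX S:Obj C. EX inj prj.
	 (ALL i<k. inj i:Hom C (X i) S & prj i:Hom C S (X i)) &
	 (ALL i<k. ALL j<k. Cmp C (prj i) (inj j) = (if i = j then Idm C (X i) else 0)) &
	 (\<Sum>i<k. Cmp C (inj i) (prj i)) = Idm C (S :: 'o)"
	and P: "P:Obj C"
	and separator: "M:Obj C ==> N:Obj C ==> a:Hom C M N ==> (!!g. g:Hom C P M ==> Cmp C a g = 0) ==> a = 0"
	and annihilator: "M:Obj C ==> N:Obj C ==> th:lin (Scl C) (Hom C M N) (*) UNIV ==>
	 EX N':Obj C. EX v:Hom C N' N. (ALL g:Hom C M N'. th (Cmp C v g) = 0) &
		(ALL Y:Obj C. ALL h:Hom C Y N. (ALL g:Hom C M Y. th (Cmp C h g) = 0) --> (EX h':Hom C Y N'. h = Cmp C v h'))"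
begin

text \<open>\<open>S\<close> is a sum of copies of \<open>M\<close>, one for each basis vector of
  \<open>f(M)\<close>, and \<open>x\<close> is the tuple of all these basis vectors. The elements
  \<open>f(g) x\<close> form a subspace, the image of a linear map; a functional that kills it kills
  everything that comes from \<open>f(M)\<close>.\<close>

lemma gen_single:
 assumes f: "f:Obj (FunK C)" and g: "gen M f"
 shows "EX S:Obj C. EX x:Fo f S. ALL X:Obj C. ALL y:Fo f X. EX g:Hom C S X. y = Fm f S X g x"
proof -
 have M: "M:Obj C" using g by (simp add: gen_def)
 note V = FobjD(1)[OF f M]
 let ?B = "bas vscale (Fo f M)"
 obtain e where e: "bij_betw e {..<card ?B} ?B" using ex_bij_betw_nat_finite[OF bas(1)[OF V]] by (auto simp: atLeast0LessThan)
 let ?k = "card ?B"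
 obtain S i p where S: "S:Obj C" and ip0: "ALL j<?k. i j:Hom C M S & p j:Hom C S M"
	and pi0: "ALL j<?k. ALL l<?k. Cmp C (p j) (i l) = (if j = l then Idm C M else 0)"
	using sums[of ?k "%_. M", OF M] by blast
 note ip = ip0[rule_format, THEN conjunct1] ip0[rule_format, THEN conjunct2] and pi = pi0[rule_format]
 have eM: "e j:Fo f M" if "j < ?k" for j using e that bas(3)[OF V] by (auto simp: bij_betw_def)
 define x where "x = (\<Sum>j<?k. Fm f M S (i j) (e j))"
 note SV = subspD[OF fsub[OF FobjD(1)[OF f]]]
 have x: "x:Fo f S" unfolding x_def by (rule SV(6)[OF S]) (auto intro: Fm_in[OF f M S ip(1) eM])
 have px: "Fm f S M (p j) x = e j" if j: "j < ?k" for j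
 proof -
	have "Fm f S M (p j) x = (\<Sum>l<?k. Fm f S M (p j) (Fm f M S (i l) (e l)))"
	 unfolding x_def by (rule lin_more(4)[OF FobjD(2)[OF f S M ip(2)[OF j]] fsub[OF FobjD(1)[OF f S]] vs_v])
		(auto intro: Fm_in[OF f M S ip(1) eM])
	also have "... = (\<Sum>l<?k. if l = j then e j else 0)"
	proof (rule sum.cong[OF refl])
	 fix l assume "l:{..<?k}"
	 then have l: "l < ?k" by simp
	 show "Fm f S M (p j) (Fm f M S (i l) (e l)) = (if l = j then e j else 0)"
		using Fm_comp[OF f M S M ip(1)[OF l] ip(2)[OF j], of "e l"] pi[OF j l] Fm_id[OF f M eM[OF l]] Fm_zero[OF f M M eM[OF l]]
		by (auto split: if_splits)
	qed
	finally show ?thesis using j by simp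
 qed
 have "EX g:Hom C S X. y = Fm f S X g x" if X: "X:Obj C" and y: "y:Fo f X" for X y
 proof (rule ccontr)
	let ?U = "(%g. Fm f S X g x) ` Hom C S X"
	assume "~ ?thesis"
	then have yU: "y ~: ?U" by auto
	have U: "subsp vscale ?U" by (rule subsp_image[OF fsub[OF hom_fds[OF S X]] vs_v Fm_linon[OF f S X x]])
	obtain xi where xi: "xi:lin vscale (Fo f X) (*) UNIV" "ALL u:?U. xi u = 0" "xi y ~= 0"
	 using separation[OF FobjD(1)[OF f X] U _ y yU] Fm_in[OF f S X _ x] by blast
	have "xi y = 0"
	proof (rule genD[OF g X xi(1) _ y])
	 fix g z assume gh: "g:Hom C M X" and z: "z:Fo f M"
	 have 0: "xi (Fm f M X g (e j)) = 0" if j: "j < ?k" for j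
		using Fm_comp[OF f S M X ip(2)[OF j] gh, of x] px[OF j] xi(2) cmp[OF S M X ip(2)[OF j] gh] by force
	 have b: "xi (Fm f M X g b) = 0" if "b:?B" for b
	 proof -
		have "b:e ` {..<?k}" using e that by (simp add: bij_betw_def)
		then show ?thesis using 0 by auto
	 qed
	 show "xi (Fm f M X g z) = 0"
		using lin_bas[OF V _ linon_comp[OF lin_linon[OF FobjD(2)[OF f M X gh]] lin_linon[OF xi(1)]] z] b by simp
	qed
	then show False using xi(3) by simp
 qed
 then show ?thesis using S x by blast
qed

text \<open>Dual to \<open>gen_single\<close>: on a sum of copies of \<open>N\<close>, the
  functional \<open>ze\<close> adds up one coordinate of \<open>f(N)\<close> from each copy.
  Composing an arrow into \<open>N\<close> with one of the injections isolates a single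
  coordinate.\<close>

lemma cogen_single:
 assumes f: "f:Obj (FunK C)" and g: "cogen N f"
 shows "EX S:Obj C. EX ze:lin vscale (Fo f S) (*) UNIV. ALL X:Obj C. ALL y:Fo f X. (ALL h:Hom C X S. ze (Fm f X S h y) = 0) --> y = 0"
proof -
 have N: "N:Obj C" using g by (simp add: cogen_def)
 note V = FobjD(1)[OF f N]
 let ?B = "bas vscale (Fo f N)"
 obtain e where e: "bij_betw e {..<card ?B} ?B" using ex_bij_betw_nat_finite[OF bas(1)[OF V]] by (auto simp: atLeast0LessThan)
 let ?k = "card ?B"
 obtain S i p where S: "S:Obj C" and ip0: "ALL j<?k. i j:Hom C N S & p j:Hom C S N"
	and pi0: "ALL j<?k. ALL l<?k. Cmp C (p j) (i l) = (if j = l then Idm C N else 0)"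
	using sums[of ?k "%_. N", OF N] by blast
 note ip = ip0[rule_format, THEN conjunct1] ip0[rule_format, THEN conjunct2] and pi = pi0[rule_format]
 have eB: "e j:?B" if "j < ?k" for j using e that by (auto simp: bij_betw_def)
 define ze where "ze = (\<Sum>j<?k. cob vscale (Fo f N) (e j) o Fm f S N (p j))"
 have z: "ze:lin vscale (Fo f S) (*) UNIV" unfolding ze_def
	by (rule subspD(6)[OF subsp_linon])
	 (auto intro!: functional_comp[OF FobjD(2)[OF f S N ip(2)] bas(4)[OF V eB] V])
 have "y = 0" if X: "X:Obj C" and y: "y:Fo f X" and v: "ALL h:Hom C X S. ze (Fm f X S h y) = 0" for X y
 proof (rule cogenD[OF g X y])
	fix h assume h: "h:Hom C X N"
	have w: "Fm f X N h y:Fo f N" by (rule Fm_in[OF f X N h y])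
	have c: "cob vscale (Fo f N) (e j) (Fm f X N h y) = 0" if j: "j < ?k" for j
	proof -
	 note ih = cmp[OF X N S h ip(1)[OF j]]
	 have "ze (Fm f X S (Cmp C (i j) h) y) = (\<Sum>l<?k. if l = j then cob vscale (Fo f N) (e j) (Fm f X N h y) else 0)"
		unfolding ze_def sum_fun_apply comp_apply
	 proof (rule sum.cong[OF refl])
		fix l assume "l:{..<?k}"
		then have l: "l < ?k" by simp
		have "Fm f S N (p l) (Fm f X S (Cmp C (i j) h) y) = Fm f N N (Cmp C (p l) (i j)) (Fm f X N h y)"
		 using Fm_comp[OF f X N S h ip(1)[OF j], of y] Fm_comp[OF f N S N ip(1)[OF j] ip(2)[OF l], of "Fm f X N h y"] by simp
		also have "... = (if l = j then Fm f X N h y else 0)"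
		 using pi[OF l j] Fm_id[OF f N w] Fm_zero[OF f N N w] by simp
		finally show "cob vscale (Fo f N) (e l) (Fm f S N (p l) (Fm f X S (Cmp C (i j) h) y)) =
		 (if l = j then cob vscale (Fo f N) (e j) (Fm f X N h y) else 0)"
		 using lin_more(1)[OF bas(4)[OF V eB[OF l]] fsub[OF V]] by simp
	 qed
	 then show ?thesis using v ih j by simp
	qed
	have "cob vscale (Fo f N) b (Fm f X N h y) = 0" if "b:?B" for b
	proof -
	 have "b:e ` {..<?k}" using e that by (simp add: bij_betw_def)
	 then show ?thesis using c by auto
	qed
	then have "(SUM b:?B. vscale (cob vscale (Fo f N) b (Fm f X N h y)) b) = 0" by (simp add: vs_simps[OF vs_v])
	then show "Fm f X N h y = 0" using bas(6)[OF V w] by simp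
 qed
 then show ?thesis using S z by blast
qed

text \<open>Let \<open>x\<close> generate \<open>f\<close>, let \<open>ze\<close> on
  \<open>g(N)\<close> detect the elements of \<open>g\<close>, and let
  \<open>v : N' \<rightarrow> N\<close> be the arrow that \<open>annihilator\<close> gives for
  \<open>theta(h) = ze(g(h)(al x))\<close>. Suppose that every arrow
  \<open>X \<rightarrow> N'\<close> carries \<open>y\<close> into the image of \<open>al\<close>. If
  \<open>h : X \<rightarrow> N\<close> satisfies \<open>theta(h g') = 0\<close> for all
  \<open>g'\<close>, then \<open>h = v h'\<close>, and \<open>ze(g(h) y) = theta(v g'') = 0\<close>
  for some \<open>g''\<close>. By double annihilators the functional
  \<open>h \<mapsto> ze(g(h) y)\<close> equals \<open>h \<mapsto> theta(h g')\<close> for some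
  \<open>g'\<close>. Hence \<open>y\<close> is the image of \<open>al x\<close> under
  \<open>g'\<close>, which lies in the image of \<open>al\<close>.\<close>

lemma coker_cogen:
 assumes f: "f:Obj (FunK C)" "g:Obj (FunK C)" "Q:Obj (FunK C)"
	and a: "al:Hom (FunK C) f g" and q: "q:Hom (FunK C) g Q" and pw: "pw_cok f g al Q q"
	and gg: "gen M0 f" "cogen N0 g"
 shows "EX N'. cogen N' Q"
proof -
 obtain M x where M: "M:Obj C" and x: "x:Fo f M"
	and gx: "!!X y. X:Obj C ==> y:Fo f X ==> EX g:Hom C M X. y = Fm f M X g x" using gen_single[OF f(1) gg(1)] by blast
 obtain N ze where N: "N:Obj C" and z: "ze:lin vscale (Fo g N) (*) UNIV"
	and zy: "!!X y. X:Obj C ==> y:Fo g X ==> (!!h. h:Hom C X N ==> ze (Fm g X N h y) = 0) ==> y = 0"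
	using cogen_single[OF f(2) gg(2)] by blast
 let ?x = "al M x"
 note ax = hom_in[OF a M x]
 define th where "th = restr (Hom C M N) (%h. ze (Fm g M N h ?x))"
 have zl: "linon (Scl C) (Hom C X N) (*) UNIV (%h. ze (Fm g X N h y))" if "X:Obj C" "y:Fo g X" for X y
	by (rule linon_comp[OF Fm_linon[OF f(2) that(1) N that(2)] lin_linon[OF z]])
 have th: "th:lin (Scl C) (Hom C M N) (*) UNIV"
	unfolding th_def by (rule restr_lin[OF fsub[OF hom_fds[OF M N]] zl[OF M ax]])
 obtain N' v where N': "N':Obj C" and v1: "v:Hom C N' N" and v2: "ALL g:Hom C M N'. th (Cmp C v g) = 0"
	and v3: "ALL Y:Obj C. ALL h:Hom C Y N. (ALL g:Hom C M Y. th (Cmp C h g) = 0) --> (EX h':Hom C Y N'. h = Cmp C v h')"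
	using annihilator[OF M N th] by blast
 have v: "v:Hom C N' N" "!!g. g:Hom C M N' ==> th (Cmp C v g) = 0"
	"!!X h. X:Obj C ==> h:Hom C X N ==> (!!g. g:Hom C M X ==> th (Cmp C h g) = 0) ==> EX h':Hom C X N'. h = Cmp C v h'"
	using v1 v2 v3 by (simp_all add: Ball_def)
 have im: "y : al X ` Fo f X \<longleftrightarrow> (EX g':Hom C M X. y = Fm g M X g' ?x)" if X: "X:Obj C" for X y
 proof
	assume "y : al X ` Fo f X"
	then obtain z where z: "z:Fo f X" "y = al X z" by blast
	obtain g' where g': "g':Hom C M X" "z = Fm f M X g' x" using gx[OF X z(1)] by blast
	show "EX g':Hom C M X. y = Fm g M X g' ?x" using FhomD(2)[OF a M X g'(1), of x] g' z(2) by auto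
 next
	assume "EX g':Hom C M X. y = Fm g M X g' ?x"
	then obtain g' where g': "g':Hom C M X" "y = Fm g M X g' ?x" by blast
	then have "y = al X (Fm f M X g' x)" using FhomD(2)[OF a M X g'(1), of x] by simp
	then show "y : al X ` Fo f X" using Fm_in[OF f(1) M X g'(1) x] by blast
 qed
 have pq: "q X ` Fo g X = Fo Q X" "!!y. y:Fo g X ==> q X y = 0 \<longleftrightarrow> y : al X ` Fo f X" if X: "X:Obj C" for X
 proof -
	show "q X ` Fo g X = Fo Q X" using pw X by (simp add: pw_cok_def)
	have "{y:Fo g X. q X y = 0} = al X ` Fo f X" using pw X by (simp add: pw_cok_def)
	then show "!!y. y:Fo g X ==> q X y = 0 \<longleftrightarrow> y : al X ` Fo f X" by blast
 qed
 have "cogen N' Q"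
	unfolding cogen_def
 proof (intro conjI ballI impI)
	fix X w assume X: "X:Obj C" and w: "w:Fo Q X" and vv: "ALL k:Hom C X N'. Fm Q X N' k w = 0"
	obtain y where y: "y:Fo g X" "w = q X y" using pq(1)[OF X] w by blast
	have ky: "Fm g X N' k y : al N' ` Fo f N'" if k: "k:Hom C X N'" for k
	 using vv k FhomD(2)[OF q X N' k, of y] y(2) pq(2)[OF N' Fm_in[OF f(2) X N' k y(1)]] by simp
	let ?om = "restr (Hom C X N) (%h. ze (Fm g X N h y))"
	let ?S = "(%g'. restr (Hom C X N) (%h. ze (Fm g X N h (Fm g M X g' ?x)))) ` Hom C M X"
	have rl: "restr (Hom C X N) (%h. ze (Fm g X N h y)):lin (Scl C) (Hom C X N) (*) UNIV" if "y:Fo g X" for y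
	 by (rule restr_lin[OF fsub[OF hom_fds[OF X N]] zl[OF X that]])
	have gin: "Fm g M X g' ?x:Fo g X" if "g':Hom C M X" for g' by (rule Fm_in[OF f(2) M X that ax])
	have "?om:?S"
	proof (rule annihilator_annihilator[OF hom_fds[OF X N] _ _ rl[OF y(1)]])
	 show "?S <= lin (Scl C) (Hom C X N) (*) UNIV" using rl[OF gin] by blast
	 show "subsp (fscale (*)) ?S"
	 proof (rule subsp_image[OF fsub[OF hom_fds[OF M X]]])
		have e: "ze (Fm g X N h (a + b)) = ze (Fm g X N h a) + ze (Fm g X N h b)" "ze (Fm g X N h (vscale c a)) = c * ze (Fm g X N h a)"
		 if "h:Hom C X N" "a:Fo g X" "b:Fo g X" for a b h c
		 using linD[OF FobjD(2)[OF f(2) X N that(1)]] linD[OF z] that by simp_all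
		show "linon (Scl C) (Hom C M X) (fscale (*)) (lin (Scl C) (Hom C X N) (*) UNIV) (%g'. restr (Hom C X N) (%h. ze (Fm g X N h (Fm g M X g' ?x))))"
		 unfolding linon_def
		proof (intro conjI ballI allI ext)
		 show "restr (Hom C X N) (%h. ze (Fm g X N h (Fm g M X g' ?x))):lin (Scl C) (Hom C X N) (*) UNIV"
			if "g':Hom C M X" for g' by (rule rl[OF gin[OF that]])
		 show "restr (Hom C X N) (%h. ze (Fm g X N h (Fm g M X (a + b) ?x))) h =
			(restr (Hom C X N) (%h. ze (Fm g X N h (Fm g M X a ?x))) + restr (Hom C X N) (%h. ze (Fm g X N h (Fm g M X b ?x)))) h"
			if "a:Hom C M X" "b:Hom C M X" for a b h
			using e(1)[OF _ gin[OF that(1)] gin[OF that(2)]] linonD(2)[OF Fm_linon[OF f(2) M X ax] that]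
			by (cases "h:Hom C X N") simp_all
		 show "restr (Hom C X N) (%h. ze (Fm g X N h (Fm g M X (Scl C c a) ?x))) h =
			fscale (*) c (restr (Hom C X N) (%h. ze (Fm g X N h (Fm g M X a ?x)))) h"
			if "a:Hom C M X" for a c h
			using e(2)[OF _ gin[OF that] gin[OF that]] linonD(3)[OF Fm_linon[OF f(2) M X ax] that]
			by (cases "h:Hom C X N") (simp_all add: fsc_app)
		qed
	 qed simp
	 fix h assume h: "h:Hom C X N" and 0: "!!xi. xi:?S ==> xi h = 0"
	 have "EX h':Hom C X N'. h = Cmp C v h'"
	 proof (rule v(3)[OF X h])
		fix g' assume g': "g':Hom C M X"
		have "restr (Hom C X N) (%h. ze (Fm g X N h (Fm g M X g' ?x))) h = 0" using 0 g' by blast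
		then show "th (Cmp C h g') = 0" using h cmp[OF M X N g' h] Fm_comp[OF f(2) M X N g' h, of ?x] by (simp add: th_def)
	 qed
	 then obtain h' where h': "h':Hom C X N'" "h = Cmp C v h'" by blast
	 obtain g'' where g'': "g'':Hom C M N'" "Fm g X N' h' y = Fm g M N' g'' ?x" using ky[OF h'(1)] im[OF N'] by blast
	 have "ze (Fm g X N h y) = ze (Fm g N' N v (Fm g M N' g'' ?x))"
		using Fm_comp[OF f(2) X N' N h'(1) v(1), of y] h'(2) g''(2) by simp
	 also have "... = th (Cmp C v g'')"
		using Fm_comp[OF f(2) M N' N g''(1) v(1), of ?x] cmp[OF M N' N g''(1) v(1)] by (simp add: th_def)
	 also have "... = 0" by (rule v(2)[OF g''(1)])
	 finally show "?om h = 0" using h by simp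
	qed
	then obtain g' where g': "g':Hom C M X" "?om = restr (Hom C X N) (%h. ze (Fm g X N h (Fm g M X g' ?x)))" by blast
	note gy = gin[OF g'(1)]
	have "y - Fm g M X g' ?x = 0"
	proof (rule zy[OF X subspD(5)[OF fsub[OF FobjD(1)[OF f(2) X]] y(1) gy]])
	 fix h assume h: "h:Hom C X N"
	 have "ze (Fm g X N h y) = ze (Fm g X N h (Fm g M X g' ?x))" using fun_cong[OF g'(2), of h] h by simp
	 then show "ze (Fm g X N h (y - Fm g M X g' ?x)) = 0"
		using lin_more(3)[OF FobjD(2)[OF f(2) X N h] fsub[OF FobjD(1)[OF f(2) X]] vs_v y(1) gy]
		 lin_more(3)[OF z fsub[OF FobjD(1)[OF f(2) N]] _ Fm_in[OF f(2) X N h y(1)] Fm_in[OF f(2) X N h gy]] by simp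
	qed
	then have "y : al X ` Fo f X" using im[OF X] g'(1) by auto
	then show "w = 0" using pq(2)[OF X y(1)] y(2) by simp
 qed (rule N')
 then show ?thesis by blast
qed

text \<open>The dual of the kernel is the cokernel of the dual map, to which
  \<open>coker_cogen\<close> applies; biduality brings the result back.\<close>

lemma ker_gen:
 assumes f: "f:Obj (FunK C)" "g:Obj (FunK C)" "K:Obj (FunK C)"
	and a: "al:Hom (FunK C) f g" and k: "k:Hom (FunK C) K f" and pw: "pw_ker f al K k"
	and gg: "gen M f" "cogen N g"
 shows "EX M'. gen M' K"
proof -
 obtain N' where N': "cogen N' (dF K)"
	using coker_cogen[OF dF_obj[OF f(2)] dF_obj[OF f(1)] dF_obj[OF f(3)] dFm_hom[OF f(1,2) a] dFm_hom[OF f(3,1) k]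
		pw_ker_dual[OF f a k pw] cogen_dual[OF f(2) gg(2)] gen_dual[OF f(1) gg(1)]] by blast
 have s: "iF' K X ` Fo (dF (dF K)) X = Fo K X" if X: "X:Obj C" for X
 proof
	show "iF' K X ` Fo (dF (dF K)) X <= Fo K X" using hom_in[OF iF'_hom(1)[OF f(3)] X] by blast
	show "Fo K X <= iF' K X ` Fo (dF (dF K)) X"
	proof
	 fix x assume x: "x:Fo K X"
	 have "x = iF' K X (iF K X x)"
		using fun_cong[OF fun_cong[OF iF'_hom(2)[OF f(3)], of X], of x] X x by (simp add: FunK_sel(3,4) id_on_def)
	 then show "x:iF' K X ` Fo (dF (dF K)) X" using hom_in[OF iF_hom[OF f(3)] X x] by (rule image_eqI)
	qed
 qed
 show ?thesis
	using gen_quotient[OF dF_obj[OF dF_obj[OF f(3)]] f(3) iF'_hom(1)[OF f(3)] s cogen_dual[OF dF_obj[OF f(3)] N']] by blast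
qed

text \<open>Arrows out of the separator \<open>P\<close> detect zero arrows. Dualized, arrows into
  \<open>D0 P\<close> detect them, and this is cogeneration of \<open>Hom(M, -)\<close>.\<close>

lemma hrep_cogen:
 assumes M: "M:Obj C" shows "cogen (D0 P) (hrep C M)"
 unfolding cogen_def
proof (intro conjI ballI impI)
 show DP: "D0 P:Obj C" by (rule D_obj[OF P])
 fix X y assume X: "X:Obj C" and y: "y:Fo (hrep C M) X" and v: "ALL g:Hom C X (D0 P). Fm (hrep C M) X (D0 P) g y = 0"
 let ?h = "dec (Scl C) (Hom C M X) y"
 have h: "y = coords (Scl C) (Hom C M X) ?h" "?h:Hom C M X" using y by (simp_all add: hrep_Fo)
 have gh: "Cmp C g ?h = 0" if g: "g:Hom C X (D0 P)" for g
 proof -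
	have "coords (Scl C) (Hom C M (D0 P)) (Cmp C g ?h) = coords (Scl C) (Hom C M (D0 P)) 0"
	 using v g hrep_Fm[OF M X h(2), of "D0 P" g] h(1) coords_zero[OF hom_fds[OF M DP]] by simp
	then show ?thesis
	 by (rule coords_inj[OF hom_fds[OF M DP] cmp[OF M X DP h(2) g] hom_closed(1)[OF M DP]])
 qed
 note d = D_obj[OF M] D_obj[OF X]
 have "D1 M X ?h = 0"
 proof (rule separator[OF d(2,1) D_hom[OF M X h(2)]])
	fix u assume u: "u:Hom C P (D0 X)"
	obtain g where g: "g:Hom C X (D0 P)" "Cmp C (D1 X (D0 P) g) (io P) = u" using D_surj[OF X P u] by blast
	have z: "Cmp C 0 w = 0" for w using addl[of 0 0 w] by simp
	have z': "D1 M (D0 P) 0 = 0" using D_add[OF M DP hom_closed(1)[OF M DP] hom_closed(1)[OF M DP]] by simp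
	show "Cmp C (D1 M X ?h) u = 0"
	 using D_comp[OF M X DP h(2) g(1)] gh[OF g(1)] g(2) z z' assoc[of "D1 M X ?h" "D1 X (D0 P) g" "io P"] by simp
 qed
 then have "?h = 0" by (rule D_faithful[OF M X h(2)])
 then show "y = 0" using h(1) coords_zero[OF hom_fds[OF M X]] by simp
qed

text \<open>From right to left, \<open>gen_single\<close> covers \<open>f\<close> by a representable
  functor. The kernel of this cover is generated because \<open>f\<close> is cogenerated, so it is
  covered by a representable functor in turn.\<close>

lemma coherent_iff:
 assumes f: "f:Obj (FunK C)"
 shows "coherent C f \<longleftrightarrow> (EX M. gen M f) & (EX N. cogen N f)"
proof
 assume "coherent C f"
 then obtain M N al be where MN: "M:Obj C" "N:Obj C" and a: "al:Hom (FunK C) (hrep C N) (hrep C M)"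
	and b: "be:Hom (FunK C) (hrep C M) f"
	and sk: "ALL X:Obj C. be X ` Fo (hrep C M) X = Fo f X & {y:Fo (hrep C M) X. be X y = 0} = al X ` Fo (hrep C N) X"
	unfolding coherent_def by blast
 have s: "!!X. X:Obj C ==> be X ` Fo (hrep C M) X = Fo f X"
	and k: "!!X. X:Obj C ==> {y:Fo (hrep C M) X. be X y = 0} = al X ` Fo (hrep C N) X"
	using bspec[OF sk] by simp_all
 have "pw_cok (hrep C N) (hrep C M) al f be" using s k by (simp add: pw_cok_def)
 from coker_cogen[OF hrep_obj[OF MN(2)] hrep_obj[OF MN(1)] f a b this hrep_gen[OF MN(2)] hrep_cogen[OF MN(1)]]
	gen_quotient[OF hrep_obj[OF MN(1)] f b s hrep_gen[OF MN(1)]]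
 show "(EX M. gen M f) & (EX N. cogen N f)" by blast
next
 assume "(EX M. gen M f) & (EX N. cogen N f)"
 then obtain M0 N0 where g: "gen M0 f" "cogen N0 f" by blast
 obtain M x where M: "M:Obj C" and x: "x:Fo f M"
	and gx: "!!X y. X:Obj C ==> y:Fo f X ==> EX g:Hom C M X. y = Fm f M X g x" using gen_single[OF f g(1)] by blast
 let ?b = "yon M f x"
 note b = yon_hom[OF M f x] and hM = hrep_obj[OF M]
 obtain K k where K: "K:Obj (FunK C)" and k: "k:Hom (FunK C) K (hrep C M)" and pk: "pw_ker (hrep C M) ?b K k"
	using pw_ker_ex[OF hM f b] by blast
 obtain M1 where M1: "gen M1 K" using ker_gen[OF hM f K b k pk hrep_gen[OF M] g(2)] by blast
 obtain N u where N: "N:Obj C" and u: "u:Fo K N"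
	and gu: "!!X y. X:Obj C ==> y:Fo K X ==> EX g:Hom C N X. y = Fm K N X g u" using gen_single[OF K M1] by blast
 let ?a = "Cmp (FunK C) k (yon N K u)"
 note y = yon_hom[OF N K u]
 have a: "?a:Hom (FunK C) (hrep C N) (hrep C M)" by (rule FunK_cmp[OF hrep_obj[OF N] K hM y k])
 have sy: "yon M f x X ` Fo (hrep C M) X = Fo f X"
	if M: "M:Obj C" and f: "f:Obj (FunK C)" and x: "x:Fo f M" and X: "X:Obj C"
	 and gx: "!!y. y:Fo f X ==> EX g:Hom C M X. y = Fm f M X g x" for M f x X
 proof
	show "yon M f x X ` Fo (hrep C M) X <= Fo f X" using hom_in[OF yon_hom[OF M f x] X] by blast
	show "Fo f X <= yon M f x X ` Fo (hrep C M) X"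
	proof
	 fix y assume "y:Fo f X"
	 then obtain h where h: "h:Hom C M X" "y = Fm f M X h x" using gx by blast
	 then have "y = yon M f x X (coords (Scl C) (Hom C M X) h)" using yon_coords[OF M X h(1)] by simp
	 then show "y:yon M f x X ` Fo (hrep C M) X" using h(1) by (simp add: hrep_Fo)
	qed
 qed
 have "?b X ` Fo (hrep C M) X = Fo f X & {y:Fo (hrep C M) X. ?b X y = 0} = ?a X ` Fo (hrep C N) X" if X: "X:Obj C" for X
 proof
	show "?b X ` Fo (hrep C M) X = Fo f X" by (rule sy[OF M f x X gx[OF X]])
	have "?a X ` Fo (hrep C N) X = k X ` Fo K X" using sy[OF N K u X gu[OF X]] by (simp add: FunK_sel(4) flip: image_image)
	then show "{y:Fo (hrep C M) X. ?b X y = 0} = ?a X ` Fo (hrep C N) X" using pk X by (simp add: pw_ker_def)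
 qed
 then show "coherent C f" unfolding coherent_def using M N a b by blast
qed

lemma coherent_zero:
 assumes Z: "Z:Obj (FunK C)" "!!X. X:Obj C ==> Fo Z X = {0}" shows "coherent C Z"
proof -
 have "gen P Z" using P Z(2) lin_more(1)[where s=vscale and V="{0}" and t="(*)" and W=UNIV]
	by (auto simp: gen_def functionals_def intro!: lin_more(1)[where s=vscale and V="{0}" and t="(*)" and W=UNIV])
 moreover have "cogen P Z" using P Z(2) by (auto simp: cogen_def)
 ultimately show ?thesis using coherent_iff[OF Z(1)] by blast
qed

lemma pair_sum:
 assumes "M:Obj C" "N:Obj C"
 shows "EX S:Obj C. EX i:Hom C M S. EX p:Hom C S M. EX i':Hom C N S. EX p':Hom C S N. Cmp C p i = Idm C M & Cmp C p' i' = Idm C N"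
proof -
 let ?X = "%j::nat. if j = 0 then M else N"
 have "?X j:Obj C" for j using assms by simp
 then obtain S i p where S: "S:Obj C" and ip: "ALL j<2. i j:Hom C (?X j) S & p j:Hom C S (?X j)"
	and pi: "ALL j<2. ALL l<2. Cmp C (p j) (i l) = (if j = l then Idm C (?X j) else 0)"
	using sums[of 2 ?X] by blast
 show ?thesis
	using S ip[rule_format, of 0] ip[rule_format, of 1] pi[rule_format, of 0 0] pi[rule_format, of 1 1]
	by (intro bexI[of _ S] bexI[of _ "i 0"] bexI[of _ "p 0"] bexI[of _ "i 1"] bexI[of _ "p 1"]) simp_all
qed

lemma coherent_biproduct:
 assumes F: "F:Obj (FunK C)" "G:Obj (FunK C)" "coherent C F" "coherent C G" and b: "biproduct (FunK C) F G S i1 i2 p1 p2"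
 shows "coherent C S"
proof -
 have S: "S:Obj (FunK C)" using b by (simp add: biproduct_def)
 obtain M N M' N' where g: "gen M F" "cogen N F" "gen M' G" "cogen N' G"
	using F(3,4) coherent_iff[OF F(1)] coherent_iff[OF F(2)] by blast
 have o: "M:Obj C" "N:Obj C" "M':Obj C" "N':Obj C" using g by (simp_all add: gen_def cogen_def)
 obtain A i p i' p' where A: "A:Obj C" "i:Hom C M A" "p:Hom C A M" "i':Hom C M' A" "p':Hom C A M'"
	"Cmp C p i = Idm C M" "Cmp C p' i' = Idm C M'" using pair_sum[OF o(1,3)] by blast
 have gA: "gen A F" "gen A G" by (rule gen_retract[OF F(1) g(1) A(1,2,3,6)], rule gen_retract[OF F(2) g(3) A(1,4,5,7)])
 obtain B i p i' p' where B: "B:Obj C" "i:Hom C N B" "p:Hom C B N" "i':Hom C N' B" "p':Hom C B N'"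
	"Cmp C p i = Idm C N" "Cmp C p' i' = Idm C N'" using pair_sum[OF o(2,4)] by blast
 have "cogen B F" "cogen B G" by (rule cogen_retract[OF F(1) g(2) B(1,2,3,6)], rule cogen_retract[OF F(2) g(4) B(1,4,5,7)])
 with gA show ?thesis
	using gen_biproduct[OF F(1,2) b] cogen_biproduct[OF F(1,2) b] coherent_iff[OF S] by blast
qed

lemma coherent_ker:
 assumes f: "F:Obj (FunK C)" "G:Obj (FunK C)" "K:Obj (FunK C)" "coherent C F" "coherent C G"
	and a: "al:Hom (FunK C) F G" and k: "k:Hom (FunK C) K F" and pw: "pw_ker F al K k"
 shows "coherent C K"
proof -
 obtain M N N' where g: "gen M F" "cogen N F" "cogen N' G"
	using f(4,5) coherent_iff[OF f(1)] coherent_iff[OF f(2)] by blast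
 have "inj_on (k X) (Fo K X)" if "X:Obj C" for X using pw that by (simp add: pw_ker_def)
 from cogen_sub[OF f(3,1) k this g(2)] ker_gen[OF f(1,2,3) a k pw g(1,3)] show ?thesis
	using coherent_iff[OF f(3)] by blast
qed

lemma coherent_cok:
 assumes f: "F:Obj (FunK C)" "G:Obj (FunK C)" "Q:Obj (FunK C)" "coherent C F" "coherent C G"
	and a: "al:Hom (FunK C) F G" and q: "q:Hom (FunK C) G Q" and pw: "pw_cok F G al Q q"
 shows "coherent C Q"
proof -
 obtain M N M' where g: "gen M F" "cogen N G" "gen M' G"
	using f(4,5) coherent_iff[OF f(1)] coherent_iff[OF f(2)] by blast
 have "q X ` Fo G X = Fo Q X" if "X:Obj C" for X using pw that by (simp add: pw_cok_def)
 from gen_quotient[OF f(2,3) q this g(3)] coker_cogen[OF f(1,2,3) a q pw g(1,2)] show ?thesis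
	using coherent_iff[OF f(3)] by blast
qed

lemma coherent_dual:
 assumes f: "F:Obj (FunK C)" "coherent C F" shows "coherent C (dF F)"
 using f gen_dual[OF f(1)] cogen_dual[OF f(1)] coherent_iff[OF f(1)] coherent_iff[OF dF_obj[OF f(1)]] by blast

text \<open>\<open>bF N W\<close> is the functor \<open>X \<mapsto> lin(Hom(X, N), W)\<close>, a sum
  of \<open>dim W\<close> copies of the dual of \<open>Hom(-, N)\<close>. It is cogenerated by
  \<open>N\<close> and generated by \<open>P\<close>; the values of the right adjoint will be
  kernels of maps between such functors.\<close>

definition bF :: "'o => 'k vec set => ('k, 'o, 'm) vfunc" where
 "bF N W = (let s = fscale vscale; H = (%X. lin (Scl C) (Hom C X N) vscale W) in
	 \<lparr>Fo = %X. model s (H X),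
	 Fm = %X Y g. tmap s (H X) s (H Y) (%ph. restr (Hom C Y N) (%h. ph (Cmp C h g)))\<rparr>)"

abbreviation "bH N W X == lin (Scl C) (Hom C X N) vscale W"

lemma bF_Fo: "Fo (bF N W) X = model (fscale vscale) (bH N W X)" by (simp add: bF_def Let_def)
lemma bF_Fm: "Fm (bF N W) X Y g = tmap (fscale vscale) (bH N W X) (fscale vscale) (bH N W Y) (%ph. restr (Hom C Y N) (%h. ph (Cmp C h g)))"
 by (simp add: bF_def Let_def)

lemma bH_fds: "N:Obj C ==> X:Obj C ==> fds vscale W ==> fds (fscale vscale) (bH N W X)"
 by (rule fds_lin) auto

lemma bF_lin:
 assumes N: "N:Obj C" and W: "fds vscale W" and XY: "X:Obj C" "Y:Obj C" "g:Hom C X Y"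
 shows "linon (fscale vscale) (bH N W X) (fscale vscale) (bH N W Y) (%ph. restr (Hom C Y N) (%h. ph (Cmp C h g)))"
proof -
 have "restr (Hom C Y N) (%h. ph (Cmp C h g)):bH N W Y" if "ph:bH N W X" for ph
	by (rule restr_lin[OF fsub[OF hom_fds[OF XY(2) N]] linon_comp[OF cmp_linon(2)[OF XY(1,2) N XY(3)] lin_linon[OF that]]])
 then show ?thesis by (auto simp: linon_def restr_def fscale_def[of vscale] fscale_def[of "(*)"] fun_eq_iff)
qed

lemma bF_obj:
 assumes N: "N:Obj C" and W: "fds vscale W" shows "bF N W:Obj (FunK C)"
proof (rule FunK_objI)
 note H = bH_fds[OF N _ W] and L = bF_lin[OF N W]
 show "fds vscale (Fo (bF N W) X)" if "X:Obj C" for X using H[OF that] by (simp add: bF_Fo)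
 show "Fm (bF N W) X Y f:vlin (Fo (bF N W) X) (Fo (bF N W) Y)" if "X:Obj C" "Y:Obj C" "f:Hom C X Y" for X Y f
	unfolding bF_Fo bF_Fm by (rule tmap_lin[OF H[OF that(1)] H[OF that(2)] L[OF that]])
 show "Fm (bF N W) X X (Idm C X) = id_on (Fo (bF N W) X)" if "X:Obj C" for X
	unfolding bF_Fo bF_Fm tmap_id[symmetric]
	by (rule tmap_cong) (use idr[OF that N] lin_out in \<open>fastforce simp: restr_def fun_eq_iff\<close>)
 show "Fm (bF N W) X Z (Cmp C g f) = Fm (bF N W) Y Z g o Fm (bF N W) X Y f"
	if h: "X:Obj C" "Y:Obj C" "Z:Obj C" "f:Hom C X Y" "g:Hom C Y Z" for X Y Z f g
 proof -
	let ?m = "%X Y g ph. restr (Hom C Y N) (%h. ph (Cmp C h g))"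
	have "(%ph. ?m Y Z g (?m X Y f ph)) = (?m X Z (Cmp C g f) :: ('m => 'k vec) => _)"
	 using cmp[OF h(2,3) N h(5)] by (auto simp: restr_def fun_eq_iff assoc)
	moreover have "?m Y Z g 0 = (0 :: 'm => 'k vec)" by (auto simp: restr_def)
	ultimately show ?thesis
	 using tmap_comp[where f="?m X Y f" and g="?m Y Z g", OF H[OF h(1)] H[OF h(2)] linonD(1)[OF L[OF h(1,2,4)]] H[OF h(3)]]
	 by (simp add: bF_Fm)
 qed
 show "Fm (bF N W) X Y (f + g) = Fm (bF N W) X Y f + Fm (bF N W) X Y g"
	if h: "X:Obj C" "Y:Obj C" "f:Hom C X Y" "g:Hom C X Y" for X Y f g
 proof -
	have "Fm (bF N W) X Y (f + g) = tmap (fscale vscale) (bH N W X) (fscale vscale) (bH N W Y)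
	 (%ph. restr (Hom C Y N) (%h. ph (Cmp C h f)) + restr (Hom C Y N) (%h. ph (Cmp C h g)))"
	 unfolding bF_Fm
	proof (rule tmap_cong)
	 fix ph assume p: "ph:bH N W X"
	 show "restr (Hom C Y N) (%h. ph (Cmp C h (f + g))) = restr (Hom C Y N) (%h. ph (Cmp C h f)) + restr (Hom C Y N) (%h. ph (Cmp C h g))"
	 proof
		fix u show "restr (Hom C Y N) (%h. ph (Cmp C h (f + g))) u = (restr (Hom C Y N) (%h. ph (Cmp C h f)) + restr (Hom C Y N) (%h. ph (Cmp C h g))) u"
		 using addr[OF h(1,2) N h(3,4)] cmp[OF h(1,2) N h(3)] cmp[OF h(1,2) N h(4)] linD(2)[OF p] by (cases "u:Hom C Y N") simp_all
	 qed
	qed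
	also have "... = Fm (bF N W) X Y f + Fm (bF N W) X Y g"
	 unfolding bF_Fm by (rule tmap_add[OF H[OF h(2)]]) (use linonD(1)[OF L[OF h(1,2,3)]] linonD(1)[OF L[OF h(1,2,4)]] in blast)
	finally show ?thesis .
 qed
 show "Fm (bF N W) X Y (Scl C c f) = fscale vscale c (Fm (bF N W) X Y f)"
	if h: "X:Obj C" "Y:Obj C" "f:Hom C X Y" for X Y f c
 proof -
	have "Fm (bF N W) X Y (Scl C c f) = tmap (fscale vscale) (bH N W X) (fscale vscale) (bH N W Y)
	 (%ph. fscale vscale c (restr (Hom C Y N) (%h. ph (Cmp C h f))))"
	 unfolding bF_Fm
	proof (rule tmap_cong)
	 fix ph assume p: "ph:bH N W X"
	 show "restr (Hom C Y N) (%h. ph (Cmp C h (Scl C c f))) = fscale vscale c (restr (Hom C Y N) (%h. ph (Cmp C h f)))"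
	 proof
		fix u show "restr (Hom C Y N) (%h. ph (Cmp C h (Scl C c f))) u = fscale vscale c (restr (Hom C Y N) (%h. ph (Cmp C h f))) u"
		 using sclr[OF h(1,2) N h(3)] cmp[OF h(1,2) N h(3)] linD(3)[OF p]
		 by (cases "u:Hom C Y N") (simp_all add: fscale_def[of vscale] vs_simps[OF vs_v])
	 qed
	qed
	also have "... = fscale vscale c (Fm (bF N W) X Y f)"
	 unfolding bF_Fm by (rule tmap_scale[OF H[OF h(2)]]) (use linonD(1)[OF L[OF h]] in blast)
	finally show ?thesis .
 qed
qed

lemma bF_cogen:
 assumes N: "N:Obj C" and W: "fds vscale W" shows "cogen N (bF N W)"
 unfolding cogen_def
proof (intro conjI ballI impI)
 note H = bH_fds[OF N _ W] and L = bF_lin[OF N W]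
 fix X y assume X: "X:Obj C" and "y:Fo (bF N W) X" and v: "ALL g:Hom C X N. Fm (bF N W) X N g y = 0"
 then have y: "y:model (fscale vscale) (bH N W X)" by (simp add: bF_Fo)
 let ?p = "dec (fscale vscale) (bH N W X) y"
 have p: "?p:bH N W X" using y by simp
 have "?p g = 0" if g: "g:Hom C X N" for g
 proof -
	have "coords (fscale vscale) (bH N W N) (restr (Hom C N N) (%h. ?p (Cmp C h g))) = coords (fscale vscale) (bH N W N) 0"
	 using v g y coords_zero[OF H[OF N]] by (simp add: bF_Fm)
	then have "restr (Hom C N N) (%h. ?p (Cmp C h g)) = 0"
	 by (rule coords_inj[OF H[OF N] linonD(1)[OF L[OF X N g] p] subspD(1)[OF fsub[OF H[OF N]]]])
	from fun_cong[OF this, of "Idm C N"] show ?thesis using idm[OF N] idl[OF X N g] by simp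
 qed
 then have "?p = 0" by (intro lin_eqI[OF p subspD(1)[OF fsub[OF H[OF X]]]]) simp
 then show "y = 0" using coords_dec[OF y] coords_zero[OF H[OF X]] by simp
qed (rule N)

text \<open>The space \<open>lin(Hom(X, N), W)\<close> is spanned by the maps
  \<open>om(-) w\<close>. For fixed \<open>w\<close>, \<open>xi\<close> becomes a functional of
  \<open>om\<close>, hence evaluation at some \<open>a : X \<rightarrow> N\<close>. As
  \<open>xi\<close> kills everything that comes from \<open>P\<close>, \<open>a g = 0\<close> for
  all \<open>g : P \<rightarrow> X\<close>, and \<open>separator\<close> gives
  \<open>a = 0\<close>.\<close>

lemma bF_gen:
 assumes N: "N:Obj C" and W: "fds vscale W" shows "gen P (bF N W)"
 unfolding gen_def functionals_def
proof (intro conjI ballI impI)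
 note H = bH_fds[OF N _ W] and L = bF_lin[OF N W]
 fix X xi y assume X: "X:Obj C" and xi: "xi:lin vscale (Fo (bF N W) X) (*) UNIV" and y: "y:Fo (bF N W) X"
	and v: "ALL g:Hom C P X. ALL x:Fo (bF N W) P. xi (Fm (bF N W) P X g x) = 0"
 let ?c = "coords (fscale vscale) (bH N W X)"
 have xl: "linon (fscale vscale) (bH N W X) (*) UNIV (%ph. xi (?c ph))"
	using linon_comp[OF coords_linon[OF H[OF X]], of "(*)" UNIV xi] xi by (simp add: bF_Fo lin_linon)
 have el: "elem vscale om w:bH N W Z" if "om:lin (Scl C) (Hom C Z N) (*) UNIV" "w:W" for om w Z
	by (rule elem_lin[OF fsub[OF W] that])
 have z: "xi (?c (elem vscale om w)) = 0" if o: "om:lin (Scl C) (Hom C X N) (*) UNIV" and w: "w:W" for om w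
 proof -
	have "linon (fscale (*)) (lin (Scl C) (Hom C X N) (*) UNIV) (*) UNIV (%om. xi (?c (elem vscale om w)))"
	proof (rule linon_comp[OF _ xl])
	 show "linon (fscale (*)) (lin (Scl C) (Hom C X N) (*) UNIV) (fscale vscale) (bH N W X) (%om. elem vscale om w)"
		using el[OF _ w] by (auto simp: linon_def elem_def fun_eq_iff fscale_def[of vscale] fscale_def[of "(*)"] algebra_simps)
	qed
	from bidual_rep[OF hom_fds[OF X N] this] obtain a where a: "a:Hom C X N"
	 "!!om. om:lin (Scl C) (Hom C X N) (*) UNIV ==> xi (?c (elem vscale om w)) = om a" by blast
	have "a = 0"
	proof (rule separator[OF X N a(1)], rule ccontr)
	 fix g assume g: "g:Hom C P X" and ne: "Cmp C a g ~= 0"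
	 obtain om' where o': "om':lin (Scl C) (Hom C P N) (*) UNIV" "om' (Cmp C a g) ~= 0"
		using separation0[OF hom_fds[OF P N] cmp[OF P X N g a(1)] ne] by blast
	 let ?o = "restr (Hom C X N) (%h. om' (Cmp C h g))"
	 have ol: "?o:lin (Scl C) (Hom C X N) (*) UNIV"
		by (rule restr_lin[OF fsub[OF hom_fds[OF X N]] linon_comp[OF cmp_linon(2)[OF P X N g] lin_linon[OF o'(1)]]])
	 note e = el[OF o'(1) w]
	 have "restr (Hom C X N) (%h. elem vscale om' w (Cmp C h g)) = elem vscale ?o w"
		by (auto simp: restr_def elem_def fun_eq_iff vs_simps[OF vs_v])
	 then have "Fm (bF N W) P X g (coords (fscale vscale) (bH N W P) (elem vscale om' w)) = ?c (elem vscale ?o w)"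
		using H[OF P] e by (simp add: bF_Fm)
	 then have "xi (?c (elem vscale ?o w)) = 0" using v g e by (metis bF_Fo coords_model)
	 then show False using a(2)[OF ol] a(1) o'(2) by simp
	qed
	then show ?thesis using a(2)[OF o] lin_more(1)[OF o fsub[OF hom_fds[OF X N]]] by simp
 qed
 let ?p = "dec (fscale vscale) (bH N W X) y"
 have p: "?p:bH N W X" "y = ?c ?p" using y by (simp_all add: bF_Fo)
 note B = bas[OF hom_fds[OF X N]]
 have "xi y = xi (?c (SUM b:bas (Scl C) (Hom C X N). elem vscale (cob (Scl C) (Hom C X N) b) (?p b)))"
	using lin_elem_sum[OF hom_fds[OF X N] fsub[OF W] p(1)] p(2) by simp
 also have "... = (SUM b:bas (Scl C) (Hom C X N). xi (?c (elem vscale (cob (Scl C) (Hom C X N) b) (?p b))))"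
	by (rule linon_more(4)[OF xl fsub[OF H[OF X]]]) (use el B linD(1)[OF p(1)] in auto)
 also have "... = 0" using z B linD(1)[OF p(1)] by simp
 finally show "xi y = 0" .
qed (rule P)

end

section \<open>Restriction to a full subcategory and its adjoints\<close>

lemma full_subcat_True: "full_subcat C (%_. True) = C"
 by (simp add: full_subcat_def)

context lcat
begin

text \<open>A transformation that is bijective on every object is a pointwise kernel of the zero
  arrow on its target; the universal property of the kernel provides the inverse.\<close>

lemma pw_iso:
 assumes F: "F:Obj (FunK C)" "F':Obj (FunK C)" and h: "et:Hom (FunK C) F F'"
	and b: "!!X. X:Obj C ==> inj_on (et X) (Fo F X)" "!!X. X:Obj C ==> et X ` Fo F X = Fo F' X"
 shows "iso_in (FunK C) F F' et"
proof -
 have z: "0:Hom (FunK C) F' F'" by (rule subspD(1)[OF FunK_subsp[OF F(2,2)]])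
 have "pw_ker F' 0 F et" using b by (simp add: pw_ker_def)
 from pw_ker_is_kernel[of F' F' F "%_. True", OF F(2,2,1) _ z h this]
 have k: "!!S g. S:Obj (FunK C) ==> g:Hom (FunK C) S F' ==> Cmp (FunK C) 0 g = 0 ==>
	EX! u. u:Hom (FunK C) S F & Cmp (FunK C) et u = g"
	by (simp add: is_kernel_def full_subcat_True)
 interpret a: acat "FunK C" using preadditive_FunK[of "%_. True"] by unfold_locales (simp_all add: full_subcat_True FunK_sel(4) comp_assoc)
 have c0: "Cmp (FunK C) 0 g = 0" for g :: "'o => 'k vec => 'k vec" by (auto simp: FunK_sel(4) fun_eq_iff)
 obtain u where u: "u:Hom (FunK C) F' F" "Cmp (FunK C) et u = Idm (FunK C) F'"
	using k[OF F(2) FunK_id[OF F(2)] c0] by blast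
 have "Cmp (FunK C) et (Cmp (FunK C) u et) = et" using u(2) a.idl[OF F h] by (simp flip: a.assoc)
 then have "Cmp (FunK C) u et = Idm (FunK C) F"
	using k[OF F(1) h c0] FunK_cmp[OF F(1,2,1) h u(1)] FunK_id[OF F(1)] a.idr[OF F h] by blast
 then show ?thesis using u h unfolding iso_in_def by blast
qed

end

text \<open>\<open>G\<close> is the full subcategory of \<open>C\<close> on the objects
  \<open>T V\<close>, with its own names for them. \<open>DG\<close> is a duality on the names,
  compared with \<open>D0\<close> by the isomorphisms \<open>ka V\<close>, and \<open>DG1\<close> is
  \<open>D1\<close> transported along these. \<open>dense\<close> says that each \<open>T V\<close>
  is a retract of a finite sum of copies of \<open>T E\<close>.\<close>

locale jcat = cohcat C D0 D1 io P
 for C :: "('k::field, 'o, 'm::ab_group_add) lincat" and D0 D1 io P +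
 fixes G :: "('k, 'q, 'm) lincat" and T :: "'q => 'o" and DG :: "'q => 'q" and DG1 :: "'q => 'q => 'm => 'm"
	and ka ka' :: "'q => 'm" and E :: 'q
 assumes T: "V:Obj G ==> T V:Obj C"
	and G_Hom: "Hom G V W = Hom C (T V) (T W)" and G_Idm: "Idm G V = Idm C (T V)"
	and G_Cmp: "Cmp G = Cmp C" and G_Scl: "Scl G = Scl C"
	and DG: "V:Obj G ==> DG V:Obj G"
	and kappa: "V:Obj G ==> ka V:Hom C (T (DG V)) (D0 (T V))" "V:Obj G ==> ka' V:Hom C (D0 (T V)) (T (DG V))"
	 "V:Obj G ==> Cmp C (ka' V) (ka V) = Idm C (T (DG V))" "V:Obj G ==> Cmp C (ka V) (ka' V) = Idm C (D0 (T V))"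
	and DG1: "V:Obj G ==> W:Obj G ==> f:Hom C (T V) (T W) ==>
	 DG1 V W f = Cmp C (ka' V) (Cmp C (D1 (T V) (T W) f) (ka W))"
	and E: "E:Obj G"
	and dense: "V:Obj G ==> EX (k::nat) a b. (ALL i<k. a i:Hom C (T E) (T V) & b i:Hom C (T V) (T E)) &
	 (\<Sum>i<k. Cmp C (a i) (b i)) = Idm C (T V)"
begin

sublocale G: lcat G
 by unfold_locales
	(auto simp: G_Hom G_Idm G_Cmp G_Scl T assoc addl scll
	 intro: idl[OF T T] idr[OF T T] cmp[OF T T T] addr[OF T T T] sclr[OF T T T])

text \<open>The biduality of \<open>C\<close> carried over: from \<open>T V\<close> to
  \<open>D0 (D0 (T V))\<close>, to \<open>D0 (T (DG V))\<close>, to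
  \<open>T (DG (DG V))\<close>.\<close>

definition ioG :: "'q => 'm" where
 "ioG V = Cmp C (ka' (DG V)) (Cmp C (D1 (T (DG V)) (D0 (T V)) (ka V)) (io (T V)))"

lemma kappa_cancel:
 assumes "V:Obj G" "X:Obj C"
 shows "h:Hom C X (D0 (T V)) ==> Cmp C (ka V) (Cmp C (ka' V) h) = h"
	"h:Hom C X (T (DG V)) ==> Cmp C (ka' V) (Cmp C (ka V) h) = h"
 using kappa(3,4)[OF assms(1)] idl[OF assms(2) D_obj[OF T[OF assms(1)]]] idl[OF assms(2) T[OF DG[OF assms(1)]]]
 by (simp_all flip: assoc)

lemma DG1_hom:
 assumes V: "V:Obj G" "W:Obj G" and f: "f:Hom C (T V) (T W)"
 shows "Cmp C (D1 (T V) (T W) f) (ka W):Hom C (T (DG W)) (D0 (T V))" "DG1 V W f:Hom C (T (DG W)) (T (DG V))"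
proof -
 note o = T[OF V(1)] T[OF V(2)] T[OF DG[OF V(1)]] T[OF DG[OF V(2)]]
 show 1: "Cmp C (D1 (T V) (T W) f) (ka W):Hom C (T (DG W)) (D0 (T V))"
	by (rule cmp[OF o(4) D_obj[OF o(2)] D_obj[OF o(1)] kappa(1)[OF V(2)] D_hom[OF o(1,2) f]])
 show "DG1 V W f:Hom C (T (DG W)) (T (DG V))"
	unfolding DG1[OF V f] by (rule cmp[OF o(4) D_obj[OF o(1)] o(3) 1 kappa(2)[OF V(1)]])
qed

lemma ioG_hom:
 assumes V: "V:Obj G"
 shows "Cmp C (D1 (T (DG V)) (D0 (T V)) (ka V)) (io (T V)):Hom C (T V) (D0 (T (DG V)))"
	"ioG V:Hom C (T V) (T (DG (DG V)))"
proof -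
 note o = T[OF V] T[OF DG[OF V]] T[OF DG[OF DG[OF V]]]
 show 1: "Cmp C (D1 (T (DG V)) (D0 (T V)) (ka V)) (io (T V)):Hom C (T V) (D0 (T (DG V)))"
	by (rule cmp[OF o(1) D_obj[OF D_obj[OF o(1)]] D_obj[OF o(2)] io_hom[OF o(1)] D_hom[OF o(2) D_obj[OF o(1)] kappa(1)[OF V]]])
 show "ioG V:Hom C (T V) (T (DG (DG V)))"
	unfolding ioG_def by (rule cmp[OF o(1) D_obj[OF o(2)] o(3) 1 kappa(2)[OF DG[OF V]]])
qed

sublocale G: lduality G DG DG1 ioG
proof (unfold_locales, unfold G_Hom G_Idm G_Cmp G_Scl)
 fix X Y f assume X: "X:Obj G" and Y: "Y:Obj G" and f: "f:Hom C (T X) (T Y)"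
 note o = T[OF X] T[OF Y] T[OF DG[OF X]] T[OF DG[OF Y]] and d = D_obj[OF T[OF X]] D_obj[OF T[OF Y]]
	D_obj[OF T[OF DG[OF X]]] D_obj[OF T[OF DG[OF Y]]] D_obj[OF D_obj[OF T[OF X]]] D_obj[OF D_obj[OF T[OF Y]]]
 note Df = D_hom[OF o(1,2) f]
 show "DG1 X Y f:Hom C (T (DG Y)) (T (DG X))" by (rule DG1_hom(2)[OF X Y f])
 show "DG1 X Z (Cmp C g f) = Cmp C (DG1 X Y f) (DG1 Y Z g)" if Z: "Z:Obj G" and g: "g:Hom C (T Y) (T Z)" for Z g
	by (simp add: DG1[OF X Y f] DG1[OF Y Z g] DG1[OF X Z cmp[OF o(1,2) T[OF Z] f g]] D_comp[OF o(1,2) T[OF Z] f g] assoc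
		kappa_cancel(1)[OF Y T[OF DG[OF Z]] DG1_hom(1)[OF Y Z g]])
 show "DG1 X Y (f + g) = DG1 X Y f + DG1 X Y g" if g: "g:Hom C (T X) (T Y)" for g
	using addr[OF o(4) d(1) o(3) DG1_hom(1)[OF X Y f] DG1_hom(1)[OF X Y g] kappa(2)[OF X]]
	by (simp add: DG1[OF X Y f] DG1[OF X Y g] DG1[OF X Y hom_closed(2)[OF o(1,2) f g]] D_add[OF o(1,2) f g] addl)
 show "DG1 X Y (Scl C c f) = Scl C c (DG1 X Y f)" for c
	using sclr[OF o(4) d(1) o(3) DG1_hom(1)[OF X Y f] kappa(2)[OF X]]
	by (simp add: DG1[OF X Y f] DG1[OF X Y hom_closed(3)[OF o(1,2) f]] D_scl[OF o(1,2) f] scll)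

 show "Cmp C (DG1 (DG Y) (DG X) (DG1 X Y f)) (ioG X) = Cmp C (ioG Y) f"
 proof -
	note Dg = DG1_hom(2)[OF X Y f]
	have 1: "Cmp C (DG1 (DG Y) (DG X) (DG1 X Y f)) (ioG X)
		= Cmp C (ka' (DG Y)) (Cmp C (D1 (T (DG Y)) (T (DG X)) (DG1 X Y f)) (Cmp C (D1 (T (DG X)) (D0 (T X)) (ka X)) (io (T X))))"
	 by (simp add: DG1[OF DG[OF Y] DG[OF X] Dg] ioG_def assoc kappa_cancel(1)[OF DG[OF X] o(1) ioG_hom(1)[OF X]])
	have 2: "Cmp C (D1 (T (DG Y)) (T (DG X)) (DG1 X Y f)) (D1 (T (DG X)) (D0 (T X)) (ka X)) =
		Cmp C (D1 (T (DG Y)) (D0 (T Y)) (ka Y)) (D1 (D0 (T Y)) (D0 (T X)) (D1 (T X) (T Y) f))"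
	proof -
	 have "Cmp C (ka X) (DG1 X Y f) = Cmp C (D1 (T X) (T Y) f) (ka Y)"
		by (simp add: DG1[OF X Y f] kappa_cancel(1)[OF X o(4) DG1_hom(1)[OF X Y f]])
	 then show ?thesis
		using D_comp[OF o(4,3) d(1) Dg kappa(1)[OF X]] D_comp[OF o(4) d(2,1) kappa(1)[OF Y] Df] by simp
	qed
	show ?thesis
	 unfolding 1 using arg_cong[OF 2, of "%u. Cmp C u (io (T X))"] io_nat[OF o(1,2) f] by (simp add: assoc ioG_def)
 qed
next
 fix X assume X: "X:Obj G"
 note o = T[OF X] T[OF DG[OF X]] T[OF DG[OF DG[OF X]]] T[OF DG[OF DG[OF DG[OF X]]]]
 note d = D_obj[OF o(1)] D_obj[OF o(2)] D_obj[OF o(3)] D_obj[OF D_obj[OF o(1)]] D_obj[OF D_obj[OF o(2)]] D_obj[OF D_obj[OF D_obj[OF o(1)]]]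
 show "DG X:Obj G" by (rule DG[OF X])
 show "DG1 X X (Idm C (T X)) = Idm C (T (DG X))"
	by (simp add: DG1[OF X X idm[OF o(1)]] D_id[OF o(1)] idl[OF o(2) d(1) kappa(1)[OF X]] kappa(3)[OF X])
 show "ioG X:Hom C (T X) (T (DG (DG X)))" by (rule ioG_hom(2)[OF X])
 note k = kappa[OF X] kappa[OF DG[OF X]]
 have Dk: "Cmp C (D1 (T (DG X)) (D0 (T X)) (ka X)) (D1 (D0 (T X)) (T (DG X)) (ka' X)) = Idm C (D0 (T (DG X)))"
	"Cmp C (D1 (D0 (T X)) (T (DG X)) (ka' X)) (D1 (T (DG X)) (D0 (T X)) (ka X)) = Idm C (D0 (D0 (T X)))"
	using D_comp[OF o(2) d(1) o(2) k(1,2)] D_comp[OF d(1) o(2) d(1) k(2,1)] k(3,4) D_id[OF o(2)] D_id[OF d(1)] by simp_all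
 show "Cmp C (DG1 X (DG (DG X)) (ioG X)) (ioG (DG X)) = Idm C (T (DG X))"
 proof -
	note Dio = D_hom[OF o(1,3) ioG_hom(2)[OF X]]
	note h = ioG_hom(1)[OF DG[OF X]] ioG_hom(1)[OF X]
	have 1: "Cmp C (DG1 X (DG (DG X)) (ioG X)) (ioG (DG X)) = Cmp C (ka' X) (Cmp C (D1 (T X) (T (DG (DG X))) (ioG X))
		(Cmp C (D1 (T (DG (DG X))) (D0 (T (DG X))) (ka (DG X))) (io (T (DG X)))))"
	 by (simp add: DG1[OF X DG[OF DG[OF X]] ioG_hom(2)[OF X]] ioG_def[of "DG X"] assoc kappa_cancel(1)[OF DG[OF DG[OF X]] o(2) h(1)])
	have 2: "Cmp C (D1 (T X) (T (DG (DG X))) (ioG X)) (D1 (T (DG (DG X))) (D0 (T (DG X))) (ka (DG X)))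
	 = Cmp C (D1 (T X) (D0 (D0 (T X))) (io (T X))) (D1 (D0 (D0 (T X))) (D0 (T (DG X))) (D1 (T (DG X)) (D0 (T X)) (ka X)))"
	proof -
	 have "Cmp C (ka (DG X)) (ioG X) = Cmp C (D1 (T (DG X)) (D0 (T X)) (ka X)) (io (T X))"
		by (simp add: ioG_def kappa_cancel(1)[OF DG[OF X] o(1) h(2)])
	 then show ?thesis
		using D_comp[OF o(1,3) d(2) ioG_hom(2)[OF X] k(5)] D_comp[OF o(1) d(4,2) io_hom[OF o(1)] D_hom[OF o(2) d(1) k(1)]] by simp
	qed
	have "Cmp C (DG1 X (DG (DG X)) (ioG X)) (ioG (DG X)) = Cmp C (ka' X) (Cmp C (D1 (T X) (D0 (D0 (T X))) (io (T X)))
		(Cmp C (io (D0 (T X))) (ka X)))"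
	 unfolding 1 using arg_cong[OF 2, of "%u. Cmp C u (io (T (DG X)))"] io_nat[OF o(2) d(1) k(1)] by (simp add: assoc)
	also have "... = Cmp C (ka' X) (ka X)"
	 using io_tri[OF o(1)] idl[OF o(2) d(1) k(1)] by (simp flip: assoc)
	finally show ?thesis by (simp add: k(3))
 qed
 obtain g where g: "g:Hom C (D0 (D0 (T X))) (T X)" "Cmp C g (io (T X)) = Idm C (T X)" "Cmp C (io (T X)) g = Idm C (D0 (D0 (T X)))"
	using io_iso[OF o(1)] by blast
 let ?h = "Cmp C (D1 (D0 (T X)) (T (DG X)) (ka' X)) (ka (DG X))"
 have hh: "?h:Hom C (T (DG (DG X))) (D0 (D0 (T X)))"
	by (rule cmp[OF o(3) d(2,4) k(5) D_hom[OF d(1) o(2) k(2)]])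
 show "EX g:Hom C (T (DG (DG X))) (T X). Cmp C g (ioG X) = Idm C (T X) & Cmp C (ioG X) g = Idm C (T (DG (DG X)))"
 proof (intro bexI conjI)
	show "Cmp C g ?h:Hom C (T (DG (DG X))) (T X)" by (rule cmp[OF o(3) d(4) o(1) hh g(1)])
	have "Cmp C (Cmp C g ?h) (ioG X) = Cmp C g (Cmp C (Cmp C (D1 (D0 (T X)) (T (DG X)) (ka' X)) (D1 (T (DG X)) (D0 (T X)) (ka X))) (io (T X)))"
	 by (simp add: ioG_def assoc kappa_cancel(1)[OF DG[OF X] o(1) ioG_hom(1)[OF X]])
	also have "... = Idm C (T X)" by (simp add: Dk idl[OF o(1) d(4) io_hom[OF o(1)]] g(2))
	finally show "Cmp C (Cmp C g ?h) (ioG X) = Idm C (T X)" .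
	have "Cmp C (ioG X) (Cmp C g ?h) = Cmp C (ka' (DG X)) (Cmp C (D1 (T (DG X)) (D0 (T X)) (ka X)) (Cmp C (Cmp C (io (T X)) g) ?h))"
	 by (simp add: ioG_def assoc)
	also have "... = Cmp C (ka' (DG X)) (Cmp C (Cmp C (D1 (T (DG X)) (D0 (T X)) (ka X)) (D1 (D0 (T X)) (T (DG X)) (ka' X))) (ka (DG X)))"
	 unfolding g(3) idl[OF o(3) d(4) hh] by (simp add: assoc)
	also have "... = Idm C (T (DG (DG X)))" by (simp add: Dk idl[OF o(3) d(2) k(5)] k(7))
	finally show "Cmp C (ioG X) (Cmp C g ?h) = Idm C (T (DG (DG X)))" .
 qed
qed

section \<open>The restriction functor and its right adjoint\<close>

definition jst :: "(('k, 'o, 'm) vfunc, 'o => 'k vec => 'k vec, ('k, 'q, 'm) vfunc, 'q => 'k vec => 'k vec) func" where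
 "jst = \<lparr>Fo = %f. \<lparr>Fo = %V. Fo f (T V), Fm = %V W. Fm f (T V) (T W)\<rparr>,
	 Fm = %f g al V. if V:Obj G then al (T V) else 0\<rparr>"

lemma jst_sel [simp]: "Fo (Fo jst f) V = Fo f (T V)" "Fm (Fo jst f) V W = Fm f (T V) (T W)"
 by (simp_all add: jst_def)

lemma jst_Fm: "Fm jst f g al V = (if V:Obj G then al (T V) else 0)"
 by (simp add: jst_def)

lemma jst_obj: assumes f: "f:Obj (FunK C)" shows "Fo jst f:Obj (FunK G)"
 by (rule G.FunK_objI)
	(auto simp: G_Hom G_Idm G_Cmp G_Scl FobjD(1,3,5,6)[OF f] T intro!: FobjD(2,4)[OF f])

lemma jst_hom:
 assumes f: "f:Obj (FunK C)" "g:Obj (FunK C)" and a: "al:Hom (FunK C) f g"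
 shows "Fm jst f g al:Hom (FunK G) (Fo jst f) (Fo jst g)"
 by (rule G.FhomI[OF jst_obj[OF f(1)] jst_obj[OF f(2)]])
	(auto simp: jst_Fm G_Hom T FhomD(1,2)[OF a])

lemma jst_additive: "additive_functor (full_subcat (FunK C) Q) (FunK G) jst"
 unfolding additive_functor_def is_functor_def
 by (auto simp: jst_obj jst_hom jst_Fm FunK_sel(3,4) T fun_eq_iff)

definition jH :: "('k, 'q, 'm) vfunc => 'o => ('q => 'k vec => 'k vec) set" where
 "jH F M = Hom (FunK G) (Fo jst (hrep C M)) F"

text \<open>Members of \<open>jH F M\<close> act on coordinate vectors of arrows. \<open>ev\<close>
  lets them act on the arrows themselves, so that naturality says that \<open>ev\<close> commutes
  with composition from the left.\<close>

definition ev :: "'o => ('q => 'k vec => 'k vec) => 'q => 'm => 'k vec" where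
 "ev M ph V h = ph V (coords (Scl C) (Hom C M (T V)) h)"

lemma ev:
 assumes M: "M:Obj C" and p: "ph:jH F M" and V: "V:Obj G"
 shows "linon (Scl C) (Hom C M (T V)) vscale (Fo F V) (ev M ph V)"
	"h:Hom C M (T V) ==> ev M ph V h:Fo F V"
	"W:Obj G ==> h:Hom C M (T V) ==> u:Hom C (T V) (T W) ==> ev M ph W (Cmp C u h) = Fm F V W u (ev M ph V h)"
proof -
 have p': "ph:Hom (FunK G) (Fo jst (hrep C M)) F" using p by (simp add: jH_def)
 have "ph V:vlin (model (Scl C) (Hom C M (T V))) (Fo F V)" using G.FhomD(1)[OF p' V] by (simp add: hrep_Fo)
 from linon_comp[OF coords_linon[OF hom_fds[OF M T[OF V]]] lin_linon[OF this]]
 show 1: "linon (Scl C) (Hom C M (T V)) vscale (Fo F V) (ev M ph V)" by (simp add: ev_def[abs_def])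
 show "h:Hom C M (T V) ==> ev M ph V h:Fo F V" by (rule linonD(1)[OF 1])
 show "ev M ph W (Cmp C u h) = Fm F V W u (ev M ph V h)" if "W:Obj G" "h:Hom C M (T V)" "u:Hom C (T V) (T W)"
	using G.FhomD(2)[OF p' V that(1), of u "coords (Scl C) (Hom C M (T V)) h"] that hrep_Fm[OF M T[OF V] that(2), of "T W" u]
	by (simp add: G_Hom ev_def)
qed

lemma jH_eqI:
 assumes M: "M:Obj C" and p: "ph:jH F M" "ps:jH F M"
	and e: "!!V h. V:Obj G ==> h:Hom C M (T V) ==> ev M ph V h = ev M ps V h"
 shows "ph = ps"
proof (rule G.hom_eqI[OF p[unfolded jH_def]])
 fix V y assume V: "V:Obj G" and "y:Fo (Fo jst (hrep C M)) V"
 then have y: "y:model (Scl C) (Hom C M (T V))" by (simp add: hrep_Fo)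
 show "ph V y = ps V y" using e[OF V dec_in[OF y]] y by (simp add: ev_def)
qed

lemma jH_subsp: "F:Obj (FunK G) ==> M:Obj C ==> subsp (Scl (FunK G)) (jH F M)"
 unfolding jH_def FunK_sel(5) by (rule G.FunK_subsp[OF jst_obj[OF hrep_obj]])

definition jev :: "'o => ('q => 'k vec => 'k vec) => 'm => 'k vec" where
 "jev M ph = restr (Hom C M (T E)) (ev M ph E)"

text \<open>The identity of \<open>T V\<close> is a sum of arrows that pass through
  \<open>T E\<close>, so a natural transformation is determined by its component at
  \<open>E\<close>.\<close>

lemma ev_dense:
 assumes M: "M:Obj C" and F: "F:Obj (FunK G)" and p: "ph:jH F M" and V: "V:Obj G" and h: "h:Hom C M (T V)"
	and ab: "!!i. i < k ==> a i:Hom C (T E) (T V)" "!!i. i < k ==> b i:Hom C (T V) (T E)"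
	 "(\<Sum>i<k. Cmp C (a i) (b i)) = Idm C (T V)"
 shows "ev M ph V h = (\<Sum>i<(k::nat). Fm F E V (a i) (jev M ph (Cmp C (b i) h)))"
proof -
 note o = M T[OF V] T[OF E]
 have "h = Cmp C (\<Sum>i<k. Cmp C (a i) (b i)) h" using ab(3) idl[OF o(1,2) h] by simp
 also have "... = (\<Sum>i<k. Cmp C (Cmp C (a i) (b i)) h)"
	by (rule linon_more(4)[OF cmp_linon(2)[OF o(1,2,2) h]]) (auto intro!: cmp[OF o(2,3,2) ab(2,1)] simp: o fds_vs[OF hom_fds[OF o(1,1)]])
 finally have "ev M ph V h = ev M ph V (\<Sum>i<k. Cmp C (a i) (Cmp C (b i) h))" by (simp add: assoc)
 also have "... = (\<Sum>i<k. ev M ph V (Cmp C (a i) (Cmp C (b i) h)))"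
	by (rule linon_more(4)[OF ev(1)[OF M p V]]) (auto intro!: cmp[OF o(1,3,2) cmp[OF o(1,2,3) h ab(2)] ab(1)] simp: o)
 also have "... = (\<Sum>i<k. Fm F E V (a i) (jev M ph (Cmp C (b i) h)))"
	by (rule sum.cong[OF refl]) (use ev(3)[OF M p E V cmp[OF o(1,2,3) h ab(2)] ab(1)] cmp[OF o(1,2,3) h ab(2)] in \<open>simp add: jev_def\<close>)
 finally show ?thesis .
qed

lemma jev_linon:
 assumes M: "M:Obj C" and F: "F:Obj (FunK G)"
 shows "linon (Scl (FunK G)) (jH F M) (fscale vscale) (bH (T E) (Fo F E) M) (jev M)"
	"inj_on (jev M) (jH F M)"
proof -
 have "jev M ph:bH (T E) (Fo F E) M" if "ph:jH F M" for ph
	unfolding jev_def by (rule restr_lin[OF fsub[OF hom_fds[OF M T[OF E]]] ev(1)[OF M that E]])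
 then show "linon (Scl (FunK G)) (jH F M) (fscale vscale) (bH (T E) (Fo F E) M) (jev M)"
	by (auto simp: linon_def jev_def ev_def[abs_def] restr_def FunK_sel(5) fsc_app fun_eq_iff)
 show "inj_on (jev M) (jH F M)"
 proof (rule inj_onI, rule jH_eqI[OF M], assumption, assumption)
	fix ph ps V h assume p: "ph:jH F M" "ps:jH F M" and e: "jev M ph = jev M ps" and V: "V:Obj G" and h: "h:Hom C M (T V)"
	obtain k a b where "ALL i<(k::nat). a i:Hom C (T E) (T V) & b i:Hom C (T V) (T E)" "(\<Sum>i<k. Cmp C (a i) (b i)) = Idm C (T V)"
	 using dense[OF V] by blast
	with ev_dense[OF M F p(1) V h, of k a b] ev_dense[OF M F p(2) V h, of k a b] e
	show "ev M ph V h = ev M ps V h" by simp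
 qed
qed

lemma jH_fds: "F:Obj (FunK G) ==> M:Obj C ==> fds (Scl (FunK G)) (jH F M)"
 by (rule fds_inj[OF jH_subsp bH_fds jev_linon]) (auto intro: T[OF E] G.FobjD(1)[OF _ E])

text \<open>Commuting with \<open>End(T E)\<close> is the only condition on the component at
  \<open>E\<close>: such a \<open>p\<close> extends to all \<open>V\<close> by the formula that
  \<open>ev_dense\<close> forces.\<close>

lemma jev_image:
 assumes M: "M:Obj C" and F: "F:Obj (FunK G)"
 shows "jev M ` jH F M = {p:bH (T E) (Fo F E) M. ALL e:Hom C (T E) (T E). ALL h:Hom C M (T E). p (Cmp C e h) = Fm F E E e (p h)}"
	(is "_ = ?R")
proof
 note oE = T[OF E]
 show "jev M ` jH F M <= ?R"
	using linonD(1)[OF jev_linon(1)[OF M F]] ev(3)[OF M _ E E] cmp[OF M oE oE] by (auto simp: jev_def)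
 show "?R <= jev M ` jH F M"
 proof
	fix p assume "p:?R"
	then have p: "p:bH (T E) (Fo F E) M" and pe: "!!e h. e:Hom C (T E) (T E) ==> h:Hom C M (T E) ==> p (Cmp C e h) = Fm F E E e (p h)"
	 by auto
	have "ALL V:Obj G. EX t. (ALL i<(fst t::nat). fst (snd t) i:Hom C (T E) (T V) & snd (snd t) i:Hom C (T V) (T E)) &
	 (\<Sum>i<fst t. Cmp C (fst (snd t) i) (snd (snd t) i)) = Idm C (T V)"
	proof
	 fix V assume "V:Obj G"
	 from dense[OF this] obtain k a b where "(ALL i<(k::nat). a i:Hom C (T E) (T V) & b i:Hom C (T V) (T E)) &
		(\<Sum>i<k. Cmp C (a i) (b i)) = Idm C (T V)" by blast
	 then show "EX t. (ALL i<(fst t::nat). fst (snd t) i:Hom C (T E) (T V) & snd (snd t) i:Hom C (T V) (T E)) &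
		(\<Sum>i<fst t. Cmp C (fst (snd t) i) (snd (snd t) i)) = Idm C (T V)" by (intro exI[of _ "(k, a, b)"]) simp
	qed
	from bchoice[OF this] obtain t where t: "ALL V:Obj G. (ALL i<(fst (t V)::nat). fst (snd (t V)) i:Hom C (T E) (T V) & snd (snd (t V)) i:Hom C (T V) (T E)) &
	 (\<Sum>i<fst (t V). Cmp C (fst (snd (t V)) i) (snd (snd (t V)) i)) = Idm C (T V)" by blast
	define k a b where "k V = fst (t V)" and "a V = fst (snd (t V))" and "b V = snd (snd (t V))" for V
	have ab: "i < k V ==> a V i:Hom C (T E) (T V)" "i < k V ==> b V i:Hom C (T V) (T E)"
	 "(\<Sum>i<k V. Cmp C (a V i) (b V i)) = Idm C (T V)" if "V:Obj G" for V i
	 using t that by (auto simp: k_def a_def b_def)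
	\<comment> \<open>The right-hand side of \<open>ev_dense\<close>, with one splitting
	  \<open>a V\<close>, \<open>b V\<close> chosen for every \<open>V\<close>.\<close>
	define Ph where "Ph V h = (\<Sum>i<k V. Fm F E V (a V i) (p (Cmp C (b V i) h)))" for V h
	have bh: "Cmp C (b V i) h:Hom C M (T E)" if "V:Obj G" "i < k V" "h:Hom C M (T V)" for V i h
	 by (rule cmp[OF M T[OF that(1)] oE that(3) ab(2)[OF that(1,2)]])
	note FV = G.FobjD(1)[OF F]
	have ah: "a V i:Hom G E V" if "V:Obj G" "i < k V" for V i using ab(1)[OF that] by (simp add: G_Hom)
	have nat: "Ph W (Cmp C u h) = Fm F V W u (Ph V h)"
	 if V: "V:Obj G" and W: "W:Obj G" and h: "h:Hom C M (T V)" and u: "u:Hom C (T V) (T W)" for V W h u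
	proof -
	 have uG: "u:Hom G V W" using u by (simp add: G_Hom)
	 note o = M T[OF V] T[OF W] oE
	 have ua: "Cmp C u (a V j):Hom C (T E) (T W)" "Cmp C u (a V j):Hom G E W" if "j < k V" for j
		using cmp[OF o(4,2,3) ab(1)[OF V that] u] by (simp_all add: G_Hom)
	 have bua: "Cmp C (b W i) (Cmp C u (a V j)):Hom C (T E) (T E)" "Cmp C (b W i) (Cmp C u (a V j)):Hom G E E" if "i < k W" "j < k V" for i j
		using cmp[OF o(4,3,4) ua(1)[OF that(2)] ab(2)[OF W that(1)]] by (simp_all add: G_Hom)
	 have pin: "p (Cmp C (b V j) h):Fo F E" if "j < k V" for j by (rule linD(1)[OF p bh[OF V that h]])
	 have "Fm F V W u (Ph V h) = (\<Sum>j<k V. Fm F V W u (Fm F E V (a V j) (p (Cmp C (b V j) h))))"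
		unfolding Ph_def
		by (rule lin_more(4)[OF G.FobjD(2)[OF F V W uG] fsub[OF FV[OF V]] vs_v])
		 (auto intro!: G.Fm_in[OF F E V ah[OF V]] pin)
	 also have "... = (\<Sum>j<k V. Fm F E W (Cmp C u (a V j)) (p (Cmp C (b V j) h)))"
		by (rule sum.cong[OF refl]) (simp add: G.Fm_comp[OF F E V W ah[OF V] uG, unfolded G_Cmp])
	 \<comment> \<open>Inserting the splitting of the identity of \<open>T W\<close> makes
	   \<open>b W i\<close> after \<open>u\<close> after \<open>a V j\<close> appear. This is an
	   endomorphism of \<open>T E\<close>, so \<open>p\<close> commutes with it. Afterwards the sum
	   over \<open>j\<close> collapses to the identity of \<open>T V\<close>.\<close>
	 also have "... = (\<Sum>j<k V. \<Sum>i<k W. Fm F E W (a W i) (p (Cmp C (b W i) (Cmp C u (Cmp C (a V j) (Cmp C (b V j) h))))))"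
	 proof (rule sum.cong[OF refl])
		fix j assume "j:{..<k V}"
		then have j: "j < k V" by simp
		have "Cmp C u (a V j) = Cmp C (\<Sum>i<k W. Cmp C (a W i) (b W i)) (Cmp C u (a V j))"
		 using ab(3)[OF W] idl[OF o(4,3) ua(1)[OF j]] by simp
		also have "... = (\<Sum>i<k W. Cmp C (Cmp C (a W i) (b W i)) (Cmp C u (a V j)))"
		 by (rule linon_more(4)[OF cmp_linon(2)[OF o(4,3,3) ua(1)[OF j]]])
			(auto intro!: cmp[OF o(3,4,3) ab(2,1)[OF W]] simp: o fds_vs[OF hom_fds[OF o(1,1)]])
		finally have "Fm F E W (Cmp C u (a V j)) (p (Cmp C (b V j) h))
		 = Fm F E W (\<Sum>i<k W. Cmp C (a W i) (Cmp C (b W i) (Cmp C u (a V j)))) (p (Cmp C (b V j) h))" by (simp add: assoc)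
		also have "... = (\<Sum>i<k W. Fm F E W (Cmp C (a W i) (Cmp C (b W i) (Cmp C u (a V j)))) (p (Cmp C (b V j) h)))"
		 by (rule G.Fm_sum[OF F E W pin[OF j]]) (use cmp[OF o(4,4,3) bua(1)[OF _ j] ab(1)[OF W]] in \<open>simp add: G_Hom\<close>)
		also have "... = (\<Sum>i<k W. Fm F E W (a W i) (p (Cmp C (b W i) (Cmp C u (Cmp C (a V j) (Cmp C (b V j) h))))))"
		proof (rule sum.cong[OF refl])
		 fix i assume "i:{..<k W}"
		 then have i: "i < k W" by simp
		 show "Fm F E W (Cmp C (a W i) (Cmp C (b W i) (Cmp C u (a V j)))) (p (Cmp C (b V j) h)) =
			Fm F E W (a W i) (p (Cmp C (b W i) (Cmp C u (Cmp C (a V j) (Cmp C (b V j) h)))))"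
			using G.Fm_comp[OF F E E W bua(2)[OF i j] ah[OF W i], unfolded G_Cmp] pe[OF bua(1)[OF i j] bh[OF V j h]]
			by (simp add: assoc)
		qed
		finally show "Fm F E W (Cmp C u (a V j)) (p (Cmp C (b V j) h)) =
		 (\<Sum>i<k W. Fm F E W (a W i) (p (Cmp C (b W i) (Cmp C u (Cmp C (a V j) (Cmp C (b V j) h))))))" .
	 qed
	 also have "... = (\<Sum>i<k W. \<Sum>j<k V. Fm F E W (a W i) (p (Cmp C (Cmp C (b W i) u) (Cmp C (Cmp C (a V j) (b V j)) h))))"
		by (subst sum.swap) (simp add: assoc)
	 also have "... = Ph W (Cmp C u h)"
		unfolding Ph_def
	 proof (rule sum.cong[OF refl])
		fix i assume "i:{..<k W}"
		then have i: "i < k W" by simp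
		have buh: "Cmp C (b W i) u:Hom C (T V) (T E)" by (rule cmp[OF o(2,3,4) u ab(2)[OF W i]])
		have abh: "Cmp C (Cmp C (a V j) (b V j)) h:Hom C M (T V)" if "j < k V" for j
		 by (rule cmp[OF o(1,2,2) h cmp[OF o(2,4,2) ab(2,1)[OF V that]]])
		have "linon (Scl C) (Hom C M (T V)) vscale (Fo F W) (%h. Fm F E W (a W i) (p (Cmp C (Cmp C (b W i) u) h)))"
		 by (rule linon_comp[OF linon_comp[OF cmp_linon(1)[OF o(1,2,4) buh] lin_linon[OF p]] lin_linon[OF G.FobjD(2)[OF F E W ah[OF W i]]]])
		from linon_more(4)[OF this fsub[OF hom_fds[OF o(1,2)]] vs_v, of "{..<k V}" "%j. Cmp C (Cmp C (a V j) (b V j)) h"] abh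
		have "(\<Sum>j<k V. Fm F E W (a W i) (p (Cmp C (Cmp C (b W i) u) (Cmp C (Cmp C (a V j) (b V j)) h))))
		 = Fm F E W (a W i) (p (Cmp C (Cmp C (b W i) u) (\<Sum>j<k V. Cmp C (Cmp C (a V j) (b V j)) h)))" by simp
		also have "(\<Sum>j<k V. Cmp C (Cmp C (a V j) (b V j)) h) = Cmp C (\<Sum>j<k V. Cmp C (a V j) (b V j)) h"
		 by (rule linon_more(4)[OF cmp_linon(2)[OF o(1,2,2) h], symmetric])
			(auto intro!: cmp[OF o(2,4,2) ab(2,1)[OF V]] simp: o fds_vs[OF hom_fds[OF o(1,1)]])
		also have "... = h" using ab(3)[OF V] idl[OF o(1,2) h] by simp
		finally show "(\<Sum>j<k V. Fm F E W (a W i) (p (Cmp C (Cmp C (b W i) u) (Cmp C (Cmp C (a V j) (b V j)) h))))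
		 = Fm F E W (a W i) (p (Cmp C (b W i) (Cmp C u h)))" by (simp add: assoc)
	 qed
	 finally show ?thesis by simp
	qed
	have lin: "linon (Scl C) (Hom C M (T V)) vscale (Fo F V) (Ph V)" if V: "V:Obj G" for V
	proof -
	 have l: "linon (Scl C) (Hom C M (T V)) vscale (Fo F V) (%h. Fm F E V (a V i) (p (Cmp C (b V i) h)))" if "i < k V" for i
		by (rule linon_comp[OF linon_comp[OF cmp_linon(1)[OF M T[OF V] oE ab(2)[OF V that]] lin_linon[OF p]] lin_linon[OF G.FobjD(2)[OF F E V ah[OF V that]]]])
	 show ?thesis
		unfolding linon_def Ph_def
	 proof (intro conjI ballI allI)
		show "(\<Sum>i<k V. Fm F E V (a V i) (p (Cmp C (b V i) x))):Fo F V" if "x:Hom C M (T V)" for x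
		 by (rule subspD(6)[OF fsub[OF FV[OF V]]]) (use linonD(1)[OF l] that in simp)
	 qed (use linonD(2,3)[OF l] in \<open>simp_all add: vs_simps(11)[OF vs_v] flip: sum.distrib\<close>)
	qed
	define ph where "ph V = (if V:Obj G then restr (model (Scl C) (Hom C M (T V))) (%y. Ph V (dec (Scl C) (Hom C M (T V)) y)) else 0)" for V
	have ph: "ph:jH F M" unfolding jH_def
	proof (rule G.FhomI[OF jst_obj[OF hrep_obj[OF M]] F])
	 fix V assume V: "V:Obj G"
	 note H = hom_fds[OF M T[OF V]]
	 show "ph V:vlin (Fo (Fo jst (hrep C M)) V) (Fo F V)"
		using restr_lin[OF fsub[OF model_fds[OF H]] linon_comp[OF dec_linon[OF H] lin[OF V]]] V by (simp add: ph_def hrep_Fo)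
	next
	 fix V W u y assume V: "V:Obj G" and W: "W:Obj G" and u: "u:Hom G V W" and y: "y:Fo (Fo jst (hrep C M)) V"
	 have u': "u:Hom C (T V) (T W)" using u by (simp add: G_Hom)
	 let ?h = "dec (Scl C) (Hom C M (T V)) y"
	 have h: "?h:Hom C M (T V)" "y:model (Scl C) (Hom C M (T V))" "coords (Scl C) (Hom C M (T V)) ?h = y" using y by (simp_all add: hrep_Fo)
	 have "Fm (hrep C M) (T V) (T W) u y = coords (Scl C) (Hom C M (T W)) (Cmp C u ?h)"
		using hrep_Fm[OF M T[OF V] h(1), of "T W" u] h(3) by simp
	 then show "ph W (Fm (Fo jst (hrep C M)) V W u y) = Fm F V W u (ph V y)"
		using nat[OF V W h(1) u'] cmp[OF M T[OF V] T[OF W] h(1) u'] hom_fds[OF M T[OF W]] V W h(2) by (simp add: ph_def)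
	qed (simp add: ph_def)
	have "Ph E h = p h" if h: "h:Hom C M (T E)" for h
	proof -
	 have "Ph E h = (\<Sum>i<k E. p (Cmp C (a E i) (Cmp C (b E i) h)))"
		unfolding Ph_def by (rule sum.cong[OF refl]) (use pe[OF ab(1)[OF E] bh[OF E _ h]] in simp)
	 also have "... = p (\<Sum>i<k E. Cmp C (a E i) (Cmp C (b E i) h))"
		by (rule lin_more(4)[OF p, symmetric]) (auto intro!: cmp[OF M oE oE bh[OF E _ h] ab(1)[OF E]] simp: M oE)
	 also have "(\<Sum>i<k E. Cmp C (a E i) (Cmp C (b E i) h)) = Cmp C (\<Sum>i<k E. Cmp C (a E i) (b E i)) h"
		unfolding assoc[symmetric]
		by (rule linon_more(4)[OF cmp_linon(2)[OF M oE oE h], symmetric])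
		 (auto intro!: cmp[OF oE oE oE ab(2,1)[OF E]] simp: M oE fds_vs[OF hom_fds[OF M M]])
	 finally show ?thesis using ab(3)[OF E] idl[OF M oE h] by simp
	qed
	then have "jev M ph = p"
	 using lin_out[OF p] hom_fds[OF M oE] E by (auto simp: jev_def restr_def ev_def ph_def fun_eq_iff)
	then show "p:jev M ` jH F M" using ph by blast
 qed
qed

end

lemma tmap_inj:
 assumes W: "fds s W" and Z: "fds t Z" and f: "!!x. x:W ==> f x:Z" and i: "inj_on f W"
 shows "inj_on (tmap s W t Z f) (model s W)"
proof (rule inj_onI)
 fix x y assume x: "x:model s W" and y: "y:model s W" and e: "tmap s W t Z f x = tmap s W t Z f y"
 have "f (dec s W x) = f (dec s W y)" using coords_inj[OF Z f[OF dec_in[OF x]] f[OF dec_in[OF y]]] e x y by simp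
 then have "dec s W x = dec s W y" using inj_onD[OF i] x y by simp
 then show "x = y" using dec_inj[OF x y] by simp
qed

lemma tmap_image:
 assumes W: "fds s W" shows "tmap s W t Z f ` model s W = coords t Z ` f ` W"
proof
 show "tmap s W t Z f ` model s W <= coords t Z ` f ` W" by auto
 show "coords t Z ` f ` W <= tmap s W t Z f ` model s W"
 proof
	fix z assume "z:coords t Z ` f ` W"
	then obtain x where x: "x:W" "z = coords t Z (f x)" by blast
	then have "z = tmap s W t Z f (coords s W x)" using W by simp
	then show "z:tmap s W t Z f ` model s W" using x(1) by simp
 qed
qed

lemma tmap_zero_iff:
 assumes Z: "fds t Z" and y: "y:model s W" and f: "f (dec s W y):Z"
 shows "tmap s W t Z f y = 0 \<longleftrightarrow> f (dec s W y) = 0"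
 using coords_inj[OF Z f subspD(1)[OF fsub[OF Z]]] coords_zero[OF Z] y by auto

context lcat
begin

lemma hrep_map_hom:
 assumes M: "M:Obj C" and N: "N:Obj C" and g: "g:Hom C M N"
 shows "hrep_map C M N g:Hom (FunK C) (hrep C N) (hrep C M)"
	"X:Obj C ==> h:Hom C N X ==> hrep_map C M N g X (coords (Scl C) (Hom C N X) h) = coords (Scl C) (Hom C M X) (Cmp C h g)"
proof -
 show 2: "hrep_map C M N g X (coords (Scl C) (Hom C N X) h) = coords (Scl C) (Hom C M X) (Cmp C h g)"
	if "X:Obj C" "h:Hom C N X" for X h
	using that N by (simp add: hrep_map_def)
 show "hrep_map C M N g:Hom (FunK C) (hrep C N) (hrep C M)"
 proof (rule FhomI[OF hrep_obj[OF N] hrep_obj[OF M]])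
	show "hrep_map C M N g X:vlin (Fo (hrep C N) X) (Fo (hrep C M) X)" if "X:Obj C" for X
	 using tmap_lin[OF hom_fds[OF N that] hom_fds[OF M that] cmp_linon(2)[OF M N that g]] that by (simp add: hrep_map_def hrep_Fo)
	show "hrep_map C M N g Y (Fm (hrep C N) X Y f y) = Fm (hrep C M) X Y f (hrep_map C M N g X y)"
	 if X: "X:Obj C" and Y: "Y:Obj C" and f: "f:Hom C X Y" and y: "y:Fo (hrep C N) X" for X Y f y
	proof -
	 let ?h = "dec (Scl C) (Hom C N X) y"
	 have h: "?h:Hom C N X" "y = coords (Scl C) (Hom C N X) ?h" using y by (simp_all add: hrep_Fo)
	 show ?thesis
		by (subst (1 2) h(2)) (simp only: hrep_Fm[OF N X h(1)] 2[OF X h(1)] 2[OF Y cmp[OF N X Y h(1) f]] hrep_Fm[OF M X cmp[OF M N X g h(1)]] assoc)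
	qed
 qed (simp add: hrep_map_def)
qed

end

context jcat
begin

definition pre :: "'o => 'o => 'm => ('q => 'k vec => 'k vec) => ('q => 'k vec => 'k vec)" where
 "pre M N g al = Cmp (FunK G) al (Fm jst (hrep C N) (hrep C M) (hrep_map C M N g))"

definition jlow :: "(('k, 'q, 'm) vfunc, 'q => 'k vec => 'k vec, ('k, 'o, 'm) vfunc, 'o => 'k vec => 'k vec) func" where
 "jlow = (let s = Scl (FunK G) in
	 \<lparr>Fo = %F. \<lparr>Fo = %M. model s (jH F M), Fm = %M N g. tmap s (jH F M) s (jH F N) (pre M N g)\<rparr>,
	 Fm = %F F' be M. if M:Obj C then tmap s (jH F M) s (jH F' M) (%al. Cmp (FunK G) be al) else 0\<rparr>)"

abbreviation "sG == Scl (FunK G)"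

lemma jlow_sel [simp]: "Fo (Fo jlow F) M = model sG (jH F M)"
 "Fm (Fo jlow F) M N g = tmap sG (jH F M) sG (jH F N) (pre M N g)"
 by (simp_all add: jlow_def Let_def)

lemma jlow_Fm: "Fm jlow F F' be M = (if M:Obj C then tmap sG (jH F M) sG (jH F' M) (%al. Cmp (FunK G) be al) else 0)"
 by (simp add: jlow_def Let_def)

lemma pre:
 assumes M: "M:Obj C" and N: "N:Obj C" and g: "g:Hom C M N" and F: "F:Obj (FunK G)" and a: "al:jH F M"
 shows "pre M N g al:jH F N"
	"V:Obj G ==> h:Hom C N (T V) ==> ev N (pre M N g al) V h = ev M al V (Cmp C h g)"
proof -
 note h = jst_hom[OF hrep_obj[OF N] hrep_obj[OF M] hrep_map_hom(1)[OF M N g]]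
 show "pre M N g al:jH F N" unfolding pre_def jH_def
	by (rule G.FunK_cmp[OF jst_obj[OF hrep_obj[OF N]] jst_obj[OF hrep_obj[OF M]] F h a[unfolded jH_def]])
 show "ev N (pre M N g al) V h = ev M al V (Cmp C h g)" if "V:Obj G" "h:Hom C N (T V)"
	using that hrep_map_hom(2)[OF M N g T[OF that(1)] that(2)] by (simp add: ev_def pre_def FunK_sel(4) jst_Fm)
qed

lemma ev_linear: "ev M (ph + ps) V h = ev M ph V h + ev M ps V h" "ev M (sG c ph) V h = vscale c (ev M ph V h)"
 by (auto simp: ev_def FunK_sel(5) fsc_app fun_eq_iff)

lemma pre_linon:
 assumes M: "M:Obj C" and N: "N:Obj C" and g: "g:Hom C M N" and F: "F:Obj (FunK G)"
 shows "linon sG (jH F M) sG (jH F N) (pre M N g)"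
 using pre(1)[OF M N g F] by (auto simp: linon_def pre_def FunK_sel(4,5) fsc_app fun_eq_iff)

lemma jlow_obj:
 assumes F: "F:Obj (FunK G)" shows "Fo jlow F:Obj (FunK C)"
proof (rule FunK_objI)
 note H = jH_fds[OF F] and S = subspD[OF jH_subsp[OF F]]
 show "fds vscale (Fo (Fo jlow F) M)" if "M:Obj C" for M using H[OF that] by simp
 show "Fm (Fo jlow F) M N g:vlin (Fo (Fo jlow F) M) (Fo (Fo jlow F) N)" if "M:Obj C" "N:Obj C" "g:Hom C M N" for M N g
	using tmap_lin[OF H[OF that(1)] H[OF that(2)] pre_linon[OF that F]] by simp
 show "Fm (Fo jlow F) M M (Idm C M) = id_on (Fo (Fo jlow F) M)" if M: "M:Obj C" for M
	unfolding jlow_sel tmap_id[symmetric]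
 proof (rule tmap_cong)
	fix al assume a: "al:jH F M"
	show "pre M M (Idm C M) al = al"
	 by (rule jH_eqI[OF M pre(1)[OF M M idm[OF M] F a] a]) (simp add: pre(2)[OF M M idm[OF M] F a] idr[OF M T])
 qed
 show "Fm (Fo jlow F) M L (Cmp C u g) = Fm (Fo jlow F) N L u o Fm (Fo jlow F) M N g"
	if o: "M:Obj C" "N:Obj C" "L:Obj C" "g:Hom C M N" "u:Hom C N L" for M N L g u
 proof -
	have "pre N L u 0 = 0" by (auto simp: pre_def FunK_sel(4) fun_eq_iff)
	moreover have "tmap sG (jH F M) sG (jH F L) (pre M L (Cmp C u g)) = tmap sG (jH F M) sG (jH F L) (%al. pre N L u (pre M N g al))"
	proof (rule tmap_cong)
	 fix al assume a: "al:jH F M"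
	 note ug = cmp[OF o] and p = pre[OF o(1,2,4) F a]
	 show "pre M L (Cmp C u g) al = pre N L u (pre M N g al)"
		by (rule jH_eqI[OF o(3) pre(1)[OF o(1,3) ug F a] pre(1)[OF o(2,3,5) F p(1)]])
		 (simp add: pre(2)[OF o(1,3) ug F a] pre(2)[OF o(2,3,5) F p(1)] p(2) assoc T cmp[OF o(2,3) T o(5)])
	qed
	ultimately show ?thesis
	 using tmap_comp[where f="pre M N g" and g="pre N L u", OF H[OF o(1)] H[OF o(2)] pre(1)[OF o(1,2,4) F] H[OF o(3)]] by simp
 qed
 show "Fm (Fo jlow F) M N (f + g) = Fm (Fo jlow F) M N f + Fm (Fo jlow F) M N g"
	if o: "M:Obj C" "N:Obj C" "f:Hom C M N" "g:Hom C M N" for M N f g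
 proof -
	note fg = hom_closed(2)[OF o]
	have "tmap sG (jH F M) sG (jH F N) (pre M N (f + g)) = tmap sG (jH F M) sG (jH F N) (%al. pre M N f al + pre M N g al)"
	proof (rule tmap_cong)
	 fix al assume a: "al:jH F M"
	 note p = pre[OF o(1,2,3) F a] pre[OF o(1,2,4) F a]
	 show "pre M N (f + g) al = pre M N f al + pre M N g al"
	 proof (rule jH_eqI[OF o(2) pre(1)[OF o(1,2) fg F a] S(2)[OF o(2) p(1,3)]])
		fix V h assume V: "V:Obj G" and h: "h:Hom C N (T V)"
		note c = cmp[OF o(1,2) T[OF V] o(3) h] cmp[OF o(1,2) T[OF V] o(4) h]
		show "ev N (pre M N (f + g) al) V h = ev N (pre M N f al + pre M N g al) V h"
		 by (simp add: pre(2)[OF o(1,2) fg F a V h] ev_linear p(2)[OF V h] p(4)[OF V h] addr[OF o(1,2) T[OF V] o(3,4) h]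
			 linonD(2)[OF ev(1)[OF o(1) a V] c])
	 qed
	qed
	then show ?thesis using tmap_add[OF H[OF o(2)], of "jH F M" "pre M N f" "pre M N g" sG] pre(1)[OF o(1,2,3) F] pre(1)[OF o(1,2,4) F] by simp
 qed
 show "Fm (Fo jlow F) M N (Scl C c f) = fscale vscale c (Fm (Fo jlow F) M N f)"
	if o: "M:Obj C" "N:Obj C" "f:Hom C M N" for M N f c
 proof -
	note fg = hom_closed(3)[OF o]
	have "tmap sG (jH F M) sG (jH F N) (pre M N (Scl C c f)) = tmap sG (jH F M) sG (jH F N) (%al. sG c (pre M N f al))"
	proof (rule tmap_cong)
	 fix al assume a: "al:jH F M"
	 note p = pre[OF o(1,2,3) F a]
	 show "pre M N (Scl C c f) al = sG c (pre M N f al)"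
	 proof (rule jH_eqI[OF o(2) pre(1)[OF o(1,2) fg F a] S(3)[OF o(2) p(1)]])
		fix V h assume V: "V:Obj G" and h: "h:Hom C N (T V)"
		note c = cmp[OF o(1,2) T[OF V] o(3) h]
		show "ev N (pre M N (Scl C c f) al) V h = ev N (sG c (pre M N f al)) V h"
		 by (simp add: pre(2)[OF o(1,2) fg F a V h] ev_linear p(2)[OF V h] sclr[OF o(1,2) T[OF V] o(3) h]
			 linonD(3)[OF ev(1)[OF o(1) a V] c])
	 qed
	qed
	then show ?thesis using tmap_scale[OF H[OF o(2)], of "jH F M" "pre M N f" sG c] pre(1)[OF o(1,2,3) F] by simp
 qed
qed

definition Eb :: "('k, 'q, 'm) vfunc => ('m => 'k vec) set" where
 "Eb F = lin (Scl C) (Hom C (T E) (T E)) vscale (Fo F E)"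

text \<open>\<open>dft\<close> measures the failure of a linear map \<open>Hom(M, T E) \<rightarrow> F(E)\<close> to be equivariant
 under the endomorphisms of \<open>T E\<close>; its kernel is \<open>jlow F\<close>.\<close>

definition dft :: "('k, 'q, 'm) vfunc => 'o => ('m => 'k vec) => 'm => 'm => 'k vec" where
 "dft F M p = (%h. restr (Hom C (T E) (T E)) (%e. p (Cmp C e h) - Fm F E E e (p h)))"

text \<open>The defect is read in the model of \<open>Eb F\<close>, since \<open>bF\<close> takes
  values in spaces of maps into a space in the fixed universe of vectors.\<close>

definition jb :: "('k, 'q, 'm) vfunc => 'o => ('m => 'k vec) => 'm => 'k vec" where
 "jb F M p = restr (Hom C M (T E)) (%h. coords (fscale vscale) (Eb F) (dft F M p h))"

lemma dft:
 assumes M: "M:Obj C" and F: "F:Obj (FunK G)" and p: "p:bH (T E) (Fo F E) M"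
 shows "h:Hom C M (T E) ==> dft F M p h:Eb F"
	"linon (Scl C) (Hom C M (T E)) (fscale vscale) (Eb F) (dft F M p)"
proof -
 note oE = T[OF E] and FE = G.FobjD(1)[OF F E]
 have l1: "linon (Scl C) (Hom C (T E) (T E)) vscale (Fo F E) (%e. p (Cmp C e h))" if "h:Hom C M (T E)" for h
	by (rule linon_comp[OF cmp_linon(2)[OF M oE oE that] lin_linon[OF p]])
 have l2: "linon (Scl C) (Hom C (T E) (T E)) vscale (Fo F E) (%e. Fm F E E e x)" if "x:Fo F E" for x
	using G.Fm_linon[OF F E E that] by (simp add: G_Hom G_Scl)
 show 1: "dft F M p h:Eb F" if h: "h:Hom C M (T E)" for h
	unfolding dft_def Eb_def
 proof (rule restr_lin[OF fsub[OF hom_fds[OF oE oE]]])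
	show "linon (Scl C) (Hom C (T E) (T E)) vscale (Fo F E) (%e. p (Cmp C e h) - Fm F E E e (p h))"
	 using linonD[OF l1[OF h]] linonD[OF l2[OF linD(1)[OF p h]]] subspD(5)[OF fsub[OF FE]]
	 by (simp add: linon_def vs_simps[OF vs_v])
 qed
 have a: "p (Cmp C e (h + h')) = p (Cmp C e h) + p (Cmp C e h')" "p (Cmp C e (Scl C c h)) = vscale c (p (Cmp C e h))"
	if "h:Hom C M (T E)" "h':Hom C M (T E)" "e:Hom C (T E) (T E)" for h h' e c
	using addr[OF M oE oE that] sclr[OF M oE oE that(1,3)] linD(2,3)[OF p] cmp[OF M oE oE that(1,3)] cmp[OF M oE oE that(2,3)] by simp_all
 have b: "Fm F E E e (p (h + h')) = Fm F E E e (p h) + Fm F E E e (p h')" "Fm F E E e (p (Scl C c h)) = vscale c (Fm F E E e (p h))"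
	if "h:Hom C M (T E)" "h':Hom C M (T E)" "e:Hom C (T E) (T E)" for h h' e c
	using linD(2,3)[OF p] linD(2,3)[OF G.FobjD(2)[OF F E E], of e] linD(1)[OF p] that by (simp_all add: G_Hom)
 show "linon (Scl C) (Hom C M (T E)) (fscale vscale) (Eb F) (dft F M p)"
	unfolding linon_def
 proof (intro conjI ballI allI)
	show "dft F M p (x + y) = dft F M p x + dft F M p y" if "x:Hom C M (T E)" "y:Hom C M (T E)" for x y
	proof
	 fix e show "dft F M p (x + y) e = (dft F M p x + dft F M p y) e"
		using a(1)[OF that] b(1)[OF that] by (cases "e:Hom C (T E) (T E)") (simp_all add: dft_def)
	qed
	show "dft F M p (Scl C c x) = fscale vscale c (dft F M p x)" if "x:Hom C M (T E)" for x c
	proof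
	 fix e show "dft F M p (Scl C c x) e = fscale vscale c (dft F M p x) e"
		using a(2)[OF that that] b(2)[OF that that]
		by (cases "e:Hom C (T E) (T E)") (simp_all add: dft_def fsc_app[of vscale] vs_simps[OF vs_v])
	qed
 qed (rule 1)
qed

lemma Eb_fds: "F:Obj (FunK G) ==> fds (fscale vscale) (Eb F)"
 unfolding Eb_def by (rule fds_lin) (auto simp: T[OF E] G.FobjD(1)[OF _ E])

lemma jb_linon:
 assumes M: "M:Obj C" and F: "F:Obj (FunK G)"
 shows "linon (fscale vscale) (bH (T E) (Fo F E) M) (fscale vscale) (bH (T E) (model (fscale vscale) (Eb F)) M) (jb F M)"
proof -
 note oE = T[OF E] and FE = G.FobjD(1)[OF F E]
 note c = coords_linon[OF Eb_fds[OF F]]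
 have in': "jb F M p:bH (T E) (model (fscale vscale) (Eb F)) M" if "p:bH (T E) (Fo F E) M" for p
	unfolding jb_def by (rule restr_lin[OF fsub[OF hom_fds[OF M oE]] linon_comp[OF dft(2)[OF M F that] c]])
 have lin: "dft F M (p + q) h = dft F M p h + dft F M q h" "dft F M (fscale vscale r p) h = fscale vscale r (dft F M p h)"
	if p: "p:bH (T E) (Fo F E) M" "q:bH (T E) (Fo F E) M" and h: "h:Hom C M (T E)" for p q h r
 proof -
	have "dft F M (p + q) h e = (dft F M p h + dft F M q h) e & dft F M (fscale vscale r p) h e = fscale vscale r (dft F M p h) e" for e
	proof (cases "e:Hom C (T E) (T E)")
	 case True
	 then show ?thesis
		using linD(2,3)[OF G.FobjD(2)[OF F E E], of e] linD(1)[OF p(1) h] linD(1)[OF p(2) h]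
		by (simp add: dft_def G_Hom fsc_app[of vscale] vs_simps[OF vs_v])
	qed (simp add: dft_def fsc_app[of vscale] vs_simps[OF vs_v])
	then show "dft F M (p + q) h = dft F M p h + dft F M q h" "dft F M (fscale vscale r p) h = fscale vscale r (dft F M p h)"
	 by (blast intro: ext)+
 qed
 show ?thesis
	unfolding linon_def
 proof (intro conjI ballI allI)
	show "jb F M (p + q) = jb F M p + jb F M q" if "p:bH (T E) (Fo F E) M" "q:bH (T E) (Fo F E) M" for p q
	proof
	 fix h show "jb F M (p + q) h = (jb F M p + jb F M q) h"
		using lin(1)[OF that] linonD(2)[OF c dft(1)[OF M F that(1)] dft(1)[OF M F that(2)]]
		by (cases "h:Hom C M (T E)") (simp_all add: jb_def)
	qed
	show "jb F M (fscale vscale r p) = fscale vscale r (jb F M p)" if "p:bH (T E) (Fo F E) M" for p r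
	proof
	 fix h show "jb F M (fscale vscale r p) h = fscale vscale r (jb F M p) h"
		using lin(2)[OF that that] linonD(3)[OF c dft(1)[OF M F that]]
		by (cases "h:Hom C M (T E)") (simp_all add: jb_def fsc_app[of vscale] vs_simps[OF vs_v])
	qed
 qed (rule in')
qed

text \<open>By \<open>jev_image\<close>, \<open>jlow F\<close> is the kernel of the defect map from
  \<open>bF (T E)\<close> with values in \<open>F(E)\<close> to \<open>bF (T E)\<close> with values
  in the model of \<open>Eb F\<close>. The source is generated and cogenerated, the target is
  cogenerated; so \<open>ker_gen\<close> and \<open>cogen_sub\<close> give both conditions for the
  kernel.\<close>

lemma coherent_jlow:
 assumes F: "F:Obj (FunK G)" shows "coherent C (Fo jlow F)"
proof -
 let ?N = "T E" let ?W = "Fo F E" let ?W' = "model (fscale vscale) (Eb F)" let ?t = "fscale (vscale :: 'k => 'k vec => 'k vec)"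
 note N = T[OF E] and W = G.FobjD(1)[OF F E] and W' = model_fds[OF Eb_fds[OF F]]
 note H = jH_fds[OF F] and B = bH_fds[OF N _ W] and B' = bH_fds[OF N _ W']
 note o = jlow_obj[OF F] bF_obj[OF N W] bF_obj[OF N W']
 define k where "k M = (if M:Obj C then tmap sG (jH F M) ?t (bH ?N ?W M) (jev M) else 0)" for M
 define b where "b M = (if M:Obj C then tmap ?t (bH ?N ?W M) ?t (bH ?N ?W' M) (jb F M) else 0)" for M
 have k: "k:Hom (FunK C) (Fo jlow F) (bF ?N ?W)"
 proof (rule FhomI[OF o(1,2)])
	show "k M:vlin (Fo (Fo jlow F) M) (Fo (bF ?N ?W) M)" if "M:Obj C" for M
	 using tmap_lin[OF H[OF that] B[OF that] jev_linon(1)[OF that F]] that by (simp add: k_def bF_Fo)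
	show "k M' (Fm (Fo jlow F) M M' g y) = Fm (bF ?N ?W) M M' g (k M y)"
	 if g: "M:Obj C" "M':Obj C" "g:Hom C M M'" and y: "y:Fo (Fo jlow F) M" for M M' g y
	proof -
	 have y': "y:model sG (jH F M)" using y by simp
	 note a = dec_in[OF y'] and p = pre[OF g F dec_in[OF y']]
	 have "jev M' (pre M M' g (dec sG (jH F M) y)) = restr (Hom C M' ?N) (%h. jev M (dec sG (jH F M) y) (Cmp C h g))"
		using p(2)[OF E] cmp[OF g(1,2) N g(3)] by (auto simp: jev_def restr_def)
	 then show ?thesis
		using g y' p(1) H[OF g(2)] linonD(1)[OF jev_linon(1)[OF g(1) F] a] B[OF g(1)] by (simp add: k_def bF_Fm)
	qed
 qed (simp add: k_def)
 have b: "b:Hom (FunK C) (bF ?N ?W) (bF ?N ?W')"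
 proof (rule FhomI[OF o(2,3)])
	show "b M:vlin (Fo (bF ?N ?W) M) (Fo (bF ?N ?W') M)" if "M:Obj C" for M
	 using tmap_lin[OF B[OF that] B'[OF that] jb_linon[OF that F]] that by (simp add: b_def bF_Fo)
	show "b M' (Fm (bF ?N ?W) M M' g y) = Fm (bF ?N ?W') M M' g (b M y)"
	 if g: "M:Obj C" "M':Obj C" "g:Hom C M M'" and y: "y:Fo (bF ?N ?W) M" for M M' g y
	proof -
	 have y': "y:model ?t (bH ?N ?W M)" using y by (simp add: bF_Fo)
	 let ?p = "dec ?t (bH ?N ?W M) y"
	 have p: "?p:bH ?N ?W M" using y' by simp
	 note q = linonD(1)[OF bF_lin[OF N W g] p]
	 have "jb F M' (restr (Hom C M' ?N) (%h. ?p (Cmp C h g))) = restr (Hom C M' ?N) (%h. jb F M ?p (Cmp C h g))"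
	 proof
		fix h
		show "jb F M' (restr (Hom C M' ?N) (%h. ?p (Cmp C h g))) h = restr (Hom C M' ?N) (%h. jb F M ?p (Cmp C h g)) h"
		proof (cases "h:Hom C M' ?N")
		 case True
		 have "dft F M' (restr (Hom C M' ?N) (%h. ?p (Cmp C h g))) h = dft F M ?p (Cmp C h g)"
			unfolding dft_def using True cmp[OF g(2) N N True] by (auto simp: restr_def fun_eq_iff assoc)
		 then show ?thesis using True cmp[OF g(1,2) N g(3) True] by (simp add: jb_def)
		qed (simp add: jb_def)
	 qed
	 then show ?thesis
		using g y' q B[OF g(2)] linonD(1)[OF jb_linon[OF g(1) F] p] B'[OF g(1)] by (simp add: b_def bF_Fm)
	qed
 qed (simp add: b_def)
 have inj: "inj_on (k M) (Fo (Fo jlow F) M)" if M: "M:Obj C" for M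
	using tmap_inj[OF H[OF M] B[OF M] linonD(1)[OF jev_linon(1)[OF M F]] jev_linon(2)[OF M F]] M by (simp add: k_def)
 have "k M ` Fo (Fo jlow F) M = {x:Fo (bF ?N ?W) M. b M x = 0}" if M: "M:Obj C" for M
 proof -
	have "jb F M p = 0 \<longleftrightarrow> (ALL e:Hom C ?N ?N. ALL h:Hom C M ?N. p (Cmp C e h) = Fm F E E e (p h))"
	 if p: "p:bH ?N ?W M" for p
	proof -
	 have "jb F M p = 0 \<longleftrightarrow> (ALL h:Hom C M ?N. coords ?t (Eb F) (dft F M p h) = 0)"
		by (auto simp: jb_def fun_eq_iff[of _ "0 :: 'm => 'k vec"] restr_def)
	 also have "... \<longleftrightarrow> (ALL h:Hom C M ?N. dft F M p h = 0)"
		using coords_inj[OF Eb_fds[OF F] dft(1)[OF M F p] subspD(1)[OF fsub[OF Eb_fds[OF F]]]] coords_zero[OF Eb_fds[OF F]] by auto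
	 also have "... \<longleftrightarrow> (ALL h:Hom C M ?N. ALL e:Hom C ?N ?N. p (Cmp C e h) = Fm F E E e (p h))"
		by (auto simp: dft_def restr_def fun_eq_iff[of _ "0 :: 'm => 'k vec"])
	 finally show ?thesis by blast
	qed
	then have "jev M ` jH F M = {p:bH ?N ?W M. jb F M p = 0}" using jev_image[OF M F] by auto
	then have "k M ` Fo (Fo jlow F) M = coords ?t (bH ?N ?W M) ` {p:bH ?N ?W M. jb F M p = 0}"
	 using tmap_image[OF H[OF M], of ?t "bH ?N ?W M" "jev M"] M by (simp add: k_def)
	also have "... = {x:Fo (bF ?N ?W) M. b M x = 0}"
	proof (intro equalityI subsetI)
	 fix x assume "x:coords ?t (bH ?N ?W M) ` {p:bH ?N ?W M. jb F M p = 0}"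
	 then show "x:{x:Fo (bF ?N ?W) M. b M x = 0}"
		using M B[OF M] coords_zero[OF B'[OF M]] by (auto simp: bF_Fo b_def)
	next
	 fix x assume "x:{x:Fo (bF ?N ?W) M. b M x = 0}"
	 then have x: "x:model ?t (bH ?N ?W M)" "tmap ?t (bH ?N ?W M) ?t (bH ?N ?W' M) (jb F M) x = 0" using M by (auto simp: bF_Fo b_def)
	 then have "jb F M (dec ?t (bH ?N ?W M) x) = 0"
		using tmap_zero_iff[OF B'[OF M] x(1) linonD(1)[OF jb_linon[OF M F] dec_in[OF x(1)]]] by simp
	 then show "x:coords ?t (bH ?N ?W M) ` {p:bH ?N ?W M. jb F M p = 0}"
		using x(1) by (intro image_eqI[of _ _ "dec ?t (bH ?N ?W M) x"]) simp_all
	qed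
	finally show ?thesis .
 qed
 then have pk: "pw_ker (bF ?N ?W) b (Fo jlow F) k" using inj by (simp add: pw_ker_def)
 have "EX M'. gen M' (Fo jlow F)" by (rule ker_gen[OF o(2,3,1) b k pk bF_gen[OF N W] bF_cogen[OF N W']])
 moreover have "cogen ?N (Fo jlow F)" by (rule cogen_sub[OF o(1,2) k inj bF_cogen[OF N W]])
 ultimately show ?thesis using coherent_iff[OF o(1)] by blast
qed

definition eps :: "('k, 'q, 'm) vfunc => 'q => 'k vec => 'k vec" where
 "eps F V = (if V:Obj G then restr (model sG (jH F (T V))) (%y. ev (T V) (dec sG (jH F (T V)) y) V (Idm C (T V))) else 0)"

lemma eps_hom:
 assumes F: "F:Obj (FunK G)"
 shows "eps F:Hom (FunK G) (Fo jst (Fo jlow F)) F"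
proof (rule G.FhomI[OF jst_obj[OF jlow_obj[OF F]] F])
 fix V assume V: "V:Obj G"
 note o = T[OF V] and H = jH_fds[OF F T[OF V]]
 have "linon sG (jH F (T V)) vscale (Fo F V) (%ph. ev (T V) ph V (Idm C (T V)))"
	using ev(2)[OF o _ V idm[OF o]] by (simp add: linon_def ev_linear)
 from restr_lin[OF fsub[OF model_fds[OF H]] linon_comp[OF dec_linon[OF H] this]]
 show "eps F V:vlin (Fo (Fo jst (Fo jlow F)) V) (Fo F V)" using V by (simp add: eps_def)
next
 fix V W u y assume V: "V:Obj G" and W: "W:Obj G" and u: "u:Hom G V W" and "y:Fo (Fo jst (Fo jlow F)) V"
 then have y: "y:model sG (jH F (T V))" and u': "u:Hom C (T V) (T W)" by (simp_all add: G_Hom)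
 let ?p = "dec sG (jH F (T V)) y"
 note p = dec_in[OF y] and pp = pre[OF T[OF V] T[OF W] u' F dec_in[OF y]]
 have "ev (T W) (pre (T V) (T W) u ?p) W (Idm C (T W)) = Fm F V W u (ev (T V) ?p V (Idm C (T V)))"
	using pp(2)[OF W idm[OF T[OF W]]] ev(3)[OF T[OF V] p V W idm[OF T[OF V]] u'] idl[OF T[OF V] T[OF W] u'] idr[OF T[OF V] T[OF W] u'] by simp
 then show "eps F W (Fm (Fo jst (Fo jlow F)) V W u y) = Fm F V W u (eps F V y)"
	using V W y pp(1) jH_fds[OF F T[OF W]] by (simp add: eps_def)
qed (simp add: eps_def)

lemma eps_coords: "F:Obj (FunK G) ==> V:Obj G ==> ph:jH F (T V) ==>
	eps F V (coords sG (jH F (T V)) ph) = ev (T V) ph V (Idm C (T V))"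
 using jH_fds[of F "T V"] T by (simp add: eps_def)

text \<open>Fullness of \<open>T\<close> makes the restriction of the functor represented by
  \<open>T V\<close> the functor represented by \<open>V\<close> on \<open>G\<close>. So this is the
  Yoneda lemma: a transformation is determined by its value at the identity, and every value
  occurs.\<close>

lemma eps_iso:
 assumes F: "F:Obj (FunK G)" shows "iso_in (FunK G) (Fo jst (Fo jlow F)) F (eps F)"
proof (rule G.pw_iso[OF jst_obj[OF jlow_obj[OF F]] F eps_hom[OF F]])
 fix V assume V: "V:Obj G"
 note o = T[OF V] and H = jH_fds[OF F T[OF V]]
 have det: "ev (T V) ph W h = Fm F V W h (ev (T V) ph V (Idm C (T V)))" if "ph:jH F (T V)" "W:Obj G" "h:Hom C (T V) (T W)" for ph W h
	using ev(3)[OF o that(1) V that(2) idm[OF o] that(3)] idr[OF o T[OF that(2)] that(3)] by simp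
 show "inj_on (eps F V) (Fo (Fo jst (Fo jlow F)) V)"
 proof (rule inj_onI)
	fix y z assume "y:Fo (Fo jst (Fo jlow F)) V" "z:Fo (Fo jst (Fo jlow F)) V" and e: "eps F V y = eps F V z"
	then have yz: "y:model sG (jH F (T V))" "z:model sG (jH F (T V))" by simp_all
	have "dec sG (jH F (T V)) y = dec sG (jH F (T V)) z"
	 by (rule jH_eqI[OF o dec_in[OF yz(1)] dec_in[OF yz(2)]])
		(use e V yz in \<open>simp add: eps_def det[OF dec_in[OF yz(1)]] det[OF dec_in[OF yz(2)]]\<close>)
	then show "y = z" using dec_inj[OF yz] by simp
 qed
 show "eps F V ` Fo (Fo jst (Fo jlow F)) V = Fo F V"
 proof
	show "eps F V ` Fo (Fo jst (Fo jlow F)) V <= Fo F V" using G.hom_in[OF eps_hom[OF F] V] by blast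
	show "Fo F V <= eps F V ` Fo (Fo jst (Fo jlow F)) V"
	proof
	 fix x assume x: "x:Fo F V"
	 have "hrep G V = Fo jst (hrep C (T V))" by (simp add: hrep_def jst_def G_Hom G_Cmp G_Scl)
	 then have y: "G.yon V F x:jH F (T V)" using G.yon_hom[OF V F x] by (simp add: jH_def)
	 have "ev (T V) (G.yon V F x) V (Idm C (T V)) = x"
		using G.yon_coords[OF V V G.idm[OF V], of F x] G.Fm_id[OF F V x] by (simp add: ev_def G_Hom G_Scl G_Idm)
	 then have e: "eps F V (coords sG (jH F (T V)) (G.yon V F x)) = x" using eps_coords[OF F V y] by simp
	 have "coords sG (jH F (T V)) (G.yon V F x):Fo (Fo jst (Fo jlow F)) V"
		unfolding jst_sel jlow_sel by (rule coords_model[OF y])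
	 from imageI[OF this, of "eps F V"] show "x:eps F V ` Fo (Fo jst (Fo jlow F)) V" by (simp only: e)
	qed
 qed
qed

lemma jlow_Fm_hom:
 assumes F: "F:Obj (FunK G)" "F':Obj (FunK G)" and b: "be:Hom (FunK G) F F'"
 shows "Fm jlow F F' be:Hom (FunK C) (Fo jlow F) (Fo jlow F')"
	"Cmp (FunK G) (eps F') (Fm jst (Fo jlow F) (Fo jlow F') (Fm jlow F F' be)) = Cmp (FunK G) be (eps F)"
proof -
 have bj: "Cmp (FunK G) be al:jH F' M" if "M:Obj C" "al:jH F M" for M al
	using G.FunK_cmp[OF jst_obj[OF hrep_obj[OF that(1)]] F that(2)[unfolded jH_def] b] by (simp add: jH_def)
 have bl: "linon sG (jH F M) sG (jH F' M) (%al. Cmp (FunK G) be al)" if M: "M:Obj C" for M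
	unfolding linon_def
 proof (intro conjI ballI allI)
	fix al assume a: "al:jH F M"
	show "Cmp (FunK G) be al:jH F' M" by (rule bj[OF M a])
	note h = jst_obj[OF hrep_obj[OF M]]
	show "Cmp (FunK G) be (al + al') = Cmp (FunK G) be al + Cmp (FunK G) be al'" if "al':jH F M" for al'
	 by (rule G.FunK_cmp_add[OF h F a[unfolded jH_def] that[unfolded jH_def] b])
	show "Cmp (FunK G) be (sG c al) = sG c (Cmp (FunK G) be al)" for c
	proof (rule jH_eqI[OF M bj[OF M subspD(3)[OF jH_subsp[OF F(1) M] a]] subspD(3)[OF jH_subsp[OF F(2) M] bj[OF M a]]])
	 fix V h assume V: "V:Obj G" and h: "h:Hom C M (T V)"
	 show "ev M (Cmp (FunK G) be (sG c al)) V h = ev M (sG c (Cmp (FunK G) be al)) V h"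
		using linD(3)[OF G.FhomD(1)[OF b V] ev(2)[OF M a V h]] ev_linear(2)[of M c al V h]
		by (simp add: ev_linear(2), simp add: ev_def FunK_sel(4))
	qed
 qed
 note H = jH_fds[OF F(1)] and H' = jH_fds[OF F(2)]
 show 1: "Fm jlow F F' be:Hom (FunK C) (Fo jlow F) (Fo jlow F')"
 proof (rule FhomI[OF jlow_obj[OF F(1)] jlow_obj[OF F(2)]])
	show "Fm jlow F F' be M:vlin (Fo (Fo jlow F) M) (Fo (Fo jlow F') M)" if "M:Obj C" for M
	 using tmap_lin[OF H[OF that] H'[OF that] bl[OF that]] that by (simp add: jlow_Fm)
	show "Fm jlow F F' be N (Fm (Fo jlow F) M N g y) = Fm (Fo jlow F') M N g (Fm jlow F F' be M y)"
	 if g: "M:Obj C" "N:Obj C" "g:Hom C M N" and y: "y:Fo (Fo jlow F) M" for M N g y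
	proof -
	 have y': "y:model sG (jH F M)" using y by simp
	 note a = dec_in[OF y'] and p = pre[OF g F(1) dec_in[OF y']]
	 have "Cmp (FunK G) be (pre M N g (dec sG (jH F M) y)) = pre M N g (Cmp (FunK G) be (dec sG (jH F M) y))"
		by (simp add: pre_def FunK_sel(4) comp_assoc)
	 then show ?thesis using g y' p(1) H[OF g(2)] bj[OF g(1) a] H'[OF g(1)] by (simp add: jlow_Fm)
	qed
 qed (simp add: jlow_Fm)
 note j = jst_hom[OF jlow_obj[OF F(1)] jlow_obj[OF F(2)] 1]
 note o = jst_obj[OF jlow_obj[OF F(1)]] jst_obj[OF jlow_obj[OF F(2)]]
 show "Cmp (FunK G) (eps F') (Fm jst (Fo jlow F) (Fo jlow F') (Fm jlow F F' be)) = Cmp (FunK G) be (eps F)"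
 proof (rule G.hom_eqI[OF G.FunK_cmp[OF o F(2) j eps_hom[OF F(2)]] G.FunK_cmp[OF o(1) F eps_hom[OF F(1)] b]])
	fix V y assume V: "V:Obj G" and "y:Fo (Fo jst (Fo jlow F)) V"
	then have y: "y:model sG (jH F (T V))" by simp
	note TV = T[OF V]
	show "Cmp (FunK G) (eps F') (Fm jst (Fo jlow F) (Fo jlow F') (Fm jlow F F' be)) V y = Cmp (FunK G) be (eps F) V y"
	 using eps_coords[OF F(2) V bj[OF TV dec_in[OF y]]] y V TV
	 by (simp add: FunK_sel(4)[of G] jst_Fm jlow_Fm eps_def[of F], simp add: ev_def)
 qed
qed

text \<open>The transpose of \<open>a\<close> sends \<open>x\<close> in \<open>f(X)\<close> to the
  transformation \<open>h \<mapsto> a(f(h) x)\<close>, which is \<open>a\<close> after the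
  restricted Yoneda map of \<open>x\<close>.\<close>

lemma jlow_couniversal:
 assumes F: "F:Obj (FunK G)" and f: "f:Obj (FunK C)" and a: "a:Hom (FunK G) (Fo jst f) F"
 shows "EX! b. b:Hom (FunK C) f (Fo jlow F) & Cmp (FunK G) (eps F) (Fm jst f (Fo jlow F) b) = a"
proof -
 define ps where "ps X x = Cmp (FunK G) a (Fm jst (hrep C X) f (yon X f x))" for X x
 have psi: "ps X x:jH F X" if "X:Obj C" "x:Fo f X" for X x
	unfolding ps_def jH_def
	by (rule G.FunK_cmp[OF jst_obj[OF hrep_obj[OF that(1)]] jst_obj[OF f] F jst_hom[OF hrep_obj[OF that(1)] f yon_hom[OF that(1) f that(2)]] a])
 have evp: "ev X (ps X x) V h = a V (Fm f X (T V) h x)" if "X:Obj C" "V:Obj G" "h:Hom C X (T V)" for X x V h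
	using yon_coords[OF that(1) T[OF that(2)] that(3)] that(2) by (simp add: ps_def ev_def FunK_sel(4) jst_Fm)
 define b where "b X = (if X:Obj C then restr (Fo f X) (%x. coords sG (jH F X) (ps X x)) else 0)" for X
 note H = jH_fds[OF F] and S = subspD[OF jH_subsp[OF F]] and Sf = subspD[OF fsub[OF FobjD(1)[OF f]]]
 have al: "a V (x + y) = a V x + a V y" if "V:Obj G" "x:Fo f (T V)" "y:Fo f (T V)" for V x y
	using linD(2)[OF G.FhomD(1)[OF a that(1)]] that by simp
 have al': "a V (vscale c x) = vscale c (a V x)" if "V:Obj G" "x:Fo f (T V)" for V x c
	using linD(3)[OF G.FhomD(1)[OF a that(1)]] that by simp
 have pl: "linon vscale (Fo f X) sG (jH F X) (ps X)" if X: "X:Obj C" for X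
	unfolding linon_def
 proof (intro conjI ballI allI)
	show "ps X x:jH F X" if "x:Fo f X" for x by (rule psi[OF X that])
	show "ps X (x + y) = ps X x + ps X y" if "x:Fo f X" "y:Fo f X" for x y
	 by (rule jH_eqI[OF X psi[OF X Sf(2)[OF X that]] S(2)[OF X psi[OF X that(1)] psi[OF X that(2)]]])
		(simp add: evp[OF X] ev_linear linD(2)[OF FobjD(2)[OF f X T]] al Fm_in[OF f X T] that)
	show "ps X (vscale c x) = sG c (ps X x)" if "x:Fo f X" for x c
	 by (rule jH_eqI[OF X psi[OF X Sf(3)[OF X that]] S(3)[OF X psi[OF X that(1)]]])
		(simp add: evp[OF X] ev_linear linD(3)[OF FobjD(2)[OF f X T]] al' Fm_in[OF f X T] that)
 qed
 have b: "b:Hom (FunK C) f (Fo jlow F)"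
 proof (rule FhomI[OF f jlow_obj[OF F]])
	show "b X:vlin (Fo f X) (Fo (Fo jlow F) X)" if X: "X:Obj C" for X
	 using restr_lin[OF fsub[OF FobjD(1)[OF f X]] linon_comp[OF pl[OF X] coords_linon[OF H[OF X]]]] X by (simp add: b_def)
	show "b Y (Fm f X Y g x) = Fm (Fo jlow F) X Y g (b X x)"
	 if g: "X:Obj C" "Y:Obj C" "g:Hom C X Y" and x: "x:Fo f X" for X Y g x
	proof -
	 note p = psi[OF g(1) x] and gx = Fm_in[OF f g x]
	 have "ps Y (Fm f X Y g x) = pre X Y g (ps X x)"
		by (rule jH_eqI[OF g(2) psi[OF g(2) gx] pre(1)[OF g F p]])
		 (simp add: evp[OF g(2)] pre(2)[OF g F p] evp[OF g(1)] cmp[OF g(1,2) T g(3)] Fm_comp[OF f g(1,2) T g(3)])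
	 then show ?thesis using g x gx p H[OF g(1)] by (simp add: b_def)
	qed
 qed (simp add: b_def)
 note oj = jlow_obj[OF F] jst_obj[OF f] jst_obj[OF jlow_obj[OF F]]
 have eb: "Cmp (FunK G) (eps F) (Fm jst f (Fo jlow F) b) = a"
 proof (rule G.hom_eqI[OF G.FunK_cmp[OF oj(2,3) F jst_hom[OF f oj(1) b] eps_hom[OF F]] a])
	fix V x assume V: "V:Obj G" and "x:Fo (Fo jst f) V"
	then have x: "x:Fo f (T V)" by simp
	show "Cmp (FunK G) (eps F) (Fm jst f (Fo jlow F) b) V x = a V x"
	 using eps_coords[OF F V psi[OF T[OF V] x]] evp[OF T[OF V] V idm[OF T[OF V]], of x] Fm_id[OF f T[OF V] x] V x T[OF V]
	 by (simp add: FunK_sel(4) jst_Fm b_def)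
 qed
 show ?thesis
 proof (rule ex1I[of _ b])
	show "b:Hom (FunK C) f (Fo jlow F) & Cmp (FunK G) (eps F) (Fm jst f (Fo jlow F) b) = a" using b eb by blast
	fix b' assume b': "b':Hom (FunK C) f (Fo jlow F) & Cmp (FunK G) (eps F) (Fm jst f (Fo jlow F) b') = a"
	then have b'h: "b':Hom (FunK C) f (Fo jlow F)" by simp
	have e': "eps F V (b' (T V) x) = a V x" if V: "V:Obj G" for V x
	proof -
	 have "Cmp (FunK G) (eps F) (Fm jst f (Fo jlow F) b') V x = a V x" using b' by simp
	 then show ?thesis using V by (simp add: FunK_sel(4) jst_Fm)
	qed
	show "b' = b"
	proof (rule hom_eqI[OF b'h b])
	 fix X x assume X: "X:Obj C" and x: "x:Fo f X"
	 have bx: "b' X x:model sG (jH F X)" using hom_in[OF b'h X x] by simp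
	 have "dec sG (jH F X) (b' X x) = ps X x"
	 proof (rule jH_eqI[OF X dec_in[OF bx] psi[OF X x]])
		fix V h assume V: "V:Obj G" and h: "h:Hom C X (T V)"
		note p = pre[OF X T[OF V] h F dec_in[OF bx]]
		have "a V (Fm f X (T V) h x) = eps F V (b' (T V) (Fm f X (T V) h x))" by (simp only: e'[OF V])
		also have "... = eps F V (Fm (Fo jlow F) X (T V) h (b' X x))"
		 by (simp only: FhomD(2)[OF b'h X T[OF V] h, of x])
		also have "... = ev (T V) (pre X (T V) h (dec sG (jH F X) (b' X x))) V (Idm C (T V))"
		 using eps_coords[OF F V p(1)] bx by simp
		also have "... = ev X (dec sG (jH F X) (b' X x)) V h"
		 using p(2)[OF V idm[OF T[OF V]]] idl[OF X T[OF V] h] by simp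
		finally show "ev X (dec sG (jH F X) (b' X x)) V h = ev X (ps X x) V h" by (simp add: evp[OF X V h])
	 qed
	 then show "b' X x = b X x" using coords_dec[OF bx] X x by (simp add: b_def)
	qed
 qed
qed

section \<open>The left adjoint by duality, and the abstract recollement\<close>

definition jshr :: "(('k, 'q, 'm) vfunc, 'q => 'k vec => 'k vec, ('k, 'o, 'm) vfunc, 'o => 'k vec => 'k vec) func" where
 "jshr = \<lparr>Fo = %F. dF (Fo jlow (G.dF F)),
	 Fm = %F F' be. dFm (Fo jlow (G.dF F')) (Fo jlow (G.dF F)) (Fm jlow (G.dF F') (G.dF F) (G.dFm F F' be))\<rparr>"

text \<open>The comparison between dualizing before and after restriction; it is an isomorphism
  because \<open>ka V\<close> is one, and \<open>cc'\<close> is its inverse.\<close>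

definition cc :: "('k, 'o, 'm) vfunc => 'q => 'k vec => 'k vec" where
 "cc f V = (if V:Obj G then dual_map (Fo f (T (DG V))) (Fo f (D0 (T V))) (Fm f (T (DG V)) (D0 (T V)) (ka V)) else 0)"

definition cc' :: "('k, 'o, 'm) vfunc => 'q => 'k vec => 'k vec" where
 "cc' f V = (if V:Obj G then dual_map (Fo f (D0 (T V))) (Fo f (T (DG V))) (Fm f (D0 (T V)) (T (DG V)) (ka' V)) else 0)"

lemma jst_dF_Fo: "Fo (Fo jst (dF f)) V = dual (Fo f (D0 (T V)))" "Fo (G.dF (Fo jst f)) V = dual (Fo f (T (DG V)))"
 by (simp_all add: dF_Fo G.dF_Fo)

lemma cc:
 assumes f: "f:Obj (FunK C)"
 shows "cc f:Hom (FunK G) (Fo jst (dF f)) (G.dF (Fo jst f))" "cc' f:Hom (FunK G) (G.dF (Fo jst f)) (Fo jst (dF f))"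
	"Cmp (FunK G) (cc' f) (cc f) = Idm (FunK G) (Fo jst (dF f))"
	"Cmp (FunK G) (cc f) (cc' f) = Idm (FunK G) (G.dF (Fo jst f))"
proof -
 note V = FobjD(1)[OF f]
 note o1 = jst_obj[OF dF_obj[OF f]] and o2 = G.dF_obj[OF jst_obj[OF f]]
 have d: "D0 (T W):Obj C" "T (DG W):Obj C" if "W:Obj G" for W using that by (simp_all add: D_obj T DG)
 note h = FobjD(2)[OF f d(2,1) kappa(1)] and h' = FobjD(2)[OF f d(1,2) kappa(2)]
 show "cc f:Hom (FunK G) (Fo jst (dF f)) (G.dF (Fo jst f))"
 proof (rule G.FhomI[OF o1 o2])
	show "cc f W:vlin (Fo (Fo jst (dF f)) W) (Fo (G.dF (Fo jst f)) W)" if W: "W:Obj G" for W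
	 using dual_map_lin[OF V[OF d(2)[OF W]] V[OF d(1)[OF W]] h[OF W W W]] W by (simp add: jst_dF_Fo cc_def del: jst_sel)
	fix W W' u y assume W: "W:Obj G" "W':Obj G" and u: "u:Hom G W W'" and "y:Fo (Fo jst (dF f)) W"
	then have y: "y:dual (Fo f (D0 (T W)))" and u': "u:Hom C (T W) (T W')" by (simp_all add: G_Hom dF_Fo)
	note 1 = dual_map_in[OF V[OF d(2)[OF W(1)]] V[OF d(1)[OF W(1)]] h[OF W(1) W(1) W(1)] y]
	have y': "dual_map (Fo f (T (DG W))) (Fo f (D0 (T W))) (Fm f (T (DG W)) (D0 (T W)) (ka W)) y:dual (Fo (Fo jst f) (DG W))" using 1(1) by simp
	note 2 = G.dF_Fm[OF jst_obj[OF f] W u y', unfolded jst_sel]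
	note 3 = dF_Fm[OF f T[OF W(1)] T[OF W(2)] u' y]
	note 4 = dual_map_in[OF V[OF d(2)[OF W(2)]] V[OF d(1)[OF W(2)]] h[OF W(2) W(2) W(2)] 3(1)]
	have "cc f W' (Fm (dF f) (T W) (T W') u y) = Fm (G.dF (Fo jst f)) W W' u (cc f W y)"
	proof (rule dual_ext[of _ "Fo f (T (DG W'))"])
	 show "cc f W' (Fm (dF f) (T W) (T W') u y):dual (Fo f (T (DG W')))" using 4(1) W by (simp add: cc_def)
	 show "Fm (G.dF (Fo jst f)) W W' u (cc f W y):dual (Fo f (T (DG W')))" using 2(1) W by (simp add: cc_def)
	 fix x assume x: "x:Fo f (T (DG W'))"
	 have "Fm f (D0 (T W')) (D0 (T W)) (D1 (T W) (T W') u) (Fm f (T (DG W')) (D0 (T W')) (ka W') x)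
		= Fm f (T (DG W)) (D0 (T W)) (ka W) (Fm f (T (DG W')) (T (DG W)) (DG1 W W' u) x)"
		using Fm_comp[OF f d(2)[OF W(2)] d(1)[OF W(2)] d(1)[OF W(1)] kappa(1)[OF W(2)] D_hom[OF T[OF W(1)] T[OF W(2)] u'], of x]
		 Fm_comp[OF f d(2)[OF W(2)] d(2)[OF W(1)] d(1)[OF W(1)] DG1_hom(2)[OF W u'] kappa(1)[OF W(1)], of x]
		 DG1[OF W u'] kappa_cancel(1)[OF W(1) d(2)[OF W(2)] DG1_hom(1)[OF W u']] by simp
	 then show "eval_dual (Fo f (T (DG W'))) (cc f W' (Fm (dF f) (T W) (T W') u y)) x =
		eval_dual (Fo f (T (DG W'))) (Fm (G.dF (Fo jst f)) W W' u (cc f W y)) x"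
		using 1(2) 2(2) 3(2) 4(2) W by (simp add: cc_def)
	qed
	then show "cc f W' (Fm (Fo jst (dF f)) W W' u y) = Fm (G.dF (Fo jst f)) W W' u (cc f W y)" by simp
 qed (simp add: cc_def)
 note cch = this
 have dd: "cc f W o cc' f W = id_on (dual (Fo f (T (DG W))))" "cc' f W o cc f W = id_on (dual (Fo f (D0 (T W))))" if W: "W:Obj G" for W
	using dual_map_comp[OF V[OF d(2)[OF W]] V[OF d(1)[OF W]] V[OF d(2)[OF W]] h[OF W W W] h'[OF W W W]]
	 dual_map_comp[OF V[OF d(1)[OF W]] V[OF d(2)[OF W]] V[OF d(1)[OF W]] h'[OF W W W] h[OF W W W]]
	 FobjD(4)[OF f d(2)[OF W] d(1)[OF W] d(2)[OF W] kappa(1,2)[OF W]] FobjD(4)[OF f d(1)[OF W] d(2)[OF W] d(1)[OF W] kappa(2,1)[OF W]]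
	 kappa(3,4)[OF W] FobjD(3)[OF f d(1)[OF W]] FobjD(3)[OF f d(2)[OF W]] dual_map_id[OF V[OF d(1)[OF W]]] dual_map_id[OF V[OF d(2)[OF W]]] W
	by (simp_all add: cc_def cc'_def)
 have cl: "cc' f W:vlin (dual (Fo f (T (DG W)))) (dual (Fo f (D0 (T W))))" if W: "W:Obj G" for W
	using dual_map_lin[OF V[OF d(1)[OF W]] V[OF d(2)[OF W]] h'[OF W W W]] W by (simp add: cc'_def)
 show "cc' f:Hom (FunK G) (G.dF (Fo jst f)) (Fo jst (dF f))"
 proof (rule G.FhomI[OF o2 o1])
	show "cc' f W:vlin (Fo (G.dF (Fo jst f)) W) (Fo (Fo jst (dF f)) W)" if W: "W:Obj G" for W
	 using cl[OF W] by (simp add: jst_dF_Fo del: jst_sel)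
	fix W W' u y assume W: "W:Obj G" "W':Obj G" and u: "u:Hom G W W'" and y: "y:Fo (G.dF (Fo jst f)) W"
	let ?z = "cc' f W y"
	have z: "?z:Fo (Fo jst (dF f)) W" using linD(1)[OF cl[OF W(1)]] y by (simp add: jst_dF_Fo del: jst_sel)
	have yz: "y = cc f W ?z" using fun_cong[OF dd(1)[OF W(1)], of y] y by (simp add: id_on_def jst_dF_Fo del: jst_sel)
	have "cc' f W' (Fm (G.dF (Fo jst f)) W W' u y) = cc' f W' (cc f W' (Fm (Fo jst (dF f)) W W' u ?z))"
	 using G.FhomD(2)[OF cch W u, of ?z] yz by simp
	also have "... = Fm (Fo jst (dF f)) W W' u ?z"
	 using fun_cong[OF dd(2)[OF W(2)]] G.Fm_in[OF o1 W u z] by (simp add: id_on_def jst_dF_Fo del: jst_sel)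
	finally show "cc' f W' (Fm (G.dF (Fo jst f)) W W' u y) = Fm (Fo jst (dF f)) W W' u (cc' f W y)" .
 qed (simp add: cc'_def)
 show "Cmp (FunK G) (cc' f) (cc f) = Idm (FunK G) (Fo jst (dF f))"
	using dd(2) by (auto simp: FunK_sel(3,4) jst_dF_Fo cc_def cc'_def fun_eq_iff simp del: jst_sel)
 show "Cmp (FunK G) (cc f) (cc' f) = Idm (FunK G) (G.dF (Fo jst f))"
	using dd(1) by (auto simp: FunK_sel(3,4) jst_dF_Fo cc_def cc'_def fun_eq_iff simp del: jst_sel)
qed

lemma cc_nat:
 assumes f: "f:Obj (FunK C)" "f':Obj (FunK C)" and p: "ph:Hom (FunK C) f f'"
 shows "Cmp (FunK G) (G.dFm (Fo jst f) (Fo jst f') (Fm jst f f' ph)) (cc f') = Cmp (FunK G) (cc f) (Fm jst (dF f') (dF f) (dFm f f' ph))"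
proof
 fix W
 show "Cmp (FunK G) (G.dFm (Fo jst f) (Fo jst f') (Fm jst f f' ph)) (cc f') W = Cmp (FunK G) (cc f) (Fm jst (dF f') (dF f) (dFm f f' ph)) W"
 proof (cases "W:Obj G")
	case W: True
	have d: "D0 (T W):Obj C" "T (DG W):Obj C" using W by (simp_all add: D_obj T DG)
	note V = FobjD(1)[OF f(1)] and V' = FobjD(1)[OF f(2)]
	note h = FobjD(2)[OF f(1) d(2,1) kappa(1)[OF W]] and h' = FobjD(2)[OF f(2) d(2,1) kappa(1)[OF W]]
	note q = FhomD(1)[OF p d(1)] FhomD(1)[OF p d(2)]
	have "Fm f' (T (DG W)) (D0 (T W)) (ka W) o ph (T (DG W)) = ph (D0 (T W)) o Fm f (T (DG W)) (D0 (T W)) (ka W)"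
	 using FhomD(2)[OF p d(2,1) kappa(1)[OF W]] by (simp add: fun_eq_iff)
	then show ?thesis
	 using dual_map_comp[OF V[OF d(2)] V'[OF d(2)] V'[OF d(1)] q(2) h'] dual_map_comp[OF V[OF d(2)] V[OF d(1)] V'[OF d(1)] h q(1)] W
	 by (simp add: FunK_sel(4) G.dFm_def jst_Fm cc_def dFm_def T DG)
 qed (simp add: FunK_sel(4) cc_def G.dFm_def jst_Fm fun_eq_iff)
qed

theorem recollement_FunK:
 "EX iL iR. recollement (kernel_subcat (full_subcat (FunK C) (coherent C)) (FunK G) jst)
	 (full_subcat (FunK C) (coherent C)) (FunK G) iL id_func iR jshr jst jlow"
proof -
 let ?A = "full_subcat (FunK C) (coherent C)"
 have aA: "acat ?A" by (rule acat_FunK)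
 have aG: "acat (FunK G)" using G.acat_FunK[of "%_. True"] by (simp add: full_subcat_True)
 have abA: "abelian_category ?A"
	by (rule abelian_FunK_sub) (auto intro: coherent_zero coherent_biproduct coherent_ker coherent_cok)
 have abG: "abelian_category (FunK G)"
	using G.abelian_FunK_sub[of "%_. True"] by (simp add: full_subcat_True)
 \<comment> \<open>Written as a condition on single values, membership in the kernel passes to
   kernels, cokernels and biproducts, so \<open>abelian_FunK_sub\<close> applies a second
   time.\<close>
 have ks: "kernel_subcat ?A (FunK G) jst = full_subcat (FunK C) (%f. coherent C f & (ALL V:Obj G. Fo f (T V) = {0}))"
 proof -
	have "{X:Obj ?A. zero_object (FunK G) (Fo jst X)} = {X:Obj (FunK C). coherent C X & (ALL V:Obj G. Fo X (T V) = {0})}"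
	 by (auto simp: G.zero_object_FunK jst_obj)
	then show ?thesis by (simp add: kernel_subcat_def full_subcat_def)
 qed
 have abK: "abelian_category (kernel_subcat ?A (FunK G) jst)"
	unfolding ks
 proof (rule abelian_FunK_sub)
	fix F K S i1 i2 p1 p2
	assume F: "F:Obj (FunK C)" "K:Obj (FunK C)" and z: "coherent C F & (ALL V:Obj G. Fo F (T V) = {0})" "coherent C K & (ALL V:Obj G. Fo K (T V) = {0})"
	 and b: "biproduct (FunK C) F K S i1 i2 p1 p2"
	have S: "S:Obj (FunK C)" and i: "i1:Hom (FunK C) F S" "i2:Hom (FunK C) K S"
	 and p: "p1:Hom (FunK C) S F" "p2:Hom (FunK C) S K" using b by (simp_all add: biproduct_def)
	have "Fo S (T V) = {0}" if V: "V:Obj G" for V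
	proof -
	 have "y = 0" if y: "y:Fo S (T V)" for y
	 proof -
		have "p1 (T V) y = 0" "p2 (T V) y = 0" using hom_in[OF p(1) T[OF V] y] hom_in[OF p(2) T[OF V] y] z V by auto
		then show ?thesis using biproduct_pw[OF b T[OF V] y] hom0[OF i(1) F(1) T[OF V]] hom0[OF i(2) F(2) T[OF V]] by simp
	 qed
	 then show ?thesis using subspD(1)[OF fsub[OF FobjD(1)[OF S T[OF V]]]] by blast
	qed
	then show "coherent C S & (ALL V:Obj G. Fo S (T V) = {0})" using coherent_biproduct[OF F _ _ b] z by blast
 next
	fix F K al N k
	assume F: "F:Obj (FunK C)" "K:Obj (FunK C)" "N:Obj (FunK C)" and z: "coherent C F & (ALL V:Obj G. Fo F (T V) = {0})" "coherent C K & (ALL V:Obj G. Fo K (T V) = {0})"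
	 and a: "al:Hom (FunK C) F K" and k: "k:Hom (FunK C) N F" and pw: "pw_ker F al N k"
	have "Fo N (T V) = {0}" if V: "V:Obj G" for V
	proof -
	 note o = subspD(1)[OF fsub[OF FobjD(1)[OF F(3) T[OF V]]]]
	 have i: "inj_on (k (T V)) (Fo N (T V))" using pw T[OF V] by (simp add: pw_ker_def)
	 have "y = 0" if y: "y:Fo N (T V)" for y
		using inj_onD[OF i _ y o] hom_in[OF k T[OF V] y] hom0[OF k F(3) T[OF V]] z V by auto
	 then show ?thesis using o by blast
	qed
	then show "coherent C N & (ALL V:Obj G. Fo N (T V) = {0})" using coherent_ker[OF F _ _ a k pw] z by blast
 next
	fix F K al N k
	assume F: "F:Obj (FunK C)" "K:Obj (FunK C)" "N:Obj (FunK C)" and z: "coherent C F & (ALL V:Obj G. Fo F (T V) = {0})" "coherent C K & (ALL V:Obj G. Fo K (T V) = {0})"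
	 and a: "al:Hom (FunK C) F K" and k: "k:Hom (FunK C) K N" and pw: "pw_cok F K al N k"
	have "Fo N (T V) = {0}" if V: "V:Obj G" for V
	proof -
	 have "k (T V) ` Fo K (T V) = Fo N (T V)" using pw T[OF V] by (simp add: pw_cok_def)
	 then show ?thesis using z(2) V hom0[OF k F(2) T[OF V]] by auto
	qed
	then show "coherent C N & (ALL V:Obj G. Fo N (T V) = {0})" using coherent_cok[OF F _ _ a k pw] z by blast
 qed (auto intro: coherent_zero T)
 have adR: "additive_functor (FunK G) ?A jlow & (EX et. adjunction ?A (FunK G) jst jlow et eps)"
	by (rule right_adjoint_of_couniversal[OF aA aG jst_additive])
	 (simp_all add: jlow_obj coherent_jlow eps_hom jlow_Fm_hom jlow_couniversal)
 then obtain et where R: "additive_functor (FunK G) ?A jlow" and ad: "adjunction ?A (FunK G) jst jlow et eps" by blast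
 have isoR: "nat_iso (FunK G) (FunK G) (jst \<odot> jlow) id_func eps"
	using ad eps_iso by (simp add: nat_iso_def adjunction_def comp_func_def id_func_def)
 have dA: "catdual ?A dF dFm iF iF'" by (rule catdual_FunK[where P="coherent C", OF coherent_dual])
 have dG: "catdual (FunK G) G.dF G.dFm G.iF G.iF'" using G.catdual_FunK[of "%_. True"] by (simp add: full_subcat_True)
 have "additive_functor (FunK G) ?A jshr & (EX u e. adjunction (FunK G) ?A jshr jst u e & nat_iso (FunK G) (FunK G) id_func (jst \<odot> jshr) u)"
	by (rule left_adjoint_by_duality[OF dA dG jst_additive additive_functorD(1)[OF R] ad isoR, where c=cc and c'=cc'])
	 (auto simp: cc cc_nat jshr_def)
 then obtain u e where L: "additive_functor (FunK G) ?A jshr" and adL: "adjunction (FunK G) ?A jshr jst u e"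
	and isoL: "nat_iso (FunK G) (FunK G) id_func (jst \<odot> jshr) u" by blast
 show ?thesis
	by (rule recollement_of_adjoint_triple[OF aA abA aG abG abK jst_additive L R adL isoL ad isoR])
qed

end

section \<open>Representations of a finite group\<close>

lemma Rep_Obj:
 "M:Obj (Rep G) \<longleftrightarrow> fds vscale (fst M) & (ALL g:carrier G. snd M g:vlin (fst M) (fst M)) &
	 snd M \<one>\<^bsub>G\<^esub> = id_on (fst M) &
	 (ALL g:carrier G. ALL h:carrier G. snd M (g \<otimes>\<^bsub>G\<^esub> h) = snd M g o snd M h)"
 by (cases M) (auto simp: Rep_def Vect_Obj Vect_sel)

lemma Rep_Hom: "Hom (Rep G) M N = {f:vlin (fst M) (fst N). ALL g:carrier G. ALL x:fst M. f (snd M g x) = snd N g (f x)}"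
 by (cases M; cases N) (auto simp: Rep_def Vect_sel)

lemma Rep_sel: "Idm (Rep G) M = id_on (fst M)" "Cmp (Rep G) = (o)" "Scl (Rep G) = fscale vscale"
 by (cases M) (simp_all add: Rep_def Vect_sel)

locale fin_group = group G for G (structure) +
 assumes fin: "finite (carrier G)"
begin

lemma RepD:
 assumes "M:Obj (Rep G)"
 shows "fds vscale (fst M)" "g:carrier G ==> snd M g:vlin (fst M) (fst M)"
	"x:fst M ==> snd M \<one> x = x"
	"g:carrier G ==> h:carrier G ==> snd M (g \<otimes> h) x = snd M g (snd M h x)"
	"g:carrier G ==> x:fst M ==> snd M g x:fst M"
	"g:carrier G ==> h:carrier G ==> snd M (g \<otimes> h) = snd M g o snd M h" "snd M \<one> = id_on (fst M)"
 using assms linD(1)[of "snd M g" vscale "fst M" vscale "fst M" x] by (auto simp: Rep_Obj id_on_def)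

lemma Rep_inv:
 assumes M: "M:Obj (Rep G)" and g: "g:carrier G" and x: "x:fst M"
 shows "snd M (inv g) (snd M g x) = x" "snd M g (snd M (inv g) x) = x"
 using RepD(4)[OF M inv_closed[OF g] g, of x] RepD(4)[OF M g inv_closed[OF g], of x] g RepD(3)[OF M x] by simp_all

lemma RepHomD:
 assumes "f:Hom (Rep G) M N"
 shows "f:vlin (fst M) (fst N)" "g:carrier G ==> x:fst M ==> f (snd M g x) = snd N g (f x)"
	"x:fst M ==> f x:fst N"
 using assms linD(1)[of f vscale "fst M" vscale "fst N" x] by (auto simp: Rep_Hom)

lemma RepHomI:
 assumes "f:vlin (fst M) (fst N)" "!!g x. g:carrier G ==> x:fst M ==> f (snd M g x) = snd N g (f x)"
 shows "f:Hom (Rep G) M N"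
 using assms by (simp add: Rep_Hom)

lemma lcat_Rep: "lcat (Rep G :: ('k::field, ('k, 'a) rep, 'k vec => 'k vec) lincat)"
proof (unfold_locales, unfold Rep_sel)
 fix X Y :: "('k, 'a) rep"
 assume X: "X:Obj (Rep G)"
 note vX = RepD(1)[OF X]
 show "id_on (fst X):Hom (Rep G) X X"
	by (rule RepHomI[OF id_on_lin[OF fsub[OF vX]]]) (simp add: id_on_def RepD(5)[OF X])
 assume Y: "Y:Obj (Rep G)"
 note vY = RepD(1)[OF Y]
 show "g o f:Hom (Rep G) X Z" if "Z:Obj (Rep G)" "f:Hom (Rep G) X Y" "g:Hom (Rep G) Y Z" for Z f g
	by (rule RepHomI[OF lin_comp[OF RepHomD(1)[OF that(2)] RepHomD(1)[OF that(3)] fsub[OF vY] vs_v]])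
	 (simp add: RepHomD(2,3)[OF that(2)] RepHomD(2)[OF that(3)])
 show "f o id_on (fst X) = f" if "f:Hom (Rep G) X Y" for f
	using lin_out[OF RepHomD(1)[OF that]] lin_more(1)[OF RepHomD(1)[OF that] fsub[OF vX]]
	by (auto simp: fun_eq_iff[of _ f] id_on_def)
 show "id_on (fst Y) o f = f" if "f:Hom (Rep G) X Y" for f
	using lin_out[OF RepHomD(1)[OF that]] RepHomD(3)[OF that] by (auto simp: fun_eq_iff[of _ f] id_on_def)
 show "fds (fscale vscale) (Hom (Rep G) X Y)"
 proof (rule fds_sub[OF fds_lin[OF vX vY]])
	show "Hom (Rep G) X Y <= vlin (fst X) (fst Y)" by (auto simp: Rep_Hom)
	note S = subspD[OF subsp_linon[where s=vscale and V="fst X", OF vs_v fsub[OF vY]]]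
	show "subsp (fscale vscale) (Hom (Rep G) X Y)"
	proof (rule subspI)
	 show "0:Hom (Rep G) X Y"
		using lin_more(1)[OF RepD(2)[OF Y] fsub[OF vY]] by (intro RepHomI S(1)) simp
	 show "f + g:Hom (Rep G) X Y" if "f:Hom (Rep G) X Y" "g:Hom (Rep G) X Y" for f g
		by (rule RepHomI[OF S(2)[OF RepHomD(1)[OF that(1)] RepHomD(1)[OF that(2)]]])
		 (simp add: RepHomD(2,3)[OF that(1)] RepHomD(2,3)[OF that(2)] linD(2)[OF RepD(2)[OF Y]])
	 show "fscale vscale c f:Hom (Rep G) X Y" if "f:Hom (Rep G) X Y" for f c
		by (rule RepHomI[OF S(3)[OF RepHomD(1)[OF that(1)]]])
		 (simp add: RepHomD(2,3)[OF that(1)] linD(3)[OF RepD(2)[OF Y]] fsc_app[of vscale])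
	qed simp
 qed
 show "g o (f + f') = (g o f) + (g o f')" if "f:Hom (Rep G) X Y" "f':Hom (Rep G) X Y" "g:Hom (Rep G) Y Z" for f f' g Z
 proof
	fix x show "(g o (f + f')) x = ((g o f) + (g o f')) x"
	 using linD(2)[OF RepHomD(1)[OF that(3)] RepHomD(3)[OF that(1)] RepHomD(3)[OF that(2)]]
		lin_out[OF RepHomD(1)[OF that(1)]] lin_out[OF RepHomD(1)[OF that(2)]] lin_more(1)[OF RepHomD(1)[OF that(3)] fsub[OF vY]]
	 by (cases "x:fst X") auto
 qed
 show "g o fscale vscale c f = fscale vscale c (g o f)" if "f:Hom (Rep G) X Y" "g:Hom (Rep G) Y Z" for f g Z c
 proof
	fix x show "(g o fscale vscale c f) x = fscale vscale c (g o f) x"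
	 using linD(3)[OF RepHomD(1)[OF that(2)] RepHomD(3)[OF that(1)]]
		lin_out[OF RepHomD(1)[OF that(1)]] lin_more(1)[OF RepHomD(1)[OF that(2)] fsub[OF vY]]
	 by (cases "x:fst X") (auto simp: fsc_app[of vscale] vs_simps[OF vs_v])
 qed
qed (auto simp: comp_assoc fsc_app[of vscale] fun_eq_iff fsc_app[of "(*)"])

lemma Rep_inverse_hom:
 assumes X: "X:Obj (Rep G)" and Y: "Y:Obj (Rep G)" and f: "f:Hom (Rep G) X Y"
	and g: "g:vlin (fst Y) (fst X)" "g o f = id_on (fst X)" "f o g = id_on (fst Y)"
 shows "g:Hom (Rep G) Y X"
proof (rule RepHomI[OF g(1)])
 fix c y assume c: "c:carrier G" and y: "y:fst Y"
 have x: "g y:fst X" by (rule linD(1)[OF g(1) y])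
 have fg: "f (g y) = y" using fun_cong[OF g(3), of y] y by (simp add: id_on_def)
 have "g (snd Y c y) = g (f (snd X c (g y)))" by (simp add: RepHomD(2)[OF f c x] fg)
 then show "g (snd Y c y) = snd X c (g y)" using fun_cong[OF g(2), of "snd X c (g y)"] RepD(5)[OF X c x] by (simp add: id_on_def)
qed

lemma dual_rep_sel: "fst (dual_rep G M) = dual (fst M)" "snd (dual_rep G M) g = dual_map (fst M) (fst M) (snd M (inv g))"
 by (simp_all add: dual_rep_def split_def)

lemma dual_rep_obj:
 assumes M: "M:Obj (Rep G)" shows "dual_rep G M:Obj (Rep G)"
 unfolding Rep_Obj dual_rep_sel
proof (intro conjI ballI)
 note V = RepD(1)[OF M]
 show "fds vscale (dual (fst M))" using V by simp
 show "dual_map (fst M) (fst M) (snd M (inv g)):vlin (dual (fst M)) (dual (fst M))" if "g:carrier G" for g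
	using dual_map_lin[OF V V RepD(2)[OF M inv_closed[OF that]]] .
 show "dual_map (fst M) (fst M) (snd M (inv \<one>)) = id_on (dual (fst M))"
	using dual_map_id[OF V] RepD(7)[OF M] by simp
 show "dual_map (fst M) (fst M) (snd M (inv (g \<otimes> h))) =
	dual_map (fst M) (fst M) (snd M (inv g)) o dual_map (fst M) (fst M) (snd M (inv h))" if "g:carrier G" "h:carrier G" for g h
	using dual_map_comp[OF V V V RepD(2)[OF M] RepD(2)[OF M], of "inv g" "inv h"] that
	by (simp add: inv_mult_group RepD(6)[OF M])
qed

lemma lduality_Rep: "lduality (Rep G :: ('k::field, ('k, 'a) rep, 'k vec => 'k vec) lincat) (dual_rep G) (%M N. dual_map (fst M) (fst N)) (%M. iotaV (fst M))"
proof -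
 interpret R: lcat "Rep G :: ('k, ('k, 'a) rep, 'k vec => 'k vec) lincat" by (rule lcat_Rep)
 show ?thesis
 proof (unfold_locales, unfold Rep_sel dual_rep_sel)
	fix X Y :: "('k, 'a) rep" and f
	assume X: "X:Obj (Rep G)" and Y: "Y:Obj (Rep G)" and f: "f:Hom (Rep G) X Y"
	note v = RepD(1)[OF X] RepD(1)[OF Y] and fl = RepHomD(1)[OF f]
	show "dual_map (fst X) (fst Y) f:Hom (Rep G) (dual_rep G Y) (dual_rep G X)"
	proof (rule RepHomI, unfold dual_rep_sel)
	 show "dual_map (fst X) (fst Y) f:vlin (dual (fst Y)) (dual (fst X))" by (rule dual_map_lin[OF v fl])
	 fix g assume g: "g:carrier G"
	 note ig = inv_closed[OF g]
	 have "f o snd X (inv g) = snd Y (inv g) o f"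
		by (rule lin_eqI[OF lin_comp[OF RepD(2)[OF X ig] fl fsub[OF v(1)] vs_v] lin_comp[OF fl RepD(2)[OF Y ig] fsub[OF v(2)] vs_v]])
		 (simp add: RepHomD(2)[OF f ig])
	 then have "dual_map (fst X) (fst Y) f o dual_map (fst Y) (fst Y) (snd Y (inv g)) =
		dual_map (fst X) (fst X) (snd X (inv g)) o dual_map (fst X) (fst Y) f"
		using dual_map_comp[OF v(1,2,2) fl RepD(2)[OF Y ig]] dual_map_comp[OF v(1,1,2) RepD(2)[OF X ig] fl] by simp
	 from fun_cong[OF this] show "dual_map (fst X) (fst Y) f (dual_map (fst Y) (fst Y) (snd Y (inv g)) x) =
		dual_map (fst X) (fst X) (snd X (inv g)) (dual_map (fst X) (fst Y) f x)" for x by simp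
	qed
	show "dual_map (fst X) (fst Z) (g o f) = dual_map (fst X) (fst Y) f o dual_map (fst Y) (fst Z) g"
	 if "Z:Obj (Rep G)" "g:Hom (Rep G) Y Z" for Z g
	 by (rule dual_map_comp[OF v RepD(1)[OF that(1)] fl RepHomD(1)[OF that(2)]])
	show "dual_map (fst X) (fst Y) (f + g) = dual_map (fst X) (fst Y) f + dual_map (fst X) (fst Y) g"
	 if "g:Hom (Rep G) X Y" for g by (rule dual_map_add[OF v fl RepHomD(1)[OF that]])
	show "dual_map (fst X) (fst Y) (fscale vscale c f) = fscale vscale c (dual_map (fst X) (fst Y) f)" for c
	 by (rule dual_map_scale[OF v fl])
	show "dual_map (dual (fst Y)) (dual (fst X)) (dual_map (fst X) (fst Y) f) o iotaV (fst X) = iotaV (fst Y) o f"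
	 by (rule iotaV_natural[OF v fl])
 next
	fix X :: "('k, 'a) rep"
	assume X: "X:Obj (Rep G)"
	note v = RepD(1)[OF X] and DX = dual_rep_obj[OF X] and DDX = dual_rep_obj[OF dual_rep_obj[OF X]]
	show "dual_rep G X:Obj (Rep G)" by (rule DX)
	show "dual_map (fst X) (fst X) (id_on (fst X)) = id_on (dual (fst X))" by (rule dual_map_id[OF v])
	show io: "iotaV (fst X):Hom (Rep G) X (dual_rep G (dual_rep G X))"
	proof (rule RepHomI, unfold dual_rep_sel)
	 show "iotaV (fst X):vlin (fst X) (dual (dual (fst X)))" by (rule iotaV_lin[OF v])
	 fix g x assume g: "g:carrier G"
	 from fun_cong[OF iotaV_natural[OF v v RepD(2)[OF X g]], of x]
	 show "iotaV (fst X) (snd X g x) = dual_map (dual (fst X)) (dual (fst X)) (dual_map (fst X) (fst X) (snd X (inv (inv g)))) (iotaV (fst X) x)"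
		using g by simp
	qed
	show "dual_map (fst X) (dual (dual (fst X))) (iotaV (fst X)) o iotaV (dual (fst X)) = id_on (dual (fst X))"
	 by (rule iotaV_triangle[OF v])
	have "iotaV' (fst X):Hom (Rep G) (dual_rep G (dual_rep G X)) X"
	 by (rule Rep_inverse_hom[OF X DDX io]) (simp_all add: dual_rep_sel iotaV'_lin[OF v])
	then show "EX g:Hom (Rep G) (dual_rep G (dual_rep G X)) X. g o iotaV (fst X) = id_on (fst X) & iotaV (fst X) o g = id_on (dual (dual (fst X)))"
	 using iotaV'_lin(2,3)[OF v] by blast
 qed
qed

text \<open>A module whose natural carrier consists of families of vectors or of functions on
  cosets, moved to its model in the universe of vectors. \<open>mrep_in\<close> and
  \<open>mrep_out\<close> allow homomorphisms to be given on the natural carrier.\<close>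

definition mrep :: "('k::field => 'w::ab_group_add => 'w) => 'w set => ('a => 'w => 'w) => ('k, 'a) rep" where
 "mrep s W act = (model s W, %g. tmap s W s W (act g))"

definition is_act :: "('k::field => 'w::ab_group_add => 'w) => 'w set => ('a => 'w => 'w) => bool" where
 "is_act s W act \<longleftrightarrow> fds s W & (ALL g:carrier G. linon s W s W (act g)) & (ALL x:W. act \<one> x = x) &
	 (ALL g:carrier G. ALL h:carrier G. ALL x:W. act (g \<otimes> h) x = act g (act h x))"

lemma mrep_obj:
 assumes "is_act s W act" shows "mrep s W act:Obj (Rep G)"
proof -
 have W: "fds s W" and a: "!!g. g:carrier G ==> linon s W s W (act g)" "!!x. x:W ==> act \<one> x = x"
	"!!g h x. g:carrier G ==> h:carrier G ==> x:W ==> act (g \<otimes> h) x = act g (act h x)"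
	using assms by (auto simp: is_act_def)
 have 1: "tmap s W s W (act \<one>) = id_on (model s W)" unfolding tmap_id[symmetric] by (rule tmap_cong) (rule a(2))
 have 2: "tmap s W s W (act (g \<otimes> h)) = tmap s W s W (act g) o tmap s W s W (act h)" if g: "g:carrier G" "h:carrier G" for g h
 proof -
	have "act g 0 = 0" by (rule linon_more(1)[OF a(1)[OF g(1)] fsub[OF W] fds_vs[OF W]])
	then have "tmap s W s W (act g) o tmap s W s W (act h) = tmap s W s W (%x. act g (act h x))"
	 using tmap_comp[where f="act h" and g="act g", OF W W linonD(1)[OF a(1)[OF g(2)]] W] by simp
	also have "... = tmap s W s W (act (g \<otimes> h))" by (rule tmap_cong) (simp add: a(3)[OF g])
	finally show ?thesis by simp
 qed
 show ?thesis unfolding Rep_Obj mrep_def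
	using W 1 2 tmap_lin[OF W W a(1)] by simp
qed

lemma mrep_in:
 assumes A: "is_act s W act" and M: "M:Obj (Rep G)" and p: "linon vscale (fst M) s W ph"
	and e: "!!g x. g:carrier G ==> x:fst M ==> ph (snd M g x) = act g (ph x)"
 shows "restr (fst M) (%x. coords s W (ph x)):Hom (Rep G) M (mrep s W act)"
proof (rule RepHomI)
 have W: "fds s W" using A by (simp add: is_act_def)
 show "restr (fst M) (%x. coords s W (ph x)):vlin (fst M) (fst (mrep s W act))"
	using restr_lin[OF fsub[OF RepD(1)[OF M]] linon_comp[OF p coords_linon[OF W]]] by (simp add: mrep_def)
 show "restr (fst M) (%x. coords s W (ph x)) (snd M g x) = snd (mrep s W act) g (restr (fst M) (%x. coords s W (ph x)) x)"
	if "g:carrier G" "x:fst M" for g x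
	using that RepD(5)[OF M that] W linonD(1)[OF p] by (simp add: mrep_def e)
qed

lemma mrep_out:
 assumes A: "is_act s W act" and M: "M:Obj (Rep G)" and p: "linon s W vscale (fst M) ps"
	and e: "!!g x. g:carrier G ==> x:W ==> ps (act g x) = snd M g (ps x)"
 shows "restr (model s W) (%y. ps (dec s W y)):Hom (Rep G) (mrep s W act) M"
proof (rule RepHomI)
 have W: "fds s W" and a: "!!g. g:carrier G ==> linon s W s W (act g)" using A by (auto simp: is_act_def)
 show "restr (model s W) (%y. ps (dec s W y)):vlin (fst (mrep s W act)) (fst M)"
	using restr_lin[OF fsub[OF model_fds[OF W]] linon_comp[OF dec_linon[OF W] p]] by (simp add: mrep_def)
 show "restr (model s W) (%y. ps (dec s W y)) (snd (mrep s W act) g x) = snd M g (restr (model s W) (%y. ps (dec s W y)) x)"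
	if "g:carrier G" "x:fst (mrep s W act)" for g x
	using that W linonD(1)[OF a[OF that(1)] dec_in, of x] by (simp add: mrep_def e)
qed

lemma Rep_sums:
 fixes X :: "nat => ('k::field, 'a) rep"
 assumes X: "!!i. i < k ==> X i:Obj (Rep G)"
 shows "EX S:Obj (Rep G). EX inj prj.
	 (ALL i<k. inj i:Hom (Rep G) (X i) S & prj i:Hom (Rep G) S (X i)) &
	 (ALL i<k. ALL j<k. Cmp (Rep G) (prj i) (inj j) = (if i = j then Idm (Rep G) (X i) else 0)) &
	 (\<Sum>i<k. Cmp (Rep G) (inj i) (prj i)) = Idm (Rep G) S"
proof -
 define s :: "'k => (nat => 'k vec) => nat => 'k vec" where "s = fscale vscale"
 define W where "W = {w. (ALL i:{..<k}. w i:fst (X i)) & (ALL i. i ~: {..<k} --> w i = 0)}"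
 define act where "act g w = (%i. if i < k then snd (X i) g (w i) else 0)" for g and w :: "nat => 'k vec"
 have W: "fds s W" unfolding s_def W_def by (rule fds_fun) (use RepD(1)[OF X] in auto)
 have Wi: "w:W \<longleftrightarrow> (ALL i<k. w i:fst (X i)) & (ALL i>=k. w i = 0)" for w by (auto simp: W_def)
 have A: "is_act s W act"
	unfolding is_act_def
 proof (intro conjI ballI W)
	show "linon s W s W (act g)" if g: "g:carrier G" for g
	 unfolding linon_def
	proof (intro conjI ballI allI)
	 show "act g x:W" if "x:W" for x using that RepD(5)[OF X g] by (simp add: Wi act_def)
	 show "act g (x + y) = act g x + act g y" if "x:W" "y:W" for x y
	 proof
		fix i show "act g (x + y) i = (act g x + act g y) i"
		 using that linD(2)[OF RepD(2)[OF X g]] by (simp add: Wi act_def)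
	 qed
	 show "act g (s c x) = s c (act g x)" if "x:W" for x c
	 proof
		fix i show "act g (s c x) i = s c (act g x) i"
		 using that linD(3)[OF RepD(2)[OF X g]] by (simp add: Wi act_def s_def fsc_app[of vscale] vs_simps[OF vs_v])
	 qed
	qed
	show "act \<one> x = x" if "x:W" for x using that RepD(3)[OF X] by (auto simp: Wi act_def fun_eq_iff[of _ x])
	show "act (g \<otimes> h) x = act g (act h x)" if "g:carrier G" "h:carrier G" "x:W" for g h x
	 using RepD(4)[OF X that(1,2)] by (auto simp: act_def)
 qed
 define i where "i j = restr (fst (X j)) (%x. coords s W (%l. if l = j then x else 0))" for j
 define p where "p j = restr (model s W) (%y. dec s W y j)" for j
 have z: "0:fst (X j)" "snd (X j) g 0 = 0" if "j < k" "g:carrier G" for j g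
	using subspD(1)[OF fsub[OF RepD(1)[OF X]]] lin_more(1)[OF RepD(2)[OF X] fsub[OF RepD(1)[OF X]]] that by auto
 have e: "(%l. if l = j then x else 0):W" if "j < k" "x:fst (X j)" for j x
	using that z(1)[OF _ one_closed] by (auto simp: Wi)
 have ih: "i j:Hom (Rep G) (X j) (mrep s W act)" if j: "j < k" for j
	unfolding i_def
 proof (rule mrep_in[OF A X[OF j]])
	show "linon vscale (fst (X j)) s W (%x l. if l = j then x else 0)"
	 using e[OF j] by (auto simp: linon_def s_def fscale_def fun_eq_iff)
	show "(%l. if l = j then snd (X j) g x else 0) = act g (%l. if l = j then x else 0)" if "g:carrier G" "x:fst (X j)" for g x
	 using z(2)[OF _ that(1)] j by (auto simp: act_def fun_eq_iff[of "%l. if l = j then snd (X j) g x else 0"])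
 qed
 have ph: "p j:Hom (Rep G) (mrep s W act) (X j)" if j: "j < k" for j
	unfolding p_def
	by (rule mrep_out[OF A X[OF j]]) (use j in \<open>auto simp: linon_def Wi s_def act_def fsc_app[of vscale]\<close>)
 have pi: "p j o i l = (if j = l then id_on (fst (X j)) else 0)" if jl: "j < k" "l < k" for j l
 proof
	fix x show "(p j o i l) x = (if j = l then id_on (fst (X j)) else 0) x"
	 using e[OF jl(2), of x] W by (cases "x:fst (X l)") (auto simp: p_def i_def id_on_def)
 qed
 have "(\<Sum>j<k. i j o p j) = id_on (model s W)"
 proof
	fix y show "(\<Sum>j<k. i j o p j) y = id_on (model s W) y"
	proof (cases "y:model s W")
	 case y: True
	 let ?w = "dec s W y"
	 have w: "?w:W" using y by simp
	 have ej: "(%l. if l = j then ?w j else 0):W" if "j < k" for j by (rule e[OF that]) (use w that in \<open>simp add: Wi\<close>)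
	 have "(\<Sum>j<k. i j o p j) y = (\<Sum>j<k. coords s W (%l. if l = j then ?w j else 0))"
		by (subst sum_fun_apply, rule sum.cong[OF refl]) (use y w in \<open>simp add: i_def p_def Wi\<close>)
	 also have "... = coords s W (\<Sum>j<k. (%l. if l = j then ?w j else 0))"
		by (rule linon_more(4)[OF coords_linon[OF W] fsub[OF W] vs_v, symmetric]) (use ej in simp)
	 also have "(\<Sum>j<k. (%l. if l = j then ?w j else 0)) = ?w"
	 proof
		fix l have "(\<Sum>j<k. (%l. if l = j then ?w j else 0)) l = (\<Sum>j<k. if j = l then ?w l else 0)"
		 by (subst sum_fun_apply, rule sum.cong) auto
		also have "... = ?w l" using w by (auto simp: Wi not_less)
		finally show "(\<Sum>j<k. (%l. if l = j then ?w j else 0)) l = ?w l" .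
	 qed
	 also have "coords s W ?w = y" using y W by simp
	 finally show ?thesis unfolding id_on_def if_P[OF y] .
	next
	 case False
	 have "i j 0 = 0" if "j < k" for j by (rule lin_more(1)[OF RepHomD(1)[OF ih[OF that]] fsub[OF RepD(1)[OF X[OF that]]] vs_v])
	 then show ?thesis using False by (simp add: sum_fun_apply p_def id_on_def)
	qed
 qed
 then show ?thesis
	using mrep_obj[OF A] ih ph pi by (intro bexI[of _ "mrep s W act"] exI[of _ i] exI[of _ p]) (auto simp: Rep_sel mrep_def)
qed

end

section \<open>The module of arrows annihilated by a functional\<close>

context fin_group
begin

context
 fixes M N :: "('k::field, 'a) rep" and t :: "'k vec => 'k vec"
 assumes M: "M:Obj (Rep G)" and N: "N:Obj (Rep G)" and t: "t:vlin (fst N) (fst M)"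
begin

text \<open>
 An element of \<open>kspace\<close> is a vector \<open>f None\<close> of \<open>N\<close> with vectors \<open>f (Some (d, c))\<close> of \<open>M\<close> that are
 to be the values \<open>s_c(d\<inverse> x)\<close> of linear maps \<open>s_c\<close>; \<open>kdef d f = 0\<close> is the equation
 \<open>t h = (SUM c. c\<inverse> s_c c - s_c)\<close> at \<open>d\<inverse> x\<close>, with \<open>f None = h x\<close>.
\<close>

definition kdef :: "'a => (('a \<times> 'a) option => 'k vec) => 'k vec" where
 "kdef d f = t (snd N (inv d) (f None)) -
	 (SUM c:carrier G. snd M (inv c) (f (Some (d \<otimes> inv c, c))) - f (Some (d, c)))"

text \<open>All positions \<open>(d, c)\<close> are recorded, not only those with
  \<open>d = 1\<close>: the equation at \<open>x\<close> involves \<open>s_c(c x)\<close> besides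
  \<open>s_c(x)\<close>. This is a value elsewhere on the orbit of \<open>x\<close>, which
  \<open>s_c(x)\<close> does not determine because \<open>s_c\<close> is not equivariant.\<close>

definition kamb :: "(('a \<times> 'a) option => 'k vec) set" where
 "kamb = {f. (ALL i:insert None (Some ` (carrier G \<times> carrier G)). f i:(if i = None then fst N else fst M)) &
	 (ALL i. i ~: insert None (Some ` (carrier G \<times> carrier G)) --> f i = 0)}"

definition kspace :: "(('a \<times> 'a) option => 'k vec) set" where
 "kspace = {f:kamb. ALL d:carrier G. kdef d f = 0}"

text \<open>If \<open>f\<close> records the values \<open>s_c(d^-1 x)\<close>, then passing from
  \<open>x\<close> to \<open>r x\<close> replaces \<open>d^-1\<close> by
  \<open>d^-1 r = (r^-1 d)^-1\<close>. The positions are permuted and the vectors of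
  \<open>M\<close> stay as they are.\<close>

definition kact :: "'a => (('a \<times> 'a) option => 'k vec) => ('a \<times> 'a) option => 'k vec" where
 "kact r f = (%i. case i of None => snd N r (f None)
	 | Some (d, c) => if d:carrier G & c:carrier G then f (Some (inv r \<otimes> d, c)) else 0)"

lemma kamb_iff: "f:kamb \<longleftrightarrow> f None:fst N & (ALL d:carrier G. ALL c:carrier G. f (Some (d, c)):fst M) &
	(ALL d c. d ~: carrier G | c ~: carrier G --> f (Some (d, c)) = 0)"
 unfolding kamb_def by (auto simp: split_option_all image_iff)

lemma kamb_fds: "fds (fscale vscale) kamb"
 unfolding kamb_def by (rule fds_fun) (use fin RepD(1)[OF M] RepD(1)[OF N] in auto)

lemma kdef_linon:
 assumes d: "d:carrier G"
 shows "linon (fscale vscale) kamb vscale UNIV (kdef d)"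
proof -
 note r = linD(2,3)[OF t] linD(2,3)[OF RepD(2)[OF N inv_closed[OF d]]] linD(2,3)[OF RepD(2)[OF M inv_closed]]
	RepD(5)[OF N inv_closed[OF d]]
 have cl: "d \<otimes> inv c:carrier G" if "c:carrier G" for c using that d by simp
 have "kdef d (f + g) = kdef d f + kdef d g" if f: "f:kamb" "g:kamb" for f g
 proof -
	have "(SUM c:carrier G. snd M (inv c) ((f + g) (Some (d \<otimes> inv c, c))) - (f + g) (Some (d, c))) =
	 (SUM c:carrier G. (snd M (inv c) (f (Some (d \<otimes> inv c, c))) - f (Some (d, c))) +
		(snd M (inv c) (g (Some (d \<otimes> inv c, c))) - g (Some (d, c))))"
	 by (rule sum.cong[OF refl]) (use f d cl in \<open>simp add: kamb_iff r\<close>)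
	also have "... = (SUM c:carrier G. snd M (inv c) (f (Some (d \<otimes> inv c, c))) - f (Some (d, c))) +
		(SUM c:carrier G. snd M (inv c) (g (Some (d \<otimes> inv c, c))) - g (Some (d, c)))" by (rule sum.distrib)
	finally show ?thesis using f by (simp add: kdef_def kamb_iff r)
 qed
 moreover have "kdef d (fscale vscale a f) = vscale a (kdef d f)" if f: "f:kamb" for a f
 proof -
	have "(SUM c:carrier G. snd M (inv c) ((fscale vscale a f) (Some (d \<otimes> inv c, c))) - (fscale vscale a f) (Some (d, c))) =
	 (SUM c:carrier G. vscale a (snd M (inv c) (f (Some (d \<otimes> inv c, c))) - f (Some (d, c))))"
	 by (rule sum.cong[OF refl]) (use f d cl in \<open>simp add: kamb_iff r fsc_app[of vscale] vs_simps[OF vs_v]\<close>)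
	also have "... = vscale a (SUM c:carrier G. snd M (inv c) (f (Some (d \<otimes> inv c, c))) - f (Some (d, c)))"
	 by (rule vs_simps(11)[OF vs_v, symmetric])
	finally show ?thesis using f by (simp add: kdef_def kamb_iff r fsc_app[of vscale] vs_simps[OF vs_v])
 qed
 ultimately show ?thesis by (simp add: linon_def)
qed

lemma kspace_fds: "fds (fscale vscale) kspace"
proof (rule fds_sub[OF kamb_fds])
 note S = subspD[OF fsub[OF kamb_fds]]
 show "subsp (fscale vscale) kspace"
	by (rule subspI) (auto simp: kspace_def S linonD(2,3)[OF kdef_linon] vs_simps[OF vs_v]
		linon_more(1)[OF kdef_linon fsub[OF kamb_fds] vs_v])
qed (auto simp: kspace_def)

text \<open>The group permutes the defining equations, so their solutions form a submodule.\<close>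

lemma kdef_kact:
 assumes f: "f:kamb" and d: "d:carrier G" and r: "r:carrier G"
 shows "kdef d (kact r f) = kdef (inv r \<otimes> d) f"
proof -
 have "snd N (inv d) (snd N r (f None)) = snd N (inv (inv r \<otimes> d)) (f None)"
	using d r by (simp add: inv_mult_group RepD(4)[OF N])
 moreover have "(SUM c:carrier G. snd M (inv c) (kact r f (Some (d \<otimes> inv c, c))) - kact r f (Some (d, c))) =
	 (SUM c:carrier G. snd M (inv c) (f (Some ((inv r \<otimes> d) \<otimes> inv c, c))) - f (Some (inv r \<otimes> d, c)))"
	by (rule sum.cong[OF refl]) (use d r in \<open>simp add: kact_def m_assoc\<close>)
 ultimately show ?thesis by (simp add: kdef_def kact_def)
qed

lemma kact_act: "is_act (fscale vscale) kspace kact"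
 unfolding is_act_def
proof (intro conjI ballI kspace_fds)
 fix r assume r: "r:carrier G"
 note rr = linD(2,3)[OF RepD(2)[OF N r]] RepD(5)[OF N r]
 have k: "kact r f:kamb" if "f:kamb" for f using that r rr by (auto simp: kamb_iff kact_def)
 show "linon (fscale vscale) kspace (fscale vscale) kspace (kact r)"
	unfolding linon_def
 proof (intro conjI ballI allI)
	show "kact r f:kspace" if "f:kspace" for f
	 using that k r by (auto simp: kspace_def kdef_kact)
	show "kact r (f + g) = kact r f + kact r g" if "f:kspace" "g:kspace" for f g
	proof
	 fix i show "kact r (f + g) i = (kact r f + kact r g) i"
		using that by (cases i) (auto simp: kact_def kspace_def kamb_iff rr)
	qed
	show "kact r (fscale vscale c f) = fscale vscale c (kact r f)" if "f:kspace" for f c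
	proof
	 fix i show "kact r (fscale vscale c f) i = fscale vscale c (kact r f) i"
		using that by (cases i) (auto simp: kact_def kspace_def kamb_iff rr fsc_app[of vscale] vs_simps[OF vs_v])
	qed
 qed
 show "kact (r \<otimes> h) f = kact r (kact h f)" if "h:carrier G" "f:kspace" for h f
 proof
	fix i show "kact (r \<otimes> h) f i = kact r (kact h f) i"
	 using that r by (cases i) (auto simp: kact_def inv_mult_group RepD(4)[OF N] m_assoc)
 qed
next
 fix f assume f: "f:kspace"
 show "kact \<one> f = f"
 proof
	fix i show "kact \<one> f i = f i" using f by (cases i) (auto simp: kact_def kspace_def kamb_iff RepD(3)[OF N])
 qed
qed

lemma klinon: "linon (fscale vscale) kspace vscale (fst N) (%f. f None)"
	"i:carrier G ==> j:carrier G ==> linon (fscale vscale) kspace vscale (fst M) (%f. f (Some (i, j)))"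
 by (auto simp: linon_def kspace_def kamb_iff fsc_app[of vscale])

text \<open>Let \<open>S c\<close> send \<open>m\<close> to the entry of \<open>g m\<close> at
  \<open>(1, c)\<close>. Equivariance of \<open>g\<close> identifies the entry at
  \<open>(c^-1, c)\<close> with \<open>S c (c m)\<close>, so the equation at \<open>1\<close> writes
  the composite as the sum of the maps \<open>c^-1 S_c c - S_c\<close>. Each of them has trace 0 by
  cyclicity.\<close>

lemma trace_twisted:
 assumes g: "g:Hom (Rep G) M (mrep (fscale vscale) kspace kact)"
 shows "trace vscale (fst M) (t o (restr (model (fscale vscale) kspace) (%y. dec (fscale vscale) kspace y None) o g)) = 0"
proof -
 let ?K = "fscale vscale :: 'k => (('a \<times> 'a) option => 'k vec) => ('a \<times> 'a) option => 'k vec" and ?V = "fst M"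
 note V = RepD(1)[OF M] and g1 = RepHomD[OF g, unfolded mrep_def fst_conv snd_conv]
 define f where "f m = dec ?K kspace (g m)" for m
 have fk: "f m:kspace" if "m:?V" for m using g1(3)[OF that] by (simp add: f_def)
 have fact: "f (snd M r m) = kact r (f m)" if "r:carrier G" "m:?V" for r m
 proof -
	have "kact r (f m):kspace" using kact_act that(1) fk[OF that(2)] by (auto simp: is_act_def linon_def)
	then show ?thesis using g1(2)[OF that] g1(3)[OF that(2)] kspace_fds by (simp add: f_def)
 qed
 define S where "S c = restr ?V (%m. f m (Some (\<one>, c)))" for c
 have fl: "linon vscale ?V ?K kspace f"
	unfolding f_def by (rule linon_comp[OF lin_linon[OF g1(1)] dec_linon[OF kspace_fds]])
 have S: "S c:vlin ?V ?V" if "c:carrier G" for c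
	unfolding S_def by (rule restr_lin[OF fsub[OF V] linon_comp[OF fl klinon(2)[OF one_closed that]]])
 define R where "R c = snd M (inv c) o (S c o snd M c)" for c
 have R0: "S c o snd M c:vlin ?V ?V" "snd M (inv c):vlin ?V ?V" if "c:carrier G" for c
	using lin_comp[OF RepD(2)[OF M that] S[OF that] fsub[OF V] vs_v] RepD(2)[OF M inv_closed[OF that]] .
 have R: "R c:vlin ?V ?V" if "c:carrier G" for c
	unfolding R_def by (rule lin_comp[OF R0[OF that] fsub[OF V] vs_v])
 note tl = trace_linon[OF V] and es = fsub[OF fds_lin[OF V V]]
 have trR: "trace vscale ?V (R c) = trace vscale ?V (S c)" if c: "c:carrier G" for c
 proof -
	have "trace vscale ?V (R c) = trace vscale ?V ((S c o snd M c) o snd M (inv c))"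
	 unfolding R_def by (rule trace_comm[OF V V R0[OF c]])
	also have "(S c o snd M c) o snd M (inv c) = S c"
	proof
	 fix x show "((S c o snd M c) o snd M (inv c)) x = S c x"
		using Rep_inv(2)[OF M c, of x] lin_out[OF R0(2)[OF c], of x] lin_out[OF S[OF c], of x]
		 lin_more(1)[OF R0(1)[OF c] fsub[OF V] vs_v]
		by (cases "x:?V") auto
	qed
	finally show ?thesis .
 qed
 have "t o (restr (model ?K kspace) (%y. dec ?K kspace y None) o g) = (SUM c:carrier G. R c - S c)"
 proof
	fix m show "(t o (restr (model ?K kspace) (%y. dec ?K kspace y None) o g)) m = (SUM c:carrier G. R c - S c) m"
	proof (cases "m:?V")
	 case m: True
	 have n: "f m None:fst N" using fk[OF m] by (simp add: kspace_def kamb_iff)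
	 have "f m (Some (inv c, c)) = S c (snd M c m)" if c: "c:carrier G" for c
		using fact[OF c m] RepD(5)[OF M c m] c by (simp add: S_def kact_def)
	 moreover have "kdef \<one> (f m) = 0" using fk[OF m] by (simp add: kspace_def)
	 ultimately have "t (f m None) = (SUM c:carrier G. R c m - S c m)"
		using RepD(3)[OF N n] m by (simp add: kdef_def R_def S_def)
	 then show ?thesis using g1(3)[OF m] by (subst sum_fun_apply) (simp add: f_def)
	next
	 case False
	 have "(SUM c:carrier G. R c - S c):vlin ?V ?V"
		by (rule subspD(6)[OF es]) (rule subspD(5)[OF es R S])
	 from lin_out[OF this False] show ?thesis
		using lin_out[OF g1(1) False] lin_more(1)[OF t fsub[OF RepD(1)[OF N]] vs_v] kspace_fds by (simp add: restr_in)
	qed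
 qed
 then have "trace vscale ?V (t o (restr (model ?K kspace) (%y. dec ?K kspace y None) o g)) =
	trace vscale ?V (SUM c:carrier G. R c - S c)" by (rule arg_cong)
 also have "... = (SUM c:carrier G. trace vscale ?V (R c - S c))"
	by (rule linon_more(4)[OF tl es vs_k]) (rule subspD(5)[OF es R S])
 also have "... = 0"
	by (rule sum.neutral) (simp add: linon_more(3)[OF tl es vs_k R S] trR)
 finally show ?thesis .
qed

text \<open>The trace form makes the coinvariants of \<open>lin(Y, M)\<close> dual to the invariants
  of \<open>lin(M, Y)\<close>. If \<open>w\<close> were not such a sum, a functional would kill all
  the sums but not \<open>w\<close>. It has the form \<open>s \<mapsto> tr(s g)\<close>, and killing
  the sums forces \<open>g\<close> to be equivariant, contrary to the assumption on
  \<open>w\<close>. Nothing is divided by the group order.\<close>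

lemma commutator_sum:
 assumes Y: "Y:Obj (Rep G)" and w: "w:vlin (fst Y) (fst M)"
	and 0: "!!g. g:Hom (Rep G) M Y ==> trace vscale (fst M) (w o g) = 0"
 shows "EX s. (ALL c:carrier G. s c:vlin (fst Y) (fst M)) &
	w = (SUM c:carrier G. (snd M (inv c) o (s c o snd Y c)) - s c)"
proof -
 let ?V = "fst M" and ?X = "fst Y"
 note V = RepD(1)[OF M] and X = RepD(1)[OF Y]
 let ?L = "fscale vscale :: 'k => ('k vec => 'k vec) => 'k vec => 'k vec"
 note es = fsub[OF fds_lin[OF X V]]
 define b where "b c s = (snd M (inv c) o (s o snd Y c)) - s" for c and s :: "'k vec => 'k vec"
 have q1: "s o snd Y c:vlin ?X ?V" if "c:carrier G" "s:vlin ?X ?V" for c s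
	by (rule lin_comp[OF RepD(2)[OF Y that(1)] that(2) fsub[OF X] vs_v])
 have q2: "snd M (inv c) o (s o snd Y c):vlin ?X ?V" if "c:carrier G" "s:vlin ?X ?V" for c s
	by (rule lin_comp[OF q1[OF that] RepD(2)[OF M inv_closed[OF that(1)]] fsub[OF V] vs_v])
 have bl: "b c s:vlin ?X ?V" if "c:carrier G" "s:vlin ?X ?V" for c s
	unfolding b_def by (rule subspD(5)[OF es q2[OF that] that(2)])
 have badd: "b c (s + s') = b c s + b c s'" if c: "c:carrier G" and s: "s:vlin ?X ?V" "s':vlin ?X ?V" for c s s'
 proof
	fix x show "b c (s + s') x = (b c s + b c s') x"
	 using linD(2)[OF RepD(2)[OF M inv_closed[OF c]], of "s (snd Y c x)" "s' (snd Y c x)"]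
		linD(1)[OF s(1), of "snd Y c x"] linD(1)[OF s(2), of "snd Y c x"] RepD(5)[OF Y c, of x] lin_out[OF RepD(2)[OF Y c], of x]
		subspD(1)[OF fsub[OF X]]
	 by (cases "x:?X") (auto simp: b_def)
 qed
 have bscl: "b c (?L a s) = ?L a (b c s)" if c: "c:carrier G" and s: "s:vlin ?X ?V" for c s a
 proof
	fix x show "b c (?L a s) x = ?L a (b c s) x"
	 using linD(3)[OF RepD(2)[OF M inv_closed[OF c]], of "s (snd Y c x)" a]
		linD(1)[OF s(1), of "snd Y c x"] RepD(5)[OF Y c, of x] lin_out[OF RepD(2)[OF Y c], of x]
		subspD(1)[OF fsub[OF X]]
	 by (cases "x:?X") (auto simp: b_def fsc_app[of vscale] vs_simps[OF vs_v])
 qed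
 define S where "S = {SUM c:carrier G. b c (s c) | s. ALL c:carrier G. s c:vlin ?X ?V}"
 have sS: "subsp ?L S"
 proof (rule subspI)
	have z: "(0 :: 'k vec => 'k vec):vlin ?X ?V" by (rule subspD(1)[OF es])
	have "b c 0 = 0" if c: "c:carrier G" for c using bscl[OF c z, of 0] vs_simps(2)[OF fds_vs[OF fds_lin[OF X V]]] by simp
	then show "0:S" unfolding S_def by (intro CollectI exI[of _ "%_. 0"]) (simp add: z)
	fix x assume "x:S"
	then obtain s where s: "ALL c:carrier G. s c:vlin ?X ?V" "x = (SUM c:carrier G. b c (s c))" by (auto simp: S_def)
	{ fix y assume "y:S"
	 then obtain s' where s': "ALL c:carrier G. s' c:vlin ?X ?V" "y = (SUM c:carrier G. b c (s' c))" by (auto simp: S_def)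
	 have "x + y = (SUM c:carrier G. b c (s c + s' c))"
		unfolding s s' sum.distrib[symmetric] by (rule sum.cong) (use s s' badd in auto)
	 then show "x + y:S" unfolding S_def
		by (intro CollectI exI[of _ "%c. s c + s' c"]) (use s s' subspD(2)[OF es] in auto) }
	have "?L a x = (SUM c:carrier G. b c (?L a (s c)))" for a
	 unfolding s vs_simps(11)[OF fds_vs[OF fds_lin[OF X V]]] by (rule sum.cong) (use s bscl in auto)
	then show "?L a x:S" for a unfolding S_def
	 by (intro CollectI exI[of _ "%c. ?L a (s c)"]) (use s subspD(3)[OF es] in auto)
 qed simp
 have SV: "S <= vlin ?X ?V" unfolding S_def using bl by (auto intro!: subspD(6)[OF es])
 have "w:S"
 proof (rule ccontr)
	assume "w ~: S"
	from separation[OF fds_lin[OF X V] sS SV w this] obtain Xi where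
	 Xi: "Xi:lin ?L (vlin ?X ?V) (*) UNIV" "!!u. u:S ==> Xi u = 0" "Xi w ~= 0" by blast
	from trace_rep[OF X V Xi(1)] obtain g where g: "g:vlin ?V ?X" and
	 tr: "!!f. f:vlin ?X ?V ==> Xi f = trace vscale ?V (f o g)" by blast
	\<comment> \<open>The functional is tested on \<open>c^-1 s c - s\<close> for the rank one map
	  \<open>s = xi(-) v\<close>. There the traces are values of \<open>xi\<close>, and the test reads
	  \<open>xi(c g c^-1 v) = xi(g v)\<close>; functionals separate vectors.\<close>
	have inv: "snd Y c (g (snd M (inv c) v)) = g v" if c: "c:carrier G" and v: "v:?V" for c v
	proof (rule ccontr)
	 note gg = linD(1)[OF g]
	 let ?a = "snd Y c (g (snd M (inv c) v))"
	 have a: "?a:?X" by (intro RepD(5)[OF Y c] gg RepD(5)[OF M inv_closed[OF c] v])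
	 assume "?a ~= g v"
	 then have "?a - g v:?X" "?a - g v ~= 0" using subspD(5)[OF fsub[OF X] a gg[OF v]] by auto
	 from separation0[OF X this] obtain xi where xi: "xi:lin vscale ?X (*) UNIV" "xi (?a - g v) ~= 0" by blast
	 let ?s = "elem vscale xi v"
	 have s: "?s:vlin ?X ?V" by (rule elem_lin[OF fsub[OF V] xi(1) v])
	 define s' where "s' c' = (if c' = c then ?s else 0)" for c'
	 have "b c' 0 = 0" if c: "c':carrier G" for c'
		using bscl[OF c s, of 0] vs_simps(2)[OF fds_vs[OF fds_lin[OF X V]]] by simp
	 then have "(SUM c':carrier G. b c' (s' c')) = (SUM c':carrier G. if c' = c then b c ?s else 0)"
		by (intro sum.cong) (auto simp: s'_def)
	 also have "... = b c ?s" using c fin by simp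
	 finally have "b c ?s:S" unfolding S_def
		by (intro CollectI exI[of _ s']) (use s subspD(1)[OF es] in \<open>auto simp: s'_def\<close>)
	 then have "Xi (b c ?s) = 0" by (rule Xi(2))
	 then have "Xi (snd M (inv c) o (?s o snd Y c)) = Xi ?s"
		using linon_more(3)[OF lin_linon[OF Xi(1)] es vs_k q2[OF c s] s] by (simp add: b_def)
	 moreover have "Xi (snd M (inv c) o (?s o snd Y c)) = xi ?a"
	 proof -
		note h1 = lin_comp[OF g q1[OF c s] fsub[OF X] vs_v] and h2 = RepD(2)[OF M inv_closed[OF c]]
		have "Xi (snd M (inv c) o (?s o snd Y c)) = trace vscale ?V (snd M (inv c) o ((?s o snd Y c) o g))"
		 using tr[OF q2[OF c s]] by (simp add: comp_assoc)
		also have "... = trace vscale ?V (?s o (snd Y c o (g o snd M (inv c))))"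
		 using trace_comm[OF V V h1 h2] by (simp add: comp_assoc)
		also have "... = xi ((snd Y c o (g o snd M (inv c))) v)"
		 by (rule trace_elem[OF V X _ xi(1) v])
			(rule lin_comp[OF lin_comp[OF h2 g fsub[OF V] vs_v] RepD(2)[OF Y c] fsub[OF X] vs_v])
		finally show ?thesis by simp
	 qed
	 moreover have "Xi ?s = xi (g v)" using tr[OF s] trace_elem[OF V X g xi(1) v] by simp
	 ultimately show False using xi(2) linon_more(3)[OF lin_linon[OF xi(1)] fsub[OF X] vs_k a gg[OF v]] by simp
	qed
	have "g:Hom (Rep G) M Y"
	proof (rule RepHomI[OF g])
	 fix c x assume c: "c:carrier G" and x: "x:?V"
	 show "g (snd M c x) = snd Y c (g x)"
		using inv[OF c RepD(5)[OF M c x]] Rep_inv(1)[OF M c x] by simp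
	qed
	then show False using 0 tr[OF w] Xi(3) by simp
 qed
 then show ?thesis unfolding S_def b_def by blast
qed

text \<open>With the maps \<open>s c\<close> from \<open>commutator_sum\<close>, \<open>h'\<close>
  sends \<open>x\<close> to \<open>h x\<close> together with all \<open>s_c(d^-1 x)\<close>. The
  equations of \<open>kspace\<close> then hold because the expression for \<open>t h\<close> holds
  at each point \<open>d^-1 x\<close>.\<close>

lemma factor_kspace:
 assumes Y: "Y:Obj (Rep G)" and h: "h:Hom (Rep G) Y N"
	and 0: "!!g. g:Hom (Rep G) M Y ==> trace vscale (fst M) (t o (h o g)) = 0"
 shows "EX h':Hom (Rep G) Y (mrep (fscale vscale) kspace kact).
	h = restr (model (fscale vscale) kspace) (%y. dec (fscale vscale) kspace y None) o h'"
proof -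
 let ?K = "fscale vscale :: 'k => (('a \<times> 'a) option => 'k vec) => ('a \<times> 'a) option => 'k vec" and ?X = "fst Y"
 note X = RepD(1)[OF Y] and V = RepD(1)[OF M]
 have "t o h:vlin ?X (fst M)" by (rule lin_comp[OF RepHomD(1)[OF h] t fsub[OF RepD(1)[OF N]] vs_v])
 from commutator_sum[OF Y this] 0 obtain s where s: "!!c. c:carrier G ==> s c:vlin ?X (fst M)"
	and ts: "t o h = (SUM c:carrier G. (snd M (inv c) o (s c o snd Y c)) - s c)"
	by (auto simp: comp_assoc)
 have th: "t (h x) = (SUM c:carrier G. snd M (inv c) (s c (snd Y c x)) - s c x)" for x
	using fun_cong[OF ts, of x] by (subst (asm) sum_fun_apply) simp
 define ph where "ph x = (%i. case i of None => h x
	 | Some (d, c) => if d:carrier G & c:carrier G then s c (snd Y (inv d) x) else 0)" for x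
 have pk: "ph x:kspace" if x: "x:?X" for x
	unfolding kspace_def
 proof (intro CollectI conjI ballI)
	show "ph x:kamb" using x RepHomD(3)[OF h x] linD(1)[OF s] RepD(5)[OF Y]
	 by (auto simp: kamb_iff ph_def)
	fix d assume d: "d:carrier G"
	have "(SUM c:carrier G. snd M (inv c) (ph x (Some (d \<otimes> inv c, c))) - ph x (Some (d, c))) =
	 (SUM c:carrier G. snd M (inv c) (s c (snd Y c (snd Y (inv d) x))) - s c (snd Y (inv d) x))"
	 by (rule sum.cong[OF refl]) (use d in \<open>simp add: ph_def inv_mult_group RepD(4)[OF Y]\<close>)
	also have "... = t (snd N (inv d) (ph x None))"
	 using th[of "snd Y (inv d) x"] RepHomD(2)[OF h inv_closed[OF d] x] by (simp add: ph_def)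
	finally show "kdef d (ph x) = 0" by (simp add: kdef_def)
 qed
 have pl: "linon vscale ?X ?K kspace ph"
	unfolding linon_def
 proof (intro conjI ballI allI pk)
	note hl = linD(2,3)[OF RepHomD(1)[OF h]] linD(2,3)[OF s] linD(2,3)[OF RepD(2)[OF Y inv_closed]] RepD(5)[OF Y inv_closed]
	show "ph (x + y) = ph x + ph y" if "x:?X" "y:?X" for x y
	proof
	 fix i show "ph (x + y) i = (ph x + ph y) i" using that by (cases i) (auto simp: ph_def hl)
	qed
	show "ph (vscale c x) = ?K c (ph x)" if "x:?X" for x c
	proof
	 fix i show "ph (vscale c x) i = ?K c (ph x) i" using that
		by (cases i) (auto simp: ph_def hl fsc_app[of vscale] vs_simps[OF vs_v])
	qed
 qed
 let ?h = "restr ?X (%x. coords ?K kspace (ph x))"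
 have hh: "?h:Hom (Rep G) Y (mrep ?K kspace kact)"
 proof (rule mrep_in[OF kact_act Y pl])
	fix r x assume r: "r:carrier G" and x: "x:?X"
	show "ph (snd Y r x) = kact r (ph x)"
	proof
	 fix i show "ph (snd Y r x) i = kact r (ph x) i"
		using r RepHomD(2)[OF h r x] by (cases i) (auto simp: ph_def kact_def inv_mult_group RepD(4)[OF Y])
	qed
 qed
 moreover have "h = restr (model ?K kspace) (%y. dec ?K kspace y None) o ?h"
 proof
	fix x show "h x = (restr (model ?K kspace) (%y. dec ?K kspace y None) o ?h) x"
	 using pk[of x] kspace_fds lin_out[OF RepHomD(1)[OF h], of x] by (cases "x:?X") (auto simp: ph_def)
 qed
 ultimately show ?thesis by blast
qed

end

lemma Rep_annihilator:
 fixes M N :: "('k::field, 'a) rep"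
 assumes M: "M:Obj (Rep G)" and N: "N:Obj (Rep G)" and th: "th:lin (Scl (Rep G)) (Hom (Rep G) M N) (*) UNIV"
 shows "EX N':Obj (Rep G). EX v:Hom (Rep G) N' N. (ALL g:Hom (Rep G) M N'. th (Cmp (Rep G) v g) = 0) &
		(ALL Y:Obj (Rep G). ALL h:Hom (Rep G) Y N. (ALL g:Hom (Rep G) M Y. th (Cmp (Rep G) h g) = 0) -->
		 (EX h':Hom (Rep G) Y N'. h = Cmp (Rep G) v h'))"
proof -
 interpret R: lcat "Rep G :: ('k, ('k, 'a) rep, 'k vec => 'k vec) lincat" by (rule lcat_Rep)
 note V = RepD(1)[OF M] and W = RepD(1)[OF N]
 have "Hom (Rep G) M N <= vlin (fst M) (fst N)" by (auto simp: Rep_Hom)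
 \<comment> \<open>The trace form represents functionals on the space of all linear maps, so the
   given functional is first extended from the equivariant ones.\<close>
 from lin_extend[OF fsub[OF fds_lin[OF V W]] R.hom_fds[OF M N, unfolded Rep_sel] this subsp_UNIV[OF vs_k] th[unfolded Rep_sel]]
 obtain Th where T: "Th:lin (fscale vscale) (vlin (fst M) (fst N)) (*) UNIV" "!!x. x:Hom (Rep G) M N ==> Th x = th x" by blast
 from trace_rep[OF V W T(1)] obtain t where t: "t:vlin (fst N) (fst M)"
	and tr: "!!f. f:vlin (fst M) (fst N) ==> Th f = trace vscale (fst N) (f o t)" by blast
 have th: "th f = trace vscale (fst M) (t o f)" if "f:Hom (Rep G) M N" for f
	using T(2)[OF that] tr[OF RepHomD(1)[OF that]] trace_comm[OF V W RepHomD(1)[OF that] t] by simp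
 let ?K = "fscale vscale :: 'k => (('a \<times> 'a) option => 'k vec) => ('a \<times> 'a) option => 'k vec"
 let ?S = "kspace M N t"
 let ?N = "mrep ?K ?S (kact N)" and ?v = "restr (model ?K ?S) (%y. dec ?K ?S y None)"
 have N': "?N:Obj (Rep G)" by (rule mrep_obj[OF kact_act[OF M N t]])
 have v: "?v:Hom (Rep G) ?N N"
	by (rule mrep_out[OF kact_act[OF M N t] N klinon(1)[OF M N t]]) (simp add: kact_def[OF M N t])
 show ?thesis
 proof (intro bexI[OF _ N'] bexI[OF _ v] conjI ballI impI)
	show "th (Cmp (Rep G) ?v g) = 0" if g: "g:Hom (Rep G) M ?N" for g
	 using th[OF R.cmp[OF M N' N g v]] trace_twisted[OF M N t g] by (simp add: Rep_sel)
	fix Y h assume Y: "Y:Obj (Rep G)" and h: "h:Hom (Rep G) Y N" and 0: "ALL g:Hom (Rep G) M Y. th (Cmp (Rep G) h g) = 0"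
	show "EX h':Hom (Rep G) Y ?N. h = Cmp (Rep G) ?v h'"
	 unfolding Rep_sel
	proof (rule factor_kspace[OF M N t Y h])
	 fix g assume g: "g:Hom (Rep G) M Y"
	 show "trace vscale (fst M) (t o (h o g)) = 0" using th[OF R.cmp[OF M Y N g h]] 0 g by (simp add: Rep_sel)
	qed
 qed
qed

end

section \<open>Permutation modules\<close>

context fin_group
begin

definition crep :: "'a set => 'a set => 'a" where
 "crep H C = (SOME a. a:carrier G & C = a <# H)"

lemma crep:
 assumes "C:lcosets H" shows "crep H C:carrier G" "crep H C <# H = C"
proof -
 have "EX a. a:carrier G & C = a <# H" using assms by (auto simp: LCOSETS_def)
 from someI_ex[OF this] show "crep H C:carrier G" "crep H C <# H = C" by (simp_all add: crep_def)
qed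

lemma lcoset_in: "a:carrier G ==> a <# H:lcosets H"
 by (auto simp: LCOSETS_def)

lemma lcosets_finite: "finite (lcosets H)"
 using fin by (simp add: LCOSETS_def)

lemma lcoset_eqD:
 assumes H: "subgroup H G" and a: "a:carrier G" and b: "b:carrier G" and e: "a <# H = b <# H"
 shows "EX h:H. a = b \<otimes> h"
proof -
 have "a:b <# H" using lcos_self[OF a H] e by simp
 then show ?thesis by (auto simp: l_coset_def)
qed

lemma lcoset_smult:
 assumes H: "subgroup H G" and g: "g:carrier G" and C: "C:lcosets H"
 shows "g <# C:lcosets H" "g \<otimes> crep H C:carrier G" "(g \<otimes> crep H C) <# H = g <# C"
proof -
 show 1: "g \<otimes> crep H C:carrier G" using g crep(1)[OF C] by simp
 show 2: "(g \<otimes> crep H C) <# H = g <# C"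
	using lcos_m_assoc[OF subgroup.subset[OF H] g crep(1)[OF C]] crep(2)[OF C] by simp
 show "g <# C:lcosets H" unfolding 2[symmetric] by (rule lcoset_in[OF 1])
qed

lemma lcoset_act:
 assumes H: "subgroup H G" and C: "C:lcosets H"
 shows "\<one> <# C = C" "g:carrier G ==> h:carrier G ==> g <# (h <# C) = (g \<otimes> h) <# C"
proof -
 have "C <= carrier G" using crep[OF C] subgroup.subset[OF H] by (force simp: l_coset_def)
 then show "\<one> <# C = C" "g:carrier G ==> h:carrier G ==> g <# (h <# C) = (g \<otimes> h) <# C"
	using lcos_mult_one lcos_m_assoc by auto
qed

lemma lcoset_one: "subgroup H G ==> \<one> <# H = H"
 using subgroup.subset lcos_mult_one by blast

definition pact :: "'a set => 'a => ('a set => 'k::field) => 'a set => 'k" where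
 "pact H g x = (%C. if C:lcosets H then x (inv g <# C) else 0)"

lemma perm_rep_mrep: "perm_rep G H = mrep (fscale (*)) (coset_space G H) (pact H)"
 by (simp add: perm_rep_def mrep_def pact_def[abs_def] Let_def)

lemma coset_space_fds: "fds (fscale (*)) (coset_space G H :: ('a set => 'k::field) set)"
proof -
 have "fds (fscale (*)) {f :: 'a set => 'k. (ALL i:lcosets H. f i:UNIV) & (ALL i. i ~: lcosets H --> f i = 0)}"
	by (rule fds_fun) (auto simp: lcosets_finite)
 then show ?thesis by (simp add: coset_space_def)
qed

lemma pact_act:
 assumes H: "subgroup H G"
 shows "is_act (fscale (*)) (coset_space G H :: ('a set => 'k::field) set) (pact H)"
 unfolding is_act_def
proof (intro conjI ballI coset_space_fds)
 fix g assume g: "g:carrier G"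
 show "linon (fscale (*)) (coset_space G H) (fscale (*)) (coset_space G H :: ('a set => 'k) set) (pact H g)"
	by (auto simp: linon_def coset_space_def pact_def fscale_def fun_eq_iff)
 show "pact H (g \<otimes> h) x = pact H g (pact H h x)" if h: "h:carrier G" and "x:coset_space G H" for h and x :: "'a set => 'k"
	using lcoset_smult(1)[OF H inv_closed[OF g]] lcoset_act(2)[OF H _ inv_closed[OF h] inv_closed[OF g]]
	by (auto simp: pact_def fun_eq_iff inv_mult_group[OF g h])
next
 show "pact H \<one> x = x" if "x:coset_space G H" for x :: "'a set => 'k"
	using that lcoset_act(1)[OF H] by (auto simp: pact_def coset_space_def fun_eq_iff[of _ x])
qed

lemma perm_rep_obj: "subgroup H G ==> perm_rep G H:Obj (Rep G)"
 unfolding perm_rep_mrep by (rule mrep_obj[OF pact_act])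

context
 fixes H and M :: "('k::field, 'a) rep"
 assumes H: "subgroup H G" and M: "M:Obj (Rep G)"
begin

text \<open>Frobenius reciprocity in both directions: an \<open>H\<close>-invariant functional
  \<open>xi\<close> gives a map from \<open>M\<close> to \<open>K[G/H]\<close>,
  \<open>x \<mapsto> (aH \<mapsto> xi(a^-1 x))\<close>, and an \<open>H\<close>-invariant vector
  \<open>v\<close> gives a map back, \<open>aH \<mapsto> a v\<close>. Invariance makes the chosen
  coset representatives immaterial.\<close>

definition pin :: "('k vec => 'k) => 'k vec => 'a set => 'k" where
 "pin xi x = (%C. if C:lcosets H then xi (snd M (inv (crep H C)) x) else 0)"

definition pout :: "'k vec => ('a set => 'k) => 'k vec" where
 "pout v x = (SUM C:lcosets H. vscale (x C) (snd M (crep H C) v))"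

definition perm_in :: "('k vec => 'k) => 'k vec => 'k vec" where
 "perm_in xi = restr (fst M) (%x. coords (fscale (*)) (coset_space G H) (pin xi x))"

definition perm_out :: "'k vec => 'k vec => 'k vec" where
 "perm_out v = restr (model (fscale (*)) (coset_space G H)) (%y. pout v (dec (fscale (*)) (coset_space G H) y))"

lemma invariant_functional:
 assumes xi: "!!h x. h:H ==> x:fst M ==> xi (snd M h x) = xi x"
	and a: "a:carrier G" "b:carrier G" "a <# H = b <# H" and x: "x:fst M"
 shows "xi (snd M (inv a) x) = xi (snd M (inv b) x)"
proof -
 obtain h where h: "h:H" "a = b \<otimes> h" using lcoset_eqD[OF H a] by blast
 have hc: "h:carrier G" using subgroup.mem_carrier[OF H h(1)] .
 have "snd M (inv a) x = snd M (inv h) (snd M (inv b) x)"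
	unfolding h(2) using a(2) hc by (simp add: inv_mult_group RepD(4)[OF M])
 then show ?thesis using xi[OF subgroup.m_inv_closed[OF H h(1)] RepD(5)[OF M inv_closed[OF a(2)] x]] by simp
qed

lemma invariant_vector:
 assumes v: "v:fst M" "!!h. h:H ==> snd M h v = v"
	and a: "a:carrier G" "b:carrier G" "a <# H = b <# H"
 shows "snd M a v = snd M b v"
proof -
 obtain h where h: "h:H" "a = b \<otimes> h" using lcoset_eqD[OF H a] by blast
 show ?thesis unfolding h(2) using RepD(4)[OF M a(2) subgroup.mem_carrier[OF H h(1)]] v(2)[OF h(1)] by simp
qed

lemma perm_in_hom:
 assumes l: "xi:lin vscale (fst M) (*) UNIV" and xi: "!!h x. h:H ==> x:fst M ==> xi (snd M h x) = xi x"
 shows "perm_in xi:Hom (Rep G) M (perm_rep G H)"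
 unfolding perm_rep_mrep perm_in_def
proof (rule mrep_in[OF pact_act[OF H] M])
 show "linon vscale (fst M) (fscale (*)) (coset_space G H) (pin xi)"
	unfolding linon_def
	by (auto simp: coset_space_def pin_def fun_eq_iff linD(2,3)[OF RepD(2)[OF M inv_closed[OF crep(1)]]]
		linD(2,3)[OF l] RepD(5)[OF M inv_closed[OF crep(1)]] fsc_app[of "(*)" _ "%C. _ C"])
 fix g x assume g: "g:carrier G" and x: "x:fst M"
 show "pin xi (snd M g x) = pact H g (pin xi x)"
 proof
	fix C show "pin xi (snd M g x) C = pact H g (pin xi x) C"
	proof (cases "C:lcosets H")
	 case C: True
	 note ig = inv_closed[OF g] and ci = crep(1)[OF C]
	 note s = lcoset_smult[OF H ig C]
	 have "pact H g (pin xi x) C = xi (snd M (inv (crep H (inv g <# C))) x)" using C s(1) by (simp add: pact_def pin_def)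
	 also have "... = xi (snd M (inv (inv g \<otimes> crep H C)) x)"
		by (rule invariant_functional[OF xi crep(1)[OF s(1)] s(2) _ x]) (simp_all add: crep(2)[OF s(1)] s(3))
	 also have "inv (inv g \<otimes> crep H C) = inv (crep H C) \<otimes> g" using g ci by (simp add: inv_mult_group)
	 finally show ?thesis using C by (simp add: pin_def RepD(4)[OF M inv_closed[OF ci] g])
	qed (simp add: pin_def pact_def)
 qed
qed

lemma pout_linon:
 assumes v: "v:fst M" shows "linon (fscale (*)) (coset_space G H) vscale (fst M) (pout v)"
 unfolding linon_def
proof (intro conjI ballI allI)
 note S = subspD[OF fsub[OF RepD(1)[OF M]]]
 show "pout v x:fst M" for x unfolding pout_def by (rule S(6)) (intro S(3) RepD(5)[OF M crep(1)] v)
 show "pout v (x + y) = pout v x + pout v y" for x y by (simp add: pout_def sum.distrib[symmetric] vs_simps(5)[OF vs_v])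
 show "pout v (fscale (*) c x) = vscale c (pout v x)" for x c
	by (simp add: pout_def vs_simps(6,11)[OF vs_v] fsc_app[of _ c x])
qed

lemma perm_out_hom:
 assumes v: "v:fst M" "!!h. h:H ==> snd M h v = v"
 shows "perm_out v:Hom (Rep G) (perm_rep G H) M"
 unfolding perm_rep_mrep perm_out_def
proof (rule mrep_out[OF pact_act[OF H] M pout_linon[OF v(1)]])
 fix g x assume g: "g:carrier G" and x: "x:(coset_space G H :: ('a set => 'k) set)"
 have "pout v (pact H g x) = (SUM C:lcosets H. vscale (x (inv g <# C)) (snd M (crep H C) v))"
	unfolding pout_def by (rule sum.cong[OF refl]) (simp add: pact_def)
 also have "... = (SUM C:lcosets H. vscale (x C) (snd M g (snd M (crep H C) v)))"
 proof (rule sum.reindex_bij_witness[where i="%C. g <# C" and j="%C. inv g <# C"])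
	fix C assume C: "C:lcosets H"
	note ig = inv_closed[OF g]
	show "g <# (inv g <# C) = C" "inv g <# (g <# C) = C"
	 using lcoset_act(2)[OF H C g ig] lcoset_act(2)[OF H C ig g] lcoset_act(1)[OF H C] g by simp_all
	show "inv g <# C:lcosets H" "g <# C:lcosets H" using lcoset_smult(1)[OF H _ C] g by auto
	have s: "inv g <# C:lcosets H" by (rule lcoset_smult(1)[OF H ig C])
	have "g <# (inv g <# C) = C" unfolding lcoset_act(2)[OF H C g ig] r_inv[OF g] by (rule lcoset_act(1)[OF H C])
	note e = trans[OF lcoset_smult(3)[OF H g s] this]
	have "snd M (crep H C) v = snd M (g \<otimes> crep H (inv g <# C)) v"
	 by (rule invariant_vector[OF v crep(1)[OF C] lcoset_smult(2)[OF H g s] trans[OF crep(2)[OF C] e[symmetric]]])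
	then show "vscale (x (inv g <# C)) (snd M g (snd M (crep H (inv g <# C)) v)) = vscale (x (inv g <# C)) (snd M (crep H C) v)"
	 by (simp add: RepD(4)[OF M g crep(1)[OF s]])
 qed
 also have "... = snd M g (pout v x)"
	unfolding pout_def by (rule linon_more(5)[OF lin_linon[OF RepD(2)[OF M g]] fsub[OF RepD(1)[OF M]] vs_v, symmetric])
	 (rule RepD(5)[OF M crep(1) v(1)])
 finally show "pout v (pact H g x) = snd M g (pout v x)" .
qed

lemma pin_in: "pin xi x:coset_space G H" by (simp add: pin_def coset_space_def)

text \<open>The composite in this order is an endomorphism of \<open>M\<close>; on tensor powers it
  becomes the projection onto an orbit of words.\<close>

lemma perm_out_in:
 assumes "x:fst M"
 shows "perm_out v (perm_in xi x) = (SUM C:lcosets H. vscale (xi (snd M (inv (crep H C)) x)) (snd M (crep H C) v))"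
proof -
 have "perm_out v (perm_in xi x) = pout v (pin xi x)"
	using assms pin_in by (simp add: perm_out_def perm_in_def coset_space_fds)
 then show ?thesis by (simp add: pout_def pin_def)
qed

lemma perm_out_delta:
 assumes v: "v:fst M" "!!h. h:H ==> snd M h v = v"
 shows "perm_out v (coords (fscale (*)) (coset_space G H) (%C. if C = H then 1 else 0)) = v"
proof -
 have HC: "H:lcosets H" using lcoset_in[OF one_closed, of H] lcoset_one[OF H] by simp
 then have "(%C. if C = H then 1 else 0 :: 'k):coset_space G H" by (auto simp: coset_space_def)
 then have "perm_out v (coords (fscale (*)) (coset_space G H) (%C. if C = H then 1 else 0)) =
	 (SUM C:lcosets H. vscale (if C = H then 1 else 0) (snd M (crep H C) v))"
	by (simp add: perm_out_def pout_def coset_space_fds)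
 also have "... = (SUM C:lcosets H. if C = H then snd M (crep H H) v else 0)"
	by (rule sum.cong) (auto simp: vs_simps[OF vs_v])
 also have "... = snd M (crep H H) v" using HC by (simp add: lcosets_finite)
 also have "... = snd M \<one> v"

	by (rule invariant_vector[OF v crep(1)[OF HC] one_closed trans[OF crep(2)[OF HC] lcoset_one[OF H, symmetric]]])
 finally show ?thesis by (simp add: RepD(3)[OF M v(1)])
qed

text \<open>By \<open>d\<close> the translates of \<open>v\<close> and of \<open>xi\<close> over the
  cosets are dual to each other: the coefficient at \<open>C\<close> of the image of the coset
  \<open>D\<close> is the value of \<open>xi\<close> at \<open>C^-1 D v\<close>, which is 1 exactly
  if the representatives of \<open>C\<close> and \<open>D\<close> lie in the same coset.\<close>

lemma perm_retract:
 assumes v: "v:fst M" "!!h. h:H ==> snd M h v = v"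
	and l: "xi:lin vscale (fst M) (*) UNIV"
	and d: "!!g. g:carrier G ==> xi (snd M g v) = (if g:H then 1 else 0)"
 shows "perm_in xi o perm_out v = id_on (fst (perm_rep G H :: ('k, 'a) rep))"
proof
 fix y :: "'k vec"
 let ?s = "fscale (*) :: 'k => ('a set => 'k) => 'a set => 'k" and ?W = "coset_space G H :: ('a set => 'k) set"
 show "(perm_in xi o perm_out v) y = id_on (fst (perm_rep G H)) y"
 proof (cases "y:model ?s ?W")
	case y: True
	let ?x = "dec ?s ?W y"
	have x: "?x:?W" using y by simp
	have p: "pout v ?x:fst M" using linonD(1)[OF pout_linon[OF v(1)] x] .
	have "pin xi (pout v ?x) = ?x"
	proof
	 fix C show "pin xi (pout v ?x) C = ?x C"
	 proof (cases "C:lcosets H")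
		case C: True
		note c = crep(1)[OF C] and V = fsub[OF RepD(1)[OF M]]
		have "pin xi (pout v ?x) C = xi (snd M (inv (crep H C)) (pout v ?x))" using C by (simp add: pin_def)
		also have "snd M (inv (crep H C)) (pout v ?x) =
		 (SUM D:lcosets H. vscale (?x D) (snd M (inv (crep H C)) (snd M (crep H D) v)))"
		 unfolding pout_def by (rule linon_more(5)[OF lin_linon[OF RepD(2)[OF M inv_closed[OF c]]] V vs_v])
			(rule RepD(5)[OF M crep(1) v(1)])
		also have "xi ... = (SUM D:lcosets H. ?x D * xi (snd M (inv (crep H C)) (snd M (crep H D) v)))"
		 by (rule linon_more(5)[OF lin_linon[OF l] V vs_k]) (intro RepD(5)[OF M] inv_closed c crep(1) v(1))
		also have "... = (SUM D:lcosets H. if D = C then ?x C else 0)"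
		proof (rule sum.cong[OF refl])
		 fix D assume D: "D:lcosets H"
		 have "inv (crep H C) \<otimes> crep H D:H \<longleftrightarrow> D = C"
		 proof
			assume "inv (crep H C) \<otimes> crep H D:H"
			moreover have "crep H D = crep H C \<otimes> (inv (crep H C) \<otimes> crep H D)"
			 using c crep(1)[OF D] by (simp add: m_assoc[symmetric])
			ultimately have "crep H D:crep H C <# H" by (force simp: l_coset_def)
			from l_repr_independence[OF this c H] show "D = C" by (simp add: crep(2)[OF C] crep(2)[OF D])
		 next
			show "inv (crep H C) \<otimes> crep H D:H" if "D = C" using that c subgroup.one_closed[OF H] by simp
		 qed
		 then show "?x D * xi (snd M (inv (crep H C)) (snd M (crep H D) v)) = (if D = C then ?x C else 0)"
			using d[of "inv (crep H C) \<otimes> crep H D"] c crep(1)[OF D] by (simp add: RepD(4)[OF M])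
		qed
		also have "... = ?x C" using C by (simp add: lcosets_finite)
		finally show ?thesis .
	 qed (use x in \<open>simp add: pin_def coset_space_def\<close>)
	qed
	then show ?thesis using y p by (simp add: perm_in_def perm_out_def id_on_def perm_rep_mrep mrep_def)
 next
	case False
	then show ?thesis
	 using fun_cong[OF refl, of "pin xi 0"] linon_more(1)[OF lin_linon[OF l] fsub[OF RepD(1)[OF M]] vs_k]
		lin_more(1)[OF RepD(2)[OF M inv_closed[OF crep(1)]] fsub[OF RepD(1)[OF M]] vs_v]
		coords_zero[OF coset_space_fds] subspD(1)[OF fsub[OF RepD(1)[OF M]]]
	 by (auto simp: perm_in_def perm_out_def id_on_def perm_rep_mrep mrep_def pin_def[abs_def] zero_fun_def cong: if_cong)
 qed
qed

end

text \<open>For the trivial subgroup every vector is invariant, so every vector of \<open>M\<close>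
  is the image of the unit coset under a homomorphism from the regular module.\<close>

lemma Rep_separator:
 fixes M N :: "('k::field, 'a) rep"
 assumes M: "M:Obj (Rep G)" and N: "N:Obj (Rep G)" and a: "a:Hom (Rep G) M N"
	and 0: "!!g. g:Hom (Rep G) (perm_rep G {\<one>}) M ==> Cmp (Rep G) a g = 0"
 shows "a = 0"
proof
 fix x show "a x = 0 x"
 proof (cases "x:fst M")
	case x: True
	have i: "snd M h x = x" if "h:{\<one>}" for h using that RepD(3)[OF M x] by simp
	have "a o perm_out {\<one>} M x = 0" using 0[OF perm_out_hom[OF triv_subgroup M x i]] by (simp add: Rep_sel)
	from fun_cong[OF this, of "coords (fscale (*)) (coset_space G {\<one>}) (%C. if C = {\<one>} then 1 else 0)"]
	show ?thesis using perm_out_delta[OF triv_subgroup M x i] by simp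
 qed (use lin_out[OF RepHomD(1)[OF a]] in simp)
qed

lemma cohcat_Rep:
 "cohcat (Rep G :: ('k::field, ('k, 'a) rep, 'k vec => 'k vec) lincat) (dual_rep G)
	 (%M N. dual_map (fst M) (fst N)) (%M. iotaV (fst M)) (perm_rep G {\<one>})"
proof (rule cohcat.intro[OF lduality_Rep], rule cohcat_axioms.intro)
 show "perm_rep G {\<one>}:Obj (Rep G)" by (rule perm_rep_obj[OF triv_subgroup])
qed (rule Rep_sums Rep_separator Rep_annihilator; assumption)+

end

declare One_nat_def [simp del]

section \<open>Tensor powers\<close>

lemma pure_tensor_apply:
 "pure_tensor n v i = (case i of Ix _ => 0 | Tup ts => if length ts = n then \<Prod>k=1..n. v k (ts ! (k - 1)) else 0)"
 by (simp add: pure_tensor_def)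

lemma pure_tensor_cong: "(!!k. k:{1..n} ==> v k = w k) ==> pure_tensor n v = pure_tensor n w"
 by (auto simp: fun_eq_iff pure_tensor_apply split: idx.split intro!: prod.cong)

lemma tpow_subsp: "subsp vscale (tpow n V)"
proof -
 interpret v: vector_space vscale by (rule vs_v)
 show ?thesis by (simp add: subsp_def tpow_def v.vector_space_axioms v.subspace_span)
qed

lemma pure_in_tpow: "ALL k:{1..n}. v k:V ==> pure_tensor n v:tpow n V"
proof -
 interpret v: vector_space vscale by (rule vs_v)
 show "ALL k:{1..n}. v k:V ==> pure_tensor n v:tpow n V"
	unfolding tpow_def by (rule v.span_base) blast
qed

lemma tpow_subset:
 assumes U: "subsp vscale U" and p: "!!v. (ALL k:{1..n}. v k:V) ==> pure_tensor n v:U"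
 shows "tpow n V <= U"
proof -
 interpret v: vector_space vscale by (rule vs_v)
 show ?thesis unfolding tpow_def by (rule v.span_minimal) (use U p in \<open>auto simp: subsp_def\<close>)
qed

text \<open>The substitute for the uniqueness half of the universal property of tensor
  powers.\<close>

lemma tpow_eq:
 assumes f: "linon vscale (tpow n V) t W f" and g: "linon vscale (tpow n V) t W' g" and t: "vector_space t"
	and p: "!!v. (ALL k:{1..n}. v k:V) ==> f (pure_tensor n v) = g (pure_tensor n v)"
	and x: "x:tpow n V"
 shows "f x = g x"
proof -
 note S = subspD[OF tpow_subsp]
 have "tpow n V <= {x:tpow n V. f x = g x}"
 proof (rule tpow_subset)
	show "subsp vscale {x:tpow n V. f x = g x}"
	 by (rule subspI) (auto simp: S linonD(2,3)[OF f] linonD(2,3)[OF g] linon_more(1)[OF f tpow_subsp t] linon_more(1)[OF g tpow_subsp t])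
 qed (use p pure_in_tpow in blast)
 then show ?thesis using x by blast
qed

text \<open>Vectors are functions on \<open>idx\<close>, and evaluations at indices separate them;
  by the double annihilator they span the dual of \<open>V\<close>. This prepares the existence half
  of the universal property: functionals on \<open>tpow n V\<close>, a space of functions on tuples,
  can be built from evaluations at tuples.\<close>

lemma evaluation_sum:
 fixes V :: "'k::field vec set"
 assumes V: "fds vscale V" and xi: "xi:lin vscale V (*) UNIV"
 shows "EX (m::nat) c ta. ALL x:V. xi x = (\<Sum>i<m. c i * x (ta i))"
proof -
 define ev where "ev L = restr V (%x. \<Sum>(c, i)\<leftarrow>L. c * x i)" for L :: "('k \<times> idx) list"
 have add: "(\<Sum>(c, i)\<leftarrow>L. c * (x + y :: 'k vec) i) = (\<Sum>(c, i)\<leftarrow>L. c * x i) + (\<Sum>(c, i)\<leftarrow>L. c * y i)" for L x y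
	by (induction L) (auto simp: algebra_simps)
 have scl: "(\<Sum>(c, i)\<leftarrow>L. c * (vscale a x :: 'k vec) i) = a * (\<Sum>(c, i)\<leftarrow>L. c * x i)" for L a x
	by (induction L) (auto simp: algebra_simps fsc_app[of _ a x])
 have sclL: "(\<Sum>(c, i)\<leftarrow>map (%(c, i). (a * c, i)) L. c * (x :: 'k vec) i) = a * (\<Sum>(c, i)\<leftarrow>L. c * x i)" for L a x
	by (induction L) (auto simp: algebra_simps)
 have evl: "ev L:lin vscale V (*) UNIV" for L
	unfolding ev_def by (rule restr_lin[OF fsub[OF V]]) (simp add: linon_def add scl del: plus_fun_apply)
 have "xi:range ev"
 proof (rule annihilator_annihilator[OF V _ _ xi])
	show "subsp (fscale (*)) (range ev)"
	proof (rule subspI)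
	 have "0 = ev []" by (auto simp: ev_def restr_def)
	 then show "0:range ev" by (rule range_eqI)
	 show "x + y:range ev" if xy: "x:range ev" "y:range ev" for x y
	 proof -
		obtain L where "x = ev L" using xy(1) by (rule rangeE)
		moreover obtain L' where "y = ev L'" using xy(2) by (rule rangeE)
		ultimately have "x + y = ev (L @ L')" by (auto simp: ev_def restr_def fun_eq_iff)
		then show ?thesis by (rule range_eqI)
	 qed
	 show "fscale (*) c x:range ev" if xy: "x:range ev" for c x
	 proof -
		obtain L where L: "x = ev L" using xy by (rule rangeE)
		have "fscale (*) c x = ev (map (%(b, i). (c * b, i)) L)"
		 by (rule ext) (simp add: L ev_def restr_def sclL fsc_app[of "(*)" c] del: map_map)
		then show ?thesis by (rule range_eqI)
	 qed
	qed simp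
	show "range ev <= lin vscale V (*) UNIV" using evl by blast
	fix v assume v: "v:V" and 0: "!!et. et:range ev ==> et v = 0"
	have "v = 0"
	proof
	 fix i show "v i = 0 i" using 0[OF rangeI, of "[(1, i)]"] v by (simp add: ev_def)
	qed
	then show "xi v = 0" using lin_more(1)[OF xi fsub[OF V] vs_k] by simp
 qed
 then obtain L where L: "xi = ev L" by blast
 show ?thesis
	by (intro exI[of _ "length L"] exI[of _ "%i. fst (L ! i)"] exI[of _ "%i. snd (L ! i)"])
	 (simp add: L ev_def sum_list_sum_nth atLeast0LessThan split_def)
qed

text \<open>Each \<open>xi k\<close> is a combination of evaluations. Multiplied out, their product
  is a combination of evaluations at tuples, and this is defined on all of \<open>tpow n V\<close>,
  not only on pure tensors.\<close>

lemma tensor_functional_ex: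
 fixes V :: "'k::field vec set"
 assumes V: "fds vscale V" and xi: "!!k. k:{1..n} ==> xi k:lin vscale V (*) UNIV"
 shows "EX Xi:lin vscale (tpow n V) (*) UNIV.
	ALL v. (ALL k:{1..n}. v k:V) --> Xi (pure_tensor n v) = (\<Prod>k=1..n. xi k (v k))"
proof -
 have "ALL k:{1..n}. EX (m::nat) c ta. ALL x:V. xi k x = (\<Sum>i<m. c i * x (ta i))"
	using evaluation_sum[OF V xi] by blast
 then obtain m :: "nat => nat" and c ta where e: "!!k x. k:{1..n} ==> x:V ==> xi k x = (\<Sum>i<m k. c k i * x (ta k i))"
	unfolding bchoice_iff by blast
 \<comment> \<open>\<open>F\<close> lists the choices of one summand in every factor, and
   \<open>tp f\<close> is the tuple of the chosen indices.\<close>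
 define F where "F = PiE {1..n} (%k. {..<m k})"
 define tp where "tp f = Tup (map (%k. ta k (f k)) [1..<Suc n])" for f
 define Xi where "Xi x = (SUM f:F. (\<Prod>k=1..n. c k (f k)) * x (tp f))" for x
 have "restr (tpow n V) Xi:lin vscale (tpow n V) (*) UNIV"
	by (rule restr_lin[OF tpow_subsp])
	 (auto simp: linon_def Xi_def sum.distrib[symmetric] sum_distrib_left fsc_app[of "(*)"] algebra_simps intro!: sum.cong)
 moreover have "Xi (pure_tensor n v) = (\<Prod>k=1..n. xi k (v k))" if v: "ALL k:{1..n}. v k:V" for v
 proof -
	have "pure_tensor n v (tp f) = (\<Prod>k=1..n. v k (ta k (f k)))" for f
	 unfolding pure_tensor_apply tp_def by (auto simp del: upt_Suc intro!: prod.cong)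
	then have "Xi (pure_tensor n v) = (SUM f:F. \<Prod>k=1..n. c k (f k) * v k (ta k (f k)))"
	 by (simp add: Xi_def prod.distrib)
	also have "... = (\<Prod>k=1..n. \<Sum>i<m k. c k i * v k (ta k i))" unfolding F_def by (rule prod_sum_PiE[symmetric]) auto
	also have "... = (\<Prod>k=1..n. xi k (v k))" by (rule prod.cong) (use e v in auto)
	finally show ?thesis .
 qed
 ultimately show ?thesis by (intro bexI[of _ "restr (tpow n V) Xi"]) (simp_all add: pure_in_tpow)
qed

definition tfun :: "nat => 'k::field vec set => (nat => 'k vec => 'k) => 'k vec => 'k" where
 "tfun n V xi = (SOME Xi. Xi:lin vscale (tpow n V) (*) UNIV &
	(ALL v. (ALL k:{1..n}. v k:V) --> Xi (pure_tensor n v) = (\<Prod>k=1..n. xi k (v k))))"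

lemma tfun:
 assumes V: "fds vscale V" and xi: "!!k. k:{1..n} ==> xi k:lin vscale V (*) UNIV"
 shows "tfun n V xi:lin vscale (tpow n V) (*) UNIV"
	"(ALL k:{1..n}. v k:V) ==> tfun n V xi (pure_tensor n v) = (\<Prod>k=1..n. xi k (v k))"
 using someI_ex[OF tensor_functional_ex[OF V xi, unfolded Bex_def]] by (auto simp: tfun_def)

text \<open>Words of length \<open>n\<close> in the chosen basis index the pure tensors in which
  \<open>tpow_expand\<close> develops a tensor; \<open>tcob n V w\<close> is the coefficient at the
  word \<open>w\<close>.\<close>

abbreviation words :: "nat => 'k::field vec set => (nat => 'k vec) set" where
 "words n V == PiE {1..n} (%_. bas vscale V)"

abbreviation tcob :: "nat => 'k::field vec set => (nat => 'k vec) => 'k vec => 'k" where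
 "tcob n V w == tfun n V (%k. cob vscale V (w k))"

lemma words:
 assumes "fds vscale V"
 shows "finite (words n V)" "w:words n V ==> k:{1..n} ==> w k:bas vscale V"
	"w:words n V ==> k:{1..n} ==> w k:V" "w:words n V ==> pure_tensor n w:tpow n V"
 using bas(1,3)[OF assms] by (auto intro!: finite_PiE pure_in_tpow simp: PiE_iff simp del: atLeastAtMost_iff)

lemma tcob:
 assumes V: "fds vscale V" and w: "w:words n V"
 shows "tcob n V w:lin vscale (tpow n V) (*) UNIV"
	"(ALL k:{1..n}. v k:V) ==> tcob n V w (pure_tensor n v) = (\<Prod>k=1..n. cob vscale V (w k) (v k))"
 using tfun[OF V bas(4)[OF V words(2)[OF V w]]] by auto

lemma pure_tensor_sum:
 assumes I: "finite I" and v: "!!k. k:{1..n} ==> v k = (SUM b:I. vscale (c k b) (d b))"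
 shows "pure_tensor n v = (SUM w:PiE {1..n} (%_. I). vscale (\<Prod>k=1..n. c k (w k)) (pure_tensor n (%k. d (w k))))"
proof
 fix i
 have "(SUM w:PiE {1..n} (%_. I). vscale (\<Prod>k=1..n. c k (w k)) (pure_tensor n (%k. d (w k)))) i =
	(SUM w:PiE {1..n} (%_. I). (\<Prod>k=1..n. c k (w k)) * pure_tensor n (%k. d (w k)) i)"
	by (subst sum_fun_apply) (simp add: fsc_app[of "(*)"])
 also have "... = pure_tensor n v i"
 proof (cases "EX ts. i = Tup ts & length ts = n")
	case True
	then obtain ts where ts: "i = Tup ts" "length ts = n" by blast
	have "pure_tensor n v i = (\<Prod>k=1..n. SUM b:I. c k b * d b (ts ! (k - 1)))"
	 unfolding pure_tensor_apply using ts v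
	 by (auto intro!: prod.cong simp: sum_fun_apply[of "%b. vscale (c _ b) (d b)"] fsc_app[of "(*)"])
	also have "... = (SUM w:PiE {1..n} (%_. I). \<Prod>k=1..n. c k (w k) * d (w k) (ts ! (k - 1)))"
	 by (rule prod_sum_PiE) (use I in auto)
	finally show ?thesis using ts by (simp add: pure_tensor_apply prod.distrib)
 qed (auto simp: pure_tensor_apply split: idx.split)
 finally show "pure_tensor n v i = (SUM w:PiE {1..n} (%_. I). vscale (\<Prod>k=1..n. c k (w k)) (pure_tensor n (%k. d (w k)))) i" by simp
qed

lemma tpow_expand:
 assumes V: "fds vscale V" and x: "x:tpow n V"
 shows "(SUM w:words n V. vscale (tcob n V w x) (pure_tensor n w)) = x"
proof (rule tpow_eq[OF _ _ vs_v _ x])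
 note l = tcob(1)[OF V]
 show "linon vscale (tpow n V) vscale UNIV (%x. SUM w:words n V. vscale (tcob n V w x) (pure_tensor n w))"
	by (auto simp: linon_def linD(2,3)[OF l] sum.distrib[symmetric] vs_simps(5,6,11)[OF vs_v] intro!: sum.cong)
 show "linon vscale (tpow n V) vscale UNIV (%x. x)" by (simp add: linon_def)
 fix v assume v: "ALL k:{1..n}. v k:V"
 have "pure_tensor n v = (SUM w:words n V. vscale (\<Prod>k=1..n. cob vscale V (w k) (v k)) (pure_tensor n (%k. w k)))"
	by (rule pure_tensor_sum[OF bas(1)[OF V]]) (use bas(6)[OF V bspec[OF v]] in simp)
 also have "... = (SUM w:words n V. vscale (tcob n V w (pure_tensor n v)) (pure_tensor n w))"
	by (rule sum.cong[OF refl]) (simp only: tcob(2)[OF V _ v])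
 finally show "(SUM w:words n V. vscale (tcob n V w (pure_tensor n v)) (pure_tensor n w)) = pure_tensor n v" by (rule sym)
qed

lemma tpow_fds [simp]: assumes V: "fds vscale V" shows "fds vscale (tpow n V)"
proof (rule fdsI_sum[OF tpow_subsp words(1)[OF V] words(4)[OF V]])
 show "EX c. x = (SUM w:words n V. vscale (c w) (pure_tensor n w))" if "x:tpow n V" for x
	using tpow_expand[OF V that] by (intro exI[of _ "%w. tcob n V w x"]) simp
qed

lemma permute_linear: "permute_factors n sg (x + y) = permute_factors n sg x + permute_factors n sg y"
	"permute_factors n sg (vscale c x) = vscale c (permute_factors n sg x)"
 by (auto simp: permute_factors_def fun_eq_iff fsc_app[of "(*)"] split: idx.split)

lemma permute_pure:
 assumes s: "sg permutes {1..n}"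
 shows "permute_factors n sg (pure_tensor n v) = pure_tensor n (%k. v (inv_into UNIV sg k))"
proof
 fix i show "permute_factors n sg (pure_tensor n v) i = pure_tensor n (%k. v (inv_into UNIV sg k)) i"
 proof (cases i)
	case (Tup ts)
	have "(\<Prod>k=1..n. v k (map (%k. ts ! (sg k - 1)) [1..<Suc n] ! (k - 1))) = (\<Prod>k=1..n. v k (ts ! (sg k - 1)))"
	 by (rule prod.cong) (auto simp del: upt_Suc)
	also have "... = (\<Prod>k=1..n. v (inv_into UNIV sg k) (ts ! (k - 1)))"
	 by (subst prod.permute[OF s]) (simp add: permutes_inverses(2)[OF s])
	finally show ?thesis by (simp add: Tup permute_factors_def pure_tensor_apply del: upt_Suc)
 qed (simp add: permute_factors_def pure_tensor_apply)
qed

lemma tpow_rep_sel: "fst (tpow_rep n V) = tpow n V"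
	"x:tpow n V ==> snd (tpow_rep n V) sg x = permute_factors n sg x" "snd (tpow_rep n V) sg = restr (tpow n V) (permute_factors n sg)"
 by (simp_all add: tpow_rep_def restr_def)

lemma tpow_rep_pure:
 assumes "sg permutes {1..n}" "ALL k:{1..n}. v k:V"
 shows "snd (tpow_rep n V) sg (pure_tensor n v) = pure_tensor n (%k. v (inv_into UNIV sg k))"
 using pure_in_tpow[OF assms(2)] by (simp add: tpow_rep_sel permute_pure[OF assms(1)])

lemma permutes_in: "sg permutes {1..n} ==> k:{1..n} ==> sg k:{1..n}"
	"sg permutes {1..n} ==> k:{1..n} ==> inv_into UNIV sg k:{1..n}"
 using permutes_in_image[of sg "{1..n}" k] permutes_in_image[OF permutes_inv, of sg "{1..n}" k] by auto

lemma permutes_ball: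
 assumes "sg permutes {1..n}" "ALL k:{1..n}. P k"
 shows "ALL k:{1..n}. P (sg k)" "ALL k:{1..n}. P (inv_into UNIV sg k)"
 using assms permutes_in[OF assms(1)] by auto

lemma fin_group_sym: "fin_group (sym_group n)"
 unfolding fin_group_def fin_group_axioms_def
 using sym_group_is_group finite_permutations[of "{1..n}"] by (auto simp: sym_group_def)

lemma tpow_rep_lin:
 fixes V :: "'k::field vec set"
 assumes s: "sg permutes {1..n}" shows "snd (tpow_rep n V) sg:vlin (tpow n V) (tpow n V)"
 unfolding tpow_rep_sel
proof (rule restr_lin[OF tpow_subsp])
 let ?P = "permute_factors n sg :: 'k vec => 'k vec"
 note S = subspD[OF tpow_subsp]
 have "?P 0 = 0" using permute_linear(2)[of n sg 0 "0 :: 'k vec"] by (simp add: vs_simps[OF vs_v])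
 then have "subsp vscale {x. ?P x:tpow n V}"
	by (intro subspI) (auto simp: permute_linear S)
 then have "tpow n V <= {x. ?P x:tpow n V}"
 proof (rule tpow_subset)
	fix v assume v: "ALL k:{1..n}. v k:V"
	show "pure_tensor n v:{x. ?P x:tpow n V}"
	 unfolding mem_Collect_eq permute_pure[OF s] by (rule pure_in_tpow[OF permutes_ball(2)[OF s v]])
 qed
 then show "linon vscale (tpow n V) vscale (tpow n V) ?P" by (auto simp: linon_def permute_linear)
qed

lemma tpow_rep_obj:
 assumes V: "fds vscale V" shows "tpow_rep n V:Obj (Rep (sym_group n))"
 unfolding Rep_Obj tpow_rep_sel(1) sym_group_def
proof (simp add: V, intro conjI allI impI)
 let ?r = "snd (tpow_rep n V)"
 show l: "?r sg:vlin (tpow n V) (tpow n V)" if "sg permutes {1..n}" for sg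
	using tpow_rep_lin[of sg n V] that by simp
 note i = id_on_lin[OF tpow_subsp, of n V]
 have one: "id permutes {1..n}" by (rule permutes_id)
 show "?r id = id_on (tpow n V)"
 proof (rule lin_eqI[OF tpow_rep_lin[OF one] i], rule tpow_eq[OF lin_linon[OF tpow_rep_lin[OF one]] lin_linon[OF i] vs_v])
	fix v assume v: "ALL k:{1..n}. v k:V"
	show "?r id (pure_tensor n v) = id_on (tpow n V) (pure_tensor n v)"
	 using tpow_rep_pure[OF one v] pure_in_tpow[OF v] by (simp add: id_on_def)
 qed
 fix g h :: "nat => nat" assume "g permutes {1..n}" "h permutes {1..n}"
 then have g: "g permutes {1..n}" and h: "h permutes {1..n}" by simp_all
 note gh = permutes_compose[OF h g]
 note c = lin_comp[OF tpow_rep_lin[OF h, of V] tpow_rep_lin[OF g, of V] tpow_subsp vs_v]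
 show "?r (g o h) = ?r g o ?r h"
 proof (rule lin_eqI[OF tpow_rep_lin[OF gh] c], rule tpow_eq[OF lin_linon[OF tpow_rep_lin[OF gh]] lin_linon[OF c] vs_v])
	fix v assume v: "ALL k:{1..n}. v k:V"
	show "?r (g o h) (pure_tensor n v) = (?r g o ?r h) (pure_tensor n v)"
	 using tpow_rep_pure[OF gh v] tpow_rep_pure[OF h v] tpow_rep_pure[OF g permutes_ball(2)[OF h v]]
	 by (simp add: o_inv_distrib[OF permutes_bij[OF g] permutes_bij[OF h]])
 qed
qed

subsection \<open>Duality of tensor powers\<close>

context
 fixes n :: nat and V :: "'k::field vec set"
 assumes V: "fds vscale V"
begin

definition is_tdual :: "('k vec => 'k vec => 'k) => bool" where
 "is_tdual ka \<longleftrightarrow> ka:lin vscale (tpow n (dual V)) dscale (functionals (tpow n V)) &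
		(ALL xi v. (ALL k:{1..n}. xi k:dual V & v k:V) -->
			ka (pure_tensor n xi) (pure_tensor n v) = (\<Prod>k=1..n. eval_dual V (xi k) (v k)))"

lemma functionals_subsp: "subsp dscale (functionals W)"
 unfolding functionals_def by (rule subsp_linon) auto

text \<open>An element of \<open>(V\<^sup>\<or>)\<^sup>\<otimes>\<^sup>n\<close> is paired with
  every word in a basis of \<open>V\<close>, and the results become the coefficients of the
  coordinate functionals of the words.\<close>

lemma is_tdual_ex: "EX ka. is_tdual ka"
proof -
 define e where "e w = tfun n (dual V) (%k. restr (dual V) (%y. eval_dual V y (w k)))" for w
 have e0: "restr (dual V) (%y. eval_dual V y x):lin vscale (dual V) (*) UNIV" for x
	by (rule restr_lin[OF fsub[OF dual_fds[OF V]] eval_dual_linon[OF V]])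
 note e = tfun[OF dual_fds[OF V] e0, of n, folded e_def]
 define ka where "ka = restr (tpow n (dual V)) (%x. SUM w:words n V. dscale (e w x) (tcob n V w))"
 have "ka:lin vscale (tpow n (dual V)) dscale (functionals (tpow n V))"
	unfolding ka_def
 proof (rule restr_lin[OF tpow_subsp], unfold linon_def, intro conjI ballI allI)
	note S = subspD[OF functionals_subsp] and D = vs_simps[OF subsp_vs[OF functionals_subsp]]
	show "(SUM w:words n V. dscale (e w x) (tcob n V w)):functionals (tpow n V)" for x
	 by (intro S(6) S(3)) (use tcob(1)[OF V] in \<open>simp add: functionals_def\<close>)
	show "(SUM w:words n V. dscale (e w (x + y)) (tcob n V w)) = (SUM w:words n V. dscale (e w x) (tcob n V w)) + (SUM w:words n V. dscale (e w y) (tcob n V w))"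
	 if "x:tpow n (dual V)" "y:tpow n (dual V)" for x y
	 using that linD(2)[OF e(1)] by (simp add: sum.distrib[symmetric] D(5))
	show "(SUM w:words n V. dscale (e w (vscale c x)) (tcob n V w)) = dscale c (SUM w:words n V. dscale (e w x) (tcob n V w))"
	 if "x:tpow n (dual V)" for x c
	 using that linD(3)[OF e(1)] by (simp add: D(11) D(6))
 qed
 moreover have "ka (pure_tensor n xi) (pure_tensor n v) = (\<Prod>k=1..n. eval_dual V (xi k) (v k))"
	if a: "ALL k:{1..n}. xi k:dual V & v k:V" for xi v
 proof -
	have x: "ALL k:{1..n}. xi k:dual V" and v: "ALL k:{1..n}. v k:V" using a by auto
	have "ka (pure_tensor n xi) (pure_tensor n v) =
	 (SUM w:words n V. (\<Prod>k=1..n. eval_dual V (xi k) (w k)) * (\<Prod>k=1..n. cob vscale V (w k) (v k)))"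
	 unfolding ka_def restr_in[OF pure_in_tpow[OF x]]
	 by (subst sum_fun_apply, rule sum.cong[OF refl])
		(use x in \<open>simp add: fsc_app[of "(*)" _ "tfun _ _ _"] e(2)[OF x] tcob(2)[OF V _ v]\<close>)
	also have "... = (\<Prod>k=1..n. SUM b:bas vscale V. eval_dual V (xi k) b * cob vscale V b (v k))"
	 unfolding prod.distrib[symmetric] by (rule prod_sum_PiE[symmetric]) (use bas(1)[OF V] in auto)
	also have "... = (\<Prod>k=1..n. eval_dual V (xi k) (v k))"
	 by (rule prod.cong[OF refl]) (use lin_bas[OF V vs_k lin_linon[OF eval_dual_lin[OF bspec[OF x]] ] bspec[OF v]] in \<open>simp add: mult.commute\<close>)
	finally show ?thesis .
 qed
 ultimately show ?thesis unfolding is_tdual_def by blast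
qed

lemma functional_pure_eq:
 assumes f: "f:functionals (tpow n V)" "g:functionals (tpow n V)"
	and "!!v. (ALL k:{1..n}. v k:V) ==> f (pure_tensor n v) = g (pure_tensor n v)"
 shows "f = g"
proof -
 note l = f[unfolded functionals_def]
 show ?thesis by (rule lin_eqI[OF l]) (rule tpow_eq[OF lin_linon[OF l(1)] lin_linon[OF l(2)] vs_k assms(3)])
qed

lemma td: "is_tdual (tensor_duality n V)"
proof -
 obtain ka where k: "is_tdual ka" using is_tdual_ex by blast
 have "ka' = ka" if k': "is_tdual ka'" for ka'
 proof -
	have l: "ka:lin vscale (tpow n (dual V)) dscale (functionals (tpow n V))" "ka':lin vscale (tpow n (dual V)) dscale (functionals (tpow n V))"
	 using k k' by (simp_all add: is_tdual_def)
	show ?thesis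
	proof (rule lin_eqI[OF l(2,1)], rule tpow_eq[OF lin_linon[OF l(2)] lin_linon[OF l(1)] subsp_vs[OF functionals_subsp]])
	 fix xi assume x: "ALL k:{1..n}. xi k:dual V"
	 show "ka' (pure_tensor n xi) = ka (pure_tensor n xi)"
		by (rule functional_pure_eq[OF linD(1)[OF l(2) pure_in_tpow[OF x]] linD(1)[OF l(1) pure_in_tpow[OF x]]])
		 (use k k' x in \<open>auto simp: is_tdual_def\<close>)
	qed
 qed
 then have "tensor_duality n V = ka" unfolding tensor_duality_def is_tdual_def[symmetric]
	by (intro the_equality k)
 then show ?thesis using k by simp
qed

lemma td_lin: "tensor_duality n V:lin vscale (tpow n (dual V)) dscale (functionals (tpow n V))"
 using td by (simp add: is_tdual_def)

lemma td_pure: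
 assumes "ALL k:{1..n}. xi k:dual V" "ALL k:{1..n}. v k:V"
 shows "tensor_duality n V (pure_tensor n xi) (pure_tensor n v) = (\<Prod>k=1..n. eval_dual V (xi k) (v k))"
 using td assms by (auto simp: is_tdual_def)

lemma td_bij: "inj_on (tensor_duality n V) (tpow n (dual V))" "tensor_duality n V ` tpow n (dual V) = functionals (tpow n V)"
proof -
 define d where "d b = codual V (cob vscale V b)" for b
 \<comment> \<open>The inverse map: a functional is expanded in words over the dual basis, with its
   values on the words over the basis as coefficients.\<close>
 define h where "h F = (SUM w:words n V. vscale (F (pure_tensor n w)) (pure_tensor n (%k. d (w k))))" for F
 have d: "d b:dual V" "eval_dual V (d b) = cob vscale V b" if "b:bas vscale V" for b
	using codual[OF V bas(4)[OF V that]] by (simp_all add: d_def)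
 have dw: "ALL k:{1..n}. d (w k):dual V" if "w:words n V" for w using d(1) words(2)[OF V that] by blast
 have wV: "ALL k:{1..n}. w k:V" if "w:words n V" for w using words(3)[OF V that] by blast
 have hl: "linon dscale (functionals (tpow n V)) vscale (tpow n (dual V)) h"
	unfolding linon_def
 proof (intro conjI ballI allI)
	show "h F:tpow n (dual V)" for F unfolding h_def
	 by (intro subspD(3,6)[OF tpow_subsp]) (rule pure_in_tpow[OF dw])
	show "h (f + g) = h f + h g" for f g by (simp add: h_def sum.distrib[symmetric] vs_simps(5)[OF vs_v])
	show "h (dscale c f) = vscale c (h f)" for c f by (simp add: h_def vs_simps(6,11)[OF vs_v] fsc_app[of "(*)" c f])
 qed
 have hk: "h (tensor_duality n V x) = x" if "x:tpow n (dual V)" for x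
 proof (rule tpow_eq[OF linon_comp[OF lin_linon[OF td_lin] hl] _ vs_v _ that])
	show "linon vscale (tpow n (dual V)) vscale UNIV (%x. x)" by (simp add: linon_def)
	fix xi assume x: "ALL k:{1..n}. xi k:dual V"
	have "xi k = (SUM b:bas vscale V. vscale (eval_dual V (xi k) b) (d b))" if k: "k:{1..n}" for k
	proof (rule dual_ext[OF bspec[OF x k]])
	 note S = subspD[OF fsub[OF dual_fds[OF V]]]
	 show "(SUM b:bas vscale V. vscale (eval_dual V (xi k) b) (d b)):dual V" by (intro S(3,6) d(1))
	 fix v assume v: "v:V"
	 have "eval_dual V (SUM b:bas vscale V. vscale (eval_dual V (xi k) b) (d b)) v =
		(SUM b:bas vscale V. eval_dual V (xi k) b * eval_dual V (d b) v)"
		by (rule linon_more(5)[OF eval_dual_linon[OF V] fsub[OF dual_fds[OF V]] vs_k d(1)])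
	 also have "... = eval_dual V (xi k) v"
		using lin_bas[OF V vs_k lin_linon[OF eval_dual_lin[OF bspec[OF x k]]] v] d(2) by (simp add: mult.commute)
	 finally show "eval_dual V (xi k) v = eval_dual V (SUM b:bas vscale V. vscale (eval_dual V (xi k) b) (d b)) v" by simp
	qed
	from pure_tensor_sum[OF bas(1)[OF V] this]
	have "pure_tensor n xi = (SUM w:words n V. vscale (\<Prod>k=1..n. eval_dual V (xi k) (w k)) (pure_tensor n (%k. d (w k))))" .
	also have "... = h (tensor_duality n V (pure_tensor n xi))"
	 unfolding h_def by (rule sum.cong[OF refl]) (simp only: td_pure[OF x wV])
	finally show "h (tensor_duality n V (pure_tensor n xi)) = pure_tensor n xi" by (rule sym)
 qed
 show "inj_on (tensor_duality n V) (tpow n (dual V))" by (rule inj_on_inverseI[where g=h]) (rule hk)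
 have kh: "tensor_duality n V (h F) = F" if F: "F:functionals (tpow n V)" for F
 proof (rule functional_pure_eq[OF linD(1)[OF td_lin linonD(1)[OF hl F]] F])
	fix v assume v: "ALL k:{1..n}. v k:V"
	have "tensor_duality n V (h F) = (SUM w:words n V. dscale (F (pure_tensor n w)) (tensor_duality n V (pure_tensor n (%k. d (w k)))))"
	 unfolding h_def by (rule linon_more(5)[OF lin_linon[OF td_lin] tpow_subsp subsp_vs[OF functionals_subsp]]) (rule pure_in_tpow[OF dw])
	moreover have "(\<Prod>k=1..n. eval_dual V (d (w k)) (v k)) = (\<Prod>k=1..n. cob vscale V (w k) (v k))" if "w:words n V" for w
	 by (rule prod.cong[OF refl]) (simp add: d(2)[OF words(2)[OF V that]])
	ultimately have "tensor_duality n V (h F) (pure_tensor n v) =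
	 (SUM w:words n V. F (pure_tensor n w) * (\<Prod>k=1..n. cob vscale V (w k) (v k)))"
	 by (simp, subst sum_fun_apply, intro sum.cong refl)
		(simp add: fsc_app[of "(*)" _ "tensor_duality _ _ _"] td_pure[OF dw v])
	also have "... = (SUM w:words n V. tcob n V w (pure_tensor n v) * F (pure_tensor n w))"
	 by (rule sum.cong) (simp_all add: tcob(2)[OF V _ v])
	also have "... = F (SUM w:words n V. vscale (tcob n V w (pure_tensor n v)) (pure_tensor n w))"
	 by (rule linon_more(5)[OF lin_linon tpow_subsp vs_k words(4)[OF V], symmetric]) (use F in \<open>simp add: functionals_def\<close>)
	also have "... = F (pure_tensor n v)" using tpow_expand[OF V pure_in_tpow[OF v]] by simp
	finally show "tensor_duality n V (h F) (pure_tensor n v) = F (pure_tensor n v)" .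
 qed
 show "tensor_duality n V ` tpow n (dual V) = functionals (tpow n V)"
	using linD(1)[OF td_lin] kh linonD(1)[OF hl] by (force intro: image_eqI[OF sym])
qed

text \<open>\<open>tensor_duality\<close> takes values in genuine functionals; \<open>kapV\<close>
  moves them into \<open>dual (tpow n V)\<close>, where they can be compared with the dual
  representation.\<close>

definition kapV :: "'k vec => 'k vec" where
 "kapV = restr (tpow n (dual V)) (%x. codual (tpow n V) (tensor_duality n V x))"

definition kapV' :: "'k vec => 'k vec" where
 "kapV' = restr (dual (tpow n V)) (inv_into (tpow n (dual V)) kapV)"

lemma kapV_in:
 assumes "x:tpow n (dual V)"
 shows "kapV x:dual (tpow n V)" "eval_dual (tpow n V) (kapV x) = tensor_duality n V x"
 using codual[OF tpow_fds[OF V], of "tensor_duality n V x"] linD(1)[OF td_lin assms] assms by (simp_all add: kapV_def functionals_def)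

lemma kapV_lin: "kapV:vlin (tpow n (dual V)) (dual (tpow n V))"
 unfolding kapV_def codual_def dual_def
 by (rule restr_lin[OF tpow_subsp linon_comp[OF lin_linon[OF td_lin[unfolded dual_def]] coords_linon[OF fds_functionals[OF tpow_fds[OF V]]]]])

lemma kapV_bij: "inj_on kapV (tpow n (dual V))" "kapV ` tpow n (dual V) = dual (tpow n V)"
proof -
 show "inj_on kapV (tpow n (dual V))"
	by (rule inj_onI) (metis kapV_in(2) inj_onD[OF td_bij(1)])
 have "y:kapV ` tpow n (dual V)" if y: "y:dual (tpow n V)" for y
 proof -
	obtain x where x: "x:tpow n (dual V)" "eval_dual (tpow n V) y = tensor_duality n V x"
	 using eval_dual_in[OF y] td_bij(2) by (metis imageE)
	have "y = kapV x" using codual_eval[OF y] x by (simp add: kapV_def)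
	then show ?thesis using x(1) by blast
 qed
 then show "kapV ` tpow n (dual V) = dual (tpow n V)" using kapV_in(1) by blast
qed

lemma kapV'_lin:
 "kapV':vlin (dual (tpow n V)) (tpow n (dual V))" "kapV' o kapV = id_on (tpow n (dual V))" "kapV o kapV' = id_on (dual (tpow n V))"
 unfolding kapV'_def by (rule inverse_lin[OF kapV_lin tpow_subsp kapV_bij vs_v])+

lemma kapV_hom: "kapV:Hom (Rep (sym_group n)) (tpow_rep n (dual V)) (dual_rep (sym_group n) (tpow_rep n V))"
proof -
 interpret S: fin_group "sym_group n" by (rule fin_group_sym)
 show ?thesis
 proof (rule S.RepHomI, unfold S.dual_rep_sel tpow_rep_sel(1), rule kapV_lin)
	fix g x assume gc: "g:carrier (sym_group n)" and x: "x:tpow n (dual V)"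
	have g: "g permutes {1..n}" using gc by (simp add: sym_group_carrier)
	note ig = permutes_inv[OF g] and iv = sym_group_inv_equality[OF gc]
	let ?t = "dual_map (tpow n V) (tpow n V) (snd (tpow_rep n V) (inv_into UNIV g))"
	note rl = tpow_rep_lin[OF ig, of V] and gl = tpow_rep_lin[OF g, of "dual V"]
	note tl = dual_map_lin[OF tpow_fds[OF V] tpow_fds[OF V] rl]
	have "kapV (snd (tpow_rep n (dual V)) g x) = ?t (kapV x)"
	proof (rule tpow_eq[OF linon_comp[OF lin_linon[OF gl] lin_linon[OF kapV_lin]] linon_comp[OF lin_linon[OF kapV_lin] lin_linon[OF tl]] vs_v _ x])
	 fix xi assume xi: "ALL k:{1..n}. xi k:dual V"
	 note p = pure_in_tpow[OF xi] and xi' = permutes_ball(2)[OF g xi]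
	 have q: "snd (tpow_rep n (dual V)) g (pure_tensor n xi) = pure_tensor n (%k. xi (inv_into UNIV g k))" by (rule tpow_rep_pure[OF g xi])
	 note in1 = kapV_in[OF pure_in_tpow[OF xi']] and in2 = kapV_in[OF p]
	 note dm = dual_map_in[OF tpow_fds[OF V] tpow_fds[OF V] rl in2(1)]
	 have "eval_dual (tpow n V) (kapV (pure_tensor n (%k. xi (inv_into UNIV g k)))) = eval_dual (tpow n V) (?t (kapV (pure_tensor n xi)))"
	 proof (rule functional_pure_eq[OF eval_dual_in[OF in1(1)] eval_dual_in[OF dm(1)]])
		fix v assume v: "ALL k:{1..n}. v k:V"
		have "eval_dual (tpow n V) (?t (kapV (pure_tensor n xi))) (pure_tensor n v) =
		 tensor_duality n V (pure_tensor n xi) (pure_tensor n (%k. v (g k)))"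
		 unfolding dm(2) in2(2) tpow_rep_pure[OF ig v] by (simp add: inv_inv_eq[OF permutes_bij[OF g]])
		also have "... = (\<Prod>k=1..n. eval_dual V (xi k) (v (g k)))" by (rule td_pure[OF xi permutes_ball(1)[OF g v]])
		also have "... = (\<Prod>k=1..n. eval_dual V (xi (inv_into UNIV g k)) (v k))"
		 by (subst (2) prod.permute[OF g]) (simp add: permutes_inverses(2)[OF g])
		also have "... = eval_dual (tpow n V) (kapV (pure_tensor n (%k. xi (inv_into UNIV g k)))) (pure_tensor n v)"
		 unfolding in1(2) by (rule td_pure[OF xi' v, symmetric])
		finally show "eval_dual (tpow n V) (kapV (pure_tensor n (%k. xi (inv_into UNIV g k)))) (pure_tensor n v) =
		 eval_dual (tpow n V) (?t (kapV (pure_tensor n xi))) (pure_tensor n v)" by simp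
	 qed
	 then show "kapV (snd (tpow_rep n (dual V)) g (pure_tensor n xi)) = ?t (kapV (pure_tensor n xi))"
		unfolding q by (intro dual_ext[OF in1(1) dm(1)]) simp
	qed
	then show "kapV (snd (tpow_rep n (dual V)) g x) = dual_map (tpow n V) (tpow n V) (snd (tpow_rep n V) (inv\<^bsub>sym_group n\<^esub> g)) (kapV x)"
	 by (simp add: iv)
 qed
qed

end

text \<open>The definition inverts \<open>tensor_duality\<close> on functionals. In this form the
  dual of an arrow is its transpose conjugated by the module isomorphisms \<open>kapV\<close>, as
  \<open>DG1\<close> in \<open>jcat\<close> requires.\<close>

lemma gamma_dual_map_eq:
 assumes V: "fds vscale V" and W: "fds vscale W" and f: "ph:vlin (tpow n V) (tpow n W)"
 shows "gamma_dual_map n V W ph = kapV' n V o (dual_map (tpow n V) (tpow n W) ph o kapV n W)"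
proof
 fix x show "gamma_dual_map n V W ph x = (kapV' n V o (dual_map (tpow n V) (tpow n W) ph o kapV n W)) x"
 proof (cases "x:tpow n (dual W)")
	case x: True
	note k = kapV_in[OF W x]
	note d = dual_map_in[OF tpow_fds[OF V] tpow_fds[OF W] f k(1)]
	let ?y = "dual_map (tpow n V) (tpow n W) ph (kapV n W x)"
	let ?z = "kapV' n V ?y"
	have z: "?z:tpow n (dual V)" by (rule linD(1)[OF kapV'_lin(1)[OF V] d(1)])
	have "kapV n V ?z = ?y" using fun_cong[OF kapV'_lin(3)[OF V, of n], of ?y] d(1) by (simp add: id_on_def)
	then have "tensor_duality n V ?z = eval_dual (tpow n V) ?y" using kapV_in(2)[OF V z] by simp
	also have "... = tensor_duality n W x o ph" using d(2) k(2) by auto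
	finally have "inv_into (tpow n (dual V)) (tensor_duality n V) (tensor_duality n W x o ph) = ?z"
	 using inv_into_f_f[OF td_bij(1)[OF V] z] by simp
	then show ?thesis using x by (simp add: gamma_dual_map_def)
 next
	case False
	have "dual_map (tpow n V) (tpow n W) ph 0 = 0" "kapV' n V 0 = 0"
	 using lin_more(1)[OF dual_map_lin[OF tpow_fds[OF V] tpow_fds[OF W] f] fsub[OF dual_fds[OF tpow_fds[OF W]]] vs_v]
		lin_more(1)[OF kapV'_lin(1)[OF V] fsub[OF dual_fds[OF tpow_fds[OF V]]] vs_v] by auto
	then show ?thesis using False lin_out[OF kapV_lin[OF W] False] by (simp add: gamma_dual_map_def)
 qed
qed

section \<open>Permutation modules inside tensor powers\<close>

text \<open>The stabilizer of a colouring of the positions. Arbitrary colours let the same notion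
  cover words in a basis and the block numbering of a Young subgroup.\<close>

definition stab :: "nat => (nat => 'c) => (nat => nat) set" where
 "stab n c = {sg. sg permutes {1..n} & (ALL k:{1..n}. c (sg k) = c k)}"

lemma stab_iff: "sg:stab n c \<longleftrightarrow> sg permutes {1..n} & (ALL k:{1..n}. c (sg k) = c k)"
 by (simp add: stab_def)

lemma sym_simps:
 "carrier (sym_group n) = {sg. sg permutes {1..n}}" "mult (sym_group n) g h = g o h" "one (sym_group n) = id"
 "g permutes {1..n} ==> inv\<^bsub>sym_group n\<^esub> g = inv_into UNIV g"
 using sym_group_inv_equality[of g n] by (simp_all add: sym_group_def)

lemma stab_inv: "sg:stab n c ==> k:{1..n} ==> c (inv_into UNIV sg k) = c k"
 unfolding stab_iff using permutes_in(2)[of sg n k] by (metis permutes_inverses(1))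

lemma stab_subgroup: "subgroup (stab n c) (sym_group n)"
proof (rule subgroup.intro, unfold sym_simps)
 show "stab n c <= {sg. sg permutes {1..n}}" by (auto simp: stab_iff)
 show "id:stab n c" by (simp add: stab_iff permutes_id)
 show "x o y:stab n c" if "x:stab n c" "y:stab n c" for x y
	using that permutes_in(1)[of y n] by (auto simp: stab_iff intro: permutes_compose)
 show "inv\<^bsub>sym_group n\<^esub> x:stab n c" if x: "x:stab n c" for x
 proof -
	have p: "x permutes {1..n}" using x by (simp add: stab_iff)
	show ?thesis using stab_inv[OF x] permutes_inv[OF p] by (simp add: sym_simps(4)[OF p] stab_iff[of "inv_into UNIV x"])
 qed
qed

text \<open>A word whose letters are indexed by colours, with functionals dual to the letters. Two
  instances are needed: unit vectors coloured by block numbers, and words in a basis of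
  \<open>V\<close>, where the colours are the letters themselves.\<close>

context
 fixes n :: nat and V :: "'k::field vec set" and x :: "'c => 'k vec" and et :: "'c => 'k vec => 'k" and c :: "nat => 'c"
 assumes V: "fds vscale V" and x: "!!k. k:{1..n} ==> x (c k):V"
	and eta: "!!k. k:{1..n} ==> et (c k):lin vscale V (*) UNIV"
	and bi: "!!k l. k:{1..n} ==> l:{1..n} ==> et (c k) (x (c l)) = (if c k = c l then 1 else 0)"
begin

abbreviation (input) "word == pure_tensor n (%k. x (c k))"
abbreviation (input) "cow == tfun n V (%k. et (c k))"

lemma xall: "ALL k:{1..n}. x (c k):V" using x by blast

lemma word_in: "word:tpow n V" by (rule pure_in_tpow[OF xall])

lemma word_invariant:
 assumes s: "sg:stab n c" shows "snd (tpow_rep n V) sg word = word"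
proof -
 have p: "sg permutes {1..n}" using s by (simp add: stab_iff)
 show ?thesis unfolding tpow_rep_pure[OF p xall] by (rule pure_tensor_cong) (simp add: stab_inv[OF s])
qed

lemma cow_lin: "cow:lin vscale (tpow n V) (*) UNIV"
 by (rule tfun(1)[OF V eta])

lemma cow_invariant:
 assumes s: "sg:stab n c" and y: "y:tpow n V" shows "cow (snd (tpow_rep n V) sg y) = cow y"
proof -
 have p: "sg permutes {1..n}" using s by (simp add: stab_iff)
 show ?thesis
 proof (rule tpow_eq[OF linon_comp[OF lin_linon[OF tpow_rep_lin[OF p]] lin_linon[OF cow_lin]] lin_linon[OF cow_lin] vs_k _ y])
	fix v assume v: "ALL k:{1..n}. v k:V"
	have "cow (snd (tpow_rep n V) sg (pure_tensor n v)) = (\<Prod>k=1..n. et (c k) (v (inv_into UNIV sg k)))"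
	 unfolding tpow_rep_pure[OF p v] by (rule tfun(2)[OF V eta permutes_ball(2)[OF p v]])
	also have "... = (\<Prod>k=1..n. et (c (sg k)) (v k))"
	 by (subst prod.permute[OF p]) (simp add: permutes_inverses(2)[OF p])
	also have "... = (\<Prod>k=1..n. et (c k) (v k))" by (rule prod.cong) (use s in \<open>simp_all add: stab_iff\<close>)
	also have "... = cow (pure_tensor n v)" by (rule tfun(2)[OF V eta v, symmetric])
	finally show "cow (snd (tpow_rep n V) sg (pure_tensor n v)) = cow (pure_tensor n v)" .
 qed
qed

text \<open>A permuted word pairs to 1 with the dual word if it is the same word, and to 0
  otherwise. This is the hypothesis \<open>d\<close> of \<open>perm_retract\<close>, so the
  permutation module on the stabilizer splits off.\<close>

lemma cow_word:
 assumes p: "sg permutes {1..n}" shows "cow (snd (tpow_rep n V) sg word) = (if sg:stab n c then 1 else 0)"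
proof -
 have "cow (snd (tpow_rep n V) sg word) = (\<Prod>k=1..n. et (c k) (x (c (inv_into UNIV sg k))))"
	unfolding tpow_rep_pure[OF p xall] by (rule tfun(2)[OF V eta]) (use x permutes_in(2)[OF p] in blast)+
 also have "... = (\<Prod>k=1..n. et (c (sg k)) (x (c k)))"
	by (subst prod.permute[OF p]) (simp add: permutes_inverses(2)[OF p])
 also have "... = (\<Prod>k=1..n. if c (sg k) = c k then 1 else 0)"
	by (rule prod.cong) (use bi permutes_in(1)[OF p] in auto)
 also have "... = (if sg:stab n c then 1 else 0)" using p by (auto simp: stab_iff prod_zero_iff intro!: prod.neutral)
 finally show ?thesis .
qed

lemma word_homs:
 "fin_group.perm_out (sym_group n) (stab n c) (tpow_rep n V) word:Hom (Rep (sym_group n)) (perm_rep (sym_group n) (stab n c)) (tpow_rep n V)"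
 "fin_group.perm_in (sym_group n) (stab n c) (tpow_rep n V) cow:Hom (Rep (sym_group n)) (tpow_rep n V) (perm_rep (sym_group n) (stab n c))"
 "fin_group.perm_in (sym_group n) (stab n c) (tpow_rep n V) cow o fin_group.perm_out (sym_group n) (stab n c) (tpow_rep n V) word =
	id_on (fst (perm_rep (sym_group n) (stab n c)))"
proof -
 interpret S: fin_group "sym_group n" by (rule fin_group_sym)
 note T = tpow_rep_obj[OF V, of n]
 show "S.perm_out (stab n c) (tpow_rep n V) word:Hom (Rep (sym_group n)) (perm_rep (sym_group n) (stab n c)) (tpow_rep n V)"
	by (rule S.perm_out_hom[OF stab_subgroup T]) (simp_all add: tpow_rep_sel(1) word_in word_invariant)
 show "S.perm_in (stab n c) (tpow_rep n V) cow:Hom (Rep (sym_group n)) (tpow_rep n V) (perm_rep (sym_group n) (stab n c))"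
	by (rule S.perm_in_hom[OF stab_subgroup T]) (simp_all add: tpow_rep_sel(1) cow_lin cow_invariant)
 show "S.perm_in (stab n c) (tpow_rep n V) cow o S.perm_out (stab n c) (tpow_rep n V) word = id_on (fst (perm_rep (sym_group n) (stab n c)))"
	by (rule S.perm_retract[OF stab_subgroup T]) (simp_all add: tpow_rep_sel(1) word_in word_invariant cow_lin cow_word sym_simps)
qed

end

subsection \<open>Young subgroups as stabilizers\<close>

definition blk :: "nat list => nat => nat set" where
 "blk l i = {sum_list (take i l)<..sum_list (take (Suc i) l)}"

lemma sum_take_mono: "i <= j ==> sum_list (take i l) <= sum_list (take j (l :: nat list))"
 using take_add[of i "j - i" l] by simp

lemma blk_ex: "k:{1..sum_list l} ==> EX i<length l. k:blk l i"
proof (induction l rule: rev_induct)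
 case (snoc a l)
 show ?case
 proof (cases "k <= sum_list l")
	case True
	then obtain i where i: "i < length l" "k:blk l i" using snoc by auto
	then have "k:blk (l @ [a]) i" by (simp add: blk_def)
	then show ?thesis using i(1) by (intro exI[of _ i]) simp
 qed (use snoc.prems in \<open>auto simp: blk_def intro!: exI[of _ "length l"]\<close>)
qed simp

lemma blk_unique: "k:blk l i ==> k:blk l j ==> i = j"
 using sum_take_mono[of "Suc i" j l] sum_take_mono[of "Suc j" i l] by (auto simp: blk_def) (metis Suc_leI leD le_trans linorder_neqE_nat)

definition bidx :: "nat list => nat => nat" where
 "bidx l k = (SOME i. i < length l & k:blk l i)"

lemma bidx:
 "k:{1..sum_list l} ==> bidx l k < length l" "k:{1..sum_list l} ==> k:blk l (bidx l k)"
 "k:{1..sum_list l} ==> k:blk l i ==> bidx l k = i"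
proof -
 show 1: "bidx l k < length l" "k:blk l (bidx l k)" if "k:{1..sum_list l}"
	using someI_ex[OF blk_ex[OF that]] by (simp_all add: bidx_def)
 show "bidx l k = i" if "k:{1..sum_list l}" "k:blk l i" using blk_unique[OF 1(2)[OF that(1)] that(2)] .
qed

lemma blk_sub: "blk l i <= {1..sum_list l}"
proof -
 have "sum_list (take (Suc i) l) <= sum_list l" using sum_take_mono[of "Suc i" "max (Suc i) (length l)" l] by simp
 then show ?thesis by (auto simp: blk_def)
qed

text \<open>A permutation preserves every block exactly if it preserves the block number of each
  position; on a finite block, mapping into it already means mapping onto it.\<close>

lemma young_stab:
 assumes "sum_list l = n" shows "young_subgroup n l = stab n (bidx l)"
proof (intro equalityI subsetI)
 fix sg assume "sg:young_subgroup n l"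
 then have p: "sg permutes {1..n}" and b: "!!i. i < length l ==> sg ` blk l i = blk l i"
	by (auto simp: young_subgroup_def sym_simps blk_def Let_def)
 show "sg:stab n (bidx l)"
	unfolding stab_iff
 proof (intro conjI ballI p)
	fix k assume "k:{1..n}"
	then have k: "k:{1..sum_list l}" "sg k:{1..sum_list l}" using permutes_in(1)[OF p] assms by auto
	show "bidx l (sg k) = bidx l k" by (rule bidx(3)[OF k(2)]) (use b[OF bidx(1)[OF k(1)]] bidx(2)[OF k(1)] in blast)
 qed
next
 fix sg assume s: "sg:stab n (bidx l)"
 then have p: "sg permutes {1..n}" by (simp add: stab_iff)
 have "sg ` blk l i = blk l i" for i
 proof (rule endo_inj_surj)
	show "finite (blk l i)" by (simp add: blk_def)
	show "inj_on sg (blk l i)" using permutes_inj[OF p] inj_on_subset by blast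
	show "sg ` blk l i <= blk l i"
	proof (rule image_subsetI)
	 fix k assume k: "k:blk l i"
	 then have k1: "k:{1..sum_list l}" using blk_sub by blast
	 then have k2: "sg k:{1..sum_list l}" using permutes_in(1)[OF p] assms by simp
	 have "bidx l (sg k) = bidx l k" using s k1 assms by (simp add: stab_iff)
	 then show "sg k:blk l i" using bidx(2)[OF k2] bidx(3)[OF k1 k] by simp
	qed
 qed
 then show "sg:young_subgroup n l" using p by (simp add: young_subgroup_def sym_simps blk_def[symmetric])
qed

text \<open>The letters are listed by decreasing multiplicity, so the multiplicities form a
  partition; a permutation then gathers the positions of each letter in one block.\<close>

lemma sorted_word:
 fixes u :: "nat => 'c"
 shows "EX l p. is_partition n l & p permutes {1..n} & stab n (%k. u (p k)) = stab n (bidx l)"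
proof -
 define fib where "fib b = {k:{1..n}. u k = b}" for b
 obtain ys where ys: "set ys = u ` {1..n}" "distinct ys" using finite_distinct_list[of "u ` {1..n}"] by auto
 \<comment> \<open>Parts of a partition are weakly decreasing, hence the reversal of the increasing
   sort.\<close>
 define xs where "xs = rev (sort_key (%b. card (fib b)) ys)"
 define l where "l = map (%b. card (fib b)) xs"
 have xs: "set xs = u ` {1..n}" "distinct xs" using ys by (simp_all add: xs_def)
 have ff: "finite (fib b)" for b by (simp add: fib_def)
 have "sum_list l = (SUM b:u ` {1..n}. card (fib b))"
	unfolding l_def using sum_list_distinct_conv_sum_set[OF xs(2)] xs(1) by simp
 also have "... = card (UN b:u ` {1..n}. fib b)"
	by (rule card_UN_disjoint[symmetric]) (auto simp: fib_def)
 also have "(UN b:u ` {1..n}. fib b) = {1..n}" by (auto simp: fib_def)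
 finally have sl: "sum_list l = n" by simp
 have "sorted (map (%b. card (fib b)) (sort_key (%b. card (fib b)) ys))" by simp
 then have "sorted_wrt (>=) l" by (simp add: l_def xs_def rev_map[symmetric] sorted_wrt_rev)
 moreover have "ALL a:set l. a > 0"
	using ff xs(1) by (auto simp: l_def card_gt_0_iff) (auto simp: fib_def)
 ultimately have part: "is_partition n l" using sl by (simp add: is_partition_def)
 have cb: "card (blk l i) = card (fib (xs ! i))" if "i < length l" for i
	using that take_Suc_conv_app_nth[OF that] by (simp add: blk_def l_def)
 have "EX f. bij_betw f (blk l i) (fib (xs ! i))" if "i < length l" for i
	by (rule finite_same_card_bij[OF _ ff cb[OF that]]) (simp add: blk_def)
 then obtain f where f: "!!i. i < length l ==> bij_betw (f i) (blk l i) (fib (xs ! i))" by metis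
 \<comment> \<open>The bijections from the blocks onto the fibres of \<open>u\<close> fit together:
   the \<open>i\<close>-th block goes to the positions of the \<open>i\<close>-th letter.\<close>
 define p where "p k = (if k:{1..n} then f (bidx l k) k else k)" for k
 have pk: "p k:fib (xs ! bidx l k)" if "k:{1..n}" for k
	using bij_betwE[OF f[OF bidx(1)]] bidx(2) that sl by (auto simp: p_def)
 have up: "u (p k) = xs ! bidx l k" "p k:{1..n}" if "k:{1..n}" for k using pk[OF that] by (simp_all add: fib_def)
 have ix: "xs ! bidx l k = xs ! bidx l k' \<longleftrightarrow> bidx l k = bidx l k'" if "k:{1..n}" "k':{1..n}" for k k'
	using bidx(1)[of k l] bidx(1)[of k' l] that sl nth_eq_iff_index_eq[OF xs(2), of "bidx l k" "bidx l k'"] by (simp add: l_def)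
 have inj: "inj_on p {1..n}"
 proof (rule inj_onI)
	fix k k' assume k: "k:{1..n}" "k':{1..n}" and e: "p k = p k'"
	then have b: "bidx l k = bidx l k'" using up(1) ix by metis
	have "f (bidx l k) k = f (bidx l k) k'" using e k b by (simp add: p_def)
	then show "k = k'" using inj_onD[OF bij_betw_imp_inj_on[OF f[OF bidx(1)]]] bidx(2) k sl b by metis
 qed
 have "p ` {1..n} = {1..n}" by (rule endo_inj_surj[OF _ _ inj]) (use up(2) in auto)
 then have pp: "p permutes {1..n}"
	by (rule bij_imp_permutes[OF bij_betw_imageI[OF inj]]) (simp only: p_def if_False)
 have "stab n (%k. u (p k)) = stab n (bidx l)"
	unfolding stab_def by (rule Collect_cong, rule conj_cong[OF refl], rule ball_cong[OF refl]) (use up(1) ix permutes_in(1) in metis)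
 then show ?thesis using part pp by blast
qed

text \<open>A space with unit vectors at \<open>Ix 0\<close> to \<open>Ix (n - 1)\<close>. A
  partition of \<open>n\<close> has at most \<open>n\<close> parts, so \<open>n\<close> letters
  suffice for a word with any prescribed Young subgroup as stabilizer.\<close>

definition Estd :: "nat => 'k::field vec set" where
 "Estd n = {f. (ALL i:Ix ` {..<n}. f i:UNIV) & (ALL i. i ~: Ix ` {..<n} --> f i = 0)}"

lemma Estd_fds: "fds vscale (Estd n)"
 unfolding Estd_def by (rule fds_fun) auto

lemma partition_length: "is_partition n l ==> length l <= n"
proof -
 have "ALL x:set l. x > 0 ==> length l <= sum_list l" for l :: "nat list" by (induction l) auto
 then show "is_partition n l ==> length l <= n" by (auto simp: is_partition_def)
qed

lemma young_retract:
 assumes l: "is_partition n l"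
 shows "EX a b. a:Hom (Rep (sym_group n)) (perm_rep (sym_group n) (young_subgroup n l)) (tpow_rep n (Estd n :: 'k::field vec set)) &
	b:Hom (Rep (sym_group n)) (tpow_rep n (Estd n)) (perm_rep (sym_group n) (young_subgroup n l)) &
	b o a = id_on (fst (perm_rep (sym_group n) (young_subgroup n l) :: 'k srep))"
proof -
 define x where "x i = (%j. if j = Ix i then 1 else 0 :: 'k)" for i
 define et where "et i = restr (Estd n) (%f :: 'k vec. f (Ix i))" for i
 have sl: "sum_list l = n" using l by (simp add: is_partition_def)
 have b: "bidx l k < n" if "k:{1..n}" for k using bidx(1)[of k l] that sl partition_length[OF l] by simp
 have x: "x i:Estd n" if "i < n" for i using that by (auto simp: x_def Estd_def)
 have e: "et i:lin vscale (Estd n) (*) UNIV" for i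
	unfolding et_def by (rule restr_lin[OF fsub[OF Estd_fds]]) (simp add: linon_def fsc_app[of "(*)"])
 have "et (bidx l k) (x (bidx l k')) = (if bidx l k = bidx l k' then 1 else 0)" if "k:{1..n}" "k':{1..n}" for k k'
	using x[OF b[OF that(2)]] by (simp add: et_def) (simp add: x_def)
 note W = word_homs[where c="bidx l" and x=x and et=et and n=n and V="Estd n", folded young_stab[OF sl], OF Estd_fds x[OF b] e this]
 show ?thesis using W by blast
qed

text \<open>The composite is the projection onto the span of the orbit of \<open>w\<close>. In the
  sum over the cosets of the stabilizer, the term of \<open>sg\<close> is nonzero only if
  \<open>sg\<close> moves \<open>w\<close> to \<open>u\<close>, and the permutations that do so form
  a single coset or none.\<close>

lemma tpow_orbit_sum:
 fixes V :: "'k::field vec set"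
 assumes V: "fds vscale V" and w: "w:words n V" and u: "u:words n V"
 shows "fin_group.perm_out (sym_group n) (stab n w) (tpow_rep n V) (pure_tensor n w)
	 (fin_group.perm_in (sym_group n) (stab n w) (tpow_rep n V) (tcob n V w) (pure_tensor n u)) =
	(if EX sg. sg permutes {1..n} & (ALL k:{1..n}. u (sg k) = w k) then pure_tensor n u else 0)"
proof -
 interpret S: fin_group "sym_group n" by (rule fin_group_sym)
 note T = tpow_rep_obj[OF V, of n] and H = stab_subgroup[of n w]
 have uV: "ALL k:{1..n}. u k:V" and wV: "ALL k:{1..n}. w k:V" using words(3)[OF V] u w by blast+
 let ?r = "S.crep (stab n w)" and ?L = "lcosets\<^bsub>sym_group n\<^esub> stab n w"
 define Q where "Q sg \<longleftrightarrow> (ALL k:{1..n}. u (sg k) = w k)" for sg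
 have r: "?r C permutes {1..n}" if "C:?L" for C using S.crep(1)[OF that] by (simp add: sym_simps)
 have tm: "vscale (tcob n V w (snd (tpow_rep n V) (inv\<^bsub>sym_group n\<^esub> sg) (pure_tensor n u))) (snd (tpow_rep n V) sg (pure_tensor n w)) =
	 (if Q sg then pure_tensor n u else 0)" if p: "sg permutes {1..n}" for sg
 proof -
	have "tcob n V w (snd (tpow_rep n V) (inv\<^bsub>sym_group n\<^esub> sg) (pure_tensor n u)) = tcob n V w (pure_tensor n (%k. u (sg k)))"
	 using tpow_rep_pure[OF permutes_inv[OF p] uV] by (simp add: sym_simps(4)[OF p] inv_inv_eq[OF permutes_bij[OF p]])
	also have "... = (\<Prod>k=1..n. cob vscale V (w k) (u (sg k)))" by (rule tcob(2)[OF V w permutes_ball(1)[OF p uV]])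
	also have "... = (\<Prod>k=1..n. if w k = u (sg k) then 1 else 0)"
	 by (rule prod.cong[OF refl]) (use bas(5)[OF V words(2)[OF V w] words(2)[OF V u permutes_in(1)[OF p]]] in blast)
	also have "... = (if Q sg then 1 else 0)" by (auto simp: Q_def prod_zero_iff intro!: prod.neutral)
	finally have 1: "tcob n V w (snd (tpow_rep n V) (inv\<^bsub>sym_group n\<^esub> sg) (pure_tensor n u)) = (if Q sg then 1 else 0)" .
	have "snd (tpow_rep n V) sg (pure_tensor n w) = pure_tensor n u" if "Q sg"
	 unfolding tpow_rep_pure[OF p wV]
	 by (rule pure_tensor_cong) (use that permutes_in(2)[OF p] permutes_inverses(1)[OF p] in \<open>metis Q_def\<close>)
	then show ?thesis unfolding 1 by (simp add: vs_simps[OF vs_v])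
 qed
 have pu: "pure_tensor n u:fst (tpow_rep n V)" by (simp add: tpow_rep_sel(1) words(4)[OF V u])
 have "S.perm_out (stab n w) (tpow_rep n V) (pure_tensor n w) (S.perm_in (stab n w) (tpow_rep n V) (tcob n V w) (pure_tensor n u)) =
	 (SUM C:?L. if Q (?r C) then pure_tensor n u else 0)"
	unfolding S.perm_out_in[OF H T pu] by (rule sum.cong[OF refl]) (rule tm[OF r])
 also have "... = (if EX sg. sg permutes {1..n} & (ALL k:{1..n}. u (sg k) = w k) then pure_tensor n u else 0)"
 proof (cases "EX sg. sg permutes {1..n} & (ALL k:{1..n}. u (sg k) = w k)")
	case True
	then obtain sg where s: "sg permutes {1..n}" and q: "!!k. k:{1..n} ==> u (sg k) = w k" by blast
	let ?C = "sg <#\<^bsub>sym_group n\<^esub> stab n w"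
	have sc: "sg:carrier (sym_group n)" using s by (simp add: sym_simps)
	have C: "?C:?L" by (rule S.lcoset_in[OF sc])
	\<comment> \<open>Two permutations that move \<open>w\<close> to \<open>u\<close> differ by an
	  element of the stabilizer of \<open>w\<close>, so exactly one term of the sum survives.\<close>
	have "Q (?r D) \<longleftrightarrow> D = ?C" if D: "D:?L" for D
	proof
	 assume QD: "Q (?r D)"
	 have "inv_into UNIV sg o ?r D:stab n w"
		unfolding stab_iff
	 proof (intro conjI ballI)
		show "inv_into UNIV sg o ?r D permutes {1..n}" by (rule permutes_compose[OF r[OF D] permutes_inv[OF s]])
		fix k assume k: "k:{1..n}"
		have "w ((inv_into UNIV sg o ?r D) k) = u (sg (inv_into UNIV sg (?r D k)))"
		 using q[OF permutes_in(2)[OF s permutes_in(1)[OF r[OF D] k]]] by simp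
		also have "... = w k" using QD k by (simp add: Q_def permutes_inverses(1)[OF s])
		finally show "w ((inv_into UNIV sg o ?r D) k) = w k" .
	 qed
	 moreover have "sg o (inv_into UNIV sg o ?r D) = ?r D" by (auto simp: permutes_inverses(1)[OF s])
	 ultimately have "?r D:?C" unfolding l_coset_def sym_simps by (metis UN_iff singletonI)
	 from S.l_repr_independence[OF this sc H] show "D = ?C" using S.crep(2)[OF D] by simp
	next
	 assume "D = ?C"
	 then have "?r D <#\<^bsub>sym_group n\<^esub> stab n w = sg <#\<^bsub>sym_group n\<^esub> stab n w" using S.crep(2)[OF D] by simp
	 from S.lcoset_eqD[OF H S.crep(1)[OF D] sc this] obtain h where h: "h:stab n w" "?r D = sg o h"
		by (auto simp: sym_simps)
	 show "Q (?r D)" unfolding Q_def h(2) using h(1) q permutes_in(1)[of h n] by (auto simp: stab_iff)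
	qed
	then have "(SUM C:?L. if Q (?r C) then pure_tensor n u else 0) = (SUM D:?L. if D = ?C then pure_tensor n u else 0)"
	 by (intro sum.cong) auto
	also have "... = pure_tensor n u" using C by (simp add: S.lcosets_finite)
	finally show ?thesis using True by simp
 next
	case False
	have "(SUM C:?L. if Q (?r C) then pure_tensor n u else 0) = 0"
	 by (rule sum.neutral) (use False r in \<open>auto simp: Q_def\<close>)
	then show ?thesis unfolding if_not_P[OF False] .
 qed
 finally show ?thesis .
qed

text \<open>One word with a Young subgroup as stabilizer is chosen in every orbit. Of the
  projections for these words exactly one fixes a given basis word and the others kill it, so they
  add up to the identity.\<close>

lemma tpow_young_sum:
 fixes V :: "'k::field vec set"
 assumes V: "fds vscale V"
 shows "EX (m::nat) l a b. (ALL i<m. is_partition n (l i) &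
	 a i:Hom (Rep (sym_group n)) (perm_rep (sym_group n) (young_subgroup n (l i))) (tpow_rep n V) &
	 b i:Hom (Rep (sym_group n)) (tpow_rep n V) (perm_rep (sym_group n) (young_subgroup n (l i)))) &
	(\<Sum>i<m. a i o b i) = id_on (tpow n V)"
proof -
 interpret S: fin_group "sym_group n" by (rule fin_group_sym)
 define eq where "eq u w \<longleftrightarrow> (EX sg. sg permutes {1..n} & (ALL k:{1..n}. u (sg k) = w k))" for u w :: "nat => 'k vec"
 have eqt: "eq u w" if uv: "eq u v" and vw: "eq v w" for u v w
 proof -
	obtain sg ta where st: "sg permutes {1..n}" "ALL k:{1..n}. u (sg k) = v k" "ta permutes {1..n}" "ALL k:{1..n}. v (ta k) = w k"
	 using uv vw unfolding eq_def by blast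
	have "ALL k:{1..n}. u ((sg o ta) k) = w k" using st permutes_in(1)[OF st(3)] by simp
	then show ?thesis unfolding eq_def using permutes_compose[OF st(3,1)] by blast
 qed
 have eqs: "eq w u" if uw: "eq u w" for u w
 proof -
	obtain sg where s: "sg permutes {1..n}" "ALL k:{1..n}. u (sg k) = w k" using uw unfolding eq_def by blast
	have "ALL k:{1..n}. w (inv_into UNIV sg k) = u k"
	 using s(2) permutes_in(2)[OF s(1)] permutes_inverses(1)[OF s(1)] by metis
	then show ?thesis unfolding eq_def using permutes_inv[OF s(1)] by blast
 qed
 define sr where "sr u = (SOME w. w:words n V & eq u w & (EX l. is_partition n l & stab n w = young_subgroup n l))" for u
 have sr: "sr u:words n V" "eq u (sr u)" "EX l. is_partition n l & stab n (sr u) = young_subgroup n l" if u: "u:words n V" for u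
 proof -
	obtain l p where l: "is_partition n l" and p: "p permutes {1..n}" and st: "stab n (%k. u (p k)) = stab n (bidx l)"
	 using sorted_word by metis
	have sl: "sum_list l = n" using l by (simp add: is_partition_def)
	\<comment> \<open>Members of \<open>words\<close> are undefined outside \<open>{1..n}\<close>; the
	  restriction brings the permuted word into this set without changing its stabilizer.\<close>
	let ?w = "restrict (%k. u (p k)) {1..n}"
	have "?w:words n V" using words(2)[OF V u permutes_in(1)[OF p]] by (auto simp del: atLeastAtMost_iff)
	moreover have "eq u ?w" unfolding eq_def using p by auto
	moreover have "stab n ?w = young_subgroup n l"
	 unfolding young_stab[OF sl] st[symmetric] unfolding stab_def
	 by (rule Collect_cong, rule conj_cong[OF refl], rule ball_cong[OF refl]) (simp del: atLeastAtMost_iff add: permutes_in(1))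
	ultimately have "EX w. w:words n V & eq u w & (EX l. is_partition n l & stab n w = young_subgroup n l)" using l by blast
	from someI_ex[OF this] show "sr u:words n V" "eq u (sr u)" "EX l. is_partition n l & stab n (sr u) = young_subgroup n l"
	 by (simp_all add: sr_def)
 qed
 \<comment> \<open>The condition from which \<open>sr u\<close> is chosen depends only on the orbit
   of \<open>u\<close>, so all words of an orbit get the same representative.\<close>
 have sreq: "sr u = sr u'" if "eq u u'" for u u'
 proof -
	have "eq u w \<longleftrightarrow> eq u' w" for w using eqt eqs that by blast
	then show ?thesis by (simp add: sr_def)
 qed
 define R where "R = sr ` words n V"
 have Rf: "finite R" unfolding R_def using words(1)[OF V] by simp
 have Rw: "w:words n V" "EX l. is_partition n l & stab n w = young_subgroup n l" if "w:R" for w using that sr by (auto simp: R_def)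
 have Req: "eq u w \<longleftrightarrow> w = sr u" if u: "u:words n V" and w: "w:R" for u w
 proof
	obtain u0 where u0: "u0:words n V" "w = sr u0" using w by (auto simp: R_def)
	assume "eq u w"
	then have "eq u u0" using eqt[OF _ eqs[OF sr(2)[OF u0(1)]]] u0(2) by blast
	then show "w = sr u" using sreq u0(2) by metis
 qed (use sr(2)[OF u] in simp)
 obtain l where l: "!!w. w:R ==> is_partition n (l w) & stab n w = young_subgroup n (l w)" using Rw(2) by metis
 define A where "A w = S.perm_out (stab n w) (tpow_rep n V) (pure_tensor n w)" for w
 define B where "B w = S.perm_in (stab n w) (tpow_rep n V) (tcob n V w)" for w
 have AB: "A w:Hom (Rep (sym_group n)) (perm_rep (sym_group n) (young_subgroup n (l w))) (tpow_rep n V)"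
	"B w:Hom (Rep (sym_group n)) (tpow_rep n V) (perm_rep (sym_group n) (young_subgroup n (l w)))" if w: "w:R" for w
 proof -
	note ww = words(2,3)[OF V Rw(1)[OF w]] and e = conjunct2[OF l[OF w]]
	have "cob vscale V (w k) (w k') = (if w k = w k' then 1 else 0)" if "k:{1..n}" "k':{1..n}" for k k'
	 by (rule bas(5)[OF V ww(1)[OF that(1)] ww(1)[OF that(2)]])
	note W = word_homs[where c=w and x="%b. b" and et="cob vscale V" and n=n, OF V ww(2) bas(4)[OF V ww(1)] this, unfolded e]
	show "A w:Hom (Rep (sym_group n)) (perm_rep (sym_group n) (young_subgroup n (l w))) (tpow_rep n V)"
	 "B w:Hom (Rep (sym_group n)) (tpow_rep n V) (perm_rep (sym_group n) (young_subgroup n (l w)))"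
	 unfolding A_def B_def e by (rule W(1), assumption+) (rule W(2), assumption+)
 qed
 have ABl: "A w o B w:vlin (tpow n V) (tpow n V)" if w: "w:R" for w
 proof -
	have "subgroup (young_subgroup n (l w)) (sym_group n)" using stab_subgroup[of n w] l[OF w] by simp
	from S.perm_rep_obj[OF this] have "subsp vscale (fst (perm_rep (sym_group n) (young_subgroup n (l w)) :: 'k srep))"
	 by (rule fsub[OF S.RepD(1)])
	from lin_comp[OF S.RepHomD(1)[OF AB(2)[OF w]] S.RepHomD(1)[OF AB(1)[OF w]] this vs_v] show ?thesis by (simp add: tpow_rep_sel(1))
 qed
 have sl: "(SUM w:R. A w o B w):vlin (tpow n V) (tpow n V)"
	by (rule subspD(6)[OF fsub[OF fds_lin[OF tpow_fds[OF V] tpow_fds[OF V]]] ABl])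
 have base: "(SUM w:R. A w o B w) (pure_tensor n u) = pure_tensor n u" if u: "u:words n V" for u
 proof -
	have "(SUM w:R. A w o B w) (pure_tensor n u) = (SUM w:R. A w (B w (pure_tensor n u)))"
	 by (subst sum_fun_apply) simp
	also have "... = (SUM w:R. if w = sr u then pure_tensor n u else 0)"
	 by (rule sum.cong[OF refl]) (simp add: A_def B_def tpow_orbit_sum[OF V Rw(1) u] Req[OF u, unfolded eq_def])
	also have "... = pure_tensor n u" using Rf u by (simp add: R_def)
	finally show ?thesis .
 qed
 have sum: "(SUM w:R. A w o B w) = id_on (tpow n V)"
 proof (rule lin_eqI[OF sl id_on_lin[OF tpow_subsp]])
	fix x assume x: "x:tpow n V"
	have "(SUM w:R. A w o B w) x = (SUM w:R. A w o B w) (SUM u:words n V. vscale (tcob n V u x) (pure_tensor n u))"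
	 by (simp add: tpow_expand[OF V x])
	also have "... = (SUM u:words n V. vscale (tcob n V u x) ((SUM w:R. A w o B w) (pure_tensor n u)))"
	 by (rule linon_more(5)[OF lin_linon[OF sl] tpow_subsp vs_v words(4)[OF V]])
	also have "... = (SUM u:words n V. vscale (tcob n V u x) (pure_tensor n u))" by (rule sum.cong) (simp_all add: base)
	finally show "(SUM w:R. A w o B w) x = id_on (tpow n V) x" using x by (simp add: tpow_expand[OF V x] id_on_def)
 qed
 obtain h where h: "bij_betw h {0..<card R} R" using ex_bij_betw_nat_finite[OF Rf] by blast
 have hR: "h i:R" if "i < card R" for i using bij_betwE[OF h] that by simp
 have "(\<Sum>i<card R. A (h i) o B (h i)) = (SUM w:R. A w o B w)"
	using sum.reindex_bij_betw[OF h, of "%w. A w o B w"] by (simp add: atLeast0LessThan)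
 then show ?thesis
	by (intro exI[of _ "card R"] exI[of _ "%i. l (h i)"] exI[of _ "%i. A (h i)"] exI[of _ "%i. B (h i)"])
	 (use l AB hR sum in simp)
qed

section \<open>Restriction along tensor powers\<close>

text \<open>The identity of \<open>f(X)\<close> is a sum of maps that pass through the zero spaces
  \<open>f(Y i)\<close>.\<close>

lemma (in lcat) zero_of_sum:
 assumes f: "f:Obj (FunK C)" and X: "X:Obj C" and Y: "!!i. i < (k::nat) ==> Y i:Obj C"
	and ab: "!!i. i < k ==> a i:Hom C (Y i) X" "!!i. i < k ==> b i:Hom C X (Y i)"
	and s: "(\<Sum>i<k. Cmp C (a i) (b i)) = Idm C X" and z: "!!i. i < k ==> Fo f (Y i) = {0}"
 shows "Fo f X = {0}"
proof -
 have "y = 0" if y: "y:Fo f X" for y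
 proof -
	have "y = Fm f X X (\<Sum>i<k. Cmp C (a i) (b i)) y" using Fm_id[OF f X y] s by simp
	also have "... = (\<Sum>i<k. Fm f X X (Cmp C (a i) (b i)) y)"
	 by (rule Fm_sum[OF f X X y]) (simp add: cmp[OF X Y X ab(2,1)])
	also have "... = 0"
	proof (rule sum.neutral, rule ballI)
	 fix i assume "i:{..<k}"
	 then have i: "i < k" by simp
	 have "Fm f X (Y i) (b i) y = 0" using Fm_in[OF f X Y[OF i] ab(2)[OF i] y] z[OF i] by simp
	 then show "Fm f X X (Cmp C (a i) (b i)) y = 0"
		using Fm_comp[OF f X Y[OF i] X ab(2)[OF i] ab(1)[OF i], of y]
		 lin_more(1)[OF FobjD(2)[OF f Y[OF i] X ab(1)[OF i]] fsub[OF FobjD(1)[OF f Y[OF i]]] vs_v] by simp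
	qed
	finally show ?thesis .
 qed
 then show ?thesis using subspD(1)[OF fsub[OF FobjD(1)[OF f X]]] by blast
qed

lemma GammaVect_sel:
 "Obj (GammaVect n) = Obj Vect" "Hom (GammaVect n) V W = Hom (Rep (sym_group n)) (tpow_rep n V) (tpow_rep n W)"
 "Idm (GammaVect n) V = Idm (Rep (sym_group n)) (tpow_rep n V)" "Cmp (GammaVect n) = Cmp (Rep (sym_group n))"
 "Scl (GammaVect n) = Scl (Rep (sym_group n))"
 by (simp_all add: GammaVect_def)

text \<open>The identity of \<open>V\<^sup>\<otimes>\<^sup>n\<close> is a sum of maps through Young
  modules, and each Young module is a retract of \<open>E\<^sup>\<otimes>\<^sup>n\<close>; the
  detour \<open>d i o c i\<close> through it is inserted into each summand. This is the assumption
  \<open>dense\<close> of \<open>jcat\<close>.\<close>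

lemma tpow_factor_Estd:
 fixes V :: "'k::field vec set"
 assumes V: "fds vscale V"
 shows "EX (k::nat) a b. (ALL i<k. a i:Hom (Rep (sym_group n)) (tpow_rep n (Estd n)) (tpow_rep n V) &
	 b i:Hom (Rep (sym_group n)) (tpow_rep n V) (tpow_rep n (Estd n))) & (\<Sum>i<k. a i o b i) = id_on (tpow n V)"
proof -
 interpret S: fin_group "sym_group n" by (rule fin_group_sym)
 interpret R: lcat "Rep (sym_group n) :: ('k, 'k srep, 'k vec => 'k vec) lincat" by (rule S.lcat_Rep)
 let ?H = "Hom (Rep (sym_group n)) :: 'k srep => _" and ?T = "tpow_rep n V" and ?E = "tpow_rep n (Estd n :: 'k vec set)"
 let ?P = "%l. perm_rep (sym_group n) (young_subgroup n l) :: 'k srep"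
 obtain k :: nat and l a b where 0: "ALL i<k. is_partition n (l i) & a i:?H (?P (l i)) ?T & b i:?H ?T (?P (l i))"
	and s: "(\<Sum>i<k. a i o b i) = id_on (tpow n V)"
	using tpow_young_sum[OF V, of n] by (elim exE conjE) (rule that)
 have l: "is_partition n (l i)" and ab: "a i:?H (?P (l i)) ?T" "b i:?H ?T (?P (l i))" if "i < k" for i
	using 0 that by auto
 have "ALL i. EX c d. i < k --> c:?H (?P (l i)) ?E & d:?H ?E (?P (l i)) & d o c = id_on (fst (?P (l i)))"
	using young_retract[OF l] by blast
 then obtain c d where 1: "ALL i. i < k --> c i:?H (?P (l i)) ?E & d i:?H ?E (?P (l i)) & d i o c i = id_on (fst (?P (l i)))"
	unfolding choice_iff by (elim exE) (rule that)
 have cd: "c i:?H (?P (l i)) ?E" "d i:?H ?E (?P (l i))" "d i o c i = id_on (fst (?P (l i)))" if "i < k" for i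
	using 1 that by auto
 have P: "?P (l i):Obj (Rep (sym_group n))" if "i < k" for i
	using S.perm_rep_obj[OF stab_subgroup[of n "bidx (l i)"]] young_stab[of "l i" n] l[OF that] by (simp add: is_partition_def)
 note T = tpow_rep_obj[OF V, of n] and E = tpow_rep_obj[OF Estd_fds, of n]
 have eq: "(a i o d i) o (c i o b i) = a i o b i" if i: "i < k" for i
 proof -
	have "id_on (fst (?P (l i))) o b i = b i" using R.idl[OF T P[OF i] ab(2)[OF i]] by (simp add: Rep_sel)
	then show ?thesis using cd(3)[OF i] by (metis comp_assoc)
 qed
 show ?thesis
 proof (intro exI conjI allI impI)
	show "a i o d i:?H ?E ?T" "c i o b i:?H ?T ?E" if i: "i < k" for i
	 using R.cmp[OF E P[OF i] T cd(2)[OF i] ab(1)[OF i]] R.cmp[OF T P[OF i] E ab(2)[OF i] cd(1)[OF i]] by (simp_all add: Rep_sel)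
	show "(\<Sum>i<k. (a i o d i) o (c i o b i)) = id_on (tpow n V)"
	 unfolding s[symmetric] by (rule sum.cong) (simp_all add: eq)
 qed
qed

lemma jcat_sym:
 "jcat (Rep (sym_group n) :: ('k::field, 'k srep, 'k vec => 'k vec) lincat) (dual_rep (sym_group n))
	 (%M N. dual_map (fst M) (fst N)) (%M. iotaV (fst M)) (perm_rep (sym_group n) {\<one>\<^bsub>sym_group n\<^esub>})
	 (GammaVect n) (tpow_rep n) dual (gamma_dual_map n) (kapV n) (kapV' n) (Estd n)"
proof -
 interpret S: fin_group "sym_group n" by (rule fin_group_sym)
 note obj = GammaVect_sel(1) Vect_Obj
 show ?thesis
 proof (rule jcat.intro[OF S.cohcat_Rep], rule jcat_axioms.intro)
	fix V :: "'k vec set" assume "V:Obj (GammaVect n)"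
	then have V: "fds vscale V" by (simp add: obj)
	show T: "tpow_rep n V:Obj (Rep (sym_group n))" by (rule tpow_rep_obj[OF V])
	show "dual V:Obj (GammaVect n)" using V by (simp add: obj)
	show k: "kapV n V:Hom (Rep (sym_group n)) (tpow_rep n (dual V)) (dual_rep (sym_group n) (tpow_rep n V))" by (rule kapV_hom[OF V])
	show "kapV' n V:Hom (Rep (sym_group n)) (dual_rep (sym_group n) (tpow_rep n V)) (tpow_rep n (dual V))"
	 by (rule S.Rep_inverse_hom[OF tpow_rep_obj[OF dual_fds[OF V]] S.dual_rep_obj[OF T] k])
		(simp_all add: S.dual_rep_sel tpow_rep_sel(1) kapV'_lin[OF V])
	show "Cmp (Rep (sym_group n)) (kapV' n V) (kapV n V) = Idm (Rep (sym_group n)) (tpow_rep n (dual V))"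
	 "Cmp (Rep (sym_group n)) (kapV n V) (kapV' n V) = Idm (Rep (sym_group n)) (dual_rep (sym_group n) (tpow_rep n V))"
	 by (simp_all add: Rep_sel S.dual_rep_sel tpow_rep_sel(1) kapV'_lin[OF V])
	show "EX (k::nat) a b. (ALL i<k. a i:Hom (Rep (sym_group n)) (tpow_rep n (Estd n)) (tpow_rep n V) &
		b i:Hom (Rep (sym_group n)) (tpow_rep n V) (tpow_rep n (Estd n))) &
	 (\<Sum>i<k. Cmp (Rep (sym_group n)) (a i) (b i)) = Idm (Rep (sym_group n)) (tpow_rep n V)"
	 unfolding Rep_sel tpow_rep_sel(1) by (rule tpow_factor_Estd[OF V])
	fix W :: "'k vec set" and f
	assume "W:Obj (GammaVect n)" and f: "f:Hom (Rep (sym_group n)) (tpow_rep n V) (tpow_rep n W)"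
	then show "gamma_dual_map n V W f = Cmp (Rep (sym_group n)) (kapV' n V)
		(Cmp (Rep (sym_group n)) (dual_map (fst (tpow_rep n V)) (fst (tpow_rep n W)) f) (kapV n W))"
	 using gamma_dual_map_eq[OF V] S.RepHomD(1)[OF f] by (simp add: Rep_sel tpow_rep_sel(1) obj)
 qed (simp_all add: GammaVect_sel Vect_Obj Estd_fds)
qed

theorem proposition3p2p9:
  fixes n p :: nat
  assumes "CHAR('k::field) = p" and "p > 0" and "n > 0"
  shows "\<exists>iL iR.
    recollement (CohSymY n :: ('k, 'k sfunc, 'k snat) lincat) (CohSym n) (StrictPoly n)
      iL incl iR (jshriek n) (jstar n) (jlower n)"
proof -
 let ?R = "Rep (sym_group n) :: ('k, 'k srep, 'k vec => 'k vec) lincat"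
 interpret S: fin_group "sym_group n" by (rule fin_group_sym)
 interpret J: jcat ?R "dual_rep (sym_group n)"
	"%M N. dual_map (fst M) (fst N)" "%M. iotaV (fst M)" "perm_rep (sym_group n) {\<one>\<^bsub>sym_group n\<^esub>}"
	"GammaVect n" "tpow_rep n" dual "gamma_dual_map n" "kapV n" "kapV' n" "Estd n" by (rule jcat_sym)
 \<comment> \<open>The functors of the abstract setting have the same bodies as those of the
   statement, so they are equal and not just isomorphic; no transport of the recollement is
   needed.\<close>
 have js: "J.jst = jstar n" by (simp add: J.jst_def jstar_def GammaVect_sel)
 have jH: "J.jH = jlower_hom n"
	by (simp add: fun_eq_iff J.jH_def jlower_hom_def js StrictPoly_def)
 have jl: "J.jlow = jlower n"
	unfolding J.jlow_def jlower_def Let_def jH J.pre_def[abs_def] js StrictPoly_def by (rule refl)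
 have dA: "J.dF = dualA (sym_group n)" "J.dFm = dualA_map (sym_group n)"
	by (simp_all add: fun_eq_iff J.dF_def dualA_def J.dFm_def dualA_map_def)
 have dP: "J.G.dF = dualP n" "J.G.dFm = dualP_map"
	by (simp_all add: fun_eq_iff J.G.dF_def dualP_def J.G.dFm_def dualP_map_def GammaVect_sel)
 have jh: "J.jshr = jshriek n" by (simp add: J.jshr_def jshriek_def dA dP jl)
 \<comment> \<open>The two families of modules test vanishing equally well: each tensor power is a
   retract of a sum of Young modules, and each Young module is a retract of
   \<open>E\<^sup>\<otimes>\<^sup>n\<close>.\<close>
 have young: "(ALL l. is_partition n l --> Fo f (perm_rep (sym_group n) (young_subgroup n l)) = {0}) \<longleftrightarrow>
	 zero_object (FunK (GammaVect n)) (Fo J.jst f)" if f: "f:Obj (FunK ?R)" for f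
 proof -
	have z: "zero_object (FunK (GammaVect n)) (Fo J.jst f) \<longleftrightarrow> (ALL V:Obj (GammaVect n). Fo f (tpow_rep n V) = {0})"
	 using J.jst_obj[OF f] by (simp only: J.G.zero_object_FunK J.jst_sel simp_thms)
	show ?thesis unfolding z
 proof (intro iffI ballI allI impI)
	have P: "perm_rep (sym_group n) (young_subgroup n l):Obj ?R" if "is_partition n l" for l
	 using S.perm_rep_obj[OF stab_subgroup[of n "bidx l"]] young_stab[of l n] that by (simp add: is_partition_def)
	{ fix V :: "'k vec set"
	 assume 0: "ALL l. is_partition n l --> Fo f (perm_rep (sym_group n) (young_subgroup n l)) = {0}" and "V:Obj (GammaVect n)"
	 then have V: "fds vscale V" by (simp add: GammaVect_sel Vect_Obj)
	 obtain k :: nat and l a b where 1: "ALL i<k. is_partition n (l i) &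
		 a i:Hom ?R (perm_rep (sym_group n) (young_subgroup n (l i))) (tpow_rep n V) &
		 b i:Hom ?R (tpow_rep n V) (perm_rep (sym_group n) (young_subgroup n (l i)))"
		and s: "(\<Sum>i<k. a i o b i) = id_on (tpow n V)"
		using tpow_young_sum[OF V, of n] by (elim exE conjE) (rule that)
	 have l: "is_partition n (l i)" and ab: "a i:Hom ?R (perm_rep (sym_group n) (young_subgroup n (l i))) (tpow_rep n V)"
		"b i:Hom ?R (tpow_rep n V) (perm_rep (sym_group n) (young_subgroup n (l i)))" if "i < k" for i
		using 1 that by auto
	 show "Fo f (tpow_rep n V) = {0}"
	 proof (rule J.zero_of_sum[OF f tpow_rep_obj[OF V] P[OF l] ab])
		show "Fo f (perm_rep (sym_group n) (young_subgroup n (l i))) = {0}" if "i < k" for i using 0 l[OF that] by blast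
	 qed (simp_all add: s Rep_sel tpow_rep_sel(1)) }
	fix l assume 0: "ALL V:Obj (GammaVect n). Fo f (tpow_rep n V) = {0}" and l: "is_partition n l"
	have E: "Fo f (tpow_rep n (Estd n)) = {0}" using 0 by (simp add: GammaVect_sel Vect_Obj Estd_fds)
	obtain a b where ab: "a:Hom ?R (perm_rep (sym_group n) (young_subgroup n l)) (tpow_rep n (Estd n))"
	 "b:Hom ?R (tpow_rep n (Estd n)) (perm_rep (sym_group n) (young_subgroup n l))"
	 "b o a = id_on (fst (perm_rep (sym_group n) (young_subgroup n l) :: 'k srep))" using young_retract[OF l] by blast
	show "Fo f (perm_rep (sym_group n) (young_subgroup n l)) = {0}"
	 by (rule J.zero_of_sum[OF f P[OF l], where k=1 and Y="%_. tpow_rep n (Estd n)" and a="%_. b" and b="%_. a"])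
		(use ab E tpow_rep_obj[OF Estd_fds] in \<open>simp_all add: Rep_sel\<close>)
 qed
 qed
 \<comment> \<open>The two predicates agree on objects, so the full subcategories coincide as
   records, and the inclusion of the statement is the identity functor on
   \<open>ker j\<^sup>*\<close>.\<close>
 have K: "CohSymY n = kernel_subcat (full_subcat (FunK ?R) (coherent ?R)) (FunK (GammaVect n)) J.jst"
	unfolding CohSymY_def CohSym_def Coh_def kernel_subcat_def full_subcat_def
	using young by (intro arg_cong[where f="%S. Obj_update S _"]) auto
 from J.recollement_FunK show ?thesis
	unfolding K js jl jh CohSym_def Coh_def StrictPoly_def incl_def by simp
qed

end
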